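(* Let $R$ be a ring, let $C_R$ be a right $R$-module, and let $S=\operatorname{End}(C_R)$. (a) If $C_R$ is an M-cotilting module, then it is also AAITY-cotilting. (b) Assume that the ring $R$ is right Noetherian and the ring $S$ is left Noetherian. If $C_R$ is an AAITY-cotilting module, then it is also M-cotilting.
   Context: Rings are associative with identity, modules are unitary. $\text{mod-}R$ is the category of finitely generated right $R$-modules; $\operatorname{id}$ denotes injective dimension. $C$ is regarded as a left module over $S=\operatorname{End}(C_R)$ in the natural way. For a right $R$-module $M$, $\operatorname{add}(M)$ is the class of right $R$-modules isomorphic to a direct summand of a direct sum of finitely many copies of $M$. $M$ is self-orthogonal if $\operatorname{Ext}^i_R(M,M)=0$ for all $i\ge1$. ${}^\perp C$ is the class of right $R$-modules $N$ with $\operatorname{Ext}^i_R(N,C)=0$ for all $i\ge1$. $\operatorname{gen}^*(T)$ is the class of right $R$-modules $N$ admitting an exact sequence $\cdots\xrightarrow{f_2}T_1\xrightarrow{f_1}T_0\xrightarrow{f_0}N\to 0$ with each $T_i\in\operatorname{add}(T)$ and $\operatorname{Ext}^1_R(T,\operatorname{Ker} f_i)=0$ for all $i\ge 0$. $\operatorname{cogen}^*(T)$ is the class of right $R$-modules $N$ admitting an exact sequence $0\to N\xrightarrow{f^{-1}}T^0\xrightarrow{f^0}T^1\xrightarrow{f^1}\cdots$ with each $T^i\in\operatorname{add}(T)$ and $\operatorname{Ext}^1_R(\operatorname{Coker} f^i,T)=0$ for all $i\ge -1$. A self-orthogonal module $T_R$ is Wakamatsu tilting if $T_R\in\operatorname{gen}^*(R)$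 and $R_R\in\operatorname{cogen}^*(T)$. M-cotilting: let $C_R$ be an $R$-module with $S=\operatorname{End}(C_R)$, where $R$ is right Noetherian and $S$ is left Noetherian (these conditions are part of saying that $C_R$ is M-cotilting). $C_R$ is M-cotilting if it is Wakamatsu tilting and both $\operatorname{id}(C_R)$ and $\operatorname{id}({}_SC)$ are finite. AAITY-cotilting: a finitely generated self-orthogonal right $R$-module $C_R$ is AAITY-cotilting if (i) $\operatorname{id}(C_R)<\infty$; (ii) for any $X\in{}^\perp C\cap\text{mod-}R$ there exists a short exact sequence $0\to X\to C_0\to X'\to0$ with $C_0\in\operatorname{add}(C)$ and $X'\in{}^\perp C$. *)

theory Defs
  imports "HOL-Algebra.Module" "HOL-Algebra.AbelCoset" "HOL-Algebra.Elementary_Groups"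
    "HOL-Library.Extended_Nat"
begin

section \<open>Right modules over a not necessarily commutative ring\<close>

text \<open>
  The locale \<open>module\<close> of HOL-Algebra demands a commutative ring, so only its record type is
  reused. In a right module the term \<open>r \<odot>\<^bsub>M\<^esub> m\<close> stands for \<open>m \<cdot> r\<close>; this is why the
  factors are interchanged in \<open>smult_assoc\<close>. The fields \<open>mult\<close> and \<open>one\<close> of a module record
  carry no meaning.
\<close>

locale right_module = R: ring R + abelian_group M
  for R :: "'r ring" and M :: "('r, 'm) module" (structure) +
  assumes smult_closed: "\<lbrakk>r \<in> carrier R; x \<in> carrier M\<rbrakk> \<Longrightarrow> r \<odot> x \<in> carrier M"
    and smult_l_distr: "\<lbrakk>r \<in> carrier R; s \<in> carrier R; x \<in> carrier M\<rbrakk>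
      \<Longrightarrow> (r \<oplus>\<^bsub>R\<^esub> s) \<odot> x = r \<odot> x \<oplus> s \<odot> x"
    and smult_r_distr: "\<lbrakk>r \<in> carrier R; x \<in> carrier M; y \<in> carrier M\<rbrakk>
      \<Longrightarrow> r \<odot> (x \<oplus> y) = r \<odot> x \<oplus> r \<odot> y"
    and smult_assoc: "\<lbrakk>r \<in> carrier R; s \<in> carrier R; x \<in> carrier M\<rbrakk>
      \<Longrightarrow> (r \<otimes>\<^bsub>R\<^esub> s) \<odot> x = s \<odot> (r \<odot> x)"
    and smult_one: "x \<in> carrier M \<Longrightarrow> \<one>\<^bsub>R\<^esub> \<odot> x = x"

text \<open>Left \<open>S\<close>-modules are the right modules over the opposite ring of \<open>S\<close>.\<close>

definition op_ring :: "'r ring \<Rightarrow> 'r ring" where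
  "op_ring R = R\<lparr>mult := \<lambda>x y. y \<otimes>\<^bsub>R\<^esub> x\<rparr>"

definition regular_module :: "'r ring \<Rightarrow> ('r, 'r) module" where
  "regular_module R = \<lparr>carrier = carrier R, mult = undefined, one = undefined,
     zero = \<zero>\<^bsub>R\<^esub>, add = (\<oplus>\<^bsub>R\<^esub>), smult = (\<lambda>r x. x \<otimes>\<^bsub>R\<^esub> r)\<rparr>"

text \<open>Homomorphisms are extensional, so that they are determined by their values on the carrier.\<close>

definition mod_hom :: "'r ring \<Rightarrow> ('r, 'm) module \<Rightarrow> ('r, 'n) module \<Rightarrow> ('m \<Rightarrow> 'n) set" where
  "mod_hom R M N = {f \<in> carrier M \<rightarrow>\<^sub>E carrier N.
     (\<forall>x\<in>carrier M. \<forall>y\<in>carrier M. f (x \<oplus>\<^bsub>M\<^esub> y) = f x \<oplus>\<^bsub>N\<^esub> f y) \<and>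
     (\<forall>r\<in>carrier R. \<forall>x\<in>carrier M. f (r \<odot>\<^bsub>M\<^esub> x) = r \<odot>\<^bsub>N\<^esub> f x)}"

definition mod_iso :: "'r ring \<Rightarrow> ('r, 'm) module \<Rightarrow> ('r, 'n) module \<Rightarrow> bool" where
  "mod_iso R M N \<longleftrightarrow> (\<exists>f \<in> mod_hom R M N. bij_betw f (carrier M) (carrier N))"

definition ker_module :: "('r, 'm) module \<Rightarrow> ('r, 'n) module \<Rightarrow> ('m \<Rightarrow> 'n) \<Rightarrow> ('r, 'm) module" where
  "ker_module M N f = M\<lparr>carrier := a_kernel M N f\<rparr>"

definition quot_module :: "('r, 'm) module \<Rightarrow> 'm set \<Rightarrow> ('r, 'm set) module" where
  "quot_module M K = \<lparr>carrier = a_rcosets\<^bsub>M\<^esub> K, mult = undefined, one = undefined,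
     zero = K, add = (<+>\<^bsub>M\<^esub>), smult = (\<lambda>r X. \<Union>x\<in>X. K +>\<^bsub>M\<^esub> (r \<odot>\<^bsub>M\<^esub> x))\<rparr>"

definition coker_module :: "('r, 'm) module \<Rightarrow> ('r, 'n) module \<Rightarrow> ('m \<Rightarrow> 'n) \<Rightarrow> ('r, 'n set) module" where
  "coker_module M N f = quot_module N (f ` carrier M)"

definition fin_gen :: "'r ring \<Rightarrow> ('r, 'm) module \<Rightarrow> bool" where
  "fin_gen R M \<longleftrightarrow> (\<exists>A. finite A \<and> A \<subseteq> carrier M \<and>
     (\<forall>K. submodule K R M \<and> A \<subseteq> K \<longrightarrow> K = carrier M))"

definition power_module :: "('r, 'm) module \<Rightarrow> nat \<Rightarrow> ('r, nat \<Rightarrow> 'm) module" where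
  "power_module M n = \<lparr>carrier = {..<n} \<rightarrow>\<^sub>E carrier M, mult = undefined, one = undefined,
     zero = (\<lambda>i\<in>{..<n}. \<zero>\<^bsub>M\<^esub>), add = (\<lambda>f g. \<lambda>i\<in>{..<n}. f i \<oplus>\<^bsub>M\<^esub> g i),
     smult = (\<lambda>r f. \<lambda>i\<in>{..<n}. r \<odot>\<^bsub>M\<^esub> f i)\<rparr>"

definition direct_summand :: "'r ring \<Rightarrow> ('r, 'm) module \<Rightarrow> 'm set \<Rightarrow> bool" where
  "direct_summand R M A \<longleftrightarrow> submodule A R M \<and>
     (\<exists>B. submodule B R M \<and> A \<inter> B = {\<zero>\<^bsub>M\<^esub>} \<and> A <+>\<^bsub>M\<^esub> B = carrier M)"

definition in_add :: "'r ring \<Rightarrow> ('r, 'm) module \<Rightarrow> ('r, 'x) module \<Rightarrow> bool" where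
  "in_add R M X \<longleftrightarrow> right_module R X \<and>
     (\<exists>n A. direct_summand R (power_module M n) A \<and>
        mod_iso R X ((power_module M n)\<lparr>carrier := A\<rparr>))"

section \<open>Ext\<close>

definition free_module :: "'r ring \<Rightarrow> 'b set \<Rightarrow> ('r, 'b \<Rightarrow> 'r) module" where
  "free_module R B = \<lparr>carrier = {f. range f \<subseteq> carrier R \<and> finite {b. f b \<noteq> \<zero>\<^bsub>R\<^esub>} \<and>
        {b. f b \<noteq> \<zero>\<^bsub>R\<^esub>} \<subseteq> B},
     mult = undefined, one = undefined, zero = (\<lambda>b. \<zero>\<^bsub>R\<^esub>),
     add = (\<lambda>f g b. f b \<oplus>\<^bsub>R\<^esub> g b), smult = (\<lambda>r f b. f b \<otimes>\<^bsub>R\<^esub> r)\<rparr>"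

definition lin_ext :: "'r ring \<Rightarrow> ('r, 'n) module \<Rightarrow> ('b \<Rightarrow> 'n) \<Rightarrow> ('b \<Rightarrow> 'r) \<Rightarrow> 'n" where
  "lin_ext R N \<phi> f = (\<Oplus>\<^bsub>N\<^esub>b\<in>{b. f b \<noteq> \<zero>\<^bsub>R\<^esub>}. f b \<odot>\<^bsub>N\<^esub> \<phi> b)"

text \<open>
  Ext is computed from one functorially chosen free resolution
  \<open>\<dots> \<rightarrow> F 1 \<rightarrow> F 0 \<rightarrow> M \<rightarrow> 0\<close>. The basis of \<open>F 0\<close> is the set of all elements of \<open>M\<close>. The basis of
  \<open>F (n + 1)\<close> is the set of all formal relations of \<open>F n\<close>: finite lists of pairs of a basis element
  and a coefficient whose sum, an element of \<open>F n\<close>, is mapped to zero by the preceding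
  differential (the augmentation if \<open>n = 0\<close>). The differential sends such a list to its sum.
  Every element of the kernel is the sum of such a list, so the resolution is exact. The datatype
  of cells lets all the bases live on a single type.
\<close>

datatype ('m, 'r) cell = Gen 'm | Rel "(('m, 'r) cell \<times> 'r) list"

primrec gen_val :: "('m, 'r) cell \<Rightarrow> 'm" where
  "gen_val (Gen m) = m"
| "gen_val (Rel ps) = undefined"

primrec cell_bd :: "'r ring \<Rightarrow> ('m, 'r) cell \<Rightarrow> ('m, 'r) cell \<Rightarrow> 'r" where
  "cell_bd R (Gen m) = (\<lambda>c. \<zero>\<^bsub>R\<^esub>)"
| "cell_bd R (Rel ps) =
     (\<lambda>c. foldr (\<lambda>p s. snd p \<oplus>\<^bsub>R\<^esub> s) (filter (\<lambda>p. fst p = c) ps) \<zero>\<^bsub>R\<^esub>)"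

fun res_basis :: "'r ring \<Rightarrow> ('r, 'm) module \<Rightarrow> nat \<Rightarrow> ('m, 'r) cell set" where
  "res_basis R M 0 = Gen ` carrier M"
| "res_basis R M (Suc 0) = {Rel ps | ps. set ps \<subseteq> res_basis R M 0 \<times> carrier R \<and>
     lin_ext R M gen_val (cell_bd R (Rel ps)) = \<zero>\<^bsub>M\<^esub>}"
| "res_basis R M (Suc (Suc n)) = {Rel ps | ps. set ps \<subseteq> res_basis R M (Suc n) \<times> carrier R \<and>
     lin_ext R (free_module R (res_basis R M n)) (cell_bd R) (cell_bd R (Rel ps))
       = \<zero>\<^bsub>free_module R (res_basis R M n)\<^esub>}"

definition res_module :: "'r ring \<Rightarrow> ('r, 'm) module \<Rightarrow> nat \<Rightarrow> ('r, ('m, 'r) cell \<Rightarrow> 'r) module" where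
  "res_module R M n = free_module R (res_basis R M n)"

definition res_aug :: "'r ring \<Rightarrow> ('r, 'm) module \<Rightarrow> (('m, 'r) cell \<Rightarrow> 'r) \<Rightarrow> 'm" where
  "res_aug R M = (\<lambda>f\<in>carrier (res_module R M 0). lin_ext R M gen_val f)"

text \<open>\<open>res_diff R M n\<close> is the differential from degree \<open>n + 1\<close> to degree \<open>n\<close>.\<close>

definition res_diff ::
  "'r ring \<Rightarrow> ('r, 'm) module \<Rightarrow> nat \<Rightarrow> (('m, 'r) cell \<Rightarrow> 'r) \<Rightarrow> (('m, 'r) cell \<Rightarrow> 'r)" where
  "res_diff R M n = (\<lambda>f\<in>carrier (res_module R M (Suc n)).
     lin_ext R (res_module R M n) (cell_bd R) f)"

definition hom_group :: "'r ring \<Rightarrow> ('r, 'm) module \<Rightarrow> ('r, 'n) module \<Rightarrow> ('m \<Rightarrow> 'n) monoid" where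
  "hom_group R M N = \<lparr>carrier = mod_hom R M N,
     mult = (\<lambda>f g. \<lambda>x\<in>carrier M. f x \<oplus>\<^bsub>N\<^esub> g x), one = (\<lambda>x\<in>carrier M. \<zero>\<^bsub>N\<^esub>)\<rparr>"

definition cocycles ::
  "'r ring \<Rightarrow> nat \<Rightarrow> ('r, 'm) module \<Rightarrow> ('r, 'n) module \<Rightarrow> ((('m, 'r) cell \<Rightarrow> 'r) \<Rightarrow> 'n) set" where
  "cocycles R n M N = {f \<in> mod_hom R (res_module R M n) N.
     \<forall>x\<in>carrier (res_module R M (Suc n)). f (res_diff R M n x) = \<zero>\<^bsub>N\<^esub>}"

primrec coboundaries ::
  "'r ring \<Rightarrow> nat \<Rightarrow> ('r, 'm) module \<Rightarrow> ('r, 'n) module \<Rightarrow> ((('m, 'r) cell \<Rightarrow> 'r) \<Rightarrow> 'n) set" where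
  "coboundaries R 0 M N = {\<lambda>x\<in>carrier (res_module R M 0). \<zero>\<^bsub>N\<^esub>}"
| "coboundaries R (Suc n) M N =
     (\<lambda>g. compose (carrier (res_module R M (Suc n))) g (res_diff R M n)) `
       mod_hom R (res_module R M n) N"

definition Ext ::
  "'r ring \<Rightarrow> nat \<Rightarrow> ('r, 'm) module \<Rightarrow> ('r, 'n) module \<Rightarrow> ((('m, 'r) cell \<Rightarrow> 'r) \<Rightarrow> 'n) set monoid"
where
  "Ext R n M N =
     (hom_group R (res_module R M n) N)\<lparr>carrier := cocycles R n M N\<rparr> Mod coboundaries R n M N"

definition in_perp :: "'r ring \<Rightarrow> ('r, 'c) module \<Rightarrow> ('r, 'n) module \<Rightarrow> bool" where
  "in_perp R C N \<longleftrightarrow> right_module R N \<and> (\<forall>i\<ge>1. trivial_group (Ext R i N C))"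

definition self_orthogonal :: "'r ring \<Rightarrow> ('r, 'm) module \<Rightarrow> bool" where
  "self_orthogonal R M \<longleftrightarrow> right_module R M \<and> (\<forall>i\<ge>1. trivial_group (Ext R i M M))"

section \<open>Injective dimension\<close>

text \<open>
  A definition cannot quantify over all types, so the test modules range over a fixed type that
  contains copies of the ring and of \<open>E\<close>. By Baer's criterion any type that can hold \<open>R\<close> and its
  right ideals yields the same class of modules.
\<close>

definition injective_module :: "'r ring \<Rightarrow> ('r, 'e) module \<Rightarrow> bool" where
  "injective_module R E \<longleftrightarrow> right_module R E \<and>
     (\<forall>(A :: ('r, 'r + 'e) module) (B :: ('r, 'r + 'e) module) i f.
        right_module R A \<and> right_module R B \<and>
        i \<in> mod_hom R A B \<and> inj_on i (carrier A) \<and> f \<in> mod_hom R A E \<longrightarrow>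
        (\<exists>g \<in> mod_hom R B E. \<forall>x\<in>carrier A. g (i x) = f x))"

definition injective_resolution ::
  "'r ring \<Rightarrow> ('r, 'm) module \<Rightarrow> (nat \<Rightarrow> ('r, 'e) module) \<Rightarrow> ('m \<Rightarrow> 'e) \<Rightarrow> (nat \<Rightarrow> 'e \<Rightarrow> 'e) \<Rightarrow> bool"
where
  "injective_resolution R M E \<epsilon> d \<longleftrightarrow>
     (\<forall>n. injective_module R (E n)) \<and>
     \<epsilon> \<in> mod_hom R M (E 0) \<and> (\<forall>n. d n \<in> mod_hom R (E n) (E (Suc n))) \<and>
     inj_on \<epsilon> (carrier M) \<and> \<epsilon> ` carrier M = a_kernel (E 0) (E 1) (d 0) \<and>
     (\<forall>n. d n ` carrier (E n) = a_kernel (E (Suc n)) (E (Suc (Suc n))) (d (Suc n)))"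

text \<open>
  The modules of the resolution live on a type that holds every stage of the standard
  construction: \<open>M\<close> embeds into the injective module of additive maps from \<open>R\<close> to a divisible
  hull of \<open>M\<close>, and the cardinality \<open>\<kappa>\<close> of the type below is at least that of \<open>R\<close>, of \<open>M\<close> and of
  \<open>nat\<close> and satisfies \<open>\<kappa>\<close> to the power \<open>|R|\<close> \<open>= \<kappa>\<close>, so all cosyzygies fit again. The infimum is
  therefore the same as over resolutions on arbitrary types.
\<close>

type_synonym ('r, 'm) coresol = "nat + 'r \<Rightarrow> nat + 'm"

definition inj_dim :: "'r ring \<Rightarrow> ('r, 'm) module \<Rightarrow> enat" where
  "inj_dim R M = Inf {enat n | n.
     \<exists>(E :: nat \<Rightarrow> ('r, ('r, 'm) coresol) module) \<epsilon> d.
       injective_resolution R M E \<epsilon> d \<and> (\<forall>i>n. carrier (E i) = {\<zero>\<^bsub>E i\<^esub>})}"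

section \<open>The endomorphism ring and chain conditions\<close>

definition End_ring :: "'r ring \<Rightarrow> ('r, 'c) module \<Rightarrow> ('c \<Rightarrow> 'c) ring" where
  "End_ring R C = \<lparr>carrier = mod_hom R C C, mult = compose (carrier C),
     one = (\<lambda>x\<in>carrier C. x), zero = (\<lambda>x\<in>carrier C. \<zero>\<^bsub>C\<^esub>),
     add = (\<lambda>f g. \<lambda>x\<in>carrier C. f x \<oplus>\<^bsub>C\<^esub> g x)\<rparr>"

text \<open>
  \<open>C\<close> as a left module over its endomorphism ring, hence to be used as a right module over the
  opposite of that ring.
\<close>

definition End_module :: "('r, 'c) module \<Rightarrow> ('c \<Rightarrow> 'c, 'c) module" where
  "End_module C = \<lparr>carrier = carrier C, mult = undefined, one = undefined,
     zero = \<zero>\<^bsub>C\<^esub>, add = (\<oplus>\<^bsub>C\<^esub>), smult = (\<lambda>s x. s x)\<rparr>"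

definition right_ideal :: "'r set \<Rightarrow> 'r ring \<Rightarrow> bool" where
  "right_ideal I R \<longleftrightarrow> additive_subgroup I R \<and> (\<forall>a\<in>I. \<forall>r\<in>carrier R. a \<otimes>\<^bsub>R\<^esub> r \<in> I)"

definition left_ideal :: "'r set \<Rightarrow> 'r ring \<Rightarrow> bool" where
  "left_ideal I R \<longleftrightarrow> additive_subgroup I R \<and> (\<forall>a\<in>I. \<forall>r\<in>carrier R. r \<otimes>\<^bsub>R\<^esub> a \<in> I)"

definition right_noetherian :: "'r ring \<Rightarrow> bool" where
  "right_noetherian R \<longleftrightarrow> ring R \<and>
     (\<forall>I :: nat \<Rightarrow> 'r set. (\<forall>n. right_ideal (I n) R \<and> I n \<subseteq> I (Suc n)) \<longrightarrow> (\<exists>N. \<forall>n\<ge>N. I n = I N))"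

definition left_noetherian :: "'r ring \<Rightarrow> bool" where
  "left_noetherian R \<longleftrightarrow> ring R \<and>
     (\<forall>I :: nat \<Rightarrow> 'r set. (\<forall>n. left_ideal (I n) R \<and> I n \<subseteq> I (Suc n)) \<longrightarrow> (\<exists>N. \<forall>n\<ge>N. I n = I N))"

section \<open>Wakamatsu tilting and cotilting modules\<close>

text \<open>
  Every module in \<open>add T\<close> is isomorphic to a submodule of a finite power of \<open>T\<close>, so the types of
  the terms \<open>X i\<close> below are no restriction. The map \<open>e\<close> is the map with index \<open>0\<close>, resp. \<open>-1\<close>,
  of the sequence; \<open>f i\<close> is the map from \<open>X (i + 1)\<close> to \<open>X i\<close>, resp. from \<open>X i\<close> to \<open>X (i + 1)\<close>.
\<close>

definition gen_star :: "'r ring \<Rightarrow> ('r, 't) module \<Rightarrow> ('r, 'n) module \<Rightarrow> bool" where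
  "gen_star R T N \<longleftrightarrow> right_module R N \<and>
     (\<exists>(X :: nat \<Rightarrow> ('r, nat \<Rightarrow> 't) module) e f.
        (\<forall>i. in_add R T (X i)) \<and>
        e \<in> mod_hom R (X 0) N \<and> (\<forall>i. f i \<in> mod_hom R (X (Suc i)) (X i)) \<and>
        e ` carrier (X 0) = carrier N \<and>
        f 0 ` carrier (X 1) = a_kernel (X 0) N e \<and>
        (\<forall>i. f (Suc i) ` carrier (X (Suc (Suc i))) = a_kernel (X (Suc i)) (X i) (f i)) \<and>
        trivial_group (Ext R 1 T (ker_module (X 0) N e)) \<and>
        (\<forall>i. trivial_group (Ext R 1 T (ker_module (X (Suc i)) (X i) (f i)))))"

definition cogen_star :: "'r ring \<Rightarrow> ('r, 't) module \<Rightarrow> ('r, 'n) module \<Rightarrow> bool" where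
  "cogen_star R T N \<longleftrightarrow> right_module R N \<and>
     (\<exists>(X :: nat \<Rightarrow> ('r, nat \<Rightarrow> 't) module) e f.
        (\<forall>i. in_add R T (X i)) \<and>
        e \<in> mod_hom R N (X 0) \<and> (\<forall>i. f i \<in> mod_hom R (X i) (X (Suc i))) \<and>
        inj_on e (carrier N) \<and>
        e ` carrier N = a_kernel (X 0) (X 1) (f 0) \<and>
        (\<forall>i. f i ` carrier (X i) = a_kernel (X (Suc i)) (X (Suc (Suc i))) (f (Suc i))) \<and>
        trivial_group (Ext R 1 (coker_module N (X 0) e) T) \<and>
        (\<forall>i. trivial_group (Ext R 1 (coker_module (X i) (X (Suc i)) (f i)) T)))"

definition wakamatsu_tilting :: "'r ring \<Rightarrow> ('r, 't) module \<Rightarrow> bool" where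
  "wakamatsu_tilting R T \<longleftrightarrow> self_orthogonal R T \<and>
     gen_star R (regular_module R) T \<and> cogen_star R T (regular_module R)"

definition M_cotilting :: "'r ring \<Rightarrow> ('r, 'c) module \<Rightarrow> bool" where
  "M_cotilting R C \<longleftrightarrow> right_noetherian R \<and> left_noetherian (End_ring R C) \<and>
     wakamatsu_tilting R C \<and> inj_dim R C < \<infinity> \<and>
     inj_dim (op_ring (End_ring R C)) (End_module C) < \<infinity>"

definition short_exact ::
  "'r ring \<Rightarrow> ('r, 'x) module \<Rightarrow> ('x \<Rightarrow> 'y) \<Rightarrow> ('r, 'y) module \<Rightarrow> ('y \<Rightarrow> 'z) \<Rightarrow> ('r, 'z) module \<Rightarrow> bool"
where
  "short_exact R X f Y g Z \<longleftrightarrow>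
     right_module R X \<and> right_module R Y \<and> right_module R Z \<and>
     f \<in> mod_hom R X Y \<and> g \<in> mod_hom R Y Z \<and>
     inj_on f (carrier X) \<and> f ` carrier X = a_kernel Y Z g \<and> g ` carrier Y = carrier Z"

text \<open>
  A finitely generated module is a quotient of a finite power of \<open>R\<close>; choosing representatives,
  it is isomorphic to a module on the type \<open>nat \<Rightarrow> 'r\<close>, so \<open>X\<close> runs through all of mod-\<open>R\<close>.
  In the same way any quotient \<open>X'\<close> of a module in \<open>add C\<close> can be found on the type \<open>nat \<Rightarrow> 'c\<close>.
\<close>

definition AAITY_cotilting :: "'r ring \<Rightarrow> ('r, 'c) module \<Rightarrow> bool" where
  "AAITY_cotilting R C \<longleftrightarrow> fin_gen R C \<and> self_orthogonal R C \<and> inj_dim R C < \<infinity> \<and>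
     (\<forall>X :: ('r, nat \<Rightarrow> 'r) module. fin_gen R X \<and> in_perp R C X \<longrightarrow>
        (\<exists>(C0 :: ('r, nat \<Rightarrow> 'c) module) (X' :: ('r, nat \<Rightarrow> 'c) module) f g.
           short_exact R X f C0 g X' \<and> in_add R C C0 \<and> in_perp R C X'))"

end

theory Submission
  imports Defs "HOL-Library.Countable"
begin

text \<open>Let \<open>X\<close> be a finitely generated module in the left perpendicular category of \<open>C\<close>, and let
  \<open>X* = Hom(X, C)\<close>. If \<open>C\<close> is M-cotilting, then \<open>X*\<close> is a finitely generated \<open>S\<close>-module, and a finite
  generating system of it is a map \<open>X \<rightarrow> C^m\<close> through which every map \<open>X \<rightarrow> C\<close> factors; hence its
  cokernel is again perpendicular to \<open>C\<close>. The map is injective: dualizing a projective resolution of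
  \<open>X\<close> gives an exact sequence of \<open>S\<close>-modules in \<open>add C\<close>, whose images have no higher \<open>Ext\<close> into \<open>C\<close>
  over \<open>S\<close> because the injective dimension of \<open>C\<close> over \<open>S\<close> is finite; as \<open>R = End(C)\<close> over \<open>S\<close>,
  dualizing back shows that \<open>X\<close> embeds into its bidual.

  Conversely, let \<open>C\<close> be AAITY-cotilting, of injective dimension at most \<open>n\<close>. The exact sequences of
  condition (ii), applied to \<open>R\<close> and its cosyzygies, coresolve \<open>R\<close> by \<open>add C\<close>; a projective resolution
  of \<open>C\<close> shows that \<open>C\<close> lies in \<open>gen*(R)\<close>. By the approximation argument of Auslander and Buchweitz,
  every finitely generated \<open>R\<close>-module embeds into one with an \<open>add C\<close>-resolution of length \<open>n\<close>.
  For a left ideal \<open>I\<close> of \<open>S\<close>, a resolution of \<open>S/I\<close> by finitely generated free modules is the dual of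
  a complex of powers of \<open>C\<close>, and the embeddings show that this complex is exact from degree \<open>n\<close> on,
  so \<open>Ext(S/I, C)\<close> vanishes in degrees above \<open>n\<close>. By Baer's criterion the injective dimension of \<open>C\<close>
  over \<open>S\<close> is at most \<open>n\<close>.\<close>

section \<open>Linear maps\<close>

text \<open>The obstacle throughout is that a definition cannot quantify over types, whereas
  homological algebra passes to submodules, quotients, duals and products that live on new types.
  Notions that test against all modules are therefore replaced by type-free ones: injectivity by the
  ideal form of Baer's criterion (\<open>baer\<close>), projectivity by lifting against one given
  map (\<open>lifting\<close>), membership in \<open>add C\<close> by a dual basis
  (\<open>sumd\<close>); \<open>transport\<close> carries a module back to a type that a definition
  prescribes. Vanishing of \<open>Ext\<close> is used in two guises. \<open>exv\<close> works with
  an injective coresolution of \<open>C\<close>, so it accepts modules of every type and holds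
  trivially beyond the injective dimension. \<open>cz\<close> works with a complex in the first
  variable, which is the form in which duals of complexes of \<open>R\<close>-modules appear.
  \<open>exv_iff_cz\<close> compares the two. No long exact sequence is built; the few vanishing
  statements that are used are chased one by one.\<close>

lemma right_moduleI:
  fixes M :: "('r, 'm) module"
  assumes "ring R"
    and "\<And>x y. \<lbrakk>x \<in> carrier M; y \<in> carrier M\<rbrakk> \<Longrightarrow> x \<oplus>\<^bsub>M\<^esub> y \<in> carrier M"
    and zero: "\<zero>\<^bsub>M\<^esub> \<in> carrier M"
    and "\<And>x y z. \<lbrakk>x \<in> carrier M; y \<in> carrier M; z \<in> carrier M\<rbrakk> \<Longrightarrow> (x \<oplus>\<^bsub>M\<^esub> y) \<oplus>\<^bsub>M\<^esub> z = x \<oplus>\<^bsub>M\<^esub> (y \<oplus>\<^bsub>M\<^esub> z)"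
    and comm: "\<And>x y. \<lbrakk>x \<in> carrier M; y \<in> carrier M\<rbrakk> \<Longrightarrow> x \<oplus>\<^bsub>M\<^esub> y = y \<oplus>\<^bsub>M\<^esub> x"
    and "\<And>x. x \<in> carrier M \<Longrightarrow> \<zero>\<^bsub>M\<^esub> \<oplus>\<^bsub>M\<^esub> x = x"
    and sc: "\<And>r x. \<lbrakk>r \<in> carrier R; x \<in> carrier M\<rbrakk> \<Longrightarrow> r \<odot>\<^bsub>M\<^esub> x \<in> carrier M"
    and sl: "\<And>r s x. \<lbrakk>r \<in> carrier R; s \<in> carrier R; x \<in> carrier M\<rbrakk> \<Longrightarrow> (r \<oplus>\<^bsub>R\<^esub> s) \<odot>\<^bsub>M\<^esub> x = r \<odot>\<^bsub>M\<^esub> x \<oplus>\<^bsub>M\<^esub> s \<odot>\<^bsub>M\<^esub> x"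
    and "\<And>r x y. \<lbrakk>r \<in> carrier R; x \<in> carrier M; y \<in> carrier M\<rbrakk> \<Longrightarrow> r \<odot>\<^bsub>M\<^esub> (x \<oplus>\<^bsub>M\<^esub> y) = r \<odot>\<^bsub>M\<^esub> x \<oplus>\<^bsub>M\<^esub> r \<odot>\<^bsub>M\<^esub> y"
    and "\<And>r s x. \<lbrakk>r \<in> carrier R; s \<in> carrier R; x \<in> carrier M\<rbrakk> \<Longrightarrow> (r \<otimes>\<^bsub>R\<^esub> s) \<odot>\<^bsub>M\<^esub> x = s \<odot>\<^bsub>M\<^esub> (r \<odot>\<^bsub>M\<^esub> x)"
    and s1: "\<And>x. x \<in> carrier M \<Longrightarrow> \<one>\<^bsub>R\<^esub> \<odot>\<^bsub>M\<^esub> x = x"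
    and s0: "\<And>x. x \<in> carrier M \<Longrightarrow> \<zero>\<^bsub>R\<^esub> \<odot>\<^bsub>M\<^esub> x = \<zero>\<^bsub>M\<^esub>"
  shows "right_module R M"
proof -
  interpret R: ring R by fact
  \<comment> \<open>Negatives are produced rather than assumed: the multiple of \<open>x\<close> by
    \<open>\<ominus> \<one>\<close> is one, by \<open>sl\<close> and \<open>s0\<close>.\<close>
  have "abelian_group M"
  proof (rule abelian_groupI)
    fix x assume x: "x \<in> carrier M"
    have "(\<ominus>\<^bsub>R\<^esub> \<one>\<^bsub>R\<^esub>) \<odot>\<^bsub>M\<^esub> x \<oplus>\<^bsub>M\<^esub> x = (\<ominus>\<^bsub>R\<^esub> \<one>\<^bsub>R\<^esub> \<oplus>\<^bsub>R\<^esub> \<one>\<^bsub>R\<^esub>) \<odot>\<^bsub>M\<^esub> x"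
      using x by (simp add: sl s1)
    also have "\<dots> = \<zero>\<^bsub>M\<^esub>" using x by (simp add: R.l_neg s0)
    finally show "\<exists>y\<in>carrier M. y \<oplus>\<^bsub>M\<^esub> x = \<zero>\<^bsub>M\<^esub>"
      using x sc R.a_inv_closed R.one_closed by blast
  qed (use assms in auto)
  with assms show ?thesis
    by (intro right_module.intro right_module_axioms.intro) auto
qed

context right_module
begin

lemma smult_l_null [simp]: "x \<in> carrier M \<Longrightarrow> \<zero>\<^bsub>R\<^esub> \<odot> x = \<zero>"
  using smult_l_distr[of "\<zero>\<^bsub>R\<^esub>" "\<zero>\<^bsub>R\<^esub>" x] smult_closed[of "\<zero>\<^bsub>R\<^esub>" x]
  by (metis R.add.one_closed R.l_zero add.r_cancel_one)

lemma smult_r_null [simp]: "r \<in> carrier R \<Longrightarrow> r \<odot> \<zero> = \<zero>"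
  using smult_r_distr[of r \<zero> \<zero>] smult_closed[of r \<zero>]
  by (metis add.one_closed add.l_one add.r_cancel_one)

lemma smult_minus_one: "x \<in> carrier M \<Longrightarrow> (\<ominus>\<^bsub>R\<^esub> \<one>\<^bsub>R\<^esub>) \<odot> x = \<ominus> x"
  by (metis R.add.inv_closed R.l_neg R.one_closed minus_equality smult_closed smult_l_distr
      smult_l_null smult_one)

lemma smult_r_minus: "\<lbrakk>r \<in> carrier R; x \<in> carrier M\<rbrakk> \<Longrightarrow> r \<odot> (\<ominus> x) = \<ominus> (r \<odot> x)"
  by (metis add.inv_closed add.inv_equality add.l_inv smult_closed smult_r_distr smult_r_null)

lemma minus_eq_zero_iff: "\<lbrakk>x \<in> carrier M; y \<in> carrier M\<rbrakk> \<Longrightarrow> x \<ominus> y = \<zero> \<longleftrightarrow> x = y"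
  by (simp add: a_minus_def) (metis add.inv_closed add.inv_equality add.inv_inv add.r_inv)

lemma minus_add_cancel: "\<lbrakk>x \<in> carrier M; y \<in> carrier M\<rbrakk> \<Longrightarrow> (x \<ominus> y) \<oplus> y = x"
  by (simp add: a_minus_def a_assoc l_neg)

lemma add_minus_cancel: "\<lbrakk>x \<in> carrier M; y \<in> carrier M\<rbrakk> \<Longrightarrow> (x \<oplus> y) \<ominus> y = x"
  by (simp add: a_minus_def a_assoc r_neg)

lemma minus_eq_iff: "\<lbrakk>x \<in> carrier M; y \<in> carrier M; z \<in> carrier M\<rbrakk> \<Longrightarrow> x \<ominus> y = z \<longleftrightarrow> x = z \<oplus> y"
  using minus_add_cancel add_minus_cancel by metis

lemma minus_zero_right [simp]: "x \<in> carrier M \<Longrightarrow> x \<ominus> \<zero> = x"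
  by (simp add: minus_eq_iff)

lemma add_minus_add:
  "\<lbrakk>x \<in> carrier M; y \<in> carrier M; x' \<in> carrier M; y' \<in> carrier M\<rbrakk>
    \<Longrightarrow> (x \<oplus> y) \<ominus> (x' \<oplus> y') = (x \<ominus> x') \<oplus> (y \<ominus> y')"
  by (simp add: a_minus_def minus_add a_ac)

text \<open>The library notion also demands closure under negatives; here that is closure under the
  scalar \<open>\<ominus> \<one>\<close>.\<close>

lemma submodule_iff: "submodule K R M \<longleftrightarrow> K \<subseteq> carrier M \<and> \<zero> \<in> K \<and>
   (\<forall>x\<in>K. \<forall>y\<in>K. x \<oplus> y \<in> K) \<and> (\<forall>r\<in>carrier R. \<forall>x\<in>K. r \<odot> x \<in> K)"
proof
  assume "submodule K R M"
  then interpret submodule K R M .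
  show "K \<subseteq> carrier M \<and> \<zero> \<in> K \<and> (\<forall>x\<in>K. \<forall>y\<in>K. x \<oplus> y \<in> K) \<and> (\<forall>r\<in>carrier R. \<forall>x\<in>K. r \<odot> x \<in> K)"
    using subset one_closed m_closed smult_closed by auto
next
  assume a: "K \<subseteq> carrier M \<and> \<zero> \<in> K \<and> (\<forall>x\<in>K. \<forall>y\<in>K. x \<oplus> y \<in> K) \<and> (\<forall>r\<in>carrier R. \<forall>x\<in>K. r \<odot> x \<in> K)"
  have "\<ominus> x \<in> K" if "x \<in> K" for x
    using a that smult_minus_one[of x] R.a_inv_closed[OF R.one_closed] by (metis subsetD)
  with a show "submodule K R M"
    by (intro submodule.intro subgroup.intro submodule_axioms.intro) (auto simp: a_inv_def)
qed

lemma submodule_minus: "\<lbrakk>submodule K R M; x \<in> K; y \<in> K\<rbrakk> \<Longrightarrow> x \<ominus> y \<in> K"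
  using smult_minus_one[of y] R.a_inv_closed[OF R.one_closed] unfolding submodule_iff a_minus_def
  by (metis subsetD)

lemma submodule_carrier: "submodule (carrier M) R M"
  by (simp add: submodule_iff smult_closed)

lemma submodule_zero: "submodule {\<zero>} R M"
  by (simp add: submodule_iff)

lemma submodule_Int: "\<lbrakk>submodule K R M; submodule L R M\<rbrakk> \<Longrightarrow> submodule (K \<inter> L) R M"
  by (auto simp: submodule_iff)

lemma submodule_right_module: "submodule K R M \<Longrightarrow> right_module R (M\<lparr>carrier := K\<rparr>)"
  unfolding submodule_iff
  by (intro right_moduleI)
    (auto simp: subset_iff smult_l_distr smult_r_distr smult_assoc smult_one a_ac R.ring_axioms)

end

text \<open>Elements of \<open>mod_hom\<close> are extensional, so composites would need a
  restriction at every step. This relation drops extensionality and records that source and target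
  are modules, so that one fact carries everything a diagram chase uses.\<close>

definition lmap :: "'r ring \<Rightarrow> ('r, 'm) module \<Rightarrow> ('r, 'n) module \<Rightarrow> ('m \<Rightarrow> 'n) \<Rightarrow> bool" where
  "lmap R M N f \<longleftrightarrow> right_module R M \<and> right_module R N \<and> (\<forall>x\<in>carrier M. f x \<in> carrier N) \<and>
     (\<forall>x\<in>carrier M. \<forall>y\<in>carrier M. f (x \<oplus>\<^bsub>M\<^esub> y) = f x \<oplus>\<^bsub>N\<^esub> f y) \<and>
     (\<forall>r\<in>carrier R. \<forall>x\<in>carrier M. f (r \<odot>\<^bsub>M\<^esub> x) = r \<odot>\<^bsub>N\<^esub> f x)"

lemma lmapD:
  assumes "lmap R M N f"
  shows lmap_src: "right_module R M" and lmap_tgt: "right_module R N"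
    and lmap_closed: "\<And>x. x \<in> carrier M \<Longrightarrow> f x \<in> carrier N"
    and lmap_add: "\<And>x y. \<lbrakk>x \<in> carrier M; y \<in> carrier M\<rbrakk> \<Longrightarrow> f (x \<oplus>\<^bsub>M\<^esub> y) = f x \<oplus>\<^bsub>N\<^esub> f y"
    and lmap_smult: "\<And>r x. \<lbrakk>r \<in> carrier R; x \<in> carrier M\<rbrakk> \<Longrightarrow> f (r \<odot>\<^bsub>M\<^esub> x) = r \<odot>\<^bsub>N\<^esub> f x"
  using assms unfolding lmap_def by auto

lemma lmap_zero: "lmap R M N f \<Longrightarrow> f \<zero>\<^bsub>M\<^esub> = \<zero>\<^bsub>N\<^esub>"
proof -
  assume f: "lmap R M N f"
  interpret M: right_module R M using lmap_src[OF f] .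
  interpret N: right_module R N using lmap_tgt[OF f] .
  show ?thesis using lmap_smult[OF f M.R.zero_closed M.zero_closed] lmap_closed[OF f M.zero_closed] by simp
qed

lemma lmap_uminus: "lmap R M N f \<Longrightarrow> x \<in> carrier M \<Longrightarrow> f (\<ominus>\<^bsub>M\<^esub> x) = \<ominus>\<^bsub>N\<^esub> f x"
proof -
  assume f: "lmap R M N f" and x: "x \<in> carrier M"
  interpret M: right_module R M using lmap_src[OF f] .
  interpret N: right_module R N using lmap_tgt[OF f] .
  show ?thesis using lmap_smult[OF f _ x, of "\<ominus>\<^bsub>R\<^esub> \<one>\<^bsub>R\<^esub>"] x lmap_closed[OF f x]
    by (simp add: M.smult_minus_one N.smult_minus_one)
qed

lemma lmap_minus: "\<lbrakk>lmap R M N f; x \<in> carrier M; y \<in> carrier M\<rbrakk> \<Longrightarrow> f (x \<ominus>\<^bsub>M\<^esub> y) = f x \<ominus>\<^bsub>N\<^esub> f y"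
  by (simp add: a_minus_def lmap_add lmap_uminus lmapD
      abelian_group.a_inv_closed[OF right_module.axioms(2)[OF lmap_src]])

lemma lmap_eq_iff:
  assumes "lmap R M N f" "x \<in> carrier M" "y \<in> carrier M"
  shows "f x = f y \<longleftrightarrow> f (x \<ominus>\<^bsub>M\<^esub> y) = \<zero>\<^bsub>N\<^esub>"
  using right_module.minus_eq_zero_iff[OF lmap_tgt[OF assms(1)] lmap_closed[OF assms(1,2)] lmap_closed[OF assms(1,3)]]
  unfolding lmap_minus[OF assms] by simp

lemma lmap_inj_on_iff:
  assumes "lmap R M N f"
  shows "inj_on f (carrier M) \<longleftrightarrow> (\<forall>x\<in>carrier M. f x = \<zero>\<^bsub>N\<^esub> \<longrightarrow> x = \<zero>\<^bsub>M\<^esub>)"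
proof -
  interpret M: right_module R M using lmap_src[OF assms] .
  show ?thesis
  proof
    assume "inj_on f (carrier M)"
    then show "\<forall>x\<in>carrier M. f x = \<zero>\<^bsub>N\<^esub> \<longrightarrow> x = \<zero>\<^bsub>M\<^esub>"
      using lmap_zero[OF assms] by (metis M.zero_closed inj_onD)
  next
    assume "\<forall>x\<in>carrier M. f x = \<zero>\<^bsub>N\<^esub> \<longrightarrow> x = \<zero>\<^bsub>M\<^esub>"
    then have "x = y" if "x \<in> carrier M" "y \<in> carrier M" "f x = f y" for x y
      using that lmap_eq_iff[OF assms that(1,2)] M.minus_eq_zero_iff[OF that(1,2)] by blast
    then show "inj_on f (carrier M)" by (auto intro: inj_onI)
  qed
qed

lemma lmap_cong:
  assumes "lmap R M N f" "\<And>x. x \<in> carrier M \<Longrightarrow> g x = f x"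
  shows "lmap R M N g"
proof -
  interpret M: right_module R M using lmap_src[OF assms(1)] .
  show ?thesis using assms unfolding lmap_def by (auto simp: M.smult_closed)
qed

lemma lmap_restrict: "lmap R M N f \<Longrightarrow> lmap R M N (restrict f (carrier M))"
  by (rule lmap_cong) auto

lemma lmap_id: "right_module R M \<Longrightarrow> lmap R M M (\<lambda>x. x)"
  by (simp add: lmap_def)

lemma lmap_comp: "\<lbrakk>lmap R M N f; lmap R N Q g\<rbrakk> \<Longrightarrow> lmap R M Q (\<lambda>x. g (f x))"
  by (simp add: lmap_def)

lemma lmap_zero_map:
  assumes "right_module R M" "right_module R N"
  shows "lmap R M N (\<lambda>x. \<zero>\<^bsub>N\<^esub>)"
proof -
  interpret N: right_module R N by fact
  show ?thesis using assms by (simp add: lmap_def)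
qed

lemma lmap_plus:
  assumes "lmap R M N f" "lmap R M N g"
  shows "lmap R M N (\<lambda>x. f x \<oplus>\<^bsub>N\<^esub> g x)"
proof -
  interpret N: right_module R N using lmap_tgt[OF assms(1)] .
  show ?thesis using assms
    by (auto simp: lmap_def N.a_ac N.smult_r_distr)
qed

lemma lmap_diff:
  assumes "lmap R M N f" "lmap R M N g"
  shows "lmap R M N (\<lambda>x. f x \<ominus>\<^bsub>N\<^esub> g x)"
proof -
  interpret N: right_module R N using lmap_tgt[OF assms(1)] .
  show ?thesis using assms
    by (auto simp: lmap_def N.smult_r_distr a_minus_def N.smult_r_minus N.minus_add N.a_ac)
qed

lemma lmap_sub: "\<lbrakk>right_module R M; submodule K R M\<rbrakk> \<Longrightarrow> lmap R (M\<lparr>carrier := K\<rparr>) M (\<lambda>x. x)"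
  using right_module.submodule_right_module[of R M K]
  by (auto simp: lmap_def right_module.submodule_iff)

lemma lmap_restrict_sub: "\<lbrakk>lmap R M N f; submodule K R M\<rbrakk> \<Longrightarrow> lmap R (M\<lparr>carrier := K\<rparr>) N f"
  using lmap_comp[OF lmap_sub[OF lmap_src]] by blast

lemma lmap_corestrict:
  assumes "lmap R M N f" "submodule K R N" "\<And>x. x \<in> carrier M \<Longrightarrow> f x \<in> K"
  shows "lmap R M (N\<lparr>carrier := K\<rparr>) f"
  using assms right_module.submodule_right_module[OF lmap_tgt[OF assms(1)] assms(2)]
  by (simp add: lmap_def)

lemma mod_hom_iff:
  assumes "right_module R M" "right_module R N"
  shows "f \<in> mod_hom R M N \<longleftrightarrow> lmap R M N f \<and> f \<in> extensional (carrier M)"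
  using assms unfolding mod_hom_def lmap_def PiE_def by auto

lemma mod_hom_lmap: "\<lbrakk>f \<in> mod_hom R M N; right_module R M; right_module R N\<rbrakk> \<Longrightarrow> lmap R M N f"
  by (simp add: mod_hom_iff)

lemma lmap_mod_hom: "lmap R M N f \<Longrightarrow> restrict f (carrier M) \<in> mod_hom R M N"
  by (simp add: mod_hom_iff lmap_src lmap_tgt lmap_restrict)

section \<open>Submodules under linear maps, and factorization of linear maps\<close>

lemma submodule_image:
  assumes "lmap R M N f" "submodule K R M"
  shows "submodule (f ` K) R N"
proof -
  interpret M: right_module R M using lmap_src[OF assms(1)] .
  interpret N: right_module R N using lmap_tgt[OF assms(1)] .
  from assms(2) have K: "K \<subseteq> carrier M" "\<zero>\<^bsub>M\<^esub> \<in> K" "\<And>x y. \<lbrakk>x \<in> K; y \<in> K\<rbrakk> \<Longrightarrow> x \<oplus>\<^bsub>M\<^esub> y \<in> K"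
    "\<And>r x. \<lbrakk>r \<in> carrier R; x \<in> K\<rbrakk> \<Longrightarrow> r \<odot>\<^bsub>M\<^esub> x \<in> K"
    by (auto simp: M.submodule_iff)
  have "f x \<oplus>\<^bsub>N\<^esub> f y \<in> f ` K" if "x \<in> K" "y \<in> K" for x y
    using that K lmap_add[OF assms(1), of x y] by (metis imageI subsetD)
  moreover have "r \<odot>\<^bsub>N\<^esub> f x \<in> f ` K" if "x \<in> K" "r \<in> carrier R" for x r
    using that K lmap_smult[OF assms(1), of r x] by (metis imageI subsetD)
  ultimately show ?thesis
    using K lmap_closed[OF assms(1)] lmap_zero[OF assms(1)] unfolding N.submodule_iff
    by (auto intro: image_eqI[of _ _ "\<zero>\<^bsub>M\<^esub>"])
qed

lemma submodule_range: "lmap R M N f \<Longrightarrow> submodule (f ` carrier M) R N"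
  using submodule_image right_module.submodule_carrier lmap_src by blast

lemma submodule_vimage:
  assumes "lmap R M N f" "submodule K R N"
  shows "submodule {x \<in> carrier M. f x \<in> K} R M"
proof -
  interpret M: right_module R M using lmap_src[OF assms(1)] .
  interpret N: right_module R N using lmap_tgt[OF assms(1)] .
  show ?thesis using assms(2) unfolding M.submodule_iff N.submodule_iff
    by (auto simp: M.smult_closed lmap_zero[OF assms(1)] lmap_add[OF assms(1)] lmap_smult[OF assms(1)])
qed

lemma submodule_kernel:
  assumes "lmap R M N f"
  shows "submodule {x \<in> carrier M. f x = \<zero>\<^bsub>N\<^esub>} R M"
  using submodule_vimage[OF assms right_module.submodule_zero[OF lmap_tgt[OF assms]]] by simp

text \<open>A set-theoretic section \<open>s\<close> of \<open>p\<close> gives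
  \<open>h = g \<circ> s\<close>. It is linear because \<open>g (s (p x)) = g x\<close>: the
  elements \<open>s (p x)\<close> and \<open>x\<close> differ by a member of the kernel of
  \<open>p\<close>, which \<open>g\<close> kills.\<close>

lemma lmap_factor_surj:
  assumes p: "lmap R B M p" and surj: "p ` carrier B = carrier M" and g: "lmap R B N g"
    and ker: "\<And>x. \<lbrakk>x \<in> carrier B; p x = \<zero>\<^bsub>M\<^esub>\<rbrakk> \<Longrightarrow> g x = \<zero>\<^bsub>N\<^esub>"
  obtains h where "lmap R M N h" "\<And>x. x \<in> carrier B \<Longrightarrow> h (p x) = g x"
proof -
  interpret B: right_module R B using lmap_src[OF p] .
  interpret M: right_module R M using lmap_tgt[OF p] .
  define s where "s = inv_into (carrier B) p"
  have s: "s y \<in> carrier B" "p (s y) = y" if "y \<in> carrier M" for y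
    using that surj unfolding s_def by (auto simp: inv_into_into f_inv_into_f)
  have hp: "g (s (p x)) = g x" if x: "x \<in> carrier B" for x
  proof -
    have "p (s (p x)) = p x" "s (p x) \<in> carrier B" using s lmap_closed[OF p x] by auto
    then show ?thesis using lmap_eq_iff[OF p _ x] lmap_eq_iff[OF g _ x] ker x by (metis B.minus_closed)
  qed
  have "lmap R M N (\<lambda>y. g (s y))"
    unfolding lmap_def
  proof (intro conjI ballI)
    fix x y assume xy: "x \<in> carrier M" "y \<in> carrier M"
    have "g (s x \<oplus>\<^bsub>B\<^esub> s y) = g (s (x \<oplus>\<^bsub>M\<^esub> y))"
      using hp[of "s x \<oplus>\<^bsub>B\<^esub> s y"] xy s by (simp add: lmap_add[OF p])
    then show "g (s (x \<oplus>\<^bsub>M\<^esub> y)) = g (s x) \<oplus>\<^bsub>N\<^esub> g (s y)"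
      using s xy by (simp add: lmap_add[OF g])
  next
    fix r x assume rx: "r \<in> carrier R" "x \<in> carrier M"
    have "g (r \<odot>\<^bsub>B\<^esub> s x) = g (s (r \<odot>\<^bsub>M\<^esub> x))"
      using hp[of "r \<odot>\<^bsub>B\<^esub> s x"] rx s by (simp add: lmap_smult[OF p] B.smult_closed)
    then show "g (s (r \<odot>\<^bsub>M\<^esub> x)) = r \<odot>\<^bsub>N\<^esub> g (s x)"
      using s rx by (simp add: lmap_smult[OF g])
  qed (use s lmapD[OF g] lmapD[OF p] in auto)
  then show thesis using that hp by blast
qed

text \<open>Pull \<open>g\<close> back along the inverse of \<open>i\<close> on its image; each
  linearity equation holds after applying the injective \<open>i\<close>.\<close>

lemma lmap_factor_inj:
  assumes i: "lmap R A B i" and inj: "inj_on i (carrier A)" and g: "lmap R M B g"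
    and im: "\<And>x. x \<in> carrier M \<Longrightarrow> g x \<in> i ` carrier A"
  obtains h where "lmap R M A h" "\<And>x. x \<in> carrier M \<Longrightarrow> i (h x) = g x"
proof -
  interpret A: right_module R A using lmap_src[OF i] .
  interpret M: right_module R M using lmap_src[OF g] .
  define h where "h x = inv_into (carrier A) i (g x)" for x
  have h: "h x \<in> carrier A" "i (h x) = g x" if "x \<in> carrier M" for x
    using im[OF that] unfolding h_def by (auto simp: inv_into_into f_inv_into_f)
  have "lmap R M A h"
    unfolding lmap_def
  proof (intro conjI ballI)
    fix x y assume xy: "x \<in> carrier M" "y \<in> carrier M"
    then have "i (h (x \<oplus>\<^bsub>M\<^esub> y)) = i (h x \<oplus>\<^bsub>A\<^esub> h y)"
      by (simp add: h lmap_add[OF i] lmap_add[OF g])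
    then show "h (x \<oplus>\<^bsub>M\<^esub> y) = h x \<oplus>\<^bsub>A\<^esub> h y"
      using h xy by (intro inj_onD[OF inj]) auto
  next
    fix r x assume rx: "r \<in> carrier R" "x \<in> carrier M"
    then have "i (h (r \<odot>\<^bsub>M\<^esub> x)) = i (r \<odot>\<^bsub>A\<^esub> h x)"
      by (simp add: h lmap_smult[OF i] lmap_smult[OF g] M.smult_closed)
    then show "h (r \<odot>\<^bsub>M\<^esub> x) = r \<odot>\<^bsub>A\<^esub> h x"
      using h rx by (intro inj_onD[OF inj]) (auto simp: A.smult_closed M.smult_closed)
  qed (use h lmapD[OF g] lmapD[OF i] in auto)
  then show thesis using that h by blast
qed

section \<open>Short exact sequences and quotients\<close>

text \<open>The counterpart of \<open>short_exact\<close> for maps that need not be extensional.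
  Exactness in the middle is stated elementwise, which is how the chases use it.\<close>

definition ses where
  "ses R A i B p M \<longleftrightarrow> lmap R A B i \<and> lmap R B M p \<and> inj_on i (carrier A) \<and>
     p ` carrier B = carrier M \<and> (\<forall>x\<in>carrier B. p x = \<zero>\<^bsub>M\<^esub> \<longleftrightarrow> x \<in> i ` carrier A)"

lemma sesD:
  assumes "ses R A i B p M"
  shows "lmap R A B i" "lmap R B M p" "inj_on i (carrier A)" "p ` carrier B = carrier M"
    "\<And>x. x \<in> carrier B \<Longrightarrow> p x = \<zero>\<^bsub>M\<^esub> \<longleftrightarrow> x \<in> i ` carrier A"
    "\<And>x. x \<in> carrier A \<Longrightarrow> p (i x) = \<zero>\<^bsub>M\<^esub>"
  using assms by (auto simp: ses_def lmap_closed)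

lemma ses_factor:
  assumes "ses R A i B p M" "lmap R B N g" "\<And>x. x \<in> carrier A \<Longrightarrow> g (i x) = \<zero>\<^bsub>N\<^esub>"
  obtains h where "lmap R M N h" "\<And>x. x \<in> carrier B \<Longrightarrow> h (p x) = g x"
proof (rule lmap_factor_surj[OF sesD(2,4)[OF assms(1)] assms(2)])
  show "g x = \<zero>\<^bsub>N\<^esub>" if "x \<in> carrier B" "p x = \<zero>\<^bsub>M\<^esub>" for x
    using sesD(5)[OF assms(1)] assms(3) that by auto
qed (rule that)

lemma ses_kernel:
  assumes "lmap R B M p" "p ` carrier B = carrier M"
  shows "ses R (B\<lparr>carrier := {x \<in> carrier B. p x = \<zero>\<^bsub>M\<^esub>}\<rparr>) (\<lambda>x. x) B p M"
  using assms lmap_sub[OF lmap_src submodule_kernel, OF assms(1) assms(1)]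
  by (auto simp: ses_def)

lemma ses_kernel_range:
  assumes "lmap R B M p"
  shows "ses R (B\<lparr>carrier := {x \<in> carrier B. p x = \<zero>\<^bsub>M\<^esub>}\<rparr>) (\<lambda>x. x) B p (M\<lparr>carrier := p ` carrier B\<rparr>)"
  using ses_kernel[of R B "M\<lparr>carrier := p ` carrier B\<rparr>" p] lmap_corestrict[OF assms submodule_range[OF assms]]
  by simp

lemma quot_module_coset:
  assumes "right_module R M" "submodule K R M" "x \<in> carrier M" "y \<in> carrier M"
  shows "K +>\<^bsub>M\<^esub> x = K +>\<^bsub>M\<^esub> y \<longleftrightarrow> x \<ominus>\<^bsub>M\<^esub> y \<in> K"
proof -
  interpret M: right_module R M by fact
  interpret K: additive_subgroup K M
    using assms(2) by (simp add: additive_subgroup_def submodule_def)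
  have K: "K \<subseteq> carrier M" by (rule K.a_subset)
  have 1: "x \<in> K +>\<^bsub>M\<^esub> x" if "x \<in> carrier M" for x
    using that K.zero_closed unfolding a_r_coset_def' by force
  show ?thesis
  proof
    assume "K +>\<^bsub>M\<^esub> x = K +>\<^bsub>M\<^esub> y"
    with 1[OF assms(3)] obtain k where "k \<in> K" "x = k \<oplus>\<^bsub>M\<^esub> y" unfolding a_r_coset_def' by auto
    then show "x \<ominus>\<^bsub>M\<^esub> y \<in> K" using assms K by (auto simp: M.add_minus_cancel)
  next
    assume a: "x \<ominus>\<^bsub>M\<^esub> y \<in> K"
    have "\<exists>k'\<in>K. k \<oplus>\<^bsub>M\<^esub> x = k' \<oplus>\<^bsub>M\<^esub> y" if "k \<in> K" for k
      using that a assms K by (intro bexI[of _ "k \<oplus>\<^bsub>M\<^esub> (x \<ominus>\<^bsub>M\<^esub> y)"])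
        (auto simp: M.a_assoc M.minus_add_cancel subset_iff)
    moreover have "\<exists>k'\<in>K. k \<oplus>\<^bsub>M\<^esub> y = k' \<oplus>\<^bsub>M\<^esub> x" if "k \<in> K" for k
    proof (intro bexI[of _ "k \<ominus>\<^bsub>M\<^esub> (x \<ominus>\<^bsub>M\<^esub> y)"])
      show "k \<ominus>\<^bsub>M\<^esub> (x \<ominus>\<^bsub>M\<^esub> y) \<in> K" using that a M.submodule_minus[OF assms(2)] by blast
      have "k \<oplus>\<^bsub>M\<^esub> y = ((k \<ominus>\<^bsub>M\<^esub> (x \<ominus>\<^bsub>M\<^esub> y)) \<oplus>\<^bsub>M\<^esub> (x \<ominus>\<^bsub>M\<^esub> y)) \<oplus>\<^bsub>M\<^esub> y"
        using that a assms K by (subst M.minus_add_cancel) auto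
      also have "\<dots> = k \<ominus>\<^bsub>M\<^esub> (x \<ominus>\<^bsub>M\<^esub> y) \<oplus>\<^bsub>M\<^esub> ((x \<ominus>\<^bsub>M\<^esub> y) \<oplus>\<^bsub>M\<^esub> y)"
        using that a assms K by (subst M.a_assoc) auto
      also have "\<dots> = k \<ominus>\<^bsub>M\<^esub> (x \<ominus>\<^bsub>M\<^esub> y) \<oplus>\<^bsub>M\<^esub> x"
        using assms by (simp add: M.minus_add_cancel)
      finally show "k \<oplus>\<^bsub>M\<^esub> y = k \<ominus>\<^bsub>M\<^esub> (x \<ominus>\<^bsub>M\<^esub> y) \<oplus>\<^bsub>M\<^esub> x" .
    qed
    ultimately show "K +>\<^bsub>M\<^esub> x = K +>\<^bsub>M\<^esub> y" unfolding a_r_coset_def' by fast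
  qed
qed

text \<open>Only the scalar action takes work: \<open>quot_module\<close> defines it as a union of
  cosets over all representatives, and all cosets in that union are equal because \<open>K\<close>
  is closed under scalars.\<close>

lemma quot_module_ops:
  assumes "right_module R M" "submodule K R M" "x \<in> carrier M"
  shows "y \<in> carrier M \<Longrightarrow> (K +>\<^bsub>M\<^esub> x) \<oplus>\<^bsub>quot_module M K\<^esub> (K +>\<^bsub>M\<^esub> y) = K +>\<^bsub>M\<^esub> (x \<oplus>\<^bsub>M\<^esub> y)"
    and "r \<in> carrier R \<Longrightarrow> r \<odot>\<^bsub>quot_module M K\<^esub> (K +>\<^bsub>M\<^esub> x) = K +>\<^bsub>M\<^esub> (r \<odot>\<^bsub>M\<^esub> x)"
    and "K +>\<^bsub>M\<^esub> x = \<zero>\<^bsub>quot_module M K\<^esub> \<longleftrightarrow> x \<in> K"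
    and "\<zero>\<^bsub>quot_module M K\<^esub> = K +>\<^bsub>M\<^esub> \<zero>\<^bsub>M\<^esub>"
proof -
  interpret M: right_module R M by fact
  interpret K: abelian_subgroup K M
    using assms(2) M.abelian_group_axioms by (intro abelian_subgroupI3) (simp_all add: additive_subgroup_def submodule_def)
  have K: "K \<subseteq> carrier M" by (rule K.a_subset)
  show "(K +>\<^bsub>M\<^esub> x) \<oplus>\<^bsub>quot_module M K\<^esub> (K +>\<^bsub>M\<^esub> y) = K +>\<^bsub>M\<^esub> (x \<oplus>\<^bsub>M\<^esub> y)" if "y \<in> carrier M"
    using that assms(3) by (simp add: quot_module_def K.a_rcos_sum)
  show z: "\<zero>\<^bsub>quot_module M K\<^esub> = K +>\<^bsub>M\<^esub> \<zero>\<^bsub>M\<^esub>"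
    using K by (auto simp: quot_module_def a_r_coset_def' subset_iff intro: rev_bexI)
  show "K +>\<^bsub>M\<^esub> x = \<zero>\<^bsub>quot_module M K\<^esub> \<longleftrightarrow> x \<in> K"
    unfolding z quot_module_coset[OF assms(1,2,3) M.zero_closed] using assms(3) by simp
  show "r \<odot>\<^bsub>quot_module M K\<^esub> (K +>\<^bsub>M\<^esub> x) = K +>\<^bsub>M\<^esub> (r \<odot>\<^bsub>M\<^esub> x)" if r: "r \<in> carrier R"
  proof -
    have "K +>\<^bsub>M\<^esub> (r \<odot>\<^bsub>M\<^esub> z) = K +>\<^bsub>M\<^esub> (r \<odot>\<^bsub>M\<^esub> x)" if z: "z \<in> K +>\<^bsub>M\<^esub> x" for z
    proof -
      obtain k where k: "k \<in> K" "z = k \<oplus>\<^bsub>M\<^esub> x" using z unfolding a_r_coset_def' by auto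
      then have "r \<odot>\<^bsub>M\<^esub> z \<ominus>\<^bsub>M\<^esub> r \<odot>\<^bsub>M\<^esub> x = r \<odot>\<^bsub>M\<^esub> k"
        using assms(3) r K by (auto simp: M.smult_r_distr M.add_minus_cancel M.smult_closed)
      moreover have "r \<odot>\<^bsub>M\<^esub> k \<in> K" using k r assms(2) unfolding M.submodule_iff by blast
      moreover have "z \<in> carrier M" using k assms(3) K by auto
      ultimately show ?thesis using assms(3) r
        by (simp add: quot_module_coset[OF assms(1,2)] M.smult_closed)
    qed
    moreover have "x \<in> K +>\<^bsub>M\<^esub> x"
      using assms(3) K.zero_closed unfolding a_r_coset_def' by force
    ultimately have "(\<Union>z\<in>K +>\<^bsub>M\<^esub> x. K +>\<^bsub>M\<^esub> (r \<odot>\<^bsub>M\<^esub> z)) = K +>\<^bsub>M\<^esub> (r \<odot>\<^bsub>M\<^esub> x)" by blast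
    then show ?thesis by (simp add: quot_module_def)
  qed
qed

lemma quot_module_right_module:
  assumes "right_module R M" "submodule K R M"
  shows "right_module R (quot_module M K)"
proof -
  interpret M: right_module R M by fact
  have c: "X \<in> carrier (quot_module M K) \<longleftrightarrow> (\<exists>x\<in>carrier M. X = K +>\<^bsub>M\<^esub> x)" for X
    by (auto simp: quot_module_def A_RCOSETS_def')
  note ops = quot_module_ops[OF assms]
  show ?thesis
    by (rule right_moduleI)
      (auto simp: c ops(1,2) ops(4)[OF M.zero_closed] M.R.ring_axioms M.a_ac M.smult_l_distr
        M.smult_r_distr M.smult_assoc M.smult_one M.smult_closed)
qed

lemma ses_quot_module:
  assumes "right_module R M" "submodule K R M"
  shows "ses R (M\<lparr>carrier := K\<rparr>) (\<lambda>x. x) M (\<lambda>x. K +>\<^bsub>M\<^esub> x) (quot_module M K)"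
proof -
  interpret M: right_module R M by fact
  have "lmap R M (quot_module M K) (\<lambda>x. K +>\<^bsub>M\<^esub> x)"
    unfolding lmap_def using quot_module_right_module[OF assms] quot_module_ops[OF assms]
    by (auto simp: assms quot_module_def A_RCOSETS_def')
  then show ?thesis
    using lmap_sub[OF assms] quot_module_ops(3)[OF assms]
    by (auto simp: ses_def quot_module_def A_RCOSETS_def')
qed

lemma ses_quot_range:
  assumes "lmap R A B i" "inj_on i (carrier A)"
  shows "ses R A i B (\<lambda>x. (i ` carrier A) +>\<^bsub>B\<^esub> x) (quot_module B (i ` carrier A))"
  using ses_quot_module[OF lmap_tgt submodule_range, OF assms(1,1)] assms
  by (auto simp: ses_def)

section \<open>Finite powers and their summands\<close>

text \<open>Sums over an initial segment of the naturals, by recursion: congruence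
  (\<open>msum_cong\<close>) then holds with no membership in the carrier to check, and linear maps
  commute with such sums by a plain induction.\<close>

primrec msum :: "('r, 'm) module \<Rightarrow> (nat \<Rightarrow> 'm) \<Rightarrow> nat \<Rightarrow> 'm" where
  "msum M f 0 = \<zero>\<^bsub>M\<^esub>"
| "msum M f (Suc n) = msum M f n \<oplus>\<^bsub>M\<^esub> f n"

lemma msum_in_submodule:
  assumes "right_module R M" "submodule K R M" "\<And>i. i < n \<Longrightarrow> f i \<in> K"
  shows "msum M f n \<in> K"
  using assms(3) by (induction n) (use assms(1,2) in \<open>auto simp: right_module.submodule_iff\<close>)

lemma msum_closed: "\<lbrakk>right_module R M; \<And>i. i < n \<Longrightarrow> f i \<in> carrier M\<rbrakk> \<Longrightarrow> msum M f n \<in> carrier M"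
  using msum_in_submodule right_module.submodule_carrier by blast

lemma msum_cong: "(\<And>i. i < n \<Longrightarrow> f i = g i) \<Longrightarrow> msum M f n = msum M g n"
  by (induction n) auto

lemma lmap_msum:
  assumes "lmap R M N g" "\<And>i. i < n \<Longrightarrow> f i \<in> carrier M"
  shows "g (msum M f n) = msum N (\<lambda>i. g (f i)) n"
  using assms(2)
  by (induction n) (auto simp: lmap_zero[OF assms(1)] lmap_add[OF assms(1)] msum_closed[OF lmap_src[OF assms(1)]])

lemma msum_lmap:
  assumes "right_module R M" "right_module R N" "\<And>i. i < n \<Longrightarrow> lmap R M N (f i)"
  shows "lmap R M N (\<lambda>x. msum N (\<lambda>i. f i x) n)"
  using assms(3) by (induction n) (auto intro: lmap_zero_map lmap_plus assms)

lemma msum_zero: "right_module R M \<Longrightarrow> msum M (\<lambda>i. \<zero>\<^bsub>M\<^esub>) n = \<zero>\<^bsub>M\<^esub>"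
  by (induction n) (auto simp: right_module_def abelian_group_def abelian_monoid.l_zero abelian_monoid.zero_closed)

lemma msum_delta:
  assumes "right_module R M" "x \<in> carrier M" "i < n"
  shows "msum M (\<lambda>j. if j = i then x else \<zero>\<^bsub>M\<^esub>) n = x"
  using assms(3)
proof (induction n)
  case (Suc n)
  interpret M: right_module R M by fact
  show ?case
  proof (cases "i = n")
    case True
    then have "msum M (\<lambda>j. if j = i then x else \<zero>\<^bsub>M\<^esub>) n = msum M (\<lambda>j. \<zero>\<^bsub>M\<^esub>) n" by (intro msum_cong) auto
    then show ?thesis using True assms(2) msum_zero[OF assms(1)] by simp
  next
    case False then show ?thesis using Suc assms(2) by simp
  qed
qed simp

lemma power_module_simps [simp]:
  "carrier (power_module M n) = {..<n} \<rightarrow>\<^sub>E carrier M"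
  "\<zero>\<^bsub>power_module M n\<^esub> = (\<lambda>i\<in>{..<n}. \<zero>\<^bsub>M\<^esub>)"
  "x \<oplus>\<^bsub>power_module M n\<^esub> y = (\<lambda>i\<in>{..<n}. x i \<oplus>\<^bsub>M\<^esub> y i)"
  "r \<odot>\<^bsub>power_module M n\<^esub> x = (\<lambda>i\<in>{..<n}. r \<odot>\<^bsub>M\<^esub> x i)"
  by (simp_all add: power_module_def)

lemma right_module_power:
  assumes "right_module R M"
  shows "right_module R (power_module M n)"
proof -
  interpret M: right_module R M by fact
  show ?thesis
    by (rule right_moduleI)
      (auto simp: M.R.ring_axioms M.a_ac M.smult_closed M.smult_l_distr M.smult_r_distr M.smult_assoc
        M.smult_one PiE_iff extensional_def fun_eq_iff restrict_def)
qed

lemma lmap_proj: "\<lbrakk>right_module R M; i < n\<rbrakk> \<Longrightarrow> lmap R (power_module M n) M (\<lambda>x. x i)"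
  by (auto simp: lmap_def right_module_power)

lemma lmap_tuple:
  assumes "right_module R N" "right_module R M" "\<And>i. i < n \<Longrightarrow> lmap R N M (g i)"
  shows "lmap R N (power_module M n) (\<lambda>x. \<lambda>i\<in>{..<n}. g i x)"
  using assms by (auto simp: lmap_def right_module_power)

text \<open>The coordinate embeddings of \<open>M\<close> into its \<open>n\<close>-th power;
  together with the projections they form the dual basis behind \<open>sumd_power\<close>.\<close>

definition pinj :: "('r, 'm) module \<Rightarrow> nat \<Rightarrow> nat \<Rightarrow> 'm \<Rightarrow> nat \<Rightarrow> 'm" where
  "pinj M n i x = (\<lambda>j\<in>{..<n}. if j = i then x else \<zero>\<^bsub>M\<^esub>)"

lemma lmap_pinj:
  assumes "right_module R M"
  shows "lmap R M (power_module M n) (pinj M n i)"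
proof -
  have "lmap R M M (\<lambda>x. if j = i then x else \<zero>\<^bsub>M\<^esub>)" for j
    using lmap_id[OF assms] lmap_zero_map[OF assms assms] by (cases "j = i") auto
  from lmap_tuple[OF assms assms this] show ?thesis unfolding pinj_def[abs_def] .
qed

lemma msum_power:
  assumes "right_module R M" "\<And>i. i < k \<Longrightarrow> f i \<in> carrier (power_module M n)" "j < n"
  shows "msum (power_module M n) f k j = msum M (\<lambda>i. f i j) k"
  using lmap_msum[OF lmap_proj[OF assms(1,3)], of k f] assms(2) by simp

lemma power_decomp:
  assumes "right_module R M" "x \<in> carrier (power_module M n)"
  shows "msum (power_module M n) (\<lambda>i. pinj M n i (x i)) n = x"
proof (rule PiE_ext)
  have c: "pinj M n i (x i) \<in> carrier (power_module M n)" if "i < n" for i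
    using lmap_closed[OF lmap_pinj[OF assms(1)]] assms(2) that by (auto simp: PiE_mem)
  then show "msum (power_module M n) (\<lambda>i. pinj M n i (x i)) n \<in> {..<n} \<rightarrow>\<^sub>E carrier M"
    using msum_closed[OF right_module_power[OF assms(1)]] by force
  show "x \<in> {..<n} \<rightarrow>\<^sub>E carrier M" using assms(2) by simp
  fix j assume j: "j \<in> {..<n}"
  then have "msum (power_module M n) (\<lambda>i. pinj M n i (x i)) n j = msum M (\<lambda>i. pinj M n i (x i) j) n"
    using c by (intro msum_power[OF assms(1)]) auto
  also have "\<dots> = msum M (\<lambda>i. if i = j then x j else \<zero>\<^bsub>M\<^esub>) n"
    using j by (intro msum_cong) (auto simp: pinj_def)
  also have "\<dots> = x j" using j assms(2) by (intro msum_delta[OF assms(1)]) (auto simp: PiE_mem)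
  finally show "msum (power_module M n) (\<lambda>i. pinj M n i (x i)) n j = x j" .
qed

text \<open>A dual basis description of the modules in \<open>add M\<close>; for \<open>M\<close> the regular module these are the
  finitely generated projectives.\<close>

definition sumd :: "'r ring \<Rightarrow> ('r, 'm) module \<Rightarrow> ('r, 'p) module \<Rightarrow> bool" where
  "sumd R M P \<longleftrightarrow> right_module R M \<and> right_module R P \<and> (\<exists>n u v.
     (\<forall>i<n. lmap R M P (u i) \<and> lmap R P M (v i)) \<and>
     (\<forall>x\<in>carrier P. msum P (\<lambda>i. u i (v i x)) n = x))"

lemma sumdE:
  assumes "sumd R M P"
  obtains n u v where "right_module R M" "right_module R P" "\<And>i. i < n \<Longrightarrow> lmap R M P (u i)"
    "\<And>i. i < n \<Longrightarrow> lmap R P M (v i)" "\<And>x. x \<in> carrier P \<Longrightarrow> msum P (\<lambda>i. u i (v i x)) (n::nat) = x"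
  using assms unfolding sumd_def by blast

lemma sumd_power: "right_module R M \<Longrightarrow> sumd R M (power_module M n)"
  unfolding sumd_def using right_module_power[of R M n]
  by (intro conjI exI[of _ n] exI[of _ "pinj M n"] exI[of _ "\<lambda>i x. x i"])
    (auto simp: lmap_pinj lmap_proj power_decomp simp del: power_module_simps)

text \<open>Push one half of the dual basis forward along \<open>f\<close> and pull the other half
  back along \<open>g\<close>.\<close>

lemma sumd_retract:
  assumes "sumd R M P" "lmap R P Q f" "lmap R Q P g" "\<And>x. x \<in> carrier Q \<Longrightarrow> f (g x) = x"
  shows "sumd R M Q"
proof -
  obtain n u v where s: "right_module R M" "right_module R P" "\<And>i. i < n \<Longrightarrow> lmap R M P (u i)"
    "\<And>i. i < n \<Longrightarrow> lmap R P M (v i)" "\<And>x. x \<in> carrier P \<Longrightarrow> msum P (\<lambda>i. u i (v i x)) (n::nat) = x"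
    by (rule sumdE[OF assms(1)]) blast
  have "msum Q (\<lambda>i. f (u i (v i (g x)))) n = x" if x: "x \<in> carrier Q" for x
  proof -
    have "f (msum P (\<lambda>i. u i (v i (g x))) n) = msum Q (\<lambda>i. f (u i (v i (g x)))) n"
      using x by (intro lmap_msum[OF assms(2)] lmap_closed[OF s(3)] lmap_closed[OF s(4)] lmap_closed[OF assms(3)])
    then show ?thesis using s(5) assms x by (simp add: lmap_closed[OF assms(3)])
  qed
  then show ?thesis unfolding sumd_def using s assms lmap_tgt[OF assms(2)]
    by (intro conjI exI[of _ n] exI[of _ "\<lambda>i x. f (u i x)"] exI[of _ "\<lambda>i x. v i (g x)"])
      (auto intro: lmap_comp)
qed

text \<open>\<open>M\<close> is a retract of its first power, through coordinate
  \<open>0\<close>.\<close>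

lemma sumd_refl: "right_module R M \<Longrightarrow> sumd R M M"
  using sumd_retract[OF sumd_power lmap_proj lmap_pinj, of R M 0 1 0] by (simp add: pinj_def)

lemma lmap_inverse:
  assumes "lmap R M N f" "bij_betw f (carrier M) (carrier N)"
  obtains g where "lmap R N M g" "\<And>x. x \<in> carrier N \<Longrightarrow> f (g x) = x" "\<And>x. x \<in> carrier M \<Longrightarrow> g (f x) = x"
proof -
  obtain g where g: "lmap R N M g" "\<And>x. x \<in> carrier N \<Longrightarrow> f (g x) = x"
    by (rule lmap_factor_inj[OF assms(1) bij_betw_imp_inj_on[OF assms(2)] lmap_id[OF lmap_tgt[OF assms(1)]]])
      (use assms(2) in \<open>auto simp: bij_betw_def\<close>)
  moreover have "g (f x) = x" if "x \<in> carrier M" for x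
    using that g lmap_closed[OF g(1)] lmap_closed[OF assms(1)] bij_betw_imp_inj_on[OF assms(2)] by (metis inj_onD)
  ultimately show thesis using that by blast
qed

lemma mod_isoE:
  assumes "mod_iso R M N" "right_module R M" "right_module R N"
  obtains f g where "lmap R M N f" "lmap R N M g" "\<And>x. x \<in> carrier N \<Longrightarrow> f (g x) = x"
    "\<And>x. x \<in> carrier M \<Longrightarrow> g (f x) = x"
proof -
  obtain f where "f \<in> mod_hom R M N" "bij_betw f (carrier M) (carrier N)"
    using assms(1) unfolding mod_iso_def by auto
  with mod_hom_lmap assms lmap_inverse that show thesis by metis
qed

text \<open>The complement \<open>B\<close> is only given as a submodule. \<open>p x\<close> is the
  one element \<open>a\<close> of \<open>A\<close> with \<open>x \<ominus> a\<close> in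
  \<open>B\<close>; linearity follows from this uniqueness, because sums and multiples of such
  elements satisfy the same condition.\<close>

lemma direct_summand_projection:
  assumes "right_module R M" "direct_summand R M A"
  obtains p where "lmap R M (M\<lparr>carrier := A\<rparr>) p" "\<And>a. a \<in> A \<Longrightarrow> p a = a"
proof -
  interpret M: right_module R M by fact
  obtain B where A: "submodule A R M" and B: "submodule B R M" "A \<inter> B = {\<zero>\<^bsub>M\<^esub>}" "A <+>\<^bsub>M\<^esub> B = carrier M"
    using assms(2) unfolding direct_summand_def by auto
  have AB: "A \<subseteq> carrier M" "B \<subseteq> carrier M" using A B by (auto simp: M.submodule_iff)
  have ex: "\<exists>a\<in>A. x \<ominus>\<^bsub>M\<^esub> a \<in> B" if x: "x \<in> carrier M" for x
  proof -
    have "x \<in> (\<Union>h\<in>A. \<Union>k\<in>B. {h \<oplus>\<^bsub>M\<^esub> k})" using x B(3) unfolding set_add_def' by simp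
    then obtain a b where ab: "a \<in> A" "b \<in> B" "x = a \<oplus>\<^bsub>M\<^esub> b" by blast
    then have "x \<ominus>\<^bsub>M\<^esub> a = b" using AB by (auto simp: M.minus_eq_iff M.a_comm subset_iff)
    with ab show ?thesis by metis
  qed
  have uniq: "a = a'" if a: "a \<in> A" "a' \<in> A" and x: "x \<in> carrier M" "x \<ominus>\<^bsub>M\<^esub> a \<in> B" "x \<ominus>\<^bsub>M\<^esub> a' \<in> B" for x a a'
  proof -
    have "(x \<ominus>\<^bsub>M\<^esub> a') \<ominus>\<^bsub>M\<^esub> (x \<ominus>\<^bsub>M\<^esub> a) = a \<ominus>\<^bsub>M\<^esub> a'"
    proof (subst M.minus_eq_iff)
      have "a \<ominus>\<^bsub>M\<^esub> a' \<oplus>\<^bsub>M\<^esub> (x \<ominus>\<^bsub>M\<^esub> a) = (a \<oplus>\<^bsub>M\<^esub> x) \<ominus>\<^bsub>M\<^esub> (a \<oplus>\<^bsub>M\<^esub> a')"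
        using a x AB by (simp add: M.add_minus_add[symmetric] subset_iff M.a_comm)
      also have "\<dots> = (a \<ominus>\<^bsub>M\<^esub> a) \<oplus>\<^bsub>M\<^esub> (x \<ominus>\<^bsub>M\<^esub> a')"
        using a x AB by (intro M.add_minus_add) auto
      also have "a \<ominus>\<^bsub>M\<^esub> a = \<zero>\<^bsub>M\<^esub>" using a AB by (auto simp: M.minus_eq_zero_iff)
      finally show "x \<ominus>\<^bsub>M\<^esub> a' = a \<ominus>\<^bsub>M\<^esub> a' \<oplus>\<^bsub>M\<^esub> (x \<ominus>\<^bsub>M\<^esub> a)" using a x AB by (auto simp: subset_iff)
    qed (use a x AB in auto)
    then have "a \<ominus>\<^bsub>M\<^esub> a' \<in> A \<inter> B"
      using M.submodule_minus[OF B(1) x(3,2)] M.submodule_minus[OF A a] by simp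
    then show ?thesis using B(2) a AB M.minus_eq_zero_iff[of a a'] by auto
  qed
  define p where "p x = (SOME a. a \<in> A \<and> x \<ominus>\<^bsub>M\<^esub> a \<in> B)" for x
  have p: "p x \<in> A" "x \<ominus>\<^bsub>M\<^esub> p x \<in> B" if "x \<in> carrier M" for x
    using someI_ex[of "\<lambda>a. a \<in> A \<and> x \<ominus>\<^bsub>M\<^esub> a \<in> B"] ex[OF that] unfolding p_def by auto
  have pM: "p x \<in> carrier M" if "x \<in> carrier M" for x using p[OF that] AB by auto
  have "lmap R M (M\<lparr>carrier := A\<rparr>) p"
    unfolding lmap_def
  proof (intro conjI ballI)
    fix x y assume xy: "x \<in> carrier M" "y \<in> carrier M"
    have "(x \<oplus>\<^bsub>M\<^esub> y) \<ominus>\<^bsub>M\<^esub> (p x \<oplus>\<^bsub>M\<^esub> p y) \<in> B"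
      using B(1) p xy pM unfolding M.add_minus_add[OF xy pM[OF xy(1)] pM[OF xy(2)]] M.submodule_iff by blast
    moreover have "p x \<oplus>\<^bsub>M\<^esub> p y \<in> A" using A p xy unfolding M.submodule_iff by blast
    ultimately show "p (x \<oplus>\<^bsub>M\<^esub> y) = p x \<oplus>\<^bsub>M\<lparr>carrier := A\<rparr>\<^esub> p y"
      using uniq[of "p (x \<oplus>\<^bsub>M\<^esub> y)" "p x \<oplus>\<^bsub>M\<^esub> p y" "x \<oplus>\<^bsub>M\<^esub> y"] p xy by simp
  next
    fix r x assume rx: "r \<in> carrier R" "x \<in> carrier M"
    have "r \<odot>\<^bsub>M\<^esub> (x \<ominus>\<^bsub>M\<^esub> p x) \<in> B" using B(1) p rx unfolding M.submodule_iff by blast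
    then have "r \<odot>\<^bsub>M\<^esub> x \<ominus>\<^bsub>M\<^esub> r \<odot>\<^bsub>M\<^esub> p x \<in> B"
      using rx pM by (simp add: a_minus_def M.smult_r_distr M.smult_r_minus)
    moreover have "r \<odot>\<^bsub>M\<^esub> p x \<in> A" using A p rx unfolding M.submodule_iff by blast
    ultimately show "p (r \<odot>\<^bsub>M\<^esub> x) = r \<odot>\<^bsub>M\<lparr>carrier := A\<rparr>\<^esub> p x"
      using uniq[of "p (r \<odot>\<^bsub>M\<^esub> x)" "r \<odot>\<^bsub>M\<^esub> p x" "r \<odot>\<^bsub>M\<^esub> x"] p rx by (simp add: M.smult_closed)
  qed (use p assms M.submodule_right_module[OF A] in auto)
  moreover have "p a = a" if a: "a \<in> A" for a
  proof -
    have "a \<ominus>\<^bsub>M\<^esub> a \<in> B" using a AB B(1) by (auto simp: M.minus_eq_zero_iff M.submodule_iff a_minus_def M.r_neg subset_iff)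
    then show ?thesis using uniq[of "p a" a a] p a AB by auto
  qed
  ultimately show thesis using that by blast
qed

text \<open>The projection onto a direct summand makes \<open>X\<close> a retract of a finite power
  of \<open>M\<close>.\<close>

lemma in_add_sumd:
  assumes "right_module R M" "in_add R M X"
  shows "sumd R M X"
proof -
  obtain n A where X: "right_module R X" and A: "direct_summand R (power_module M n) A"
    "mod_iso R X ((power_module M n)\<lparr>carrier := A\<rparr>)"
    using assms(2) unfolding in_add_def by auto
  let ?P = "power_module M n"
  have P: "right_module R ?P" using right_module_power[OF assms(1)] .
  have A': "submodule A R ?P" using A(1) unfolding direct_summand_def by auto
  obtain p where p: "lmap R ?P (?P\<lparr>carrier := A\<rparr>) p" "\<And>a. a \<in> A \<Longrightarrow> p a = a"
    using direct_summand_projection[OF P A(1)] by blast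
  obtain f g where fg: "lmap R X (?P\<lparr>carrier := A\<rparr>) f" "lmap R (?P\<lparr>carrier := A\<rparr>) X g"
    "\<And>x. x \<in> carrier X \<Longrightarrow> g (f x) = x"
    using mod_isoE[OF A(2) X right_module.submodule_right_module[OF P A']] by metis
  have f: "lmap R X ?P f" using lmap_comp[OF fg(1) lmap_sub[OF P A']] .
  show ?thesis
    using sumd_retract[OF sumd_power[OF assms(1)] lmap_comp[OF p(1) fg(2)] f]
      p(2) fg(3) lmap_closed[OF fg(1)] by auto
qed

lemma in_add_power: 
  assumes "right_module R M"
  shows "in_add R M (power_module M n)"
proof -
  let ?P = "power_module M n"
  have P: "right_module R ?P" using right_module_power[OF assms] .
  interpret P: right_module R ?P by fact
  have "direct_summand R ?P (carrier ?P)"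
    unfolding direct_summand_def
  proof (intro conjI exI[of _ "{\<zero>\<^bsub>?P\<^esub>}"])
    show "carrier ?P \<inter> {\<zero>\<^bsub>?P\<^esub>} = {\<zero>\<^bsub>?P\<^esub>}" using P.zero_closed by blast
    show "carrier ?P <+>\<^bsub>?P\<^esub> {\<zero>\<^bsub>?P\<^esub>} = carrier ?P"
      unfolding set_add_def' using P.r_zero by (force simp del: power_module_simps)
  qed (rule P.submodule_carrier P.submodule_zero)+
  moreover have "mod_iso R ?P (?P\<lparr>carrier := carrier ?P\<rparr>)"
    unfolding mod_iso_def using lmap_mod_hom[OF lmap_id[OF P]]
    by (intro bexI[of _ "restrict (\<lambda>x. x) (carrier ?P)"]) (auto simp: bij_betw_def inj_on_def simp del: power_module_simps)
  ultimately show ?thesis unfolding in_add_def using P by blast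
qed

declare power_module_simps [simp del]

text \<open>Projectivity of \<open>P\<close> relative to one map \<open>q\<close>, since a
  quantifier over all surjections would range over types. The condition on the range of
  \<open>h\<close> takes the place of surjectivity of \<open>q\<close>, which makes the notion
  applicable to the differentials of an injective coresolution.\<close>

definition lifting :: "'r ring \<Rightarrow> ('r, 'p) module \<Rightarrow> ('r, 'b) module \<Rightarrow> ('r, 'n) module \<Rightarrow> ('b \<Rightarrow> 'n) \<Rightarrow> bool" where
  "lifting R P B N q \<longleftrightarrow> lmap R B N q \<and> (\<forall>h. lmap R P N h \<and> (\<forall>x\<in>carrier P. h x \<in> q ` carrier B) \<longrightarrow>
     (\<exists>g. lmap R P B g \<and> (\<forall>x\<in>carrier P. q (g x) = h x)))"

lemma liftingE:
  assumes "lifting R P B N q" "lmap R P N h" "\<And>x. x \<in> carrier P \<Longrightarrow> h x \<in> q ` carrier B"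
  obtains g where "lmap R P B g" "\<And>x. x \<in> carrier P \<Longrightarrow> q (g x) = h x"
  using assms unfolding lifting_def by meson

text \<open>Lift each composite \<open>h \<circ> u i\<close> from \<open>M\<close> and reassemble
  the lifts with the \<open>v i\<close>.\<close>

lemma lifting_sumd:
  assumes "lifting R M B N q" "sumd R M P"
  shows "lifting R P B N q"
proof -
  have q: "lmap R B N q" using assms(1) by (simp add: lifting_def)
  have "\<exists>g. lmap R P B g \<and> (\<forall>x\<in>carrier P. q (g x) = h x)"
    if h: "lmap R P N h" and hq: "\<forall>x\<in>carrier P. h x \<in> q ` carrier B" for h
  proof -
  obtain n u v where s: "right_module R M" "right_module R P" "\<And>i. i < n \<Longrightarrow> lmap R M P (u i)"
    "\<And>i. i < n \<Longrightarrow> lmap R P M (v i)" "\<And>x. x \<in> carrier P \<Longrightarrow> msum P (\<lambda>i. u i (v i x)) (n::nat) = x"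
    by (rule sumdE[OF assms(2)]) blast
  have "\<exists>g. lmap R M B g \<and> (\<forall>x\<in>carrier M. q (g x) = h (u i x))" if i: "i < n" for i
    using liftingE[OF assms(1) lmap_comp[OF s(3)[OF i] h]] hq lmap_closed[OF s(3)[OF i]] by metis
  then obtain g where g: "\<And>i. i < n \<Longrightarrow> lmap R M B (g i)" "\<And>i x. \<lbrakk>i < n; x \<in> carrier M\<rbrakk> \<Longrightarrow> q (g i x) = h (u i x)"
    by metis
  have "q (msum B (\<lambda>i. g i (v i x)) n) = h x" if x: "x \<in> carrier P" for x
  proof -
    have "q (msum B (\<lambda>i. g i (v i x)) n) = msum N (\<lambda>i. q (g i (v i x))) n"
      using x by (intro lmap_msum[OF q] lmap_closed[OF g(1)] lmap_closed[OF s(4)])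
    also have "\<dots> = msum N (\<lambda>i. h (u i (v i x))) n"
      using x by (intro msum_cong g(2) lmap_closed[OF s(4)])
    also have "\<dots> = h (msum P (\<lambda>i. u i (v i x)) n)"
      using x by (intro lmap_msum[OF h, symmetric] lmap_closed[OF s(3)] lmap_closed[OF s(4)])
    finally show ?thesis using s(5)[OF x] by simp
  qed
  moreover have "lmap R P B (\<lambda>x. msum B (\<lambda>i. g i (v i x)) n)"
    using s(2) by (intro msum_lmap lmap_src[OF q]) (auto intro: lmap_comp[OF s(4) g(1)])
  ultimately show ?thesis by blast
  qed
  with q show ?thesis unfolding lifting_def by blast
qed

section \<open>Free modules\<close>

lemma regular_module_simps [simp]:
  "carrier (regular_module R) = carrier R" "\<zero>\<^bsub>regular_module R\<^esub> = \<zero>\<^bsub>R\<^esub>"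
  "x \<oplus>\<^bsub>regular_module R\<^esub> y = x \<oplus>\<^bsub>R\<^esub> y" "r \<odot>\<^bsub>regular_module R\<^esub> x = x \<otimes>\<^bsub>R\<^esub> r"
  by (simp_all add: regular_module_def)

lemma right_module_regular:
  assumes "ring R"
  shows "right_module R (regular_module R)"
proof -
  interpret R: ring R by fact
  show ?thesis
    by (rule right_moduleI) (auto simp: assms R.a_ac R.l_distr R.r_distr R.m_assoc)
qed

lemma lmap_orbit:
  assumes "right_module R N" "x \<in> carrier N"
  shows "lmap R (regular_module R) N (\<lambda>r. r \<odot>\<^bsub>N\<^esub> x)"
proof -
  interpret N: right_module R N by fact
  show ?thesis unfolding lmap_def using right_module_regular[OF N.R.ring_axioms]
    by (auto simp: assms N.smult_closed N.smult_l_distr N.smult_assoc)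
qed

lemma lmap_regular:
  assumes "ring R" "lmap R (regular_module R) N h" "r \<in> carrier R"
  shows "h r = r \<odot>\<^bsub>N\<^esub> h \<one>\<^bsub>R\<^esub>"
proof -
  interpret R: ring R by fact
  show ?thesis using lmap_smult[OF assms(2), of r "\<one>\<^bsub>R\<^esub>"] assms(3) by simp
qed

text \<open>A map from the regular module is determined by the image of \<open>\<one>\<close>, so
  the orbit map of one preimage of that image is a lift.\<close>

lemma lifting_regular:
  assumes "ring R" and q: "lmap R B N q"
  shows "lifting R (regular_module R) B N q"
  unfolding lifting_def
proof (intro conjI allI impI q, elim conjE)
  interpret R: ring R by fact
  fix h assume h: "lmap R (regular_module R) N h"
    and hq: "\<forall>x\<in>carrier (regular_module R). h x \<in> q ` carrier B"
  from hq obtain b where b: "b \<in> carrier B" "h \<one>\<^bsub>R\<^esub> = q b" using R.one_closed by (auto simp: image_iff)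
  have "q (r \<odot>\<^bsub>B\<^esub> b) = h r" if "r \<in> carrier R" for r
    using lmap_smult[OF q that b(1)] lmap_regular[OF assms(1) h that] b(2) by argo
  then show "\<exists>g. lmap R (regular_module R) B g \<and> (\<forall>x\<in>carrier (regular_module R). q (g x) = h x)"
    using lmap_orbit[OF lmap_src[OF q] b(1)] by (intro exI[of _ "\<lambda>r. r \<odot>\<^bsub>B\<^esub> b"]) simp
qed

lemma free_module_simps [simp]:
  "carrier (free_module R B) = {f. range f \<subseteq> carrier R \<and> finite {b. f b \<noteq> \<zero>\<^bsub>R\<^esub>} \<and> {b. f b \<noteq> \<zero>\<^bsub>R\<^esub>} \<subseteq> B}"
  "\<zero>\<^bsub>free_module R B\<^esub> = (\<lambda>b. \<zero>\<^bsub>R\<^esub>)" "x \<oplus>\<^bsub>free_module R B\<^esub> y = (\<lambda>b. x b \<oplus>\<^bsub>R\<^esub> y b)"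
  "r \<odot>\<^bsub>free_module R B\<^esub> x = (\<lambda>b. x b \<otimes>\<^bsub>R\<^esub> r)"
  by (simp_all add: free_module_def)

lemma right_module_free:
  assumes "ring R"
  shows "right_module R (free_module R B)"
proof -
  interpret R: ring R by fact
  have 1: "finite {b. f b \<oplus>\<^bsub>R\<^esub> g b \<noteq> \<zero>\<^bsub>R\<^esub>}" "{b. f b \<oplus>\<^bsub>R\<^esub> g b \<noteq> \<zero>\<^bsub>R\<^esub>} \<subseteq> B"
    if "finite {b. f b \<noteq> \<zero>\<^bsub>R\<^esub>}" "{b. f b \<noteq> \<zero>\<^bsub>R\<^esub>} \<subseteq> B" "finite {b. g b \<noteq> \<zero>\<^bsub>R\<^esub>}" "{b. g b \<noteq> \<zero>\<^bsub>R\<^esub>} \<subseteq> B" for f g :: "'b \<Rightarrow> 'a"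
  proof -
    have "{b. f b \<oplus>\<^bsub>R\<^esub> g b \<noteq> \<zero>\<^bsub>R\<^esub>} \<subseteq> {b. f b \<noteq> \<zero>\<^bsub>R\<^esub>} \<union> {b. g b \<noteq> \<zero>\<^bsub>R\<^esub>}" by auto
    with that show "finite {b. f b \<oplus>\<^bsub>R\<^esub> g b \<noteq> \<zero>\<^bsub>R\<^esub>}" "{b. f b \<oplus>\<^bsub>R\<^esub> g b \<noteq> \<zero>\<^bsub>R\<^esub>} \<subseteq> B"
      by (auto intro: finite_subset)
  qed
  have 2: "finite {b. f b \<otimes>\<^bsub>R\<^esub> r \<noteq> \<zero>\<^bsub>R\<^esub>}" "{b. f b \<otimes>\<^bsub>R\<^esub> r \<noteq> \<zero>\<^bsub>R\<^esub>} \<subseteq> B"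
    if "finite {b. f b \<noteq> \<zero>\<^bsub>R\<^esub>}" "{b. f b \<noteq> \<zero>\<^bsub>R\<^esub>} \<subseteq> B" "r \<in> carrier R" for f :: "'b \<Rightarrow> 'a" and r
  proof -
    have "{b. f b \<otimes>\<^bsub>R\<^esub> r \<noteq> \<zero>\<^bsub>R\<^esub>} \<subseteq> {b. f b \<noteq> \<zero>\<^bsub>R\<^esub>}" using that(3) by auto
    with that show "finite {b. f b \<otimes>\<^bsub>R\<^esub> r \<noteq> \<zero>\<^bsub>R\<^esub>}" "{b. f b \<otimes>\<^bsub>R\<^esub> r \<noteq> \<zero>\<^bsub>R\<^esub>} \<subseteq> B"
      by (auto intro: finite_subset)
  qed
  show ?thesis
    by (rule right_moduleI)
      (use 1 2 in \<open>auto simp: assms R.a_ac R.l_distr R.r_distr R.m_assoc image_subset_iff fun_eq_iff\<close>)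
qed

definition delta :: "'r ring \<Rightarrow> 'b \<Rightarrow> 'b \<Rightarrow> 'r" where
  "delta R b = (\<lambda>c. if c = b then \<one>\<^bsub>R\<^esub> else \<zero>\<^bsub>R\<^esub>)"

lemma delta_in_free: "\<lbrakk>ring R; b \<in> B\<rbrakk> \<Longrightarrow> delta R b \<in> carrier (free_module R B)"
  using ring.ring_simprules(6)[of R] ring.ring_simprules(2)[of R]
  by (auto simp: delta_def intro: finite_subset[of _ "{b}"] split: if_splits)

text \<open>\<open>lin_ext\<close> sums over the support of \<open>f\<close>, which changes when
  functions are added; a common finite superset of the supports makes the sums comparable.\<close>

lemma lin_ext_superset:
  assumes "right_module R N" "finite A" "{b. f b \<noteq> \<zero>\<^bsub>R\<^esub>} \<subseteq> A" "\<phi> ` A \<subseteq> carrier N" "range f \<subseteq> carrier R"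
  shows "lin_ext R N \<phi> f = (\<Oplus>\<^bsub>N\<^esub>b\<in>A. f b \<odot>\<^bsub>N\<^esub> \<phi> b)"
proof -
  interpret N: right_module R N by fact
  show ?thesis unfolding lin_ext_def
    using assms by (intro N.add.finprod_mono_neutral_cong_left) (auto simp: N.smult_closed image_subset_iff)
qed

lemma lmap_lin_ext:
  assumes "right_module R N" "\<phi> ` B \<subseteq> carrier N"
  shows "lmap R (free_module R B) N (lin_ext R N \<phi>)"
proof -
  interpret N: right_module R N by fact
  have F: "right_module R (free_module R B)" using right_module_free[OF N.R.ring_axioms] .
  interpret F: right_module R "free_module R B" by fact
  have sm: "r \<odot>\<^bsub>N\<^esub> (\<Oplus>\<^bsub>N\<^esub>b\<in>A. g b) = (\<Oplus>\<^bsub>N\<^esub>b\<in>A. r \<odot>\<^bsub>N\<^esub> g b)"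
    if "finite A" "r \<in> carrier R" "g \<in> A \<rightarrow> carrier N" for A r and g :: "'c \<Rightarrow> 'b"
    using that by (induction A rule: finite_induct) (auto simp: N.smult_r_distr N.smult_closed Pi_def)
  show ?thesis
    unfolding lmap_def
  proof (intro conjI ballI)
    fix f assume f: "f \<in> carrier (free_module R B)"
    then show "lin_ext R N \<phi> f \<in> carrier N"
      unfolding lin_ext_def using assms(2)
      by (intro N.add.finprod_closed) (auto simp: subset_iff image_subset_iff intro!: N.smult_closed)
    { fix g assume g: "g \<in> carrier (free_module R B)"
      let ?A = "{b. f b \<noteq> \<zero>\<^bsub>R\<^esub>} \<union> {b. g b \<noteq> \<zero>\<^bsub>R\<^esub>}"
      have A: "finite ?A" "\<phi> ` ?A \<subseteq> carrier N" using f g assms(2) by (auto simp: subset_iff)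
      have c: "f b \<in> carrier R" "g b \<in> carrier R" for b using f g by auto
      have "lin_ext R N \<phi> (f \<oplus>\<^bsub>free_module R B\<^esub> g) = (\<Oplus>\<^bsub>N\<^esub>b\<in>?A. (f b \<oplus>\<^bsub>R\<^esub> g b) \<odot>\<^bsub>N\<^esub> \<phi> b)"
        using F.a_closed[OF f g] A by (subst lin_ext_superset[OF assms(1) A(1)]) (auto simp: c)
      also have "\<dots> = (\<Oplus>\<^bsub>N\<^esub>b\<in>?A. f b \<odot>\<^bsub>N\<^esub> \<phi> b \<oplus>\<^bsub>N\<^esub> g b \<odot>\<^bsub>N\<^esub> \<phi> b)"
        using A c by (intro N.add.finprod_cong') (auto simp: N.smult_l_distr N.smult_closed image_subset_iff)
      also have "\<dots> = (\<Oplus>\<^bsub>N\<^esub>b\<in>?A. f b \<odot>\<^bsub>N\<^esub> \<phi> b) \<oplus>\<^bsub>N\<^esub> (\<Oplus>\<^bsub>N\<^esub>b\<in>?A. g b \<odot>\<^bsub>N\<^esub> \<phi> b)"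
        using A c by (intro N.add.finprod_multf) (auto intro!: N.smult_closed)
      also have "\<dots> = lin_ext R N \<phi> f \<oplus>\<^bsub>N\<^esub> lin_ext R N \<phi> g"
        using A f g by (simp add: lin_ext_superset[OF assms(1) A(1)])
      finally show "lin_ext R N \<phi> (f \<oplus>\<^bsub>free_module R B\<^esub> g) = lin_ext R N \<phi> f \<oplus>\<^bsub>N\<^esub> lin_ext R N \<phi> g" . }
    fix r assume r: "r \<in> carrier R"
    let ?A = "{b. f b \<noteq> \<zero>\<^bsub>R\<^esub>}"
    have A: "finite ?A" "\<phi> ` ?A \<subseteq> carrier N" using f assms(2) by (auto simp: subset_iff)
    have c: "f b \<in> carrier R" for b using f by auto
    have "lin_ext R N \<phi> (r \<odot>\<^bsub>free_module R B\<^esub> f) = (\<Oplus>\<^bsub>N\<^esub>b\<in>?A. (f b \<otimes>\<^bsub>R\<^esub> r) \<odot>\<^bsub>N\<^esub> \<phi> b)"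
      using F.smult_closed[OF r f] A r by (subst lin_ext_superset[OF assms(1) A(1)]) (auto simp: c)
    also have "\<dots> = (\<Oplus>\<^bsub>N\<^esub>b\<in>?A. r \<odot>\<^bsub>N\<^esub> (f b \<odot>\<^bsub>N\<^esub> \<phi> b))"
      using A c r by (intro N.add.finprod_cong') (auto simp: N.smult_assoc N.smult_closed image_subset_iff)
    also have "\<dots> = r \<odot>\<^bsub>N\<^esub> lin_ext R N \<phi> f"
      unfolding lin_ext_def using A c r by (intro sm[symmetric]) (auto intro!: N.smult_closed)
    finally show "lin_ext R N \<phi> (r \<odot>\<^bsub>free_module R B\<^esub> f) = r \<odot>\<^bsub>N\<^esub> lin_ext R N \<phi> f" .
  qed (use assms F in auto)
qed

lemma lin_ext_delta:
  assumes "right_module R N" "\<phi> b \<in> carrier N"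
  shows "lin_ext R N \<phi> (delta R b) = \<phi> b"
proof -
  interpret N: right_module R N by fact
  have "lin_ext R N \<phi> (delta R b) = (\<Oplus>\<^bsub>N\<^esub>c\<in>{b}. delta R b c \<odot>\<^bsub>N\<^esub> \<phi> c)"
    by (rule lin_ext_superset[OF assms(1)]) (use assms in \<open>auto simp: delta_def\<close>)
  then show ?thesis using assms by (simp add: delta_def N.smult_one)
qed

text \<open>Induction on a finite set containing the support: splitting off one basis element
  \<open>a\<close> writes \<open>f\<close> as \<open>h\<close> plus a multiple of
  \<open>delta R a\<close>, with the support of \<open>h\<close> in the smaller set.\<close>

lemma free_expand:
  assumes "ring R" "lmap R (free_module R B) N g" "f \<in> carrier (free_module R B)"
  shows "g f = lin_ext R N (\<lambda>b. g (delta R b)) f"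
proof -
  interpret R: ring R by fact
  interpret F: right_module R "free_module R B" by (rule right_module_free[OF assms(1)])
  have N: "right_module R N" using lmap_tgt[OF assms(2)] .
  have im: "(\<lambda>b. g (delta R b)) ` B \<subseteq> carrier N"
    using lmap_closed[OF assms(2) delta_in_free[OF assms(1)]] by blast
  have L: "lmap R (free_module R B) N (lin_ext R N (\<lambda>b. g (delta R b)))"
    by (rule lmap_lin_ext[OF N im])
  have "\<forall>f\<in>carrier (free_module R B). {b. f b \<noteq> \<zero>\<^bsub>R\<^esub>} \<subseteq> A \<longrightarrow> g f = lin_ext R N (\<lambda>b. g (delta R b)) f" if "finite A" for A
    using that
  proof (induction A rule: finite_induct)
    case empty
    have "f = \<zero>\<^bsub>free_module R B\<^esub>" if "{b. f b \<noteq> \<zero>\<^bsub>R\<^esub>} \<subseteq> {}" for f :: "'b \<Rightarrow> 'a" using that by auto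
    then show ?case using lmap_zero[OF assms(2)] lmap_zero[OF L] by metis
  next
    case (insert a A)
    show ?case
    proof (intro ballI impI)
      fix f assume f: "f \<in> carrier (free_module R B)" "{b. f b \<noteq> \<zero>\<^bsub>R\<^esub>} \<subseteq> insert a A"
      show "g f = lin_ext R N (\<lambda>b. g (delta R b)) f"
      proof (cases "f a = \<zero>\<^bsub>R\<^esub>")
        case True
        then show ?thesis using insert f by auto
      next
        case False
        then have aB: "a \<in> B" using f by auto
        have fa: "f a \<in> carrier R" using f by auto
        have d: "delta R a \<in> carrier (free_module R B)" using delta_in_free[OF assms(1) aB] .
        define h where "h = f(a := \<zero>\<^bsub>R\<^esub>)"
        have h: "h \<in> carrier (free_module R B)" "{b. h b \<noteq> \<zero>\<^bsub>R\<^esub>} \<subseteq> A"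
        proof -
          have "{b. h b \<noteq> \<zero>\<^bsub>R\<^esub>} \<subseteq> {b. f b \<noteq> \<zero>\<^bsub>R\<^esub>}" by (auto simp: h_def)
          then show "h \<in> carrier (free_module R B)"
            using f by (auto simp: h_def intro: finite_subset)
          show "{b. h b \<noteq> \<zero>\<^bsub>R\<^esub>} \<subseteq> A" using f by (auto simp: h_def)
        qed
        have fh: "f = h \<oplus>\<^bsub>free_module R B\<^esub> (f a \<odot>\<^bsub>free_module R B\<^esub> delta R a)"
          using f fa by (auto simp: h_def delta_def fun_eq_iff image_subset_iff)
        have fd: "f a \<odot>\<^bsub>free_module R B\<^esub> delta R a \<in> carrier (free_module R B)"
          using F.smult_closed[OF fa d] .
        have "g f = g h \<oplus>\<^bsub>N\<^esub> f a \<odot>\<^bsub>N\<^esub> g (delta R a)"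
          by (subst fh) (simp only: lmap_add[OF assms(2) h(1) fd] lmap_smult[OF assms(2) fa d])
        moreover have "lin_ext R N (\<lambda>b. g (delta R b)) f = lin_ext R N (\<lambda>b. g (delta R b)) h \<oplus>\<^bsub>N\<^esub> f a \<odot>\<^bsub>N\<^esub> g (delta R a)"
          using im aB by (subst fh) (simp only: lmap_add[OF L h(1) fd] lmap_smult[OF L fa d]
              lin_ext_delta[OF N, where \<phi>="\<lambda>b. g (delta R b)", OF subsetD[OF im imageI[OF aB]]])
        ultimately show ?thesis using insert.IH h by auto
      qed
    qed
  qed
  from this[of "{b. f b \<noteq> \<zero>\<^bsub>R\<^esub>}"] assms(3) show ?thesis by auto
qed

declare free_module_simps [simp del]

text \<open>Choose preimages of the images of the basis elements and extend them linearly;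
  \<open>free_expand\<close> shows that the extension is a lift.\<close>

lemma lifting_free:
  assumes R: "ring R" and q: "lmap R B N q"
  shows "lifting R (free_module R A) B N q"
  unfolding lifting_def
proof (intro conjI allI impI q, elim conjE)
  fix h assume h: "lmap R (free_module R A) N h"
    and hq: "\<forall>x\<in>carrier (free_module R A). h x \<in> q ` carrier B"
  have "\<forall>a\<in>A. \<exists>b. b \<in> carrier B \<and> q b = h (delta R a)"
    using hq delta_in_free[OF R] by (metis imageE)
  then obtain \<phi> where \<phi>: "\<And>a. a \<in> A \<Longrightarrow> \<phi> a \<in> carrier B" "\<And>a. a \<in> A \<Longrightarrow> q (\<phi> a) = h (delta R a)" by metis
  have L: "lmap R (free_module R A) B (lin_ext R B \<phi>)"
    using \<phi> by (intro lmap_lin_ext lmap_src[OF q]) auto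
  have "q (lin_ext R B \<phi> f) = h f" if f: "f \<in> carrier (free_module R A)" for f
  proof -
    have N: "right_module R N" using lmap_tgt[OF q] .
    interpret N: right_module R N by fact
    have d: "h (delta R a) \<in> carrier N" if "a \<in> A" for a
      using lmap_closed[OF h delta_in_free[OF R that]] .
    have "q (lin_ext R B \<phi> f) = lin_ext R N (\<lambda>b. q (lin_ext R B \<phi> (delta R b))) f"
      by (rule free_expand[OF R lmap_comp[OF L q] f])
    also have "\<dots> = lin_ext R N (\<lambda>b. h (delta R b)) f"
      unfolding lin_ext_def[of R N] using f \<phi> d
      by (intro N.add.finprod_cong') (auto simp: free_module_simps lin_ext_delta[OF lmap_src[OF q]] subset_iff intro!: N.smult_closed)
    also have "\<dots> = h f" by (rule free_expand[OF R h f, symmetric])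
    finally show ?thesis .
  qed
  with L show "\<exists>g. lmap R (free_module R A) B g \<and> (\<forall>x\<in>carrier (free_module R A). q (g x) = h x)" by blast
qed

section \<open>Finitely generated and Noetherian modules\<close>

lemma submodule_subset: "\<lbrakk>right_module R M; submodule K R M\<rbrakk> \<Longrightarrow> K \<subseteq> carrier M"
  by (simp add: right_module.submodule_iff)

lemma submodule_sub_iff:
  assumes "right_module R M" "submodule N R M"
  shows "submodule K R (M\<lparr>carrier := N\<rparr>) \<longleftrightarrow> submodule K R M \<and> K \<subseteq> N"
  using assms(2) unfolding right_module.submodule_iff[OF assms(1)]
    right_module.submodule_iff[OF right_module.submodule_right_module[OF assms]]
  by auto

lemma fin_genE:
  assumes "fin_gen R M"
  obtains A where "finite A" "A \<subseteq> carrier M" "\<And>K. \<lbrakk>submodule K R M; A \<subseteq> K\<rbrakk> \<Longrightarrow> K = carrier M"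
proof -
  from assms obtain A where A: "finite A" "A \<subseteq> carrier M"
    "\<forall>K. submodule K R M \<and> A \<subseteq> K \<longrightarrow> K = carrier M"
    unfolding fin_gen_def by (elim exE conjE)
  show thesis by (rule that[OF A(1,2)]) (use A(3) in simp)
qed

lemma fin_gen_surj:
  assumes "lmap R M N e" "e ` carrier M = carrier N" "fin_gen R M"
  shows "fin_gen R N"
proof -
  obtain A where A: "finite A" "A \<subseteq> carrier M" "\<And>K. \<lbrakk>submodule K R M; A \<subseteq> K\<rbrakk> \<Longrightarrow> K = carrier M"
    by (rule fin_genE[OF assms(3)]) blast
  have "K = carrier N" if K: "submodule K R N" "e ` A \<subseteq> K" for K
  proof -
    have "{x \<in> carrier M. e x \<in> K} = carrier M"
      using A K by (intro A(3) submodule_vimage[OF assms(1)]) auto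
    then have "e ` carrier M \<subseteq> K" by blast
    then show ?thesis using assms(2) submodule_subset[OF lmap_tgt[OF assms(1)] K(1)] by simp
  qed
  then show ?thesis unfolding fin_gen_def using A(1,2) assms(2) by (intro exI[of _ "e ` A"]) blast
qed

text \<open>The images of a generating set of \<open>M\<close> under the finitely many maps
  \<open>u i\<close> generate \<open>P\<close>: a submodule containing them contains the full range
  of each \<open>u i\<close>, hence every sum given by the dual basis.\<close>

lemma fin_gen_sumd:
  assumes "sumd R M P" "fin_gen R M"
  shows "fin_gen R P"
proof -
  obtain n u v where s: "right_module R M" "right_module R P" "\<And>i. i < n \<Longrightarrow> lmap R M P (u i)"
    "\<And>i. i < n \<Longrightarrow> lmap R P M (v i)" "\<And>x. x \<in> carrier P \<Longrightarrow> msum P (\<lambda>i. u i (v i x)) (n::nat) = x"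
    by (rule sumdE[OF assms(1)]) blast
  obtain A where A: "finite A" "A \<subseteq> carrier M" "\<And>K. \<lbrakk>submodule K R M; A \<subseteq> K\<rbrakk> \<Longrightarrow> K = carrier M"
    by (rule fin_genE[OF assms(2)]) blast
  have "K = carrier P" if K: "submodule K R P" "(\<Union>i<n. u i ` A) \<subseteq> K" for K
  proof -
    have "u i y \<in> K" if "i < n" "y \<in> carrier M" for i y
    proof -
      have "{x \<in> carrier M. u i x \<in> K} = carrier M"
        using A(2) K that by (intro A(3) submodule_vimage[OF s(3)]) fastforce+
      with that show ?thesis by auto
    qed
    then have "x \<in> K" if "x \<in> carrier P" for x
      using msum_in_submodule[OF s(2) K(1), of n "\<lambda>i. u i (v i x)"] s(5)[OF that] lmap_closed[OF s(4) that] by auto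
    then show ?thesis using submodule_subset[OF s(2) K(1)] by blast
  qed
  then show ?thesis unfolding fin_gen_def using A(1,2) lmap_closed[OF s(3)]
    by (intro exI[of _ "\<Union>i<n. u i ` A"]) (auto simp: subset_iff)
qed

lemma fin_gen_regular:
  assumes "ring R"
  shows "fin_gen R (regular_module R)"
proof -
  interpret R: ring R by fact
  have "K = carrier R" if K: "submodule K R (regular_module R)" "\<one>\<^bsub>R\<^esub> \<in> K" for K
  proof -
    have "r \<in> K" if "r \<in> carrier R" for r
      using K that unfolding right_module.submodule_iff[OF right_module_regular[OF assms]] by force
    then show ?thesis using K unfolding right_module.submodule_iff[OF right_module_regular[OF assms]] by auto
  qed
  then show ?thesis unfolding fin_gen_def by (intro exI[of _ "{\<one>\<^bsub>R\<^esub>}"]) auto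
qed

lemma fin_gen_power: "ring R \<Longrightarrow> fin_gen R (power_module (regular_module R) k)"
  using fin_gen_sumd[OF sumd_power fin_gen_regular] right_module_regular by blast

lemma fin_gen_cover:
  assumes "right_module R M" "fin_gen R M"
  obtains k e where "lmap R (power_module (regular_module R) k) M e"
    "e ` carrier (power_module (regular_module R) k) = carrier M"
proof -
  interpret M: right_module R M by fact
  have R: "right_module R (regular_module R)" using right_module_regular[OF M.R.ring_axioms] .
  obtain A where A: "finite A" "A \<subseteq> carrier M" "\<And>K. \<lbrakk>submodule K R M; A \<subseteq> K\<rbrakk> \<Longrightarrow> K = carrier M"
    by (rule fin_genE[OF assms(2)]) blast
  obtain k and a :: "nat \<Rightarrow> 'b" where a: "A = a ` {i. i < k}"
    using A(1) finite_imp_nat_seg_image_inj_on by metis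
  have aM: "a i \<in> carrier M" if "i < k" for i using that a A by auto
  let ?P = "power_module (regular_module R) k"
  define e where "e x = msum M (\<lambda>i. x i \<odot>\<^bsub>M\<^esub> a i) k" for x
  have e: "lmap R ?P M e"
    unfolding e_def[abs_def]
    by (intro msum_lmap right_module_power R assms)
      (rule lmap_comp[OF lmap_proj[OF R] lmap_orbit[OF assms(1) aM]])
  have "e (pinj (regular_module R) k j \<one>\<^bsub>R\<^esub>) = a j" if j: "j < k" for j
  proof -
    have "e (pinj (regular_module R) k j \<one>\<^bsub>R\<^esub>) = msum M (\<lambda>i. if i = j then a j else \<zero>\<^bsub>M\<^esub>) k"
      unfolding e_def using aM by (intro msum_cong) (auto simp: pinj_def M.smult_one)
    with msum_delta[OF assms(1) aM[OF j] j] show ?thesis by simp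
  qed
  moreover have "pinj (regular_module R) k j \<one>\<^bsub>R\<^esub> \<in> carrier ?P" for j
    using lmap_closed[OF lmap_pinj[OF R]] by simp
  ultimately have "A \<subseteq> e ` carrier ?P" unfolding a by (metis (mono_tags) image_subsetI imageI mem_Collect_eq)
  then have "e ` carrier ?P = carrier M" by (intro A(3) submodule_range[OF e])
  with e that show thesis by blast
qed

lemma right_ideal_iff:
  assumes "ring R"
  shows "right_ideal I R \<longleftrightarrow> submodule I R (regular_module R)"
proof -
  interpret R: ring R by fact
  interpret M: right_module R "regular_module R" by (rule right_module_regular[OF assms])
  show ?thesis
  proof
    assume I: "right_ideal I R"
    then interpret I: additive_subgroup I R by (simp add: right_ideal_def)
    show "submodule I R (regular_module R)"
      using I I.a_subset by (auto simp: M.submodule_iff right_ideal_def)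
  next
    assume I: "submodule I R (regular_module R)"
    then have "subgroup I (add_monoid R)"
      unfolding submodule_def subgroup_def by (auto simp: m_inv_def)
    then show "right_ideal I R"
      using I by (auto simp: right_ideal_def M.submodule_iff additive_subgroup_def)
  qed
qed

lemma submodule_Inter:
  assumes "right_module R M"
  shows "submodule (\<Inter>{K. submodule K R M \<and> G \<subseteq> K} \<inter> carrier M) R M"
proof -
  interpret M: right_module R M by fact
  show ?thesis unfolding M.submodule_iff by (auto simp: M.smult_closed)
qed

text \<open>If no finite subset generates \<open>J\<close>, a choice function \<open>f\<close>
  provides for each finite subset an element of \<open>J\<close> outside its span. Adjoining these
  elements one after the other, from the empty set on, gives spans that form a strictly increasing
  chain of right ideals.\<close>

lemma noetherian_right_ideal:
  assumes "right_noetherian R" "submodule J R (regular_module R)"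
  shows "\<exists>G. finite G \<and> G \<subseteq> J \<and> (\<forall>K. submodule K R (regular_module R) \<and> G \<subseteq> K \<longrightarrow> J \<subseteq> K)"
proof (rule ccontr)
  let ?R = "regular_module R"
  assume neg: "\<not> ?thesis"
  have R: "ring R" and acc: "\<And>I. (\<forall>n. right_ideal (I n) R \<and> I n \<subseteq> I (Suc n)) \<Longrightarrow> \<exists>N. \<forall>n\<ge>N. I n = I N"
    using assms(1) unfolding right_noetherian_def by auto
  have M: "right_module R ?R" using right_module_regular[OF R] .
  have J: "J \<subseteq> carrier R" using assms(2) right_module.submodule_iff[OF M] by auto
  define sp where "sp G = \<Inter>{K. submodule K R ?R \<and> G \<subseteq> K} \<inter> carrier ?R" for G
  have "\<exists>x\<in>J. x \<notin> sp G" if "finite G" "G \<subseteq> J" for G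
    using neg that unfolding sp_def by blast
  then obtain f where f: "\<And>G. \<lbrakk>finite G; G \<subseteq> J\<rbrakk> \<Longrightarrow> f G \<in> J \<and> f G \<notin> sp G" by metis
  define Gs where "Gs = rec_nat {} (\<lambda>_ G. insert (f G) G)"
  have Gs: "Gs (Suc n) = insert (f (Gs n)) (Gs n)" for n by (simp add: Gs_def)
  have fin: "finite (Gs n) \<and> Gs n \<subseteq> J" for n
    by (induction n) (auto simp: Gs f Gs_def[THEN fun_cong, of 0])
  have "right_ideal (sp (Gs n)) R \<and> sp (Gs n) \<subseteq> sp (Gs (Suc n))" for n
    unfolding right_ideal_iff[OF R] using submodule_Inter[OF M] by (auto simp: sp_def Gs)
  then obtain N where "sp (Gs (Suc N)) = sp (Gs N)" using acc[of "\<lambda>n. sp (Gs n)"] by (metis le_SucI order_refl)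
  moreover have "f (Gs N) \<in> sp (Gs (Suc N))" using f fin J by (auto simp: sp_def Gs)
  ultimately show False using f fin by auto
qed

text \<open>Induction on a finite generating set of \<open>M\<close>, adjoining one generator at a
  time: a submodule \<open>S\<close> with \<open>N \<inter> S\<close> finitely generated is enlarged
  to \<open>T\<close>, the sum of \<open>S\<close> and the cyclic module on \<open>a\<close>. The
  new part of \<open>N\<close> is governed by a right ideal, as with leading coefficients in
  Hilbert's basis theorem.\<close>

lemma noetherian_submodule:
  assumes noeth: "right_noetherian R" and M: "right_module R M" and fg: "fin_gen R M" and N: "submodule N R M"
  shows "fin_gen R (M\<lparr>carrier := N\<rparr>)"
proof -
  interpret M: right_module R M by fact
  have RM: "right_module R (regular_module R)" using right_module_regular[OF M.R.ring_axioms] .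
  obtain A where A: "finite A" "A \<subseteq> carrier M" "\<And>K. \<lbrakk>submodule K R M; A \<subseteq> K\<rbrakk> \<Longrightarrow> K = carrier M"
    by (rule fin_genE[OF fg]) blast
  have N': "N \<subseteq> carrier M" "\<zero>\<^bsub>M\<^esub> \<in> N" "\<And>x y. \<lbrakk>x \<in> N; y \<in> N\<rbrakk> \<Longrightarrow> x \<oplus>\<^bsub>M\<^esub> y \<in> N"
      "\<And>r x. \<lbrakk>r \<in> carrier R; x \<in> N\<rbrakk> \<Longrightarrow> r \<odot>\<^bsub>M\<^esub> x \<in> N" using N by (auto simp: M.submodule_iff)
  have "\<exists>S. submodule S R M \<and> A' \<subseteq> S \<and>
      (\<exists>B. finite B \<and> B \<subseteq> N \<inter> S \<and> (\<forall>K. submodule K R M \<and> B \<subseteq> K \<longrightarrow> N \<inter> S \<subseteq> K))"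
    if "finite A'" "A' \<subseteq> carrier M" for A'
    using that
  proof (induction A' rule: finite_induct)
    case empty
    show ?case using M.submodule_zero
      by (intro exI[of _ "{\<zero>\<^bsub>M\<^esub>}"] conjI exI[of _ "{}"]) (auto simp: M.submodule_iff)
  next
    case (insert a A')
    then have "A' \<subseteq> carrier M" by simp
    from insert.IH[OF this] obtain S B where S: "submodule S R M" "A' \<subseteq> S" and B: "finite B" "B \<subseteq> N \<inter> S"
      and BK: "\<forall>K. submodule K R M \<and> B \<subseteq> K \<longrightarrow> N \<inter> S \<subseteq> K" by (elim exE conjE)
    note B = B BK[rule_format, OF conjI]
    from S(1) have S': "S \<subseteq> carrier M" "\<zero>\<^bsub>M\<^esub> \<in> S" "\<And>x y. \<lbrakk>x \<in> S; y \<in> S\<rbrakk> \<Longrightarrow> x \<oplus>\<^bsub>M\<^esub> y \<in> S"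
      "\<And>r x. \<lbrakk>r \<in> carrier R; x \<in> S\<rbrakk> \<Longrightarrow> r \<odot>\<^bsub>M\<^esub> x \<in> S" by (auto simp: M.submodule_iff)
    have a: "a \<in> carrier M" using insert by auto
    define T where "T = {y \<oplus>\<^bsub>M\<^esub> r \<odot>\<^bsub>M\<^esub> a | y r. y \<in> S \<and> r \<in> carrier R}"
    have T: "submodule T R M"
      unfolding M.submodule_iff
    proof (intro conjI ballI)
      show "T \<subseteq> carrier M" using S' a by (auto simp: T_def M.smult_closed)
      have "\<zero>\<^bsub>M\<^esub> = \<zero>\<^bsub>M\<^esub> \<oplus>\<^bsub>M\<^esub> \<zero>\<^bsub>R\<^esub> \<odot>\<^bsub>M\<^esub> a" using a by simp
      then show "\<zero>\<^bsub>M\<^esub> \<in> T" unfolding T_def using S' by blast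
    next
      fix x x' assume "x \<in> T" "x' \<in> T"
      then obtain y r y' r' where y: "y \<in> S" "r \<in> carrier R" "x = y \<oplus>\<^bsub>M\<^esub> r \<odot>\<^bsub>M\<^esub> a"
        "y' \<in> S" "r' \<in> carrier R" "x' = y' \<oplus>\<^bsub>M\<^esub> r' \<odot>\<^bsub>M\<^esub> a" by (auto simp: T_def)
      then have "x \<oplus>\<^bsub>M\<^esub> x' = (y \<oplus>\<^bsub>M\<^esub> y') \<oplus>\<^bsub>M\<^esub> (r \<oplus>\<^bsub>R\<^esub> r') \<odot>\<^bsub>M\<^esub> a"
        using S' a by (simp add: M.smult_l_distr M.smult_closed M.a_ac subset_iff)
      then show "x \<oplus>\<^bsub>M\<^esub> x' \<in> T" unfolding T_def using y S' by blast
    next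
      fix s x assume s: "s \<in> carrier R" "x \<in> T"
      then obtain y r where y: "y \<in> S" "r \<in> carrier R" "x = y \<oplus>\<^bsub>M\<^esub> r \<odot>\<^bsub>M\<^esub> a" by (auto simp: T_def)
      then have "s \<odot>\<^bsub>M\<^esub> x = s \<odot>\<^bsub>M\<^esub> y \<oplus>\<^bsub>M\<^esub> (r \<otimes>\<^bsub>R\<^esub> s) \<odot>\<^bsub>M\<^esub> a"
        using S' a s by (simp add: M.smult_r_distr M.smult_assoc M.smult_closed subset_iff)
      then show "s \<odot>\<^bsub>M\<^esub> x \<in> T" unfolding T_def using y S' s by blast
    qed
    have ST: "S \<subseteq> T"
    proof
      fix y assume y: "y \<in> S"
      then have "y = y \<oplus>\<^bsub>M\<^esub> \<zero>\<^bsub>R\<^esub> \<odot>\<^bsub>M\<^esub> a" using a S' by auto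
      then show "y \<in> T" unfolding T_def using y by blast
    qed
    have "a = \<zero>\<^bsub>M\<^esub> \<oplus>\<^bsub>M\<^esub> \<one>\<^bsub>R\<^esub> \<odot>\<^bsub>M\<^esub> a" using a by (simp add: M.smult_one)
    then have aT: "a \<in> T" unfolding T_def using S' by blast
    \<comment> \<open>The right ideal of coefficients of \<open>a\<close>. It is kept as a function
      of \<open>L\<close> because comparing \<open>J N\<close> with \<open>J (N \<inter> K)\<close>
      is what carries generation from \<open>R\<close> to \<open>M\<close>.\<close>
    define J where "J L = {r \<in> carrier R. \<exists>y\<in>S. y \<oplus>\<^bsub>M\<^esub> r \<odot>\<^bsub>M\<^esub> a \<in> L}" for L
    have J: "submodule (J L) R (regular_module R)" if L: "submodule L R M" for L
      unfolding right_module.submodule_iff[OF RM]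
    proof (intro conjI ballI)
      have L': "L \<subseteq> carrier M" "\<zero>\<^bsub>M\<^esub> \<in> L" "\<And>x y. \<lbrakk>x \<in> L; y \<in> L\<rbrakk> \<Longrightarrow> x \<oplus>\<^bsub>M\<^esub> y \<in> L"
        "\<And>r x. \<lbrakk>r \<in> carrier R; x \<in> L\<rbrakk> \<Longrightarrow> r \<odot>\<^bsub>M\<^esub> x \<in> L" using L by (auto simp: M.submodule_iff)
      show "J L \<subseteq> carrier (regular_module R)" by (auto simp: J_def)
      show "\<zero>\<^bsub>regular_module R\<^esub> \<in> J L" using S' L' a by (auto simp: J_def intro!: bexI[of _ "\<zero>\<^bsub>M\<^esub>"])
      fix r assume r: "r \<in> J L"
      then obtain y where y: "y \<in> S" "y \<oplus>\<^bsub>M\<^esub> r \<odot>\<^bsub>M\<^esub> a \<in> L" "r \<in> carrier R" by (auto simp: J_def)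
      { fix r' assume "r' \<in> J L"
        then obtain y' where y': "y' \<in> S" "y' \<oplus>\<^bsub>M\<^esub> r' \<odot>\<^bsub>M\<^esub> a \<in> L" "r' \<in> carrier R" by (auto simp: J_def)
        have "(y \<oplus>\<^bsub>M\<^esub> r \<odot>\<^bsub>M\<^esub> a) \<oplus>\<^bsub>M\<^esub> (y' \<oplus>\<^bsub>M\<^esub> r' \<odot>\<^bsub>M\<^esub> a) = (y \<oplus>\<^bsub>M\<^esub> y') \<oplus>\<^bsub>M\<^esub> (r \<oplus>\<^bsub>R\<^esub> r') \<odot>\<^bsub>M\<^esub> a"
          using y y' S' a by (simp add: M.smult_l_distr M.smult_closed M.a_ac subset_iff)
        then have "(y \<oplus>\<^bsub>M\<^esub> y') \<oplus>\<^bsub>M\<^esub> (r \<oplus>\<^bsub>R\<^esub> r') \<odot>\<^bsub>M\<^esub> a \<in> L" using L'(3)[OF y(2) y'(2)] by simp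
        then show "r \<oplus>\<^bsub>regular_module R\<^esub> r' \<in> J L" using y y' S' by (auto simp: J_def) }
      fix s assume s: "s \<in> carrier R"
      have "s \<odot>\<^bsub>M\<^esub> (y \<oplus>\<^bsub>M\<^esub> r \<odot>\<^bsub>M\<^esub> a) = s \<odot>\<^bsub>M\<^esub> y \<oplus>\<^bsub>M\<^esub> (r \<otimes>\<^bsub>R\<^esub> s) \<odot>\<^bsub>M\<^esub> a"
        using S' a s y by (simp add: M.smult_r_distr M.smult_assoc M.smult_closed subset_iff)
      then have "s \<odot>\<^bsub>M\<^esub> y \<oplus>\<^bsub>M\<^esub> (r \<otimes>\<^bsub>R\<^esub> s) \<odot>\<^bsub>M\<^esub> a \<in> L" using L'(4)[OF s y(2)] by simp
      then show "s \<odot>\<^bsub>regular_module R\<^esub> r \<in> J L" using y s S' by (auto simp: J_def)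
    qed
    obtain G where G: "finite G" "G \<subseteq> J N" and GK: "\<forall>K. submodule K R (regular_module R) \<and> G \<subseteq> K \<longrightarrow> J N \<subseteq> K"
      using noetherian_right_ideal[OF noeth J[OF N]] by (elim exE conjE)
    note G = G GK[rule_format, OF conjI]
    have "\<forall>g\<in>G. \<exists>y\<in>S. y \<oplus>\<^bsub>M\<^esub> g \<odot>\<^bsub>M\<^esub> a \<in> N" using G(2) by (auto simp: J_def)
    then obtain y where y: "\<And>g. g \<in> G \<Longrightarrow> y g \<in> S" "\<And>g. g \<in> G \<Longrightarrow> y g \<oplus>\<^bsub>M\<^esub> g \<odot>\<^bsub>M\<^esub> a \<in> N" by metis
    let ?B = "B \<union> (\<lambda>g. y g \<oplus>\<^bsub>M\<^esub> g \<odot>\<^bsub>M\<^esub> a) ` G"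
    have GR: "G \<subseteq> carrier R" using G(2) by (auto simp: J_def)
    have "y g \<oplus>\<^bsub>M\<^esub> g \<odot>\<^bsub>M\<^esub> a \<in> T" if "g \<in> G" for g
      unfolding T_def using y(1)[OF that] GR that by blast
    then have "?B \<subseteq> N \<inter> T" using B(2) ST y(2) by auto
    moreover have "N \<inter> T \<subseteq> K" if K: "submodule K R M" "?B \<subseteq> K" for K
    proof
      fix x assume x: "x \<in> N \<inter> T"
      then obtain z r where z: "z \<in> S" "r \<in> carrier R" "x = z \<oplus>\<^bsub>M\<^esub> r \<odot>\<^bsub>M\<^esub> a" by (auto simp: T_def)
      then have "r \<in> J N" using x by (auto simp: J_def)
      \<comment> \<open>The intersection with \<open>N\<close> matters: it provides a
        \<open>w\<close> with the same coefficient \<open>r\<close> such that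
        \<open>w \<oplus> r \<odot> a\<close> lies in both \<open>N\<close> and \<open>K\<close>.
        Then \<open>z \<ominus> w\<close> lies in \<open>N \<inter> S\<close>, where
        \<open>B\<close> generates.\<close>
      moreover have "g \<in> J (N \<inter> K)" if "g \<in> G" for g
        unfolding J_def using y[OF that] K(2) GR that by blast
      then have "G \<subseteq> J (N \<inter> K)" by blast
      ultimately have "r \<in> J (N \<inter> K)" using G(3)[OF J[OF M.submodule_Int[OF N K(1)]]] by blast
      then obtain w where w: "w \<in> S" "w \<oplus>\<^bsub>M\<^esub> r \<odot>\<^bsub>M\<^esub> a \<in> N" "w \<oplus>\<^bsub>M\<^esub> r \<odot>\<^bsub>M\<^esub> a \<in> K" by (auto simp: J_def)
      have zw: "z \<in> carrier M" "w \<in> carrier M" "r \<odot>\<^bsub>M\<^esub> a \<in> carrier M"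
        using z w S' a by (auto simp: M.smult_closed)
      have eq: "x = (z \<ominus>\<^bsub>M\<^esub> w) \<oplus>\<^bsub>M\<^esub> (w \<oplus>\<^bsub>M\<^esub> r \<odot>\<^bsub>M\<^esub> a)"
        using zw z(3) by (simp add: M.a_assoc[symmetric] M.minus_add_cancel)
      have "z \<ominus>\<^bsub>M\<^esub> w = x \<ominus>\<^bsub>M\<^esub> (w \<oplus>\<^bsub>M\<^esub> r \<odot>\<^bsub>M\<^esub> a)"
        using zw eq by (simp add: M.add_minus_cancel)
      then have "z \<ominus>\<^bsub>M\<^esub> w \<in> N \<inter> S"
        using M.submodule_minus[OF N _ w(2)] x M.submodule_minus[OF S(1) z(1) w(1)] by auto
      then have "z \<ominus>\<^bsub>M\<^esub> w \<in> K" using B(3)[OF K(1)] K(2) by blast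
      then show "x \<in> K" unfolding eq using w(3) K(1) by (simp add: M.submodule_iff)
    qed
    ultimately show ?case using T aT ST S(2) B(1) G(1)
      by (intro exI[of _ T] conjI exI[of _ ?B]) auto
  qed
  from this[OF A(1,2)] obtain S B where S: "submodule S R M" "A \<subseteq> S" and B: "finite B" "B \<subseteq> N \<inter> S"
      and BK: "\<forall>K. submodule K R M \<and> B \<subseteq> K \<longrightarrow> N \<inter> S \<subseteq> K" by (elim exE conjE)
  have "S = carrier M" using A(3) S by blast
  then have "N \<inter> S = N" using N' by auto
  with B BK show ?thesis
    unfolding fin_gen_def submodule_sub_iff[OF M N] by (intro exI[of _ B]) auto
qed

lemma noetherian_kernel:
  assumes "right_noetherian R" "fin_gen R P" "lmap R P M e"
  obtains k d where "lmap R (power_module (regular_module R) k) P d"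
    "d ` carrier (power_module (regular_module R) k) = {x \<in> carrier P. e x = \<zero>\<^bsub>M\<^esub>}"
proof -
  let ?K = "{x \<in> carrier P. e x = \<zero>\<^bsub>M\<^esub>}"
  have P: "right_module R P" using lmap_src[OF assms(3)] .
  have K: "submodule ?K R P" using submodule_kernel[OF assms(3)] .
  obtain k d where d: "lmap R (power_module (regular_module R) k) (P\<lparr>carrier := ?K\<rparr>) d"
    "d ` carrier (power_module (regular_module R) k) = carrier (P\<lparr>carrier := ?K\<rparr>)"
    by (rule fin_gen_cover[OF right_module.submodule_right_module[OF P K] noetherian_submodule[OF assms(1) P assms(2) K]])
  show thesis using that[OF lmap_comp[OF d(1) lmap_sub[OF P K]]] d(2) by simp
qed

lemma free_resolution:
  assumes noeth: "right_noetherian R" and M: "right_module R M" and fg: "fin_gen R M"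
  obtains k e d where "lmap R (power_module (regular_module R) (k 0)) M e"
    "e ` carrier (power_module (regular_module R) (k 0)) = carrier M"
    "\<And>n. lmap R (power_module (regular_module R) (k (Suc n))) (power_module (regular_module R) (k n)) (d n)"
    "d 0 ` carrier (power_module (regular_module R) (k 1)) =
      {x \<in> carrier (power_module (regular_module R) (k 0)). e x = \<zero>\<^bsub>M\<^esub>}"
    "\<And>n. d (Suc n) ` carrier (power_module (regular_module R) (k (Suc (Suc n)))) =
      {x \<in> carrier (power_module (regular_module R) (k (Suc n))). d n x = \<zero>\<^bsub>power_module (regular_module R) (k n)\<^esub>}"
proof -
  let ?P = "power_module (regular_module R)"
  have R: "ring R" using noeth by (simp add: right_noetherian_def)
  obtain k0 e where e: "lmap R (?P k0) M e" "e ` carrier (?P k0) = carrier M"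
    by (rule fin_gen_cover[OF M fg])
  define ker where "ker k k' f = {x \<in> carrier (?P k'). f x = \<zero>\<^bsub>?P k\<^esub>}" for k k' f
  obtain k1 d0 where d0: "lmap R (?P k1) (?P k0) d0" "d0 ` carrier (?P k1) = {x \<in> carrier (?P k0). e x = \<zero>\<^bsub>M\<^esub>}"
    by (rule noetherian_kernel[OF noeth fin_gen_power[OF R] e(1)])
  \<comment> \<open>A state of the recursion is one differential with the ranks of its target and
    its source, so that the next differential can be chosen onto its kernel.\<close>
  let ?A = "\<lambda>_ (k, k', d). lmap R (?P k') (?P k) d"
  let ?Q = "\<lambda>_ (k, k', d) (l, l', d'). l = k' \<and> d' ` carrier (?P l') = ker k k' d"
  have "\<exists>s. (\<forall>n. ?A n (s n)) \<and> (\<forall>n. ?Q n (s n) (s (Suc n))) \<and> s 0 = (k0, k1, d0)"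
  proof -
    have step: "\<exists>y. ?A (Suc n) y \<and> ?Q n x y" if "?A n x" for x n
    proof -
      obtain k k' d where x: "x = (k, k', d)" by (cases x) auto
      have "lmap R (?P k') (?P k) d" using that x by simp
      from noetherian_kernel[OF noeth fin_gen_power[OF R] this]
      obtain l d' where "lmap R (?P l) (?P k') d'" "d' ` carrier (?P l) = ker k k' d"
        unfolding ker_def by blast
      then show ?thesis unfolding x by (intro exI[of _ "(k', l, d')"]) auto
    qed
    have "\<exists>s. \<forall>n. (?A n (s n) \<and> (n = 0 \<longrightarrow> s n = (k0, k1, d0))) \<and> ?Q n (s n) (s (Suc n))"
    proof (rule dependent_nat_choice)
      show "\<exists>x. ?A 0 x \<and> (0 = (0::nat) \<longrightarrow> x = (k0, k1, d0))" using d0(1) by (intro exI[of _ "(k0, k1, d0)"]) simp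
      show "\<exists>y. (?A (Suc n) y \<and> (Suc n = 0 \<longrightarrow> y = (k0, k1, d0))) \<and> ?Q n x y"
        if "?A n x \<and> (n = 0 \<longrightarrow> x = (k0, k1, d0))" for x n
        using step[of x] that by simp
    qed
    then obtain s where "\<forall>n. (?A n (s n) \<and> (n = 0 \<longrightarrow> s n = (k0, k1, d0))) \<and> ?Q n (s n) (s (Suc n))" ..
    then show ?thesis by (intro exI[of _ s]) simp
  qed
  then obtain s where s: "\<And>n. ?A n (s n)" "\<And>n. ?Q n (s n) (s (Suc n))" "s 0 = (k0, k1, d0)" by blast
  define k where "k n = fst (s n)" for n
  define d where "d n = snd (snd (s n))" for n
  have sk: "s n = (k n, k (Suc n), d n)" for n
    using s(2)[of n] by (auto simp: k_def d_def split: prod.splits)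
  have k01: "k 0 = k0" "k 1 = k1" "d 0 = d0" using sk[of 0] s(3) by auto
  show thesis
    using e d0 s(1) s(2) that[of k e d] unfolding sk ker_def by (auto simp: k01(1,3) k01(2)[unfolded One_nat_def])
qed

text \<open>Structure transported along an injection. It brings modules on composite types back to
  the types over which the definitions quantify.\<close>

lemma transport:
  fixes \<phi> :: "'m \<Rightarrow> 'x"
  assumes "right_module R M" "inj_on \<phi> (carrier M)"
  obtains M' :: "('r, 'x) module" where "lmap R M M' \<phi>" "bij_betw \<phi> (carrier M) (carrier M')"
proof -
  interpret M: right_module R M by fact
  define \<psi> where "\<psi> = inv_into (carrier M) \<phi>"
  have \<psi>: "\<psi> (\<phi> x) = x" if "x \<in> carrier M" for x using that assms(2) unfolding \<psi>_def by simp
  define M' :: "('r, 'x) module" where "M' = \<lparr>carrier = \<phi> ` carrier M, mult = undefined, one = undefined, zero = \<phi> \<zero>\<^bsub>M\<^esub>,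
    add = (\<lambda>x y. \<phi> (\<psi> x \<oplus>\<^bsub>M\<^esub> \<psi> y)), smult = (\<lambda>r x. \<phi> (r \<odot>\<^bsub>M\<^esub> \<psi> x))\<rparr>"
  have "right_module R M'"
    by (rule right_moduleI)
      (auto simp: M'_def \<psi> M.R.ring_axioms M.a_ac M.smult_closed M.smult_l_distr M.smult_r_distr
        M.smult_assoc M.smult_one)
  then have "lmap R M M' \<phi>" unfolding lmap_def using assms(1) by (auto simp: M'_def \<psi>)
  moreover have "bij_betw \<phi> (carrier M) (carrier M')" using assms(2) by (simp add: M'_def bij_betw_def)
  ultimately show thesis using that by blast
qed

section \<open>Injective modules\<close>

definition prod_module :: "('r, 'm) module \<Rightarrow> ('r, 'n) module \<Rightarrow> ('r, 'm \<times> 'n) module" where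
  "prod_module M N = \<lparr>carrier = carrier M \<times> carrier N, mult = undefined, one = undefined,
     zero = (\<zero>\<^bsub>M\<^esub>, \<zero>\<^bsub>N\<^esub>), add = (\<lambda>x y. (fst x \<oplus>\<^bsub>M\<^esub> fst y, snd x \<oplus>\<^bsub>N\<^esub> snd y)),
     smult = (\<lambda>r x. (r \<odot>\<^bsub>M\<^esub> fst x, r \<odot>\<^bsub>N\<^esub> snd x))\<rparr>"

lemma prod_module_simps [simp]:
  "carrier (prod_module M N) = carrier M \<times> carrier N" "\<zero>\<^bsub>prod_module M N\<^esub> = (\<zero>\<^bsub>M\<^esub>, \<zero>\<^bsub>N\<^esub>)"
  "x \<oplus>\<^bsub>prod_module M N\<^esub> y = (fst x \<oplus>\<^bsub>M\<^esub> fst y, snd x \<oplus>\<^bsub>N\<^esub> snd y)"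
  "r \<odot>\<^bsub>prod_module M N\<^esub> x = (r \<odot>\<^bsub>M\<^esub> fst x, r \<odot>\<^bsub>N\<^esub> snd x)"
  by (simp_all add: prod_module_def)

lemma right_module_prod:
  assumes "right_module R M" "right_module R N"
  shows "right_module R (prod_module M N)"
proof -
  interpret M: right_module R M by fact
  interpret N: right_module R N by fact
  show ?thesis
    by (rule right_moduleI)
      (auto simp: M.R.ring_axioms M.a_ac M.smult_closed M.smult_l_distr M.smult_r_distr M.smult_assoc
        M.smult_one N.a_ac N.smult_closed N.smult_l_distr N.smult_r_distr N.smult_assoc N.smult_one)
qed

lemma lmap_fst: "\<lbrakk>right_module R M; right_module R N\<rbrakk> \<Longrightarrow> lmap R (prod_module M N) M fst"
  and lmap_snd: "\<lbrakk>right_module R M; right_module R N\<rbrakk> \<Longrightarrow> lmap R (prod_module M N) N snd"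
  by (auto simp: lmap_def right_module_prod)

lemma lmap_pair: "\<lbrakk>lmap R P M f; lmap R P N g\<rbrakk> \<Longrightarrow> lmap R P (prod_module M N) (\<lambda>x. (f x, g x))"
  by (auto simp: lmap_def right_module_prod)

lemma submodule_sum:
  assumes "right_module R M" "submodule K R M" "submodule L R M"
  shows "submodule {x \<oplus>\<^bsub>M\<^esub> y | x y. x \<in> K \<and> y \<in> L} R M"
proof -
  interpret M: right_module R M by fact
  have "(\<lambda>z. fst z \<oplus>\<^bsub>M\<^esub> snd z) ` (K \<times> L) = {x \<oplus>\<^bsub>M\<^esub> y | x y. x \<in> K \<and> y \<in> L}" by force
  moreover have "submodule (K \<times> L) R (prod_module M M)"
    using assms unfolding right_module.submodule_iff[OF right_module_prod[OF assms(1,1)]] M.submodule_iff by auto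
  ultimately show ?thesis
    using submodule_image[OF lmap_plus[OF lmap_fst lmap_snd], OF assms(1,1,1,1)] by metis
qed

text \<open>Baer's criterion taken as the definition: it speaks only about ideals of
  \<open>R\<close>, so it involves no type of test modules and yields extension along monomorphisms
  between modules on any types (\<open>baer_extend\<close>).\<close>

definition baer :: "'r ring \<Rightarrow> ('r, 'e) module \<Rightarrow> bool" where
  "baer R E \<longleftrightarrow> right_module R E \<and> (\<forall>I f. submodule I R (regular_module R) \<and>
     lmap R ((regular_module R)\<lparr>carrier := I\<rparr>) E f \<longrightarrow> (\<exists>e\<in>carrier E. \<forall>r\<in>I. f r = r \<odot>\<^bsub>E\<^esub> e))"

text \<open>The type of test modules in \<open>injective_module\<close> contains a copy of
  \<open>R\<close>; the ideal and the ring are moved there by \<open>Inl\<close>, and the value of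
  the extension at \<open>\<one>\<close> is the element sought.\<close>

lemma injective_module_baer:
  fixes E :: "('r, 'e) module"
  assumes "injective_module R E"
  shows "baer R E"
  unfolding baer_def
proof (intro conjI allI impI; (elim conjE)?)
  show E: "right_module R E" using assms by (simp add: injective_module_def)
  then interpret E: right_module R E .
  let ?R = "regular_module R"
  have R: "ring R" and RM: "right_module R ?R" using right_module_regular E.R.ring_axioms by auto
  fix I f assume I: "submodule I R ?R" and f: "lmap R (?R\<lparr>carrier := I\<rparr>) E f"
  have IM: "right_module R (?R\<lparr>carrier := I\<rparr>)" using lmap_src[OF f] .
  obtain B :: "('r, 'r + 'e) module" where B: "lmap R ?R B Inl" "bij_betw Inl (carrier ?R) (carrier B)"
    by (rule transport[OF RM, of Inl]) auto
  obtain A :: "('r, 'r + 'e) module" where A: "lmap R (?R\<lparr>carrier := I\<rparr>) A Inl"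
    "bij_betw Inl (carrier (?R\<lparr>carrier := I\<rparr>)) (carrier A)"
    by (rule transport[OF IM, of Inl]) auto
  obtain g where g: "lmap R A (?R\<lparr>carrier := I\<rparr>) g" "\<And>x. x \<in> carrier A \<Longrightarrow> Inl (g x) = x"
    "\<And>x. x \<in> I \<Longrightarrow> g (Inl x) = x"
    by (rule lmap_inverse[OF A]) auto
  have i: "lmap R A B (\<lambda>x. Inl (g x))"
    using lmap_comp[OF lmap_comp[OF g(1) lmap_sub[OF RM I]] B(1)] .
  define i where "i = restrict (\<lambda>x. Inl (g x) :: 'r + 'e) (carrier A)"
  define f' where "f' = restrict (\<lambda>x. f (g x)) (carrier A)"
  have "i \<in> mod_hom R A B" "inj_on i (carrier A)" "f' \<in> mod_hom R A E"
    using lmap_mod_hom[OF i] lmap_mod_hom[OF lmap_comp[OF g(1) f]] g(2) unfolding i_def f'_def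
    by (auto simp: inj_on_def)
  then obtain h where h: "h \<in> mod_hom R B E" "\<forall>x\<in>carrier A. h (i x) = f' x"
    using assms lmap_tgt[OF A(1)] lmap_tgt[OF B(1)] unfolding injective_module_def by metis
  have h': "lmap R ?R E (\<lambda>x. h (Inl x))"
    using lmap_comp[OF B(1) mod_hom_lmap[OF h(1) lmap_tgt[OF B(1)] E]] .
  have "f r = r \<odot>\<^bsub>E\<^esub> h (Inl \<one>\<^bsub>R\<^esub>)" if r: "r \<in> I" for r
  proof -
    have rR: "r \<in> carrier R" using r submodule_subset[OF RM I] by auto
    have "Inl r \<in> carrier A" using lmap_closed[OF A(1)] r by simp
    then have "f r = h (Inl r)" using h(2) g(3)[OF r] unfolding i_def f'_def by force
    with lmap_regular[OF R h' rR] show ?thesis by simp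
  qed
  moreover have "h (Inl \<one>\<^bsub>R\<^esub>) \<in> carrier E" using lmap_closed[OF h', of "\<one>\<^bsub>R\<^esub>"] by simp
  ultimately show "\<exists>e\<in>carrier E. \<forall>r\<in>I. f r = r \<odot>\<^bsub>E\<^esub> e" by blast
qed

text \<open>Zorn's lemma applied to graphs of partial extensions, that is, submodules of
  \<open>B \<times> E\<close> that contain the graph given on \<open>A\<close> and meet
  \<open>0 \<times> E\<close> only in zero. A maximal graph projects onto \<open>B\<close>: for a
  missing \<open>b\<close>, the criterion applied to the ideal of those \<open>r\<close> whose
  multiple of \<open>b\<close> lies in the domain yields a value \<open>e\<close> for
  \<open>b\<close>.\<close>

lemma baer_extend:
  assumes "baer R E" and i: "lmap R A B i" "inj_on i (carrier A)" and f: "lmap R A E f"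
  obtains g where "lmap R B E g" "\<And>x. x \<in> carrier A \<Longrightarrow> g (i x) = f x"
proof -
  have E: "right_module R E" and A: "right_module R A" and B: "right_module R B"
    using lmapD[OF i(1)] lmapD[OF f] by auto
  interpret E: right_module R E by fact
  interpret B: right_module R B by fact
  let ?P = "prod_module B E"
  have P: "right_module R ?P" using right_module_prod[OF B E] .
  interpret P: right_module R ?P by fact
  have inj: "inj_on fst G" if G: "submodule G R ?P" "\<forall>e. (\<zero>\<^bsub>B\<^esub>, e) \<in> G \<longrightarrow> e = \<zero>\<^bsub>E\<^esub>" for G
  proof -
    have "lmap R (?P\<lparr>carrier := G\<rparr>) B fst" using lmap_restrict_sub[OF lmap_fst[OF B E] G(1)] .
    from lmap_inj_on_iff[OF this] show ?thesis using G(2) by auto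
  qed
  define \<G> where "\<G> = {G. submodule G R ?P \<and> (\<forall>e. (\<zero>\<^bsub>B\<^esub>, e) \<in> G \<longrightarrow> e = \<zero>\<^bsub>E\<^esub>) \<and> (\<forall>a\<in>carrier A. (i a, f a) \<in> G)}"
  have "\<exists>G\<in>\<G>. \<forall>X\<in>\<G>. G \<subseteq> X \<longrightarrow> X = G"
  proof (rule subset_Zorn_nonempty)
    have "submodule ((\<lambda>a. (i a, f a)) ` carrier A) R ?P" using submodule_range[OF lmap_pair[OF i(1) f]] .
    moreover have "e = \<zero>\<^bsub>E\<^esub>" if e: "(\<zero>\<^bsub>B\<^esub>, e) \<in> (\<lambda>a. (i a, f a)) ` carrier A" for e
    proof -
      obtain a where a: "a \<in> carrier A" "i a = \<zero>\<^bsub>B\<^esub>" "e = f a" using e by auto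
      then have "a = \<zero>\<^bsub>A\<^esub>" using lmap_inj_on_iff[OF i(1)] i(2) by blast
      then show ?thesis using lmap_zero[OF f] a by simp
    qed
    ultimately show "\<G> \<noteq> {}" unfolding \<G>_def by blast
  next
    fix \<C> assume ne: "\<C> \<noteq> {}" and ch: "subset.chain \<G> \<C>"
    have sub: "submodule G R ?P" "\<forall>e. (\<zero>\<^bsub>B\<^esub>, e) \<in> G \<longrightarrow> e = \<zero>\<^bsub>E\<^esub>" "\<forall>a\<in>carrier A. (i a, f a) \<in> G" if "G \<in> \<C>" for G
      using ch that unfolding subset.chain_def \<G>_def by auto
    have "submodule (\<Union>\<C>) R ?P"
      unfolding P.submodule_iff
    proof (intro conjI ballI)
      show "\<Union>\<C> \<subseteq> carrier ?P" "\<zero>\<^bsub>?P\<^esub> \<in> \<Union>\<C>" using ne sub(1) unfolding P.submodule_iff by blast+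
      show "r \<odot>\<^bsub>?P\<^esub> x \<in> \<Union>\<C>" if "r \<in> carrier R" "x \<in> \<Union>\<C>" for r x
        using that sub(1) unfolding P.submodule_iff by blast
      fix x y assume "x \<in> \<Union>\<C>" "y \<in> \<Union>\<C>"
      then obtain G H where GH: "G \<in> \<C>" "H \<in> \<C>" "x \<in> G" "y \<in> H" by blast
      then have "G \<subseteq> H \<or> H \<subseteq> G" using ch unfolding subset.chain_def by blast
      then show "x \<oplus>\<^bsub>?P\<^esub> y \<in> \<Union>\<C>" using GH sub(1) unfolding P.submodule_iff by blast
    qed
    then show "\<Union>\<C> \<in> \<G>" using ne sub unfolding \<G>_def by blast
  qed
  then obtain G where G: "submodule G R ?P" "\<forall>e. (\<zero>\<^bsub>B\<^esub>, e) \<in> G \<longrightarrow> e = \<zero>\<^bsub>E\<^esub>" "\<forall>a\<in>carrier A. (i a, f a) \<in> G"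
    and max: "\<forall>X\<in>\<G>. G \<subseteq> X \<longrightarrow> X = G" by (smt (verit) \<G>_def mem_Collect_eq)
  have Gfst: "lmap R (?P\<lparr>carrier := G\<rparr>) B fst" using lmap_restrict_sub[OF lmap_fst[OF B E] G(1)] .
  have Gsnd: "lmap R (?P\<lparr>carrier := G\<rparr>) E snd" using lmap_restrict_sub[OF lmap_snd[OF B E] G(1)] .
  have Ginj: "inj_on fst (carrier (?P\<lparr>carrier := G\<rparr>))" using inj[OF G(1,2)] by simp
  have full: "b \<in> fst ` G" if b: "b \<in> carrier B" for b
  proof (rule ccontr)
    assume nb: "b \<notin> fst ` G"
    let ?R = "regular_module R"
    have RM: "right_module R ?R" using right_module_regular[OF E.R.ring_axioms] .
    define J where "J = {r \<in> carrier ?R. r \<odot>\<^bsub>B\<^esub> b \<in> fst ` G}"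
    have orb: "lmap R ?R B (\<lambda>r. r \<odot>\<^bsub>B\<^esub> b)" using lmap_orbit[OF B b] .
    have J: "submodule J R ?R"
      unfolding J_def using submodule_vimage[OF orb submodule_range[OF Gfst]] by simp
    obtain h where h: "lmap R (?R\<lparr>carrier := J\<rparr>) (?P\<lparr>carrier := G\<rparr>) h" "\<And>r. r \<in> J \<Longrightarrow> fst (h r) = r \<odot>\<^bsub>B\<^esub> b"
      by (rule lmap_factor_inj[OF Gfst Ginj lmap_restrict_sub[OF orb J]]) (auto simp: J_def)
    obtain e where e: "e \<in> carrier E" "\<forall>r\<in>J. snd (h r) = r \<odot>\<^bsub>E\<^esub> e"
      using assms(1) J lmap_comp[OF h(1) Gsnd] unfolding baer_def by blast
    have hG: "(r \<odot>\<^bsub>B\<^esub> b, r \<odot>\<^bsub>E\<^esub> e) \<in> G" if "r \<in> J" for r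
    proof -
      have "h r \<in> G" using lmap_closed[OF h(1), of r] that by simp
      moreover have "h r = (r \<odot>\<^bsub>B\<^esub> b, r \<odot>\<^bsub>E\<^esub> e)" using h(2)[OF that] e(2) that by (metis prod.collapse)
      ultimately show ?thesis by simp
    qed
    let ?L = "(\<lambda>r. r \<odot>\<^bsub>?P\<^esub> (b, e)) ` carrier ?R"
    have L: "submodule ?L R ?P" using b e by (intro submodule_range lmap_orbit[OF P]) simp
    let ?G = "{x \<oplus>\<^bsub>?P\<^esub> y | x y. x \<in> G \<and> y \<in> ?L}"
    have G': "submodule ?G R ?P" using submodule_sum[OF P G(1) L] .
    have bL: "(b, e) \<in> ?L"
      using P.smult_one[of "(b, e)"] b e by (intro image_eqI[of _ _ "\<one>\<^bsub>R\<^esub>"]) simp_all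
    have GP: "G \<subseteq> carrier ?P" "\<zero>\<^bsub>?P\<^esub> \<in> G" using G(1) unfolding P.submodule_iff by blast+
    have zP: "x \<oplus>\<^bsub>?P\<^esub> \<zero>\<^bsub>?P\<^esub> = x" "\<zero>\<^bsub>?P\<^esub> \<oplus>\<^bsub>?P\<^esub> x = x" if "x \<in> carrier ?P" for x
      using P.r_zero[OF that] P.l_zero[OF that] .
    have zL: "\<zero>\<^bsub>?P\<^esub> \<in> ?L" using L unfolding P.submodule_iff by blast
    have sumI: "x \<oplus>\<^bsub>?P\<^esub> y \<in> ?G" if "x \<in> G" "y \<in> ?L" for x y
      using that by blast
    have "G \<subseteq> ?G"
    proof
      fix x assume x: "x \<in> G"
      then show "x \<in> ?G" using sumI[OF x zL] zP(1)[of x] GP(1) by (simp only: subset_iff)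
    qed
    moreover have "(b, e) \<in> ?G" using sumI[OF GP(2) bL] zP(2)[of "(b, e)"] b e
      by (simp only: prod_module_simps(1) mem_Sigma_iff simp_thms)
    \<comment> \<open>Well-definedness of the enlarged graph: if a multiple of \<open>b\<close>
      cancels a point \<open>y\<close> of the old domain, its coefficient lies in \<open>J\<close>,
      and there the multiples of \<open>e\<close> agree with the old values.\<close>
    moreover have "x = \<zero>\<^bsub>E\<^esub>" if x: "(\<zero>\<^bsub>B\<^esub>, x) \<in> ?G" for x
    proof -
      obtain y z r where r: "(y, z) \<in> G" "r \<in> carrier R" "\<zero>\<^bsub>B\<^esub> = y \<oplus>\<^bsub>B\<^esub> r \<odot>\<^bsub>B\<^esub> b" "x = z \<oplus>\<^bsub>E\<^esub> r \<odot>\<^bsub>E\<^esub> e"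
        using x by auto
      have y: "y \<in> carrier B" using r(1) GP by auto
      have neg: "\<ominus>\<^bsub>?P\<^esub> (y, z) \<in> G" using G(1) r(1) P.smult_minus_one[of "(y, z)"] GP
        E.R.a_inv_closed[OF E.R.one_closed] unfolding P.submodule_iff by (metis subsetD)
      have "r \<odot>\<^bsub>B\<^esub> b = \<ominus>\<^bsub>B\<^esub> y" using r y b
        by (metis B.add.inv_equality B.add.inv_inv B.smult_closed)
      also have "\<dots> = fst (\<ominus>\<^bsub>?P\<^esub> (y, z))" using lmap_uminus[OF lmap_fst[OF B E], of "(y, z)"] r(1) GP by auto
      finally have "r \<in> J" using neg r(2) unfolding J_def by simp
      then have "(y, z) \<oplus>\<^bsub>?P\<^esub> (r \<odot>\<^bsub>B\<^esub> b, r \<odot>\<^bsub>E\<^esub> e) \<in> G" using hG r(1) G(1) unfolding P.submodule_iff by blast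
      then show ?thesis using G(2) r by simp
    qed
    ultimately have G'': "?G \<in> \<G>" "G \<subseteq> ?G" "(b, e) \<in> ?G" using G' G(3) unfolding \<G>_def by blast+
    have "?G = G" by (rule mp[OF bspec[OF max G''(1)] G''(2)])
    then have "(b, e) \<in> G" using G''(3) by (rule subst)
    then show False using nb by force
  qed
  obtain s where s: "lmap R B (?P\<lparr>carrier := G\<rparr>) s" "\<And>x. x \<in> carrier B \<Longrightarrow> fst (s x) = x"
    by (rule lmap_factor_inj[OF Gfst Ginj lmap_id[OF B]]) (use full in auto)
  show thesis
  proof
    show "lmap R B E (\<lambda>x. snd (s x))" using lmap_comp[OF s(1) Gsnd] .
    fix a assume a: "a \<in> carrier A"
    have "s (i a) \<in> G" "(i a, f a) \<in> G" using lmap_closed[OF s(1) lmap_closed[OF i(1) a]] G(3) a by auto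
    moreover have "fst (s (i a)) = fst (i a, f a)" using s(2) lmap_closed[OF i(1) a] by simp
    ultimately have "s (i a) = (i a, f a)" using Ginj by (intro inj_onD[of fst G]) auto
    then show "snd (s (i a)) = f a" by simp
  qed
qed

section \<open>Cohomology of a projective complex\<close>

text \<open>\<open>cz R P d k N\<close>: the cohomology of \<open>Hom(P, N)\<close> vanishes in degree \<open>k + 1\<close> (not \<open>k\<close>).\<close>

definition cz :: "'r ring \<Rightarrow> (nat \<Rightarrow> ('r, 'p) module) \<Rightarrow> (nat \<Rightarrow> 'p \<Rightarrow> 'p) \<Rightarrow> nat \<Rightarrow> ('r, 'n) module \<Rightarrow> bool" where
  "cz R P d k N \<longleftrightarrow> (\<forall>c. lmap R (P (Suc k)) N c \<and> (\<forall>x\<in>carrier (P (Suc (Suc k))). c (d (Suc k) x) = \<zero>\<^bsub>N\<^esub>) \<longrightarrow>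
     (\<exists>b. lmap R (P k) N b \<and> (\<forall>x\<in>carrier (P (Suc k)). c x = b (d k x))))"

lemma czE:
  assumes "cz R P d k N" "lmap R (P (Suc k)) N c" "\<And>x. x \<in> carrier (P (Suc (Suc k))) \<Longrightarrow> c (d (Suc k) x) = \<zero>\<^bsub>N\<^esub>"
  obtains b where "lmap R (P k) N b" "\<And>x. x \<in> carrier (P (Suc k)) \<Longrightarrow> c x = b (d k x)"
  using assms unfolding cz_def by metis

text \<open>Lifting properties of the terms are supplied where a proof uses them, so that the same
  locale serves free resolutions over \<open>R\<close> and duals of complexes in
  \<open>add C\<close> over \<open>S\<close>.\<close>

locale pcx =
  fixes R :: "'r ring" and P :: "nat \<Rightarrow> ('r, 'p) module" and d :: "nat \<Rightarrow> 'p \<Rightarrow> 'p"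
  assumes d: "lmap R (P (Suc n)) (P n) (d n)"
    and exact: "d (Suc n) ` carrier (P (Suc (Suc n))) = {x \<in> carrier (P (Suc n)). d n x = \<zero>\<^bsub>P n\<^esub>}"
begin

definition K :: "nat \<Rightarrow> ('r, 'p) module" where
  "K n = (P n)\<lparr>carrier := d n ` carrier (P (Suc n))\<rparr>"

lemma carrier_K [simp]: "carrier (K n) = d n ` carrier (P (Suc n))"
  by (simp add: K_def)

lemma dd: "x \<in> carrier (P (Suc (Suc n))) \<Longrightarrow> d n (d (Suc n) x) = \<zero>\<^bsub>P n\<^esub>"
  using exact[of n] by blast

lemma P_module: "right_module R (P n)"
  using lmap_tgt[OF d] .

lemma K_incl: "lmap R (K n) (P n) (\<lambda>x. x)" "inj_on (\<lambda>x. x) (carrier (K n))"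
  unfolding K_def using lmap_sub[OF P_module submodule_range[OF d]] by (auto simp: inj_on_def)

lemma d_K: "lmap R (P (Suc n)) (K n) (d n)"
  unfolding K_def using lmap_corestrict[OF d submodule_range[OF d]] by blast

lemma ses_K: "ses R (K (Suc n)) (\<lambda>x. x) (P (Suc n)) (d n) (K n)"
  using ses_kernel_range[OF d[of n]] exact[of n] unfolding K_def by simp

definition extends :: "nat \<Rightarrow> ('r, 'n) module \<Rightarrow> bool" where
  "extends n N \<longleftrightarrow> (\<forall>f. lmap R (K n) N f \<longrightarrow> (\<exists>b. lmap R (P n) N b \<and> (\<forall>x\<in>carrier (K n). b x = f x)))"

text \<open>A cocycle in degree \<open>k + 1\<close> kills the image of \<open>d (Suc k)\<close>,
  hence amounts to a map on the image \<open>K k\<close> of \<open>d k\<close>; it is a coboundary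
  exactly if that map extends to \<open>P k\<close>.\<close>

lemma cz_iff_extends: "cz R P d k N \<longleftrightarrow> extends k N"
proof
  assume cz: "cz R P d k N"
  show "extends k N"
    unfolding extends_def
  proof (intro allI impI)
    fix f assume f: "lmap R (K k) N f"
    have z: "f (d k (d (Suc k) x)) = \<zero>\<^bsub>N\<^esub>" if "x \<in> carrier (P (Suc (Suc k)))" for x
      using dd[OF that] lmap_zero[OF f] by (simp add: K_def)
    obtain b where "lmap R (P k) N b" "\<And>x. x \<in> carrier (P (Suc k)) \<Longrightarrow> f (d k x) = b (d k x)"
      using czE[OF cz lmap_comp[OF d_K f] z] by blast
    then show "\<exists>b. lmap R (P k) N b \<and> (\<forall>x\<in>carrier (K k). b x = f x)" by force
  qed
next
  assume ex: "extends k N"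
  show "cz R P d k N"
    unfolding cz_def
  proof (intro allI impI, elim conjE)
    fix c assume c: "lmap R (P (Suc k)) N c" "\<forall>x\<in>carrier (P (Suc (Suc k))). c (d (Suc k) x) = \<zero>\<^bsub>N\<^esub>"
    have c': "c x = \<zero>\<^bsub>N\<^esub>" if "x \<in> carrier (K (Suc k))" for x using c(2) that by auto
    obtain f where f: "lmap R (K k) N f" "\<And>x. x \<in> carrier (P (Suc k)) \<Longrightarrow> f (d k x) = c x"
      by (rule ses_factor[OF ses_K c(1) c']) (assumption, rule that)
    then obtain b where "lmap R (P k) N b" "\<forall>x\<in>carrier (K k). b x = f x" using ex unfolding extends_def by blast
    then show "\<exists>b. lmap R (P k) N b \<and> (\<forall>x\<in>carrier (P (Suc k)). c x = b (d k x))" using f(2) by auto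
  qed
qed

lemma cz_baer: "baer R E \<Longrightarrow> cz R P d k E"
  unfolding cz_iff_extends extends_def using baer_extend[OF _ K_incl] by metis

lemma cz_sumd:
  assumes "cz R P d k C" "sumd R C B"
  shows "cz R P d k B"
  unfolding cz_def
proof (intro allI impI, elim conjE)
  fix c assume c: "lmap R (P (Suc k)) B c" "\<forall>x\<in>carrier (P (Suc (Suc k))). c (d (Suc k) x) = \<zero>\<^bsub>B\<^esub>"
  obtain n u v where s: "right_module R C" "right_module R B" "\<And>i. i < n \<Longrightarrow> lmap R C B (u i)"
    "\<And>i. i < n \<Longrightarrow> lmap R B C (v i)" "\<And>x. x \<in> carrier B \<Longrightarrow> msum B (\<lambda>i. u i (v i x)) (n::nat) = x"
    by (rule sumdE[OF assms(2)]) blast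
  have "\<exists>b. lmap R (P k) C b \<and> (\<forall>x\<in>carrier (P (Suc k)). v i (c x) = b (d k x))" if "i < n" for i
    using czE[OF assms(1) lmap_comp[OF c(1) s(4)[OF that]]] c(2) lmap_zero[OF s(4)[OF that]] by metis
  then obtain b where b: "\<And>i. i < n \<Longrightarrow> lmap R (P k) C (b i)"
    "\<And>i x. \<lbrakk>i < n; x \<in> carrier (P (Suc k))\<rbrakk> \<Longrightarrow> v i (c x) = b i (d k x)" by metis
  have "lmap R (P k) B (\<lambda>x. msum B (\<lambda>i. u i (b i x)) n)"
    by (intro msum_lmap P_module s(2)) (rule lmap_comp[OF b(1) s(3)])
  moreover have "c x = msum B (\<lambda>i. u i (b i (d k x))) n" if x: "x \<in> carrier (P (Suc k))" for x
    using s(5)[OF lmap_closed[OF c(1) x]] b(2)[OF _ x] msum_cong[of n "\<lambda>i. u i (v i (c x))" "\<lambda>i. u i (b i (d k x))" B] by simp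
  ultimately show "\<exists>b. lmap R (P k) B b \<and> (\<forall>x\<in>carrier (P (Suc k)). c x = b (d k x))" by blast
qed

text \<open>The segment of a long exact sequence in which \<open>N\<close> in degree
  \<open>k + 1\<close> is caught between \<open>B\<close> in degree \<open>k + 1\<close> and
  \<open>A\<close> in degree \<open>k + 2\<close>. The cocycle is lifted to \<open>B\<close>; the
  failure of the lift to be a cocycle is a cocycle with values in \<open>A\<close>, and subtracting
  a primitive \<open>b\<close> of it repairs the lift.\<close>

lemma cz_shift:
  assumes ses: "ses R A i B p N" and lift: "lifting R (P (Suc k)) B N p"
    and B: "cz R P d k B" and A: "cz R P d (Suc k) A"
  shows "cz R P d k N"
  unfolding cz_def
proof (intro allI impI, elim conjE)
  note s = sesD[OF ses]
  interpret B: right_module R B using lmap_tgt[OF s(1)] .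
  fix c assume c: "lmap R (P (Suc k)) N c" "\<forall>x\<in>carrier (P (Suc (Suc k))). c (d (Suc k) x) = \<zero>\<^bsub>N\<^esub>"
  obtain c' where c': "lmap R (P (Suc k)) B c'" "\<And>x. x \<in> carrier (P (Suc k)) \<Longrightarrow> p (c' x) = c x"
    by (rule liftingE[OF lift c(1)]) (use s(4) lmap_closed[OF c(1)] in auto)
  obtain a where a: "lmap R (P (Suc (Suc k))) A a" "\<And>x. x \<in> carrier (P (Suc (Suc k))) \<Longrightarrow> i (a x) = c' (d (Suc k) x)"
  proof (rule lmap_factor_inj[OF s(1,3) lmap_comp[OF d c'(1)]])
    fix x assume x: "x \<in> carrier (P (Suc (Suc k)))"
    then show "c' (d (Suc k) x) \<in> i ` carrier A"
      using s(5)[OF lmap_closed[OF c'(1) lmap_closed[OF d]]] c'(2)[OF lmap_closed[OF d]] c(2) by simp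
  qed (rule that)
  have "a (d (Suc (Suc k)) x) = \<zero>\<^bsub>A\<^esub>" if x: "x \<in> carrier (P (Suc (Suc (Suc k))))" for x
  proof -
    have "i (a (d (Suc (Suc k)) x)) = \<zero>\<^bsub>B\<^esub>"
      using a(2)[OF lmap_closed[OF d x]] dd[OF x] lmap_zero[OF c'(1)] by simp
    then show ?thesis using s(3) lmap_inj_on_iff[OF s(1)] lmap_closed[OF a(1) lmap_closed[OF d x]] by blast
  qed
  then obtain b where b: "lmap R (P (Suc k)) A b" "\<And>x. x \<in> carrier (P (Suc (Suc k))) \<Longrightarrow> a x = b (d (Suc k) x)"
    using czE[OF A a(1)] by metis
  have ib: "lmap R (P (Suc k)) B (\<lambda>x. i (b x))" using lmap_comp[OF b(1) s(1)] .
  have "c' (d (Suc k) x) \<ominus>\<^bsub>B\<^esub> i (b (d (Suc k) x)) = \<zero>\<^bsub>B\<^esub>" if x: "x \<in> carrier (P (Suc (Suc k)))" for x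
    using a(2)[OF x] b(2)[OF x] lmap_closed[OF c'(1) lmap_closed[OF d x]] by (simp add: B.minus_eq_zero_iff)
  then obtain e where e: "lmap R (P k) B e" "\<And>x. x \<in> carrier (P (Suc k)) \<Longrightarrow> c' x \<ominus>\<^bsub>B\<^esub> i (b x) = e (d k x)"
    using czE[OF B lmap_diff[OF c'(1) ib]] by blast
  have "c x = p (e (d k x))" if x: "x \<in> carrier (P (Suc k))" for x
  proof -
    interpret N: right_module R N using lmap_tgt[OF s(2)] .
    have "p (e (d k x)) = p (c' x) \<ominus>\<^bsub>N\<^esub> p (i (b x))"
      using e(2)[OF x] lmap_minus[OF s(2) lmap_closed[OF c'(1) x] lmap_closed[OF ib x]] by simp
    then show ?thesis using s(6)[OF lmap_closed[OF b(1) x]] c'(2)[OF x] lmap_closed[OF c(1) x] by simp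
  qed
  then show "\<exists>b. lmap R (P k) N b \<and> (\<forall>x\<in>carrier (P (Suc k)). c x = b (d k x))"
    using lmap_comp[OF e(1) s(2)] by blast
qed

end

locale presolution = pcx R P d for R :: "'r ring" and P :: "nat \<Rightarrow> ('r, 'p) module" and d +
  fixes M :: "('r, 'm) module" and e :: "'p \<Rightarrow> 'm"
  assumes e: "lmap R (P 0) M e" and e_surj: "e ` carrier (P 0) = carrier M"
    and exact0: "d 0 ` carrier (P 1) = {x \<in> carrier (P 0). e x = \<zero>\<^bsub>M\<^esub>}"
begin

lemma ses0: "ses R (K 0) (\<lambda>x. x) (P 0) e M"
  using ses_kernel[OF e e_surj] exact0 unfolding K_def by simp

text \<open>With the first cohomology of \<open>Hom(P, A)\<close> zero,
  \<open>Hom(M, B) \<rightarrow> Hom(M, N)\<close> is surjective. Lift over \<open>P 0\<close>; on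
  \<open>K 0\<close> the lift takes values in \<open>A\<close>, and an extension of these values to
  \<open>P 0\<close> is subtracted so that the result descends to \<open>M\<close>.\<close>

lemma cz_lift:
  assumes ses: "ses R A i B p N" and lift: "lifting R (P 0) B N p" and A: "cz R P d 0 A" and h: "lmap R M N h"
  obtains g where "lmap R M B g" "\<And>x. x \<in> carrier M \<Longrightarrow> p (g x) = h x"
proof -
  note s = sesD[OF ses]
  interpret B: right_module R B using lmap_tgt[OF s(1)] .
  interpret N: right_module R N using lmap_tgt[OF s(2)] .
  obtain c where c: "lmap R (P 0) B c" "\<And>x. x \<in> carrier (P 0) \<Longrightarrow> p (c x) = h (e x)"
    by (rule liftingE[OF lift lmap_comp[OF e h]]) (use s(4) lmap_closed[OF lmap_comp[OF e h]] in auto)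
  have eK: "e x = \<zero>\<^bsub>M\<^esub>" "x \<in> carrier (P 0)" if "x \<in> carrier (K 0)" for x using that exact0 by auto
  obtain a where a: "lmap R (K 0) A a" "\<And>x. x \<in> carrier (K 0) \<Longrightarrow> i (a x) = c x"
  proof (rule lmap_factor_inj[OF s(1,3) lmap_comp[OF K_incl(1) c(1)]])
    fix x assume x: "x \<in> carrier (K 0)"
    show "c x \<in> i ` carrier A"
      using s(5)[OF lmap_closed[OF c(1) eK(2)[OF x]]] c(2)[OF eK(2)[OF x]] eK(1)[OF x] lmap_zero[OF h] by simp
  qed (rule that)
  obtain b where b: "lmap R (P 0) A b" "\<And>x. x \<in> carrier (K 0) \<Longrightarrow> b x = a x"
    using A a(1) unfolding cz_iff_extends extends_def by blast
  have ib: "lmap R (P 0) B (\<lambda>x. i (b x))" using lmap_comp[OF b(1) s(1)] .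
  obtain g where g: "lmap R M B g" "\<And>x. x \<in> carrier (P 0) \<Longrightarrow> g (e x) = c x \<ominus>\<^bsub>B\<^esub> i (b x)"
  proof (rule ses_factor[OF ses0 lmap_diff[OF c(1) ib]])
    show "c x \<ominus>\<^bsub>B\<^esub> i (b x) = \<zero>\<^bsub>B\<^esub>" if "x \<in> carrier (K 0)" for x
      using a(2)[OF that] b(2)[OF that] lmap_closed[OF c(1) eK(2)[OF that]] by (simp add: B.minus_eq_zero_iff)
  qed (rule that)
  have "p (g y) = h y" if y: "y \<in> carrier M" for y
  proof -
    obtain x where x: "x \<in> carrier (P 0)" "y = e x" using y e_surj by auto
    have "p (g y) = p (c x) \<ominus>\<^bsub>N\<^esub> p (i (b x))"
      using g(2)[OF x(1)] x(2) lmap_minus[OF s(2) lmap_closed[OF c(1) x(1)] lmap_closed[OF ib x(1)]] by simp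
    then show ?thesis using s(6)[OF lmap_closed[OF b(1) x(1)]] c(2)[OF x(1)] x(2) lmap_closed[OF h y] by simp
  qed
  with g(1) that show thesis by blast
qed

end

section \<open>Ext by an injective coresolution of the second variable\<close>

text \<open>Compared with \<open>injective_resolution\<close>, the maps need not be extensional and
  injectivity is \<open>baer\<close>, so that test modules of arbitrary types can be chased against
  one coresolution.\<close>

locale injres =
  fixes R :: "'r ring" and C :: "('r, 'c) module" and E :: "nat \<Rightarrow> ('r, 'e) module" and \<epsilon> :: "'c \<Rightarrow> 'e"
    and \<delta> :: "nat \<Rightarrow> 'e \<Rightarrow> 'e"
  assumes inj: "baer R (E n)" and \<epsilon>: "lmap R C (E 0) \<epsilon>" "inj_on \<epsilon> (carrier C)"
    and \<delta>: "lmap R (E n) (E (Suc n)) (\<delta> n)"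
    and exact0: "\<epsilon> ` carrier C = {x \<in> carrier (E 0). \<delta> 0 x = \<zero>\<^bsub>E 1\<^esub>}"
    and exact: "\<delta> n ` carrier (E n) = {x \<in> carrier (E (Suc n)). \<delta> (Suc n) x = \<zero>\<^bsub>E (Suc (Suc n))\<^esub>}"
begin

text \<open>\<open>exv k M\<close>: \<open>Ext(M, C)\<close> vanishes in degree \<open>k + 1\<close> (not \<open>k\<close>).\<close>

definition exv :: "nat \<Rightarrow> ('r, 'm) module \<Rightarrow> bool" where
  "exv k M \<longleftrightarrow> right_module R M \<and> (\<forall>g. lmap R M (E (Suc k)) g \<and> (\<forall>x\<in>carrier M. \<delta> (Suc k) (g x) = \<zero>\<^bsub>E (Suc (Suc k))\<^esub>) \<longrightarrow>
     (\<exists>h. lmap R M (E k) h \<and> (\<forall>x\<in>carrier M. g x = \<delta> k (h x))))"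

lemma exvE:
  assumes "exv k M" "lmap R M (E (Suc k)) g" "\<And>x. x \<in> carrier M \<Longrightarrow> \<delta> (Suc k) (g x) = \<zero>\<^bsub>E (Suc (Suc k))\<^esub>"
  obtains h where "lmap R M (E k) h" "\<And>x. x \<in> carrier M \<Longrightarrow> g x = \<delta> k (h x)"
  using assms unfolding exv_def by metis

lemma dd: "x \<in> carrier (E n) \<Longrightarrow> \<delta> (Suc n) (\<delta> n x) = \<zero>\<^bsub>E (Suc (Suc n))\<^esub>"
  using exact by blast

lemma d\<epsilon>: "x \<in> carrier C \<Longrightarrow> \<delta> 0 (\<epsilon> x) = \<zero>\<^bsub>E 1\<^esub>"
  using exact0 by blast

lemma E_module: "right_module R (E n)"
  using inj by (simp add: baer_def)

lemma exv_high: "carrier (E (Suc k)) = {\<zero>\<^bsub>E (Suc k)\<^esub>} \<Longrightarrow> right_module R M \<Longrightarrow> exv k M"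
  unfolding exv_def
  using lmap_zero_map[of R M "E k"] E_module lmap_zero[OF \<delta>] lmap_closed[of R M "E (Suc k)"]
  by (metis singletonD)

text \<open>Cocycles take values in the range of \<open>\<delta> k\<close> by exactness, so a lift
  against this one map is a primitive.\<close>

lemma exv_lifting: "lifting R P (E k) (E (Suc k)) (\<delta> k) \<Longrightarrow> right_module R P \<Longrightarrow> exv k P"
  unfolding exv_def
proof (intro conjI allI impI; (elim conjE)?)
  fix g assume l: "lifting R P (E k) (E (Suc k)) (\<delta> k)" and g: "lmap R P (E (Suc k)) g"
    "\<forall>x\<in>carrier P. \<delta> (Suc k) (g x) = \<zero>\<^bsub>E (Suc (Suc k))\<^esub>"
  have "g x \<in> \<delta> k ` carrier (E k)" if "x \<in> carrier P" for x
    using exact[of k] g that lmap_closed[OF g(1)] by auto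
  then show "\<exists>h. lmap R P (E k) h \<and> (\<forall>x\<in>carrier P. g x = \<delta> k (h x))"
    using liftingE[OF l g(1)] by metis
qed

lemma exv_sumd:
  assumes "exv k M" "sumd R M P"
  shows "exv k P"
  unfolding exv_def
proof (intro conjI allI impI; (elim conjE)?)
  fix g assume g: "lmap R P (E (Suc k)) g" "\<forall>x\<in>carrier P. \<delta> (Suc k) (g x) = \<zero>\<^bsub>E (Suc (Suc k))\<^esub>"
  obtain n u v where s: "right_module R M" "right_module R P" "\<And>i. i < n \<Longrightarrow> lmap R M P (u i)"
    "\<And>i. i < n \<Longrightarrow> lmap R P M (v i)" "\<And>x. x \<in> carrier P \<Longrightarrow> msum P (\<lambda>i. u i (v i x)) (n::nat) = x"
    by (rule sumdE[OF assms(2)]) blast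
  have "\<exists>h. lmap R M (E k) h \<and> (\<forall>x\<in>carrier M. g (u i x) = \<delta> k (h x))" if "i < n" for i
    using exvE[OF assms(1) lmap_comp[OF s(3)[OF that] g(1)]] g(2) lmap_closed[OF s(3)[OF that]] by metis
  then obtain h where h: "\<And>i. i < n \<Longrightarrow> lmap R M (E k) (h i)"
    "\<And>i x. \<lbrakk>i < n; x \<in> carrier M\<rbrakk> \<Longrightarrow> g (u i x) = \<delta> k (h i x)" by metis
  have "lmap R P (E k) (\<lambda>x. msum (E k) (\<lambda>i. h i (v i x)) n)"
    by (intro msum_lmap E_module s(2)) (rule lmap_comp[OF s(4) h(1)])
  moreover have "g x = \<delta> k (msum (E k) (\<lambda>i. h i (v i x)) n)" if x: "x \<in> carrier P" for x
  proof -
    have "g x = g (msum P (\<lambda>i. u i (v i x)) n)" using s(5)[OF x] by simp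
    also have "\<dots> = msum (E (Suc k)) (\<lambda>i. g (u i (v i x))) n"
      using x by (intro lmap_msum[OF g(1)] lmap_closed[OF s(3)] lmap_closed[OF s(4)])
    also have "\<dots> = msum (E (Suc k)) (\<lambda>i. \<delta> k (h i (v i x))) n"
      using x by (intro msum_cong h(2) lmap_closed[OF s(4)])
    also have "\<dots> = \<delta> k (msum (E k) (\<lambda>i. h i (v i x)) n)"
      using x by (intro lmap_msum[OF \<delta>, symmetric] lmap_closed[OF h(1)] lmap_closed[OF s(4)])
    finally show ?thesis .
  qed
  ultimately show "\<exists>h. lmap R P (E k) h \<and> (\<forall>x\<in>carrier P. g x = \<delta> k (h x))" by blast
qed (use assms(2) in \<open>simp add: sumd_def\<close>)

lemma exv_iso:
  assumes "exv k M" "lmap R M N f" "bij_betw f (carrier M) (carrier N)"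
  shows "exv k N"
proof -
  obtain g where "lmap R N M g" "\<And>x. x \<in> carrier N \<Longrightarrow> f (g x) = x"
    by (rule lmap_inverse[OF assms(2,3)]) (rule that)
  then show ?thesis using exv_sumd[OF assms(1) sumd_retract[OF sumd_refl[OF lmap_src] assms(2)]] assms(2) by blast
qed

section \<open>Vanishing of Ext along a short exact sequence in the first variable\<close>

context
  fixes A :: "('r, 'a) module" and i and B :: "('r, 'b) module" and p and M :: "('r, 'm) module"
  assumes ses: "ses R A i B p M"
begin

private lemmas s = sesD[OF ses]

text \<open>The difference of \<open>g\<close> and \<open>g'\<close> vanishes on \<open>A\<close>,
  so it factors through \<open>M\<close>.\<close>

private lemma factor:
  assumes "lmap R B (E n) g" "lmap R B (E n) g'" "\<And>x. x \<in> carrier A \<Longrightarrow> g (i x) = g' (i x)"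
  obtains h where "lmap R M (E n) h" "\<And>x. x \<in> carrier B \<Longrightarrow> g x = h (p x) \<oplus>\<^bsub>E n\<^esub> g' x"
proof -
  interpret E: right_module R "E n" by (rule E_module)
  have "g (i x) \<ominus>\<^bsub>E n\<^esub> g' (i x) = \<zero>\<^bsub>E n\<^esub>" if "x \<in> carrier A" for x
    using assms(3)[OF that] lmap_closed[OF assms(2) lmap_closed[OF s(1) that]] by (simp add: E.minus_eq_zero_iff)
  from ses_factor[OF ses lmap_diff[OF assms(1,2)] this]
  obtain h where "lmap R M (E n) h" "\<And>x. x \<in> carrier B \<Longrightarrow> h (p x) = g x \<ominus>\<^bsub>E n\<^esub> g' x" by metis
  then show thesis using that lmap_closed[OF assms(1)] lmap_closed[OF assms(2)] by (metis E.minus_add_cancel)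
qed

private lemma extend:
  assumes "lmap R A (E n) u"
  obtains u' where "lmap R B (E n) u'" "\<And>x. x \<in> carrier A \<Longrightarrow> u' (i x) = u x"
  using baer_extend[OF inj s(1,3) assms] by metis

private lemma \<delta>_cancel:
  assumes "x \<in> carrier (E n)" "y \<in> carrier (E n)" "\<delta> n y = \<zero>\<^bsub>E (Suc n)\<^esub>"
  shows "\<delta> n (x \<oplus>\<^bsub>E n\<^esub> y) = \<delta> n x" "\<delta> n (y \<oplus>\<^bsub>E n\<^esub> x) = \<delta> n x"
proof -
  interpret E': right_module R "E (Suc n)" by (rule E_module)
  show "\<delta> n (x \<oplus>\<^bsub>E n\<^esub> y) = \<delta> n x" "\<delta> n (y \<oplus>\<^bsub>E n\<^esub> x) = \<delta> n x"
    using assms lmap_closed[OF \<delta>] by (simp_all add: lmap_add[OF \<delta>])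
qed

text \<open>The connecting segment from degree \<open>k + 1\<close> for \<open>A\<close> to degree
  \<open>k + 2\<close> for \<open>M\<close>. A primitive \<open>h\<close> exists over
  \<open>B\<close>; on \<open>A\<close> it is a cocycle, hence \<open>\<delta> k \<circ> u\<close>,
  and subtracting \<open>\<delta> k\<close> of an extension of \<open>u\<close> to \<open>B\<close>
  makes it descend to \<open>M\<close>.\<close>

lemma exv_quotient_Suc:
  assumes "exv k A" "exv (Suc k) B"
  shows "exv (Suc k) M"
  unfolding exv_def
proof (intro conjI allI impI; (elim conjE)?)
  fix g assume g: "lmap R M (E (Suc (Suc k))) g" "\<forall>x\<in>carrier M. \<delta> (Suc (Suc k)) (g x) = \<zero>\<^bsub>E (Suc (Suc (Suc k)))\<^esub>"
  obtain h where h: "lmap R B (E (Suc k)) h" "\<And>x. x \<in> carrier B \<Longrightarrow> g (p x) = \<delta> (Suc k) (h x)"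
    using exvE[OF assms(2) lmap_comp[OF s(2) g(1)]] g(2) lmap_closed[OF s(2)] by metis
  obtain u where u: "lmap R A (E k) u" "\<And>x. x \<in> carrier A \<Longrightarrow> h (i x) = \<delta> k (u x)"
    using exvE[OF assms(1) lmap_comp[OF s(1) h(1)]] h(2) s(6) lmap_zero[OF g(1)] lmap_closed[OF s(1)] by metis
  obtain u' where u': "lmap R B (E k) u'" "\<And>x. x \<in> carrier A \<Longrightarrow> u' (i x) = u x" by (rule extend[OF u(1)]) (rule that)
  obtain v where v: "lmap R M (E (Suc k)) v" "\<And>x. x \<in> carrier B \<Longrightarrow> h x = v (p x) \<oplus>\<^bsub>E (Suc k)\<^esub> \<delta> k (u' x)"
    by (rule factor[OF h(1) lmap_comp[OF u'(1) \<delta>]]) (simp_all add: u u')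
  have "g y = \<delta> (Suc k) (v y)" if y: "y \<in> carrier M" for y
  proof -
    obtain x where x: "x \<in> carrier B" "y = p x" using y s(4) by auto
    show ?thesis using h(2)[OF x(1)] v(2)[OF x(1)] x dd[OF lmap_closed[OF u'(1) x(1)]]
      \<delta>_cancel(1)[OF lmap_closed[OF v(1) y] lmap_closed[OF \<delta> lmap_closed[OF u'(1) x(1)]]] by simp
  qed
  with v(1) show "\<exists>h. lmap R M (E (Suc k)) h \<and> (\<forall>x\<in>carrier M. g x = \<delta> (Suc k) (h x))" by blast
qed (rule lmap_tgt[OF s(2)])

text \<open>The lowest degree of the same argument, where the connecting map starts at
  \<open>Hom(A, C)\<close>: extendability of maps into \<open>C\<close> replaces the vanishing for
  \<open>A\<close>.\<close>

lemma exv_quotient_0: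
  assumes "\<And>u. lmap R A C u \<Longrightarrow> \<exists>u'. lmap R B C u' \<and> (\<forall>x\<in>carrier A. u' (i x) = u x)" "exv 0 B"
  shows "exv 0 M"
  unfolding exv_def
proof (intro conjI allI impI; (elim conjE)?)
  fix g assume g: "lmap R M (E (Suc 0)) g" "\<forall>x\<in>carrier M. \<delta> (Suc 0) (g x) = \<zero>\<^bsub>E (Suc (Suc 0))\<^esub>"
  obtain h where h: "lmap R B (E 0) h" "\<And>x. x \<in> carrier B \<Longrightarrow> g (p x) = \<delta> 0 (h x)"
    using exvE[OF assms(2) lmap_comp[OF s(2) g(1)]] g(2) lmap_closed[OF s(2)] by metis
  obtain u where u: "lmap R A C u" "\<And>x. x \<in> carrier A \<Longrightarrow> \<epsilon> (u x) = h (i x)"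
  proof (rule lmap_factor_inj[OF \<epsilon> lmap_comp[OF s(1) h(1)]])
    fix x assume "x \<in> carrier A"
    then show "h (i x) \<in> \<epsilon> ` carrier C"
      using h(2)[of "i x", symmetric] s(6) lmap_zero[OF g(1)] lmap_closed[OF s(1)] lmap_closed[OF h(1)]
      unfolding exact0 by simp
  qed (rule that)
  obtain u' where u': "lmap R B C u'" "\<And>x. x \<in> carrier A \<Longrightarrow> u' (i x) = u x" using assms(1)[OF u(1)] by blast
  obtain v where v: "lmap R M (E 0) v" "\<And>x. x \<in> carrier B \<Longrightarrow> h x = v (p x) \<oplus>\<^bsub>E 0\<^esub> \<epsilon> (u' x)"
    by (rule factor[OF h(1) lmap_comp[OF u'(1) \<epsilon>(1)]]) (simp_all add: u u')
  have "g y = \<delta> 0 (v y)" if y: "y \<in> carrier M" for y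
  proof -
    obtain x where x: "x \<in> carrier B" "y = p x" using y s(4) by auto
    show ?thesis using h(2)[OF x(1)] v(2)[OF x(1)] x d\<epsilon>[OF lmap_closed[OF u'(1) x(1)]]
      \<delta>_cancel(1)[OF lmap_closed[OF v(1) y] lmap_closed[OF \<epsilon>(1) lmap_closed[OF u'(1) x(1)]]] by simp
  qed
  with v(1) show "\<exists>h. lmap R M (E 0) h \<and> (\<forall>x\<in>carrier M. g x = \<delta> 0 (h x))" by blast
qed (rule lmap_tgt[OF s(2)])

text \<open>A cocycle on \<open>A\<close> extends to a cochain on \<open>B\<close>, whose coboundary
  descends to a cocycle on \<open>M\<close>. Vanishing for \<open>M\<close> gives a primitive of it,
  and subtracting that primitive leaves a cocycle on \<open>B\<close>.\<close>

private lemma connect: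
  assumes "exv n M" "lmap R A (E n) u" "\<And>x. x \<in> carrier A \<Longrightarrow> \<delta> n (u x) = \<zero>\<^bsub>E (Suc n)\<^esub>"
  obtains h where "lmap R B (E n) h" "\<And>x. x \<in> carrier A \<Longrightarrow> h (i x) = u x"
    "\<And>x. x \<in> carrier B \<Longrightarrow> \<delta> n (h x) = \<zero>\<^bsub>E (Suc n)\<^esub>"
proof -
  interpret E: right_module R "E n" by (rule E_module)
  interpret E': right_module R "E (Suc n)" by (rule E_module)
  obtain h where h: "lmap R B (E n) h" "\<And>x. x \<in> carrier A \<Longrightarrow> h (i x) = u x" by (rule extend[OF assms(2)]) (rule that)
  obtain v where v: "lmap R M (E (Suc n)) v" "\<And>x. x \<in> carrier B \<Longrightarrow> v (p x) = \<delta> n (h x)"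
    by (rule ses_factor[OF ses lmap_comp[OF h(1) \<delta>]]) (simp_all add: assms h)
  have "\<delta> (Suc n) (v y) = \<zero>\<^bsub>E (Suc (Suc n))\<^esub>" if y: "y \<in> carrier M" for y
  proof -
    obtain x where x: "x \<in> carrier B" "y = p x" using y s(4) by auto
    then show ?thesis using v(2)[OF x(1)] dd[OF lmap_closed[OF h(1) x(1)]] by simp
  qed
  then obtain w where w: "lmap R M (E n) w" "\<And>y. y \<in> carrier M \<Longrightarrow> v y = \<delta> n (w y)"
    using exvE[OF assms(1) v(1)] by metis
  show thesis
  proof
    show "lmap R B (E n) (\<lambda>x. h x \<ominus>\<^bsub>E n\<^esub> w (p x))" using lmap_diff[OF h(1) lmap_comp[OF s(2) w(1)]] .
    show "h (i x) \<ominus>\<^bsub>E n\<^esub> w (p (i x)) = u x" if "x \<in> carrier A" for x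
      using h(2)[OF that] s(6)[OF that] lmap_zero[OF w(1)] lmap_closed[OF assms(2) that] by simp
    show "\<delta> n (h x \<ominus>\<^bsub>E n\<^esub> w (p x)) = \<zero>\<^bsub>E (Suc n)\<^esub>" if x: "x \<in> carrier B" for x
      using lmap_minus[OF \<delta> lmap_closed[OF h(1) x] lmap_closed[OF w(1) lmap_closed[OF s(2) x]]]
        v(2)[OF x] w(2)[OF lmap_closed[OF s(2) x]] lmap_closed[OF \<delta> lmap_closed[OF h(1) x]]
      by (simp add: E'.minus_eq_zero_iff)
  qed
qed

text \<open>Extend a cocycle to \<open>B\<close> by \<open>connect\<close>, take a primitive there,
  and restrict it to \<open>A\<close>.\<close>

lemma exv_kernel:
  assumes "exv (Suc k) M" "exv k B"
  shows "exv k A"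
  unfolding exv_def
proof (intro conjI allI impI; (elim conjE)?)
  fix u assume u: "lmap R A (E (Suc k)) u" "\<forall>x\<in>carrier A. \<delta> (Suc k) (u x) = \<zero>\<^bsub>E (Suc (Suc k))\<^esub>"
  obtain h where h: "lmap R B (E (Suc k)) h" "\<And>x. x \<in> carrier A \<Longrightarrow> h (i x) = u x"
    "\<And>x. x \<in> carrier B \<Longrightarrow> \<delta> (Suc k) (h x) = \<zero>\<^bsub>E (Suc (Suc k))\<^esub>"
    by (rule connect[OF assms(1) u(1)]) (use u(2) in auto)
  obtain t where t: "lmap R B (E k) t" "\<And>x. x \<in> carrier B \<Longrightarrow> h x = \<delta> k (t x)"
    using exvE[OF assms(2) h(1,3)] by metis
  show "\<exists>h. lmap R A (E k) h \<and> (\<forall>x\<in>carrier A. u x = \<delta> k (h x))"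
    using lmap_comp[OF s(1) t(1)] h(2) t(2) lmap_closed[OF s(1)] by (intro exI[of _ "\<lambda>x. t (i x)"]) auto
qed (rule lmap_src[OF s(1)])

text \<open>The map obtained from \<open>connect\<close> is a cocycle in degree \<open>0\<close>, so
  it takes values in the image of \<open>C\<close>.\<close>

lemma exv_extend:
  assumes "exv 0 M" "lmap R A C u"
  obtains u' where "lmap R B C u'" "\<And>x. x \<in> carrier A \<Longrightarrow> u' (i x) = u x"
proof -
  obtain h where h: "lmap R B (E 0) h" "\<And>x. x \<in> carrier A \<Longrightarrow> h (i x) = \<epsilon> (u x)"
    "\<And>x. x \<in> carrier B \<Longrightarrow> \<delta> 0 (h x) = \<zero>\<^bsub>E (Suc 0)\<^esub>"
    by (rule connect[OF assms(1) lmap_comp[OF assms(2) \<epsilon>(1)]]) (use d\<epsilon> lmap_closed[OF assms(2)] in auto)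
  obtain u' where u': "lmap R B C u'" "\<And>x. x \<in> carrier B \<Longrightarrow> \<epsilon> (u' x) = h x"
    by (rule lmap_factor_inj[OF \<epsilon> h(1)]) (use h lmap_closed[OF h(1)] in \<open>auto simp: exact0\<close>)
  have "u' (i x) = u x" if "x \<in> carrier A" for x
    using u'(2)[OF lmap_closed[OF s(1) that]] h(2)[OF that] \<epsilon>(2) lmap_closed[OF assms(2) that]
      lmap_closed[OF u'(1) lmap_closed[OF s(1) that]] by (auto dest: inj_onD)
  with u'(1) that show thesis by blast
qed

text \<open>Subtracting the coboundary of an extended primitive makes the cocycle descend to
  \<open>M\<close>; a primitive found there is added back.\<close>

lemma exv_middle:
  assumes "exv k A" "exv k M"
  shows "exv k B"
  unfolding exv_def
proof (intro conjI allI impI; (elim conjE)?)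
  fix g assume g: "lmap R B (E (Suc k)) g" "\<forall>x\<in>carrier B. \<delta> (Suc k) (g x) = \<zero>\<^bsub>E (Suc (Suc k))\<^esub>"
  obtain u where u: "lmap R A (E k) u" "\<And>x. x \<in> carrier A \<Longrightarrow> g (i x) = \<delta> k (u x)"
    using exvE[OF assms(1) lmap_comp[OF s(1) g(1)]] g(2) lmap_closed[OF s(1)] by metis
  obtain u' where u': "lmap R B (E k) u'" "\<And>x. x \<in> carrier A \<Longrightarrow> u' (i x) = u x" by (rule extend[OF u(1)]) (rule that)
  obtain v where v: "lmap R M (E (Suc k)) v" "\<And>x. x \<in> carrier B \<Longrightarrow> g x = v (p x) \<oplus>\<^bsub>E (Suc k)\<^esub> \<delta> k (u' x)"
    by (rule factor[OF g(1) lmap_comp[OF u'(1) \<delta>]]) (simp_all add: u u')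
  have "\<delta> (Suc k) (v y) = \<zero>\<^bsub>E (Suc (Suc k))\<^esub>" if y: "y \<in> carrier M" for y
  proof -
    obtain x where x: "x \<in> carrier B" "y = p x" using y s(4) by auto
    show ?thesis using g(2) v(2)[OF x(1)] x dd[OF lmap_closed[OF u'(1) x(1)]]
      \<delta>_cancel(1)[OF lmap_closed[OF v(1) y] lmap_closed[OF \<delta> lmap_closed[OF u'(1) x(1)]]] by auto
  qed
  then obtain w where w: "lmap R M (E k) w" "\<And>y. y \<in> carrier M \<Longrightarrow> v y = \<delta> k (w y)"
    using exvE[OF assms(2) v(1)] by metis
  have "g x = \<delta> k (w (p x) \<oplus>\<^bsub>E k\<^esub> u' x)" if x: "x \<in> carrier B" for x
    using v(2)[OF x] w(2)[OF lmap_closed[OF s(2) x]]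
    by (simp add: lmap_add[OF \<delta> lmap_closed[OF w(1) lmap_closed[OF s(2) x]] lmap_closed[OF u'(1) x]])
  then show "\<exists>h. lmap R B (E k) h \<and> (\<forall>x\<in>carrier B. g x = \<delta> k (h x))"
    using lmap_plus[OF lmap_comp[OF s(2) w(1)] u'(1)] by blast
qed (rule lmap_src[OF s(2)])

end

text \<open>Balancing of \<open>Ext\<close>, by dimension shifting along the syzygies.\<close>

lemma exv_iff_cz:
  assumes "presolution R P d M e" and proj: "\<And>n k. exv k (P n)"
  shows "exv k M \<longleftrightarrow> cz R P d k C"
proof -
  interpret presolution R P d M e by fact
  \<comment> \<open>Both sides are reduced to the extension of maps from a syzygy:
    \<open>exv\<close> drops one degree at each syzygy because the terms \<open>P n\<close>
    contribute no cohomology, and in the lowest degree it says that maps into \<open>C\<close>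
    extend.\<close>
  have 0: "exv 0 N \<longleftrightarrow> extends n C" if ses: "ses R (K n) (\<lambda>x. x) (P n) q N" for n q and N :: "('r, 'x) module"
  proof
    assume N: "exv 0 N"
    show "extends n C" unfolding extends_def using exv_extend[OF ses N] by metis
  next
    assume "extends n C"
    then have "\<exists>u'. lmap R (P n) C u' \<and> (\<forall>x\<in>carrier (K n). u' x = u x)" if "lmap R (K n) C u" for u
      using that unfolding extends_def by blast
    from exv_quotient_0[OF ses this proj] show "exv 0 N" by blast
  qed
  have S: "exv (Suc k) N \<longleftrightarrow> exv k (K n)" if ses: "ses R (K n) (\<lambda>x. x) (P n) q N" for n q k and N :: "('r, 'x) module"
    using exv_quotient_Suc[OF ses _ proj] exv_kernel[OF ses _ proj] by blast
  have K0: "exv 0 (K n) \<longleftrightarrow> extends (Suc n) C" for n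
  proof
    assume N: "exv 0 (K n)"
    show "extends (Suc n) C" unfolding extends_def using exv_extend[OF ses_K N] by metis
  next
    assume "extends (Suc n) C"
    then have "\<exists>u'. lmap R (P (Suc n)) C u' \<and> (\<forall>x\<in>carrier (K (Suc n)). u' x = u x)" if "lmap R (K (Suc n)) C u" for u
      using that unfolding extends_def by blast
    from exv_quotient_0[OF ses_K this proj] show "exv 0 (K n)" by blast
  qed
  have KS: "exv (Suc k) (K n) \<longleftrightarrow> exv k (K (Suc n))" for k n
    using exv_quotient_Suc[OF ses_K _ proj] exv_kernel[OF ses_K _ proj] by blast
  have K: "exv k (K n) \<longleftrightarrow> extends (Suc (n + k)) C" for k n
    by (induction k arbitrary: n) (simp_all add: K0 KS)
  show ?thesis unfolding cz_iff_extends using 0[OF ses0] S[OF ses0] K[of _ 0] by (cases k) auto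
qed

end

section \<open>The functorial free resolution\<close>

lemma foldr_add_closed:
  assumes "ring R" "snd ` set qs \<subseteq> carrier R"
  shows "foldr (\<lambda>p s. snd p \<oplus>\<^bsub>R\<^esub> s) qs \<zero>\<^bsub>R\<^esub> \<in> carrier R"
proof -
  interpret R: ring R by fact
  show ?thesis using assms(2) by (induction qs) auto
qed

lemma cell_bd_in_free:
  assumes "ring R" "set ps \<subseteq> X \<times> carrier R"
  shows "cell_bd R (Rel ps) \<in> carrier (free_module R X)"
proof -
  have "cell_bd R (Rel ps) c \<in> carrier R" for c
  proof -
    have "snd ` set (filter (\<lambda>p. fst p = c) ps) \<subseteq> carrier R" using assms(2) by auto
    from foldr_add_closed[OF assms(1) this] show ?thesis by simp
  qed
  moreover have "c \<in> fst ` set ps" if "cell_bd R (Rel ps) c \<noteq> \<zero>\<^bsub>R\<^esub>" for c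
  proof (rule ccontr)
    assume "c \<notin> fst ` set ps"
    then have "filter (\<lambda>p. fst p = c) ps = []" by (auto simp: filter_empty_conv)
    with that show False by simp
  qed
  then have "{c. cell_bd R (Rel ps) c \<noteq> \<zero>\<^bsub>R\<^esub>} \<subseteq> fst ` set ps" by blast
  moreover have "fst ` set ps \<subseteq> X" "finite (fst ` set ps)" using assms(2) by auto
  ultimately show ?thesis
    unfolding free_module_simps by (blast intro: finite_subset)
qed

text \<open>List the support of \<open>x\<close> together with its coefficients.\<close>

lemma cell_bd_surj:
  assumes "ring R" "x \<in> carrier (free_module R X)"
  obtains ps where "set ps \<subseteq> X \<times> carrier R" "cell_bd R (Rel ps) = x"
proof -
  interpret R: ring R by fact
  have x: "range x \<subseteq> carrier R" "finite {b. x b \<noteq> \<zero>\<^bsub>R\<^esub>}" "{b. x b \<noteq> \<zero>\<^bsub>R\<^esub>} \<subseteq> X"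
    using assms(2) by (auto simp: free_module_simps)
  obtain bs where bs: "set bs = {b. x b \<noteq> \<zero>\<^bsub>R\<^esub>}" "distinct bs"
    using finite_distinct_list[OF x(2)] by auto
  have "foldr (\<lambda>p s. snd p \<oplus>\<^bsub>R\<^esub> s) (filter (\<lambda>p. fst p = c) (map (\<lambda>b. (b, x b)) bs)) \<zero>\<^bsub>R\<^esub> =
    (if c \<in> set bs then x c else \<zero>\<^bsub>R\<^esub>)" for c
    using bs(2)
  proof (induction bs)
    case (Cons b bs)
    moreover have "x b \<in> carrier R" for b using x(1) by auto
    ultimately show ?case by auto
  qed simp
  then have "cell_bd R (Rel (map (\<lambda>b. (b, x b)) bs)) = x" using bs(1) by (auto simp: fun_eq_iff)
  then show thesis using that[of "map (\<lambda>b. (b, x b)) bs"] bs(1) x by auto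
qed

lemma free_vanish:
  assumes "ring R" "lmap R (free_module R B) N g" "\<And>b. b \<in> B \<Longrightarrow> g (delta R b) = \<zero>\<^bsub>N\<^esub>"
    "f \<in> carrier (free_module R B)"
  shows "g f = \<zero>\<^bsub>N\<^esub>"
proof -
  interpret N: right_module R N using lmap_tgt[OF assms(2)] .
  have "lin_ext R N (\<lambda>b. g (delta R b)) f = \<zero>\<^bsub>N\<^esub>"
    unfolding lin_ext_def using assms(3,4) by (intro N.add.finprod_one_eqI) (auto simp: free_module_simps subset_iff)
  then show ?thesis using free_expand[OF assms(1,2,4)] by simp
qed

lemma res_basis_Suc: "c \<in> res_basis R M (Suc n) \<Longrightarrow> \<exists>ps. c = Rel ps \<and> set ps \<subseteq> res_basis R M n \<times> carrier R"
  by (cases n) auto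

text \<open>That consecutive maps compose to zero is checked on basis elements, where it is the
  defining condition of \<open>res_basis\<close>. Conversely a kernel element, listed as in
  \<open>cell_bd_surj\<close>, is a relation, hence a basis element in the next degree, and its
  \<open>delta\<close> is a preimage.\<close>

lemma presolution_res:
  assumes M: "right_module R M"
  shows "presolution R (res_module R M) (res_diff R M) M (res_aug R M)"
proof -
  interpret M: right_module R M by fact
  have R: "ring R" by (rule M.R.ring_axioms)
  let ?F = "res_module R M"
  have F: "?F n = free_module R (res_basis R M n)" for n by (simp add: res_module_def)
  have FM: "right_module R (?F n)" for n unfolding F by (rule right_module_free[OF R])
  have bd: "cell_bd R c \<in> carrier (?F n)" if "c \<in> res_basis R M (Suc n)" for c n
    using res_basis_Suc[OF that] cell_bd_in_free[OF R] unfolding F by metis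
  have L: "lmap R (?F (Suc n)) (?F n) (lin_ext R (?F n) (cell_bd R))" for n
    unfolding F[of "Suc n"] using bd by (intro lmap_lin_ext FM) auto
  have dL: "lmap R (?F (Suc n)) (?F n) (res_diff R M n)" for n
    unfolding res_diff_def by (rule lmap_restrict[OF L])
  have G: "lmap R (?F 0) M (lin_ext R M gen_val)"
    unfolding F by (intro lmap_lin_ext M) auto
  have aL: "lmap R (?F 0) M (res_aug R M)"
    unfolding res_aug_def by (rule lmap_restrict[OF G])
  have delta: "delta R c \<in> carrier (?F n)" if "c \<in> res_basis R M n" for c n
    unfolding F by (rule delta_in_free[OF R that])
  have d_delta: "res_diff R M n (delta R c) = cell_bd R c" if "c \<in> res_basis R M (Suc n)" for n c
    using delta[OF that] lin_ext_delta[OF FM, where \<phi>="cell_bd R", OF bd[OF that]] by (simp add: res_diff_def)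
  have e_delta: "res_aug R M (delta R c) = gen_val c" if "c \<in> res_basis R M 0" for c
    using delta[OF that] lin_ext_delta[OF M, of gen_val c] that by (auto simp: res_aug_def)
  have surj: "x \<in> res_aug R M ` carrier (?F 0)" if "x \<in> carrier M" for x
    using e_delta[of "Gen x"] delta[of "Gen x" 0] that by force
  have ex0: "res_diff R M 0 ` carrier (?F 1) = {x \<in> carrier (?F 0). res_aug R M x = \<zero>\<^bsub>M\<^esub>}"
  proof (intro equalityI subsetI)
    fix y assume "y \<in> res_diff R M 0 ` carrier (?F 1)"
    then obtain x where x: "x \<in> carrier (?F (Suc 0))" "y = res_diff R M 0 x" by auto
    have "res_aug R M (res_diff R M 0 x) = \<zero>\<^bsub>M\<^esub>"
    proof (rule free_vanish[OF R, where g="\<lambda>x. res_aug R M (res_diff R M 0 x)" and B="res_basis R M (Suc 0)"])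
      show "lmap R (free_module R (res_basis R M (Suc 0))) M (\<lambda>x. res_aug R M (res_diff R M 0 x))"
        using lmap_comp[OF dL aL] unfolding F .
      show "x \<in> carrier (free_module R (res_basis R M (Suc 0)))" using x unfolding F by simp
      fix c assume c: "c \<in> res_basis R M (Suc 0)"
      then have "lin_ext R M gen_val (cell_bd R c) = \<zero>\<^bsub>M\<^esub>" by auto
      then show "res_aug R M (res_diff R M 0 (delta R c)) = \<zero>\<^bsub>M\<^esub>"
        using d_delta[OF c] bd[OF c] by (simp add: res_aug_def)
    qed
    then show "y \<in> {x \<in> carrier (?F 0). res_aug R M x = \<zero>\<^bsub>M\<^esub>}" using x lmap_closed[OF dL] by auto
  next
    fix y assume y: "y \<in> {x \<in> carrier (?F 0). res_aug R M x = \<zero>\<^bsub>M\<^esub>}"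
    then have "y \<in> carrier (free_module R (res_basis R M 0))" unfolding F by simp
    then obtain ps where ps: "set ps \<subseteq> res_basis R M 0 \<times> carrier R" "cell_bd R (Rel ps) = y"
      by (rule cell_bd_surj[OF R]) 
    have "lin_ext R M gen_val y = \<zero>\<^bsub>M\<^esub>" using y by (auto simp: res_aug_def)
    then have c: "Rel ps \<in> res_basis R M (Suc 0)" using ps by (simp del: cell_bd.simps)
    show "y \<in> res_diff R M 0 ` carrier (?F 1)"
      using d_delta[OF c] delta[OF c] ps(2) by force
  qed
  have ex: "res_diff R M (Suc n) ` carrier (?F (Suc (Suc n))) =
    {x \<in> carrier (?F (Suc n)). res_diff R M n x = \<zero>\<^bsub>?F n\<^esub>}" for n
  proof (intro equalityI subsetI)
    fix y assume "y \<in> res_diff R M (Suc n) ` carrier (?F (Suc (Suc n)))"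
    then obtain x where x: "x \<in> carrier (?F (Suc (Suc n)))" "y = res_diff R M (Suc n) x" by auto
    have "res_diff R M n (res_diff R M (Suc n) x) = \<zero>\<^bsub>?F n\<^esub>"
    proof (rule free_vanish[OF R, where g="\<lambda>x. res_diff R M n (res_diff R M (Suc n) x)" and B="res_basis R M (Suc (Suc n))"])
      show "lmap R (free_module R (res_basis R M (Suc (Suc n)))) (?F n) (\<lambda>x. res_diff R M n (res_diff R M (Suc n) x))"
        using lmap_comp[OF dL[of "Suc n"] dL[of n]] unfolding F[of "Suc (Suc n)"] .
      show "x \<in> carrier (free_module R (res_basis R M (Suc (Suc n))))" using x unfolding F by simp
      fix c assume c: "c \<in> res_basis R M (Suc (Suc n))"
      then have "lin_ext R (?F n) (cell_bd R) (cell_bd R c) = \<zero>\<^bsub>?F n\<^esub>" unfolding F by auto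
      then show "res_diff R M n (res_diff R M (Suc n) (delta R c)) = \<zero>\<^bsub>?F n\<^esub>"
        using d_delta[OF c] bd[OF c] by (simp add: res_diff_def)
    qed
    then show "y \<in> {x \<in> carrier (?F (Suc n)). res_diff R M n x = \<zero>\<^bsub>?F n\<^esub>}" using x lmap_closed[OF dL] by auto
  next
    fix y assume y: "y \<in> {x \<in> carrier (?F (Suc n)). res_diff R M n x = \<zero>\<^bsub>?F n\<^esub>}"
    then have "y \<in> carrier (free_module R (res_basis R M (Suc n)))" unfolding F by simp
    then obtain ps where ps: "set ps \<subseteq> res_basis R M (Suc n) \<times> carrier R" "cell_bd R (Rel ps) = y"
      by (rule cell_bd_surj[OF R])
    have "lin_ext R (?F n) (cell_bd R) y = \<zero>\<^bsub>?F n\<^esub>" using y by (auto simp: res_diff_def)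
    then have c: "Rel ps \<in> res_basis R M (Suc (Suc n))" using ps unfolding F by (simp del: cell_bd.simps)
    show "y \<in> res_diff R M (Suc n) ` carrier (?F (Suc (Suc n)))"
      using d_delta[OF c] delta[OF c] ps(2) by force
  qed
  show ?thesis
    by unfold_locales (use dL aL ex0 ex surj lmap_closed[OF aL] in auto)
qed

section \<open>Triviality of the Ext groups as exactness of a complex of homomorphisms\<close>

lemma trivial_FactGroup_iff:
  assumes "comm_group G" "subgroup H G"
  shows "trivial_group (G Mod H) \<longleftrightarrow> carrier G \<subseteq> H"
proof -
  interpret comm_group G by fact
  have g: "group (G Mod H)" using normal.factorgroup_is_group[OF subgroup_imp_normal[OF assms(2)]] .
  show ?thesis
  proof
    assume "trivial_group (G Mod H)"
    then have "(\<lambda>x. H #>\<^bsub>G\<^esub> x) ` carrier G = {H}" by (simp add: trivial_group_def carrier_FactGroup)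
    then have "H #>\<^bsub>G\<^esub> x = H" if "x \<in> carrier G" for x using that by auto
    then show "carrier G \<subseteq> H" using coset_join1[OF _ _ assms(2)] by auto
  next
    assume "carrier G \<subseteq> H"
    then have "(\<lambda>x. H #>\<^bsub>G\<^esub> x) ` carrier G = {H}"
      using coset_join2[OF _ assms(2)] one_closed by (auto simp: subset_iff image_iff)
    then show "trivial_group (G Mod H)" using g by (simp add: trivial_group_def carrier_FactGroup)
  qed
qed

lemma comm_group_hom_group:
  assumes X: "right_module R X" and N: "right_module R N"
  shows "comm_group (hom_group R X N)"
proof (rule comm_groupI)
  interpret X: right_module R X by fact
  interpret N: right_module R N by fact
  note s = hom_group_def mod_hom_iff[OF X N]
  have cl: "f x \<in> carrier N" if "f \<in> mod_hom R X N" "x \<in> carrier X" for f x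
    using that lmap_closed[of R X N f] by (simp add: mod_hom_iff[OF X N])
  show "\<one>\<^bsub>hom_group R X N\<^esub> \<in> carrier (hom_group R X N)"
    using lmap_mod_hom[OF lmap_zero_map[OF X N]] by (simp add: hom_group_def)
  show "x \<otimes>\<^bsub>hom_group R X N\<^esub> y \<in> carrier (hom_group R X N)"
    if "x \<in> carrier (hom_group R X N)" "y \<in> carrier (hom_group R X N)" for x y
    using that lmap_mod_hom[OF lmap_plus[of R X N x y]] by (simp add: s)
  show "(x \<otimes>\<^bsub>hom_group R X N\<^esub> y) \<otimes>\<^bsub>hom_group R X N\<^esub> z = x \<otimes>\<^bsub>hom_group R X N\<^esub> (y \<otimes>\<^bsub>hom_group R X N\<^esub> z)"
    if "x \<in> carrier (hom_group R X N)" "y \<in> carrier (hom_group R X N)" "z \<in> carrier (hom_group R X N)" for x y z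
    using that cl by (auto simp: hom_group_def fun_eq_iff N.a_assoc)
  show "x \<otimes>\<^bsub>hom_group R X N\<^esub> y = y \<otimes>\<^bsub>hom_group R X N\<^esub> x"
    if "x \<in> carrier (hom_group R X N)" "y \<in> carrier (hom_group R X N)" for x y
    using that cl by (auto simp: hom_group_def fun_eq_iff N.a_comm)
  show "\<one>\<^bsub>hom_group R X N\<^esub> \<otimes>\<^bsub>hom_group R X N\<^esub> x = x" if "x \<in> carrier (hom_group R X N)" for x
  proof (rule extensionalityI)
    show "x \<in> extensional (carrier X)" using that by (simp add: s)
  qed (use that cl in \<open>auto simp: hom_group_def\<close>)
  show "\<exists>y\<in>carrier (hom_group R X N). y \<otimes>\<^bsub>hom_group R X N\<^esub> x = \<one>\<^bsub>hom_group R X N\<^esub>"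
    if x: "x \<in> carrier (hom_group R X N)" for x
  proof (intro bexI)
    let ?y = "restrict (\<lambda>t. \<zero>\<^bsub>N\<^esub> \<ominus>\<^bsub>N\<^esub> x t) (carrier X)"
    show "?y \<in> carrier (hom_group R X N)"
      using x lmap_mod_hom[OF lmap_diff[OF lmap_zero_map[OF X N], of x]] by (simp add: s)
    show "?y \<otimes>\<^bsub>hom_group R X N\<^esub> x = \<one>\<^bsub>hom_group R X N\<^esub>"
      using x cl[of x] by (auto simp: hom_group_def fun_eq_iff N.minus_add_cancel)
  qed
qed

text \<open>The factor group is trivial exactly if all cocycles are coboundaries. Most of the proof
  verifies that both sets are subgroups, so that \<open>trivial_FactGroup_iff\<close> applies; the
  rest translates between extensional homomorphisms and \<open>lmap\<close>.\<close>

lemma Ext_trivial_iff: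
  assumes M: "right_module R M" and N: "right_module R N"
  shows "trivial_group (Ext R (Suc k) M N) \<longleftrightarrow> cz R (res_module R M) (res_diff R M) k N"
proof -
  interpret presolution R "res_module R M" "res_diff R M" M "res_aug R M"
    by (rule presolution_res[OF M])
  interpret N: right_module R N by fact
  let ?F = "res_module R M" and ?d = "res_diff R M"
  let ?X = "?F (Suc k)"
  interpret G: comm_group "hom_group R ?X N" by (rule comm_group_hom_group[OF P_module N])
  let ?Z = "cocycles R (Suc k) M N"
  let ?B = "coboundaries R (Suc k) M N"
  note s = hom_group_def mod_hom_iff[OF P_module N]
  have inv_eq: "(inv\<^bsub>hom_group R ?X N\<^esub> f) x = \<ominus>\<^bsub>N\<^esub> f x" if f: "f \<in> mod_hom R ?X N" and x: "x \<in> carrier ?X" for f x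
  proof -
    have i: "inv\<^bsub>hom_group R ?X N\<^esub> f \<in> mod_hom R ?X N" using G.inv_closed[of f] f by (simp add: hom_group_def)
    have "(inv\<^bsub>hom_group R ?X N\<^esub> f \<otimes>\<^bsub>hom_group R ?X N\<^esub> f) x = \<zero>\<^bsub>N\<^esub>"
      using G.l_inv[of f] f x by (simp add: hom_group_def)
    then have "(inv\<^bsub>hom_group R ?X N\<^esub> f) x \<oplus>\<^bsub>N\<^esub> f x = \<zero>\<^bsub>N\<^esub>" using x by (simp add: hom_group_def)
    then show ?thesis using i f x lmap_closed[of R ?X N] by (intro N.minus_equality[symmetric]) (auto simp: mod_hom_iff[OF P_module N])
  qed
  have ZF: "?d (Suc k) x \<in> carrier ?X" if "x \<in> carrier (?F (Suc (Suc k)))" for x using lmap_closed[OF d that] .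
  have Z: "subgroup ?Z (hom_group R ?X N)"
  proof
    show "?Z \<subseteq> carrier (hom_group R ?X N)" by (auto simp: cocycles_def hom_group_def)
    show "\<one>\<^bsub>hom_group R ?X N\<^esub> \<in> ?Z"
      using lmap_mod_hom[OF lmap_zero_map[OF P_module N], of "Suc k"] ZF by (simp add: cocycles_def hom_group_def)
    show "x \<otimes>\<^bsub>hom_group R ?X N\<^esub> y \<in> ?Z" if "x \<in> ?Z" "y \<in> ?Z" for x y
      using that G.m_closed[of x y] ZF by (simp add: cocycles_def hom_group_def)
    show "inv\<^bsub>hom_group R ?X N\<^esub> x \<in> ?Z" if "x \<in> ?Z" for x
    proof -
      have x: "x \<in> mod_hom R ?X N" "\<forall>y\<in>carrier (?F (Suc (Suc k))). x (?d (Suc k) y) = \<zero>\<^bsub>N\<^esub>"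
        using that by (auto simp: cocycles_def)
      have "inv\<^bsub>hom_group R ?X N\<^esub> x \<in> mod_hom R ?X N" using G.inv_closed[of x] x(1) by (simp add: hom_group_def)
      moreover have "\<ominus>\<^bsub>N\<^esub> \<zero>\<^bsub>N\<^esub> = \<zero>\<^bsub>N\<^esub>" using N.minus_equality[of "\<zero>\<^bsub>N\<^esub>" "\<zero>\<^bsub>N\<^esub>"] by simp
      ultimately show ?thesis using x ZF by (simp add: cocycles_def inv_eq[OF x(1)])
    qed
  qed
  let ?G = "(hom_group R ?X N)\<lparr>carrier := ?Z\<rparr>"
  have G: "comm_group ?G"
    by (rule group.group_comm_groupI[OF G.subgroup_imp_group[OF Z]])
      (use G.m_comm subgroup.subset[OF Z] in auto)
  have B_iff: "f \<in> ?B \<longleftrightarrow> f \<in> extensional (carrier ?X) \<and> (\<exists>g. lmap R (?F k) N g \<and> (\<forall>x\<in>carrier ?X. f x = g (?d k x)))" for f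
  proof
    assume "f \<in> ?B"
    then obtain g where g: "g \<in> mod_hom R (?F k) N" "f = compose (carrier ?X) g (?d k)" by auto
    then show "f \<in> extensional (carrier ?X) \<and> (\<exists>g. lmap R (?F k) N g \<and> (\<forall>x\<in>carrier ?X. f x = g (?d k x)))"
      using mod_hom_lmap[OF g(1) P_module N] by (auto simp: compose_def)
  next
    assume "f \<in> extensional (carrier ?X) \<and> (\<exists>g. lmap R (?F k) N g \<and> (\<forall>x\<in>carrier ?X. f x = g (?d k x)))"
    then obtain g where g: "f \<in> extensional (carrier ?X)" "lmap R (?F k) N g" "\<forall>x\<in>carrier ?X. f x = g (?d k x)" by auto
    have "f = compose (carrier ?X) (restrict g (carrier (?F k))) (?d k)"
      using g lmap_closed[OF d] by (intro extensionalityI[OF g(1)]) (auto simp: compose_def)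
    then show "f \<in> ?B" using lmap_mod_hom[OF g(2)] by auto
  qed
  have B: "subgroup ?B ?G"
  proof
    show sub: "?B \<subseteq> carrier ?G"
    proof
      fix f assume "f \<in> ?B"
      then obtain g where g: "f \<in> extensional (carrier ?X)" "lmap R (?F k) N g" "\<forall>x\<in>carrier ?X. f x = g (?d k x)"
        unfolding B_iff by auto
      have "lmap R ?X N f" using lmap_cong[OF lmap_comp[OF d g(2)]] g(3) by blast
      then show "f \<in> carrier ?G"
        using g ZF dd lmap_zero[OF g(2)] by (simp add: cocycles_def mod_hom_iff[OF P_module N])
    qed
    show "\<one>\<^bsub>?G\<^esub> \<in> ?B" unfolding B_iff using lmap_zero_map[OF P_module N, of k]
      by (auto simp: hom_group_def intro!: exI[of _ "\<lambda>x. \<zero>\<^bsub>N\<^esub>"])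
    show "x \<otimes>\<^bsub>?G\<^esub> y \<in> ?B" if xy: "x \<in> ?B" "y \<in> ?B" for x y
    proof -
      obtain g h where "lmap R (?F k) N g" "\<forall>t\<in>carrier ?X. x t = g (?d k t)"
        "lmap R (?F k) N h" "\<forall>t\<in>carrier ?X. y t = h (?d k t)" using xy unfolding B_iff by auto
      then show ?thesis unfolding B_iff using lmap_plus[of R "?F k" N g h]
        by (auto simp: hom_group_def intro!: exI[of _ "\<lambda>x. g x \<oplus>\<^bsub>N\<^esub> h x"])
    qed
    show "inv\<^bsub>?G\<^esub> x \<in> ?B" if x: "x \<in> ?B" for x
    proof -
      have xZ: "x \<in> ?Z" using sub x by auto
      then have xm: "x \<in> mod_hom R ?X N" by (simp add: cocycles_def)
      have i: "inv\<^bsub>?G\<^esub> x = inv\<^bsub>hom_group R ?X N\<^esub> x" using G.m_inv_consistent[OF Z xZ] .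
      obtain g where g: "lmap R (?F k) N g" "\<forall>t\<in>carrier ?X. x t = g (?d k t)" using x unfolding B_iff by auto
      have "inv\<^bsub>hom_group R ?X N\<^esub> x \<in> extensional (carrier ?X)"
        using G.inv_closed[of x] xm by (simp add: s)
      moreover have "lmap R (?F k) N (\<lambda>t. \<zero>\<^bsub>N\<^esub> \<ominus>\<^bsub>N\<^esub> g t)" using lmap_diff[OF lmap_zero_map[OF P_module N] g(1)] .
      moreover have "(inv\<^bsub>hom_group R ?X N\<^esub> x) t = \<zero>\<^bsub>N\<^esub> \<ominus>\<^bsub>N\<^esub> g (?d k t)" if t: "t \<in> carrier ?X" for t
        using inv_eq[OF xm t] g(2) t lmap_closed[OF g(1) lmap_closed[OF d t]] by (simp add: a_minus_def)
      ultimately show ?thesis unfolding i B_iff by (intro conjI exI[of _ "\<lambda>t. \<zero>\<^bsub>N\<^esub> \<ominus>\<^bsub>N\<^esub> g t"]) auto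
    qed
  qed
  have "trivial_group (Ext R (Suc k) M N) \<longleftrightarrow> ?Z \<subseteq> ?B"
    unfolding Ext_def using trivial_FactGroup_iff[OF G B] by simp
  also have "\<dots> \<longleftrightarrow> cz R ?F ?d k N"
  proof
    assume sub: "?Z \<subseteq> ?B"
    show "cz R ?F ?d k N"
      unfolding cz_def
    proof (intro allI impI, elim conjE)
      fix c assume c: "lmap R ?X N c" "\<forall>x\<in>carrier (?F (Suc (Suc k))). c (?d (Suc k) x) = \<zero>\<^bsub>N\<^esub>"
      have "restrict c (carrier ?X) \<in> ?Z" using c lmap_mod_hom[OF c(1)] ZF by (simp add: cocycles_def)
      then have "restrict c (carrier ?X) \<in> ?B" using sub by blast
      then show "\<exists>b. lmap R (?F k) N b \<and> (\<forall>x\<in>carrier ?X. c x = b (?d k x))" unfolding B_iff by auto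
    qed
  next
    assume cz: "cz R ?F ?d k N"
    show "?Z \<subseteq> ?B"
    proof
      fix f assume "f \<in> ?Z"
      then have f: "lmap R ?X N f" "f \<in> extensional (carrier ?X)"
        "\<And>x. x \<in> carrier (?F (Suc (Suc k))) \<Longrightarrow> f (?d (Suc k) x) = \<zero>\<^bsub>N\<^esub>"
        by (auto simp: cocycles_def mod_hom_iff[OF P_module N])
      obtain b where "lmap R (?F k) N b" "\<And>x. x \<in> carrier ?X \<Longrightarrow> f x = b (?d k x)"
        by (rule czE[OF cz f(1)]) (use f(3) in blast)+
      then show "f \<in> ?B" unfolding B_iff using f(2) by blast
    qed
  qed
  finally show ?thesis .
qed

text \<open>The augmentation onto the regular module splits. With a splitting \<open>s\<close>,
  subtracting \<open>s\<close> of the augmentation from the identity retracts the first term onto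
  the kernel, so every map on the kernel extends.\<close>

lemma Ext1_regular:
  assumes "ring R" "right_module R N"
  shows "trivial_group (Ext R 1 (regular_module R) N)"
proof -
  let ?R = "regular_module R"
  have RM: "right_module R ?R" by (rule right_module_regular[OF assms(1)])
  interpret presolution R "res_module R ?R" "res_diff R ?R" ?R "res_aug R ?R"
    by (rule presolution_res[OF RM])
  interpret F: right_module R "res_module R ?R 0" by (rule P_module)
  interpret RM: right_module R ?R by (rule RM)
  obtain s where s: "lmap R ?R (res_module R ?R 0) s" "\<And>x. x \<in> carrier ?R \<Longrightarrow> res_aug R ?R (s x) = x"
    by (rule liftingE[OF lifting_regular[OF assms(1) e] lmap_id[OF RM]]) (use e_surj in auto)
  have "extends 0 N"
    unfolding extends_def
  proof (intro allI impI)
    fix f assume f: "lmap R (K 0) N f"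
    let ?t = "\<lambda>x. x \<ominus>\<^bsub>res_module R ?R 0\<^esub> s (res_aug R ?R x)"
    have t: "lmap R (res_module R ?R 0) (res_module R ?R 0) ?t"
      by (rule lmap_diff[OF lmap_id[OF P_module] lmap_comp[OF e s(1)]])
    have "res_aug R ?R (?t x) = \<zero>\<^bsub>?R\<^esub>" if x: "x \<in> carrier (res_module R ?R 0)" for x
      using lmap_minus[OF e x lmap_closed[OF s(1) lmap_closed[OF e x]]] s(2)[OF lmap_closed[OF e x]]
        lmap_closed[OF e x] by (simp add: RM.minus_eq_zero_iff del: regular_module_simps)
    then have t': "lmap R (res_module R ?R 0) (K 0) ?t"
      unfolding K_def using lmap_closed[OF t] exact0 by (intro lmap_corestrict[OF t submodule_range[OF d]]) auto
    have "f (?t x) = f x" if "x \<in> carrier (K 0)" for x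
      using that exact0 lmap_zero[OF s(1)] by auto
    then show "\<exists>b. lmap R (res_module R ?R 0) N b \<and> (\<forall>x\<in>carrier (K 0). b x = f x)"
      using lmap_comp[OF t' f] by blast
  qed
  then have "cz R (res_module R ?R) (res_diff R ?R) 0 N" unfolding cz_iff_extends .
  then show ?thesis using Ext_trivial_iff[OF RM assms(2), of 0] by simp
qed

section \<open>Ext vanishing against a module of finite injective dimension\<close>

lemma injective_resolution_injres:
  assumes "right_module R C" "injective_resolution R C E \<epsilon> \<delta>"
  shows "injres R C E \<epsilon> \<delta>"
proof -
  have a: "\<And>n. injective_module R (E n)" "\<epsilon> \<in> mod_hom R C (E 0)" "\<And>n. \<delta> n \<in> mod_hom R (E n) (E (Suc n))"
    "inj_on \<epsilon> (carrier C)" "\<epsilon> ` carrier C = a_kernel (E 0) (E 1) (\<delta> 0)"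
    "\<And>n. \<delta> n ` carrier (E n) = a_kernel (E (Suc n)) (E (Suc (Suc n))) (\<delta> (Suc n))"
    using assms(2) unfolding injective_resolution_def by auto
  have E: "right_module R (E n)" for n using a(1) by (simp add: injective_module_def)
  show ?thesis
    by unfold_locales
      (use a injective_module_baer[OF a(1)] mod_hom_lmap[OF a(2) assms(1) E] mod_hom_lmap[OF a(3) E E] in
        \<open>auto simp: a_kernel_def'\<close>)
qed

text \<open>A finite infimum comes from a nonempty set, because the infimum of the empty set is
  \<open>\<infinity>\<close>.\<close>

lemma finite_inj_dim:
  assumes "right_module R C" "inj_dim R C < \<infinity>"
  obtains E :: "nat \<Rightarrow> ('r, ('r, 'c) coresol) module" and \<epsilon> \<delta> n
  where "injres R (C :: ('r, 'c) module) E \<epsilon> \<delta>" "\<And>i. i > n \<Longrightarrow> carrier (E i) = {\<zero>\<^bsub>E i\<^esub>}"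
proof -
  let ?P = "\<lambda>n (E :: nat \<Rightarrow> ('r, ('r, 'c) coresol) module) \<epsilon> \<delta>.
    injective_resolution R C E \<epsilon> \<delta> \<and> (\<forall>i>n. carrier (E i) = {\<zero>\<^bsub>E i\<^esub>})"
  have "{enat n | n. \<exists>E \<epsilon> \<delta>. ?P n E \<epsilon> \<delta>} \<noteq> {}"
  proof
    assume "{enat n | n. \<exists>E \<epsilon> \<delta>. ?P n E \<epsilon> \<delta>} = {}"
    with assms(2) show False unfolding inj_dim_def by (simp add: Inf_enat_def)
  qed
  then obtain n E \<epsilon> \<delta> where "?P n E \<epsilon> \<delta>" by blast
  with that injective_resolution_injres[OF assms(1)] show thesis by blast
qed

section \<open>Perpendicularity read off an injective coresolution\<close>

context injres
begin

lemma C_module: "right_module R C"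
  using lmap_src[OF \<epsilon>(1)] .

lemma ring_R: "ring R"
  using C_module by (simp add: right_module_def)

lemma exv_iff_Ext: "right_module R M \<Longrightarrow> exv k M \<longleftrightarrow> trivial_group (Ext R (Suc k) M C)"
  unfolding Ext_trivial_iff[OF _ C_module]
  by (rule exv_iff_cz[OF presolution_res])
    (auto simp: res_module_def intro!: exv_lifting lifting_free \<delta> right_module_free ring_R)

lemma in_perp_iff: "in_perp R C M \<longleftrightarrow> right_module R M \<and> (\<forall>k. exv k M)"
proof -
  have "(\<forall>i\<ge>1. trivial_group (Ext R i M C)) \<longleftrightarrow> (\<forall>k. trivial_group (Ext R (Suc k) M C))"
    by (metis One_nat_def Suc_le_D le_add1 plus_1_eq_Suc)
  then show ?thesis unfolding in_perp_def using exv_iff_Ext by blast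
qed

lemma exv_projective: "sumd R (regular_module R) P \<Longrightarrow> exv k P"
  using exv_lifting[OF lifting_sumd[OF lifting_regular[OF ring_R \<delta>]]] sumd_def by blast

end

section \<open>Modules over the endomorphism ring\<close>

abbreviation op_End :: "'r ring \<Rightarrow> ('r, 'c) module \<Rightarrow> ('c \<Rightarrow> 'c) ring" where
  "op_End R C \<equiv> op_ring (End_ring R C)"

text \<open>The dual \<open>Hom(X, C)\<close> as a left \<open>S\<close>-module by composition, to
  be used as a right module over the opposite ring.\<close>

definition HomM :: "'r ring \<Rightarrow> ('r, 'x) module \<Rightarrow> ('r, 'c) module \<Rightarrow> ('c \<Rightarrow> 'c, 'x \<Rightarrow> 'c) module" where
  "HomM R X C = \<lparr>carrier = mod_hom R X C, mult = undefined, one = undefined,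
     zero = (\<lambda>x\<in>carrier X. \<zero>\<^bsub>C\<^esub>), add = (\<lambda>f g. \<lambda>x\<in>carrier X. f x \<oplus>\<^bsub>C\<^esub> g x),
     smult = (\<lambda>s f. \<lambda>x\<in>carrier X. s (f x))\<rparr>"

lemma HomM_simps [simp]:
  "\<zero>\<^bsub>HomM R X C\<^esub> = (\<lambda>x\<in>carrier X. \<zero>\<^bsub>C\<^esub>)"
  "f \<oplus>\<^bsub>HomM R X C\<^esub> g = (\<lambda>x\<in>carrier X. f x \<oplus>\<^bsub>C\<^esub> g x)"
  "s \<odot>\<^bsub>HomM R X C\<^esub> f = (\<lambda>x\<in>carrier X. s (f x))"
  by (simp_all add: HomM_def)

lemma End_module_simps [simp]:
  "carrier (End_module C) = carrier C" "\<zero>\<^bsub>End_module C\<^esub> = \<zero>\<^bsub>C\<^esub>" "x \<oplus>\<^bsub>End_module C\<^esub> y = x \<oplus>\<^bsub>C\<^esub> y"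
  "s \<odot>\<^bsub>End_module C\<^esub> x = s x"
  by (simp_all add: End_module_def)

lemma op_ring_simps [simp]:
  "carrier (op_ring S) = carrier S" "\<zero>\<^bsub>op_ring S\<^esub> = \<zero>\<^bsub>S\<^esub>" "\<one>\<^bsub>op_ring S\<^esub> = \<one>\<^bsub>S\<^esub>"
  "x \<oplus>\<^bsub>op_ring S\<^esub> y = x \<oplus>\<^bsub>S\<^esub> y" "x \<otimes>\<^bsub>op_ring S\<^esub> y = y \<otimes>\<^bsub>S\<^esub> x"
  by (simp_all add: op_ring_def)

lemma End_ring_simps [simp]:
  "\<zero>\<^bsub>End_ring R C\<^esub> = (\<lambda>x\<in>carrier C. \<zero>\<^bsub>C\<^esub>)" "\<one>\<^bsub>End_ring R C\<^esub> = (\<lambda>x\<in>carrier C. x)"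
  "f \<oplus>\<^bsub>End_ring R C\<^esub> g = (\<lambda>x\<in>carrier C. f x \<oplus>\<^bsub>C\<^esub> g x)" "f \<otimes>\<^bsub>End_ring R C\<^esub> g = (\<lambda>x\<in>carrier C. f (g x))"
  by (simp_all add: End_ring_def compose_def)

lemma ring_op:
  assumes "ring S"
  shows "ring (op_ring S)"
proof -
  interpret S: ring S by fact
  show ?thesis
    by (intro ringI abelian_groupI monoidI)
      (auto simp: S.a_ac S.l_distr S.r_distr S.m_assoc intro: bexI[of _ "\<ominus>\<^bsub>S\<^esub> _"] S.l_neg)
qed

lemma right_noetherian_op:
  assumes "left_noetherian S"
  shows "right_noetherian (op_ring S)"
proof -
  have "add_monoid (op_ring S) = add_monoid S" by (simp add: op_ring_def)
  then have "right_ideal I (op_ring S) \<longleftrightarrow> left_ideal I S" for I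
    by (simp add: right_ideal_def left_ideal_def additive_subgroup_def)
  moreover have "ring (op_ring S)" using assms ring_op unfolding left_noetherian_def by blast
  ultimately show ?thesis using assms unfolding left_noetherian_def right_noetherian_def by simp
qed

locale bimod =
  fixes R :: "'r ring" and C :: "('r, 'c) module"
  assumes C: "right_module R C"
begin

sublocale C: right_module R C by (rule C)

lemma carrier_HomM: "right_module R X \<Longrightarrow> f \<in> carrier (HomM R X C) \<longleftrightarrow> lmap R X C f \<and> f \<in> extensional (carrier X)"
  by (simp add: HomM_def mod_hom_iff C)

lemma HomM_lmap: "\<lbrakk>right_module R X; f \<in> carrier (HomM R X C)\<rbrakk> \<Longrightarrow> lmap R X C f"
  by (simp add: carrier_HomM)

lemma restrict_HomM: "lmap R X C f \<Longrightarrow> restrict f (carrier X) \<in> carrier (HomM R X C)"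
  by (simp add: carrier_HomM lmap_src lmap_restrict)

lemma carrier_End: "carrier (End_ring R C) = carrier (HomM R C C)"
  by (simp add: End_ring_def HomM_def)

lemma End_closed: "\<lbrakk>s \<in> carrier (End_ring R C); x \<in> carrier C\<rbrakk> \<Longrightarrow> s x \<in> carrier C"
  using lmap_closed HomM_lmap[OF C] by (metis carrier_End)

lemma End_lmap: "s \<in> carrier (End_ring R C) \<Longrightarrow> lmap R C C s"
  using HomM_lmap[OF C] by (metis carrier_End)

lemma restrict_End: "lmap R C C f \<Longrightarrow> restrict f (carrier C) \<in> carrier (End_ring R C)"
  using restrict_HomM by (simp add: carrier_End)

lemma ext_eq: "\<lbrakk>f \<in> carrier (HomM R X C); right_module R X\<rbrakk> \<Longrightarrow> restrict f (carrier X) = f"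
  by (simp add: carrier_HomM extensional_restrict)

lemma HomM_eqI: "\<lbrakk>right_module R X; f \<in> carrier (HomM R X C); g \<in> carrier (HomM R X C);
    \<And>x. x \<in> carrier X \<Longrightarrow> f x = g x\<rbrakk> \<Longrightarrow> f = g"
  by (auto simp: carrier_HomM intro: extensionalityI)

lemma End_eqI: "\<lbrakk>f \<in> carrier (End_ring R C); g \<in> carrier (End_ring R C);
    \<And>x. x \<in> carrier C \<Longrightarrow> f x = g x\<rbrakk> \<Longrightarrow> f = g"
  using HomM_eqI[OF C] by (simp add: carrier_End)

lemma HomM_add_closed: "\<lbrakk>right_module R X; f \<in> carrier (HomM R X C); g \<in> carrier (HomM R X C)\<rbrakk>
   \<Longrightarrow> (\<lambda>x\<in>carrier X. f x \<oplus>\<^bsub>C\<^esub> g x) \<in> carrier (HomM R X C)"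
  by (rule restrict_HomM) (auto intro: lmap_plus HomM_lmap)

lemma ring_End: "ring (End_ring R C)"
proof (intro ringI abelian_groupI monoidI)
  let ?S = "End_ring R C"
  have rI: "restrict f (carrier C) = restrict g (carrier C)" if "\<And>x. x \<in> carrier C \<Longrightarrow> f x = g x" for f g :: "'c \<Rightarrow> 'c"
    using that by (intro restrict_ext)
  note cl = End_closed
  fix f assume f: "f \<in> carrier ?S"
  show "\<zero>\<^bsub>?S\<^esub> \<oplus>\<^bsub>?S\<^esub> f = f" "\<one>\<^bsub>?S\<^esub> \<otimes>\<^bsub>?S\<^esub> f = f" "f \<otimes>\<^bsub>?S\<^esub> \<one>\<^bsub>?S\<^esub> = f"
    by (rule End_eqI[OF _ f]; use cl[OF f] restrict_End[OF lmap_cong[OF End_lmap[OF f]]] in simp)+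
  show "\<exists>g\<in>carrier ?S. g \<oplus>\<^bsub>?S\<^esub> f = \<zero>\<^bsub>?S\<^esub>"
    using restrict_End[OF lmap_diff[OF lmap_zero_map[OF C C] End_lmap[OF f]]] cl[OF f]
    by (intro bexI[of _ "restrict (\<lambda>x. \<zero>\<^bsub>C\<^esub> \<ominus>\<^bsub>C\<^esub> f x) (carrier C)"]) (auto intro!: rI simp: C.minus_add_cancel)
  fix g assume g: "g \<in> carrier ?S"
  show "f \<oplus>\<^bsub>?S\<^esub> g \<in> carrier ?S" "f \<otimes>\<^bsub>?S\<^esub> g \<in> carrier ?S"
    using restrict_End[OF lmap_plus[OF End_lmap[OF f] End_lmap[OF g]]]
      restrict_End[OF lmap_comp[OF End_lmap[OF g] End_lmap[OF f]]] by simp_all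
  show "f \<oplus>\<^bsub>?S\<^esub> g = g \<oplus>\<^bsub>?S\<^esub> f" using cl f g by (auto intro!: rI simp: C.a_comm)
  fix h assume h: "h \<in> carrier ?S"
  show "(f \<oplus>\<^bsub>?S\<^esub> g) \<oplus>\<^bsub>?S\<^esub> h = f \<oplus>\<^bsub>?S\<^esub> (g \<oplus>\<^bsub>?S\<^esub> h)" "(f \<otimes>\<^bsub>?S\<^esub> g) \<otimes>\<^bsub>?S\<^esub> h = f \<otimes>\<^bsub>?S\<^esub> (g \<otimes>\<^bsub>?S\<^esub> h)"
    "(f \<oplus>\<^bsub>?S\<^esub> g) \<otimes>\<^bsub>?S\<^esub> h = f \<otimes>\<^bsub>?S\<^esub> h \<oplus>\<^bsub>?S\<^esub> g \<otimes>\<^bsub>?S\<^esub> h" "h \<otimes>\<^bsub>?S\<^esub> (f \<oplus>\<^bsub>?S\<^esub> g) = h \<otimes>\<^bsub>?S\<^esub> f \<oplus>\<^bsub>?S\<^esub> h \<otimes>\<^bsub>?S\<^esub> g"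
    using cl f g h lmap_add[OF End_lmap[OF h]] by (auto intro!: rI simp: C.a_assoc)
next
  show "\<zero>\<^bsub>End_ring R C\<^esub> \<in> carrier (End_ring R C)" "\<one>\<^bsub>End_ring R C\<^esub> \<in> carrier (End_ring R C)"
    using restrict_End[OF lmap_zero_map[OF C C]] restrict_End[OF lmap_id[OF C]] by simp_all
qed

lemma ring_op_End: "ring (op_End R C)"
  using ring_op[OF ring_End] .

lemma right_module_End: "right_module (op_End R C) (End_module C)"
  by (rule right_moduleI)
    (auto simp: ring_op_End C.a_ac End_closed lmap_add[OF End_lmap])

lemma right_module_HomM:
  assumes X: "right_module R X"
  shows "right_module (op_End R C) (HomM R X C)"
proof -
  interpret X: right_module R X by fact
  have cl: "f x \<in> carrier C" if "f \<in> carrier (HomM R X C)" "x \<in> carrier X" for f x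
    using lmap_closed[OF HomM_lmap[OF X that(1)] that(2)] .
  have e: "restrict f (carrier X) = f" if "f \<in> carrier (HomM R X C)" for f
    using ext_eq[OF that X] .
  have e': "restrict g (carrier X) = f" if "f \<in> carrier (HomM R X C)" "\<And>x. x \<in> carrier X \<Longrightarrow> g x = f x" for f g
    using e[OF that(1)] that(2) by (metis restrict_ext)
  have sm: "(\<lambda>x\<in>carrier X. s (f x)) \<in> carrier (HomM R X C)"
    if "s \<in> carrier (End_ring R C)" "f \<in> carrier (HomM R X C)" for s f
    by (rule restrict_HomM) (rule lmap_comp[OF HomM_lmap[OF X that(2)] End_lmap[OF that(1)]])
  show ?thesis
    by (rule right_moduleI)
      (auto simp: ring_op_End HomM_add_closed[OF X] restrict_HomM[OF lmap_zero_map[OF X C]] sm cl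
        C.a_ac End_closed lmap_add[OF End_lmap] intro!: restrict_ext e')
qed

lemma HomM_sum:
  assumes "right_module R X" "\<And>i. i < n \<Longrightarrow> f i \<in> carrier (HomM R X C)" "x \<in> carrier X"
  shows "msum (HomM R X C) f n x = msum C (\<lambda>i. f i x) n"
  using assms(2)
proof (induction n)
  case (Suc n)
  then show ?case using assms(3) by simp
qed (use assms(3) in simp)

lemma lmap_eval:
  assumes "right_module R X" "x \<in> carrier X"
  shows "lmap (op_End R C) (HomM R X C) (End_module C) (\<lambda>h. h x)"
  using assms lmap_closed[OF HomM_lmap[OF assms(1)] assms(2)]
  by (auto simp: lmap_def right_module_HomM right_module_End)

text \<open>The dual of \<open>f\<close>, restricted so that its values are again
  extensional.\<close>

definition pre :: "('r, 'x) module \<Rightarrow> ('x \<Rightarrow> 'y) \<Rightarrow> ('y \<Rightarrow> 'c) \<Rightarrow> 'x \<Rightarrow> 'c" where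
  "pre X f h = (\<lambda>x\<in>carrier X. h (f x))"

lemma pre_apply [simp]: "x \<in> carrier X \<Longrightarrow> pre X f h x = h (f x)"
  by (simp add: pre_def)

lemma pre_in_HomM:
  assumes "lmap R X Y f" "h \<in> carrier (HomM R Y C)"
  shows "pre X f h \<in> carrier (HomM R X C)"
  unfolding pre_def by (rule restrict_HomM) (rule lmap_comp[OF assms(1) HomM_lmap[OF lmap_tgt[OF assms(1)] assms(2)]])

lemma lmap_pre:
  assumes f: "lmap R X Y f"
  shows "lmap (op_End R C) (HomM R Y C) (HomM R X C) (pre X f)"
  unfolding lmap_def
  using pre_in_HomM[OF f] right_module_HomM[OF lmap_src[OF f]] right_module_HomM[OF lmap_tgt[OF f]] lmap_closed[OF f]
  by (auto simp: pre_def intro!: restrict_ext)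

text \<open>\<open>Hom(C, C)\<close> and the regular module over the opposite of \<open>S\<close>
  are different records with the same carrier and operations; the identity passes between
  them.\<close>

lemma lmap_HomM_regular:
  "lmap (op_End R C) (HomM R C C) (regular_module (op_End R C)) (\<lambda>h. h)"
  "lmap (op_End R C) (regular_module (op_End R C)) (HomM R C C) (\<lambda>h. h)"
  unfolding lmap_def using right_module_HomM[OF C] right_module_regular[OF ring_op_End]
  by (auto simp: carrier_End)

text \<open>Dualizing a dual basis interchanges its halves: the \<open>v i\<close> give the maps
  into \<open>Hom(X, C)\<close> and the \<open>u i\<close> the maps out of it.\<close>

lemma sumd_HomM:
  assumes "sumd R C X"
  shows "sumd (op_End R C) (HomM R C C) (HomM R X C)"
proof -
  obtain n u v where s: "right_module R C" "right_module R X" "\<And>i. i < n \<Longrightarrow> lmap R C X (u i)"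
    "\<And>i. i < n \<Longrightarrow> lmap R X C (v i)" "\<And>x. x \<in> carrier X \<Longrightarrow> msum X (\<lambda>i. u i (v i x)) (n::nat) = x"
    by (rule sumdE[OF assms]) blast
  have "msum (HomM R X C) (\<lambda>i. pre X (v i) (pre C (u i) h)) n = h" if h: "h \<in> carrier (HomM R X C)" for h
  proof (rule HomM_eqI[OF s(2) _ h])
    have m: "pre X (v i) (pre C (u i) h) \<in> carrier (HomM R X C)" if "i < n" for i
      using pre_in_HomM[OF s(4)[OF that] pre_in_HomM[OF s(3)[OF that] h]] .
    then show "msum (HomM R X C) (\<lambda>i. pre X (v i) (pre C (u i) h)) n \<in> carrier (HomM R X C)"
      by (rule msum_closed[OF right_module_HomM[OF s(2)]])
    fix x assume x: "x \<in> carrier X"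
    have "msum (HomM R X C) (\<lambda>i. pre X (v i) (pre C (u i) h)) n x = msum C (\<lambda>i. pre X (v i) (pre C (u i) h) x) n"
      by (rule HomM_sum[OF s(2) m x])
    also have "\<dots> = msum C (\<lambda>i. h (u i (v i x))) n"
      using x lmap_closed[OF s(4)] by (intro msum_cong) simp
    also have "\<dots> = h (msum X (\<lambda>i. u i (v i x)) n)"
      using x by (intro lmap_msum[OF HomM_lmap[OF s(2) h], symmetric] lmap_closed[OF s(3)] lmap_closed[OF s(4)])
    finally show "msum (HomM R X C) (\<lambda>i. pre X (v i) (pre C (u i) h)) n x = h x" using s(5)[OF x] by simp
  qed
  then show ?thesis
    unfolding sumd_def using right_module_HomM[OF s(2)] right_module_HomM[OF C] lmap_pre[OF s(3)] lmap_pre[OF s(4)]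
    by (intro conjI exI[of _ n] exI[of _ "\<lambda>i. pre X (v i)"] exI[of _ "\<lambda>i. pre C (u i)"]) auto
qed

lemma sumd_regular_HomM_C: "sumd (op_End R C) (regular_module (op_End R C)) (HomM R C C)"
  by (rule sumd_retract[OF sumd_refl[OF right_module_regular[OF ring_op_End]] lmap_HomM_regular(2,1)]) simp

lemma fin_gen_HomM: "sumd R C X \<Longrightarrow> fin_gen (op_End R C) (HomM R X C)"
  using fin_gen_sumd[OF sumd_HomM fin_gen_sumd[OF sumd_regular_HomM_C fin_gen_regular[OF ring_op_End]]] .

lemma lifting_HomM: "\<lbrakk>lmap (op_End R C) B N q; sumd R C X\<rbrakk> \<Longrightarrow> lifting (op_End R C) (HomM R X C) B N q"
  using lifting_sumd[OF lifting_sumd[OF lifting_regular[OF ring_op_End] sumd_regular_HomM_C] sumd_HomM] .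

text \<open>Under \<open>Hom(R, C) = C\<close> the dual of \<open>v i\<close> sends \<open>c\<close>
  to the map that applies the scalar \<open>v i x\<close> to \<open>c\<close>, and the dual of
  \<open>u i\<close> is evaluation at \<open>u i \<one>\<close>.\<close>

lemma sumd_HomM_projective:
  assumes "sumd R (regular_module R) X"
  shows "sumd (op_End R C) (End_module C) (HomM R X C)"
proof -
  obtain n u v where s: "right_module R (regular_module R)" "right_module R X"
    "\<And>i. i < n \<Longrightarrow> lmap R (regular_module R) X (u i)" "\<And>i. i < n \<Longrightarrow> lmap R X (regular_module R) (v i)"
    "\<And>x. x \<in> carrier X \<Longrightarrow> msum X (\<lambda>i. u i (v i x)) (n::nat) = x"
    by (rule sumdE[OF assms]) blast
  let ?U = "\<lambda>i c. \<lambda>x\<in>carrier X. v i x \<odot>\<^bsub>C\<^esub> c"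
  have vR: "v i x \<in> carrier R" if "i < n" "x \<in> carrier X" for i x
    using lmap_closed[OF s(4)[OF that(1)] that(2)] by simp
  have Um: "?U i c \<in> carrier (HomM R X C)" if "i < n" "c \<in> carrier C" for i c
    by (rule restrict_HomM) (rule lmap_comp[OF s(4)[OF that(1)] lmap_orbit[OF C that(2)]])
  have U: "lmap (op_End R C) (End_module C) (HomM R X C) (?U i)" if i: "i < n" for i
    unfolding lmap_def using Um[OF i] vR[OF i] right_module_HomM[OF s(2)] right_module_End
    by (auto simp: C.smult_r_distr lmap_smult[OF End_lmap] intro!: restrict_ext)
  have u1: "u i \<one>\<^bsub>R\<^esub> \<in> carrier X" if "i < n" for i using lmap_closed[OF s(3)[OF that], of "\<one>\<^bsub>R\<^esub>"] by simp
  have "msum (HomM R X C) (\<lambda>i. ?U i (h (u i \<one>\<^bsub>R\<^esub>))) n = h" if h: "h \<in> carrier (HomM R X C)" for h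
  proof (rule HomM_eqI[OF s(2) _ h])
    have h': "lmap R X C h" using HomM_lmap[OF s(2) h] .
    have m: "?U i (h (u i \<one>\<^bsub>R\<^esub>)) \<in> carrier (HomM R X C)" if "i < n" for i
      using Um[OF that lmap_closed[OF h' u1[OF that]]] .
    then show "msum (HomM R X C) (\<lambda>i. ?U i (h (u i \<one>\<^bsub>R\<^esub>))) n \<in> carrier (HomM R X C)"
      by (rule msum_closed[OF right_module_HomM[OF s(2)]])
    fix x assume x: "x \<in> carrier X"
    have "msum (HomM R X C) (\<lambda>i. ?U i (h (u i \<one>\<^bsub>R\<^esub>))) n x = msum C (\<lambda>i. ?U i (h (u i \<one>\<^bsub>R\<^esub>)) x) n"
      by (rule HomM_sum[OF s(2) m x])
    also have "\<dots> = msum C (\<lambda>i. h (u i (v i x))) n"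
    proof (rule msum_cong)
      fix i assume i: "i < n"
      have "u i (v i x) = v i x \<odot>\<^bsub>X\<^esub> u i \<one>\<^bsub>R\<^esub>" by (rule lmap_regular[OF C.R.ring_axioms s(3)[OF i] vR[OF i x]])
      then show "?U i (h (u i \<one>\<^bsub>R\<^esub>)) x = h (u i (v i x))"
        using x lmap_smult[OF h' vR[OF i x] u1[OF i]] by simp
    qed
    also have "\<dots> = h (msum X (\<lambda>i. u i (v i x)) n)"
      using x by (intro lmap_msum[OF h', symmetric] lmap_closed[OF s(3)] lmap_closed[OF s(4)])
    finally show "msum (HomM R X C) (\<lambda>i. ?U i (h (u i \<one>\<^bsub>R\<^esub>))) n x = h x" using s(5)[OF x] by simp
  qed
  then show ?thesis
    unfolding sumd_def using right_module_HomM[OF s(2)] right_module_End U lmap_eval[OF s(2) u1]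
    by (intro conjI exI[of _ n] exI[of _ ?U] exI[of _ "\<lambda>i h. h (u i \<one>\<^bsub>R\<^esub>)"]) auto
qed

text \<open>The surjective half of reflexivity for modules in \<open>add C\<close>. Any
  \<open>h\<close> is the sum of the \<open>v i\<close> with coefficients
  \<open>h \<circ> u i\<close> in \<open>S\<close>, so an \<open>S\<close>-linear
  \<open>\<theta>\<close> is determined by its values on the \<open>v i\<close>; the witness is the
  sum of the \<open>u i (\<theta> (v i))\<close>.\<close>

lemma eval_surj:
  assumes "sumd R C X" and \<theta>: "lmap (op_End R C) (HomM R X C) (End_module C) \<theta>"
  obtains x where "x \<in> carrier X" "\<And>h. h \<in> carrier (HomM R X C) \<Longrightarrow> \<theta> h = h x"
proof -
  obtain n u v where s: "right_module R C" "right_module R X" "\<And>i. i < n \<Longrightarrow> lmap R C X (u i)"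
    "\<And>i. i < n \<Longrightarrow> lmap R X C (v i)" "\<And>x. x \<in> carrier X \<Longrightarrow> msum X (\<lambda>i. u i (v i x)) (n::nat) = x"
    by (rule sumdE[OF assms(1)]) blast
  let ?v = "\<lambda>i. restrict (v i) (carrier X)"
  let ?s = "\<lambda>h i. pre C (u i) h"
  have v: "?v i \<in> carrier (HomM R X C)" if "i < n" for i using restrict_HomM[OF s(4)[OF that]] .
  have \<theta>v: "\<theta> (?v i) \<in> carrier C" if "i < n" for i using lmap_closed[OF \<theta> v[OF that]] by simp
  show thesis
  proof
    show "msum X (\<lambda>i. u i (\<theta> (?v i))) n \<in> carrier X"
      by (rule msum_closed[OF s(2)]) (intro lmap_closed[OF s(3)] \<theta>v[simplified]; simp)
    fix h assume h: "h \<in> carrier (HomM R X C)"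
    have h': "lmap R X C h" using HomM_lmap[OF s(2) h] .
    have sS: "?s h i \<in> carrier (op_End R C)" if "i < n" for i
      using pre_in_HomM[OF s(3)[OF that] h] by (simp add: carrier_End)
    let ?t = "\<lambda>i. ?s h i \<odot>\<^bsub>HomM R X C\<^esub> ?v i"
    have t: "?t i \<in> carrier (HomM R X C)" if "i < n" for i
      using right_module.smult_closed[OF right_module_HomM[OF s(2)] sS[OF that] v[OF that]] .
    have "msum (HomM R X C) ?t n = h"
    proof (rule HomM_eqI[OF s(2) _ h])
      show "msum (HomM R X C) ?t n \<in> carrier (HomM R X C)" using t by (rule msum_closed[OF right_module_HomM[OF s(2)]])
      fix x assume x: "x \<in> carrier X"
      have "msum (HomM R X C) ?t n x = msum C (\<lambda>i. ?t i x) n" by (rule HomM_sum[OF s(2) t x])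
      also have "\<dots> = msum C (\<lambda>i. h (u i (v i x))) n"
        using x lmap_closed[OF s(4)] by (intro msum_cong) simp
      also have "\<dots> = h (msum X (\<lambda>i. u i (v i x)) n)"
        using x by (intro lmap_msum[OF h', symmetric] lmap_closed[OF s(3)] lmap_closed[OF s(4)])
      finally show "msum (HomM R X C) ?t n x = h x" using s(5)[OF x] by simp
    qed
    then have "\<theta> h = msum (End_module C) (\<lambda>i. \<theta> (?t i)) n"
      using lmap_msum[OF \<theta>, of n ?t] t by simp
    also have "\<dots> = msum (End_module C) (\<lambda>i. h (u i (\<theta> (?v i)))) n"
      using lmap_smult[OF \<theta> sS v] \<theta>v by (intro msum_cong) (simp del: HomM_simps)
    also have "\<dots> = msum C (\<lambda>i. h (u i (\<theta> (?v i)))) n"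
      by (induction n) simp_all
    also have "\<dots> = h (msum X (\<lambda>i. u i (\<theta> (?v i))) n)"
      by (intro lmap_msum[OF h', symmetric] lmap_closed[OF s(3)] \<theta>v)
    finally show "\<theta> h = h (msum X (\<lambda>i. u i (\<theta> (?v i))) n)" .
  qed
qed

text \<open>The maps \<open>v i\<close> of the dual basis already separate points.\<close>

lemma eval_inj:
  assumes "sumd R C X" "x \<in> carrier X" "\<And>h. h \<in> carrier (HomM R X C) \<Longrightarrow> h x = \<zero>\<^bsub>C\<^esub>"
  shows "x = \<zero>\<^bsub>X\<^esub>"
proof -
  obtain n u v where s: "right_module R C" "right_module R X" "\<And>i. i < n \<Longrightarrow> lmap R C X (u i)"
    "\<And>i. i < n \<Longrightarrow> lmap R X C (v i)" "\<And>x. x \<in> carrier X \<Longrightarrow> msum X (\<lambda>i. u i (v i x)) (n::nat) = x"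
    by (rule sumdE[OF assms(1)]) blast
  have "u i (v i x) = \<zero>\<^bsub>X\<^esub>" if "i < n" for i
    using assms(3)[OF restrict_HomM[OF s(4)[OF that]]] assms(2) lmap_zero[OF s(3)[OF that]] by simp
  then have "msum X (\<lambda>i. u i (v i x)) n = msum X (\<lambda>i. \<zero>\<^bsub>X\<^esub>) n" by (intro msum_cong)
  then show ?thesis using s(5)[OF assms(2)] msum_zero[OF s(2)] by simp
qed

text \<open>Generators of the \<open>S\<close>-module of all maps \<open>X \<rightarrow> C\<close> that vanish on \<open>B\<close> are the components of
  \<open>a\<close>.\<close>

lemma noetherian_annihilator:
  fixes X :: "('r, 'x) module"
  assumes noeth: "left_noetherian (End_ring R C)" and X: "right_module R X"
    and fg: "fin_gen (op_End R C) (HomM R X C)" and B: "B \<subseteq> carrier X"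
  obtains m a where "lmap R X (power_module C m) a" "\<And>b. b \<in> B \<Longrightarrow> a b = \<zero>\<^bsub>power_module C m\<^esub>"
    "\<And>h. \<lbrakk>lmap R X C h; \<And>b. b \<in> B \<Longrightarrow> h b = \<zero>\<^bsub>C\<^esub>\<rbrakk>
      \<Longrightarrow> \<exists>h'. lmap R (power_module C m) C h' \<and> (\<forall>x\<in>carrier X. h x = h' (a x))"
proof -
  let ?S = "op_End R C" and ?H = "HomM R X C"
  have H: "right_module ?S ?H" using right_module_HomM[OF X] .
  interpret H: right_module ?S ?H by fact
  define N where "N = {h \<in> carrier ?H. \<forall>b\<in>B. h b = \<zero>\<^bsub>C\<^esub>}"
  have N: "submodule N ?S ?H"
    unfolding H.submodule_iff N_def using B lmap_zero[OF End_lmap]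
    by (auto simp: subset_iff HomM_add_closed[OF X] restrict_HomM[OF lmap_zero_map[OF X C]])
      (use H.smult_closed in auto)
  have "fin_gen ?S (?H\<lparr>carrier := N\<rparr>)"
    by (rule noetherian_submodule[OF right_noetherian_op[OF noeth] H fg N])
  then obtain A where A: "finite A" "A \<subseteq> N" "\<And>K. \<lbrakk>submodule K ?S ?H; K \<subseteq> N; A \<subseteq> K\<rbrakk> \<Longrightarrow> K = N"
    by (rule fin_genE) (auto simp: submodule_sub_iff[OF H N])
  obtain m and g :: "nat \<Rightarrow> 'x \<Rightarrow> 'c" where g: "A = g ` {i. i < m}"
    using A(1) finite_imp_nat_seg_image_inj_on by metis
  have gN: "g i \<in> N" if "i < m" for i using g A(2) that by auto
  have gl: "lmap R X C (g i)" if "i < m" for i using gN[OF that] HomM_lmap[OF X] by (simp add: N_def)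
  let ?P = "power_module C m"
  define a where "a x = (\<lambda>i\<in>{..<m}. g i x)" for x
  have a: "lmap R X ?P a" unfolding a_def[abs_def] using lmap_tuple[OF X C gl] .
  have P: "right_module R ?P" using right_module_power[OF C] .
  have aB: "a b = \<zero>\<^bsub>?P\<^esub>" if "b \<in> B" for b
    using gN that by (auto simp: a_def power_module_simps N_def intro!: restrict_ext)
  \<comment> \<open>The range of the dual of \<open>a\<close> contains the generators
    \<open>g i\<close>, as images of the coordinate projections, and hence all of
    \<open>N\<close>.\<close>
  let ?I = "pre X a ` carrier (HomM R ?P C)"
  have I: "submodule ?I ?S ?H" using submodule_range[OF lmap_pre[OF a]] .
  have "?I \<inter> N = N"
  proof (rule A(3))
    show "submodule (?I \<inter> N) ?S ?H" using H.submodule_Int[OF I N] .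
    have "g i \<in> ?I" if i: "i < m" for i
    proof -
      have p: "restrict (\<lambda>x. x i) (carrier ?P) \<in> carrier (HomM R ?P C)" using restrict_HomM[OF lmap_proj[OF C i]] .
      have "g i = pre X a (restrict (\<lambda>x. x i) (carrier ?P))"
      proof (rule HomM_eqI[OF X])
        show "g i \<in> carrier ?H" using gN[OF i] by (simp add: N_def)
        show "pre X a (restrict (\<lambda>x. x i) (carrier ?P)) \<in> carrier ?H" using pre_in_HomM[OF a p] .
        show "g i x = pre X a (restrict (\<lambda>x. x i) (carrier ?P)) x" if "x \<in> carrier X" for x
          using that i lmap_closed[OF a that] by (simp add: a_def)
      qed
      then show ?thesis using p by blast
    qed
    then show "A \<subseteq> ?I \<inter> N" using g gN by auto
  qed auto
  then have NI: "N \<subseteq> ?I" by blast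
  show thesis
  proof
    fix h assume h: "lmap R X C h" "\<And>b. b \<in> B \<Longrightarrow> h b = \<zero>\<^bsub>C\<^esub>"
    then have "restrict h (carrier X) \<in> N" using restrict_HomM[OF h(1)] B by (auto simp: N_def)
    then obtain h' where h': "h' \<in> carrier (HomM R ?P C)" "restrict h (carrier X) = pre X a h'" using NI by blast
    have "h x = h' (a x)" if "x \<in> carrier X" for x
      using fun_cong[OF h'(2), of x] that by simp
    then show "\<exists>h'. lmap R ?P C h' \<and> (\<forall>x\<in>carrier X. h x = h' (a x))" using HomM_lmap[OF P h'(1)] by blast
  qed (use a aB in auto)
qed

end

section \<open>Embeddings into powers of the cotilting module\<close>

text \<open>Choosing a preimage of each element embeds a quotient of \<open>B\<close> into the type
  of \<open>B\<close>.\<close>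

lemma transport_surj:
  fixes B :: "('r, 'b) module"
  assumes "lmap R B N p" "p ` carrier B = carrier N"
  obtains N' :: "('r, 'b) module" and \<phi> where "lmap R N N' \<phi>" "bij_betw \<phi> (carrier N) (carrier N')"
proof -
  have "inj_on (inv_into (carrier B) p) (carrier N)"
    using assms(2) by (auto intro: inj_on_inv_into)
  from transport[OF lmap_tgt[OF assms(1)] this] show thesis using that by blast
qed

text \<open>A monomorphism that is a left approximation of \<open>X\<close> by a finite power of
  \<open>C\<close>. The extension property says that its dual is surjective, which is what keeps the
  cokernel of a perpendicular module perpendicular.\<close>

definition good_embedding :: "'r ring \<Rightarrow> ('r, 'c) module \<Rightarrow> ('r, 'x) module \<Rightarrow> nat \<Rightarrow> ('x \<Rightarrow> nat \<Rightarrow> 'c) \<Rightarrow> bool" where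
  "good_embedding R C X m f \<longleftrightarrow> lmap R X (power_module C m) f \<and> inj_on f (carrier X) \<and>
     (\<forall>g. lmap R X C g \<longrightarrow> (\<exists>h. lmap R (power_module C m) C h \<and> (\<forall>x\<in>carrier X. h (f x) = g x)))"

lemma good_embedding_iso:
  assumes "good_embedding R C Y m f" "lmap R X Y \<phi>" "bij_betw \<phi> (carrier X) (carrier Y)"
  shows "good_embedding R C X m (\<lambda>x. f (\<phi> x))"
proof -
  obtain \<psi> where \<psi>: "lmap R Y X \<psi>" "\<And>x. x \<in> carrier X \<Longrightarrow> \<psi> (\<phi> x) = x"
    by (rule lmap_inverse[OF assms(2,3)]) blast
  have f: "lmap R Y (power_module C m) f" "inj_on f (carrier Y)"
    "\<And>g. lmap R Y C g \<Longrightarrow> \<exists>h. lmap R (power_module C m) C h \<and> (\<forall>x\<in>carrier Y. h (f x) = g x)"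
    using assms(1) unfolding good_embedding_def by auto
  have "\<exists>h. lmap R (power_module C m) C h \<and> (\<forall>x\<in>carrier X. h (f (\<phi> x)) = g x)" if g: "lmap R X C g" for g
    using f(3)[OF lmap_comp[OF \<psi>(1) g]] \<psi>(2) lmap_closed[OF assms(2)] by fastforce
  moreover have "inj_on (\<lambda>x. f (\<phi> x)) (carrier X)"
    using comp_inj_on[of \<phi> "carrier X" f] assms(3) f(2) by (simp add: bij_betw_def o_def)
  ultimately show ?thesis unfolding good_embedding_def using lmap_comp[OF assms(2) f(1)] by blast
qed

context injres
begin

sublocale bimod R C
  by (rule bimod.intro) (rule C_module)

lemma exv_quotient:
  assumes "ses R A i B p M" "\<And>k. exv k A" "\<And>k. exv k B"
    "\<And>u. lmap R A C u \<Longrightarrow> \<exists>u'. lmap R B C u' \<and> (\<forall>x\<in>carrier A. u' (i x) = u x)"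
  shows "exv k M"
  using exv_quotient_0[OF assms(1,4,3)] exv_quotient_Suc[OF assms(1,2,3)] by (cases k) blast+

text \<open>Descend \<open>g\<close> to the image of \<open>f\<close>, then extend it from the
  image, using that \<open>Ext\<close> of the cokernel vanishes in degree one.\<close>

lemma extend_through:
  assumes f: "lmap R A B f" and ex: "exv 0 (quot_module B (f ` carrier A))" and g: "lmap R A C g"
    and ker: "\<And>x. \<lbrakk>x \<in> carrier A; f x = \<zero>\<^bsub>B\<^esub>\<rbrakk> \<Longrightarrow> g x = \<zero>\<^bsub>C\<^esub>"
  obtains g' where "lmap R B C g'" "\<And>x. x \<in> carrier A \<Longrightarrow> g' (f x) = g x"
proof -
  have B: "right_module R B" using lmap_tgt[OF f] .
  obtain h where h: "lmap R (B\<lparr>carrier := f ` carrier A\<rparr>) C h" "\<And>x. x \<in> carrier A \<Longrightarrow> h (f x) = g x"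
    by (rule ses_factor[OF ses_kernel_range[OF f] g]) (use ker in auto)
  obtain g' where "lmap R B C g'" "\<And>y. y \<in> f ` carrier A \<Longrightarrow> g' y = h y"
    by (rule exv_extend[OF ses_quot_module[OF B submodule_range[OF f]] ex h(1)]) auto
  then show thesis using that h(2) by auto
qed

text \<open>The cokernel is perpendicular by \<open>exv_quotient\<close> and is moved to the type
  required in \<open>AAITY_cotilting\<close>.\<close>

lemma embed_short_exact:
  assumes X: "\<And>k. exv k X" and emb: "good_embedding R C X m f" and C: "\<And>k. exv k C"
  obtains X' :: "('r, nat \<Rightarrow> 'c) module" and f' g
  where "short_exact R X f' (power_module C m) g X'" "in_perp R C X'"
proof -
  let ?P = "power_module C m"
  have f: "lmap R X ?P f" "inj_on f (carrier X)"
    "\<And>g. lmap R X C g \<Longrightarrow> \<exists>h. lmap R ?P C h \<and> (\<forall>x\<in>carrier X. h (f x) = g x)"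
    using emb unfolding good_embedding_def by auto
  note s = ses_quot_range[OF f(1,2)]
  obtain X' :: "('r, nat \<Rightarrow> 'c) module" and \<phi> where \<phi>: "lmap R (quot_module ?P (f ` carrier X)) X' \<phi>"
    "bij_betw \<phi> (carrier (quot_module ?P (f ` carrier X))) (carrier X')"
    by (rule transport_surj[OF sesD(2,4)[OF s]])
  have q: "exv k (quot_module ?P (f ` carrier X))" for k
    by (rule exv_quotient[OF s X exv_sumd[OF C sumd_power[OF C_module]] f(3)])
  have perp: "in_perp R C X'" using in_perp_iff lmap_tgt[OF \<phi>(1)] exv_iso[OF q \<phi>] by blast
  let ?g = "\<lambda>x. \<phi> ((f ` carrier X) +>\<^bsub>?P\<^esub> x)"
  have g: "lmap R ?P X' ?g" using lmap_comp[OF sesD(2)[OF s] \<phi>(1)] .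
  have surj: "?g ` carrier ?P = carrier X'"
    using sesD(4)[OF s] \<phi>(2) unfolding bij_betw_def by (metis image_image)
  have ker: "?g x = \<zero>\<^bsub>X'\<^esub> \<longleftrightarrow> x \<in> f ` carrier X" if x: "x \<in> carrier ?P" for x
    using sesD(5)[OF s x] lmap_inj_on_iff[OF \<phi>(1)] \<phi>(2) lmap_zero[OF \<phi>(1)] lmap_closed[OF sesD(2)[OF s] x]
    unfolding bij_betw_def by metis
  have "short_exact R X (restrict f (carrier X)) ?P (restrict ?g (carrier ?P)) X'"
    unfolding short_exact_def
    using lmap_src[OF f(1)] lmap_tgt[OF f(1)] lmap_tgt[OF g] lmap_mod_hom[OF f(1)] lmap_mod_hom[OF g] f(2)
      surj ker lmap_closed[OF f(1)]
    by (auto simp: a_kernel_def' cong: inj_on_cong image_cong)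
  with perp that show thesis by blast
qed

end

section \<open>M-cotilting modules are AAITY-cotilting\<close>

text \<open>The witness of \<open>cogen_star\<close> for the regular module, unpacked into linear
  maps: a coresolution of \<open>R\<close> by modules in \<open>add C\<close> whose cokernels have
  no \<open>Ext\<close> into \<open>C\<close> in degree one.\<close>

locale cogen_data = injres R C E \<epsilon> \<delta>
  for R :: "'r ring" and C :: "('r, 'c) module" and E :: "nat \<Rightarrow> ('r, 'e) module" and \<epsilon> \<delta> +
  fixes D :: "nat \<Rightarrow> ('r, nat \<Rightarrow> 'c) module" and e0 f
  assumes D: "sumd R C (D i)" and e0: "lmap R (regular_module R) (D 0) e0" "inj_on e0 (carrier R)"
    and f: "lmap R (D i) (D (Suc i)) (f i)"
    and ex0: "e0 ` carrier R = {x \<in> carrier (D 0). f 0 x = \<zero>\<^bsub>D 1\<^esub>}"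
    and ex: "f i ` carrier (D i) = {x \<in> carrier (D (Suc i)). f (Suc i) x = \<zero>\<^bsub>D (Suc (Suc i))\<^esub>}"
    and coker0: "exv 0 (quot_module (D 0) (e0 ` carrier R))"
    and coker: "exv 0 (quot_module (D (Suc i)) (f i ` carrier (D i)))"
begin

lemma D_module: "right_module R (D i)"
  using D by (simp add: sumd_def)

text \<open>The map \<open>e0\<close> sends a scalar to its action on this element, and evaluation
  at it is the dual of \<open>e0\<close> under \<open>Hom(R, C) = C\<close>.\<close>

abbreviation u :: "nat \<Rightarrow> 'c" where "u \<equiv> e0 \<one>\<^bsub>R\<^esub>"

lemma u: "u \<in> carrier (D 0)"
  using lmap_closed[OF e0(1), of "\<one>\<^bsub>R\<^esub>"] by simp

lemma e0_eq: "r \<in> carrier R \<Longrightarrow> e0 r = r \<odot>\<^bsub>D 0\<^esub> u"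
  using lmap_regular[OF ring_R e0(1)] .

lemma HomM_extend:
  assumes g: "g \<in> carrier (HomM R (D i) C)" and ker: "\<And>x. \<lbrakk>x \<in> carrier (D i); f i x = \<zero>\<^bsub>D (Suc i)\<^esub>\<rbrakk> \<Longrightarrow> g x = \<zero>\<^bsub>C\<^esub>"
  shows "g \<in> pre (D i) (f i) ` carrier (HomM R (D (Suc i)) C)"
proof -
  obtain h where h: "lmap R (D (Suc i)) C h" "\<And>x. x \<in> carrier (D i) \<Longrightarrow> h (f i x) = g x"
    by (rule extend_through[OF f coker HomM_lmap[OF D_module g]]) (use ker in auto)
  have "g = pre (D i) (f i) (restrict h (carrier (D (Suc i))))"
    using pre_in_HomM[OF f restrict_HomM[OF h(1)]] h(2) lmap_closed[OF f]
    by (intro HomM_eqI[OF D_module g]) auto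
  then show ?thesis using restrict_HomM[OF h(1)] by blast
qed

text \<open>The dual of the coresolution of \<open>R\<close> resolves \<open>Hom(R, C) = C\<close>
  over \<open>S\<close>. Exactness at the terms is the factorization property
  \<open>HomM_extend\<close>; surjectivity of the augmentation comes from
  \<open>coker0\<close>.\<close>

lemma presolution_End:
  "presolution (op_End R C) (\<lambda>i. HomM R (D i) C) (\<lambda>i. pre (D i) (f i)) (End_module C) (\<lambda>h. h u)"
proof
  show "lmap (op_End R C) (HomM R (D (Suc n)) C) (HomM R (D n) C) (pre (D n) (f n))" for n
    by (rule lmap_pre[OF f])
  show "lmap (op_End R C) (HomM R (D 0) C) (End_module C) (\<lambda>h. h u)" by (rule lmap_eval[OF D_module u])
  show "pre (D (Suc n)) (f (Suc n)) ` carrier (HomM R (D (Suc (Suc n))) C) =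
    {x \<in> carrier (HomM R (D (Suc n)) C). pre (D n) (f n) x = \<zero>\<^bsub>HomM R (D n) C\<^esub>}" for n
  proof (intro equalityI subsetI)
    fix g assume "g \<in> pre (D (Suc n)) (f (Suc n)) ` carrier (HomM R (D (Suc (Suc n))) C)"
    then obtain h where h: "h \<in> carrier (HomM R (D (Suc (Suc n))) C)" "g = pre (D (Suc n)) (f (Suc n)) h" by auto
    have "f (Suc n) (f n x) = \<zero>\<^bsub>D (Suc (Suc n))\<^esub>" if "x \<in> carrier (D n)" for x using ex[of n] that by blast
    then have "pre (D n) (f n) g = \<zero>\<^bsub>HomM R (D n) C\<^esub>"
      using lmap_zero[OF HomM_lmap[OF D_module h(1)]] lmap_closed[OF f] unfolding h(2)
      by (auto simp: pre_def intro!: restrict_ext)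
    then show "g \<in> {x \<in> carrier (HomM R (D (Suc n)) C). pre (D n) (f n) x = \<zero>\<^bsub>HomM R (D n) C\<^esub>}"
      using pre_in_HomM[OF f h(1)] h(2) by simp
  next
    fix g assume "g \<in> {x \<in> carrier (HomM R (D (Suc n)) C). pre (D n) (f n) x = \<zero>\<^bsub>HomM R (D n) C\<^esub>}"
    then have g: "g \<in> carrier (HomM R (D (Suc n)) C)" "pre (D n) (f n) g = (\<lambda>x\<in>carrier (D n). \<zero>\<^bsub>C\<^esub>)" by auto
    show "g \<in> pre (D (Suc n)) (f (Suc n)) ` carrier (HomM R (D (Suc (Suc n))) C)"
    proof (rule HomM_extend[OF g(1)])
      fix x assume "x \<in> carrier (D (Suc n))" "f (Suc n) x = \<zero>\<^bsub>D (Suc (Suc n))\<^esub>"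
      then obtain y where y: "y \<in> carrier (D n)" "x = f n y" using ex[of n] by auto
      then show "g x = \<zero>\<^bsub>C\<^esub>" using fun_cong[OF g(2), of y] by simp
    qed
  qed
  show "(\<lambda>h. h u) ` carrier (HomM R (D 0) C) = carrier (End_module C)"
  proof (intro equalityI subsetI)
    fix c assume "c \<in> carrier (End_module C)"
    then have c: "c \<in> carrier C" by simp
    have inj0: "r = \<zero>\<^bsub>R\<^esub>" if "r \<in> carrier R" "e0 r = \<zero>\<^bsub>D 0\<^esub>" for r
      using lmap_inj_on_iff[OF e0(1)] e0(2) that by simp
    have z: "r \<odot>\<^bsub>C\<^esub> c = \<zero>\<^bsub>C\<^esub>" if "r \<in> carrier (regular_module R)" "e0 r = \<zero>\<^bsub>D 0\<^esub>" for r
      using inj0 that c by fastforce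
    obtain g where g: "lmap R (D 0) C g" "\<And>r. r \<in> carrier R \<Longrightarrow> g (e0 r) = r \<odot>\<^bsub>C\<^esub> c"
      by (rule extend_through[OF e0(1) _ lmap_orbit[OF C_module c] z]) (use coker0 in auto)
    have "c = g u" using g(2)[of "\<one>\<^bsub>R\<^esub>"] c by (simp add: C.smult_one)
    then show "c \<in> (\<lambda>h. h u) ` carrier (HomM R (D 0) C)"
      using restrict_HomM[OF g(1)] u by (intro image_eqI[of _ _ "restrict g (carrier (D 0))"]) auto
  qed (use lmap_closed[OF lmap_eval[OF D_module u]] in auto)
  have hu: "h x = \<zero>\<^bsub>C\<^esub>" if h: "h \<in> carrier (HomM R (D 0) C)" "h u = \<zero>\<^bsub>C\<^esub>"
    and x: "x \<in> carrier (D 0)" "f 0 x = \<zero>\<^bsub>D 1\<^esub>" for h x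
  proof -
    have "x \<in> e0 ` carrier R" using ex0 x by simp
    then obtain r where r: "r \<in> carrier R" "x = e0 r" by auto
    then show ?thesis
      using lmap_smult[OF HomM_lmap[OF D_module h(1)] r(1) u] e0_eq[OF r(1)] h(2) by simp
  qed
  show "pre (D 0) (f 0) ` carrier (HomM R (D 1) C) = {x \<in> carrier (HomM R (D 0) C). x u = \<zero>\<^bsub>End_module C\<^esub>}"
  proof (intro equalityI subsetI)
    fix g assume "g \<in> pre (D 0) (f 0) ` carrier (HomM R (D 1) C)"
    then obtain h where h: "h \<in> carrier (HomM R (D (Suc 0)) C)" "g = pre (D 0) (f 0) h" by auto
    have "f 0 u = \<zero>\<^bsub>D 1\<^esub>" using ex0 by (metis (mono_tags, lifting) C.R.one_closed imageI mem_Collect_eq)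
    then have "g u = \<zero>\<^bsub>C\<^esub>" using lmap_zero[OF HomM_lmap[OF D_module h(1)]] u h(2) by simp
    then show "g \<in> {x \<in> carrier (HomM R (D 0) C). x u = \<zero>\<^bsub>End_module C\<^esub>}"
      using pre_in_HomM[OF f h(1)] h(2) by simp
  next
    fix g assume "g \<in> {x \<in> carrier (HomM R (D 0) C). x u = \<zero>\<^bsub>End_module C\<^esub>}"
    then have g: "g \<in> carrier (HomM R (D 0) C)" "g u = \<zero>\<^bsub>C\<^esub>" by auto
    show "g \<in> pre (D 0) (f 0) ` carrier (HomM R (D 1) C)"
      using HomM_extend[OF g(1)] hu[OF g] by simp
  qed
qed

lemma fin_gen_End: "fin_gen (op_End R C) (End_module C)"
  using fin_gen_surj[OF presolution.e[OF presolution_End] presolution.e_surj[OF presolution_End] fin_gen_HomM[OF D]] .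

text \<open>Self-orthogonality of \<open>C\<close> over \<open>S\<close>. An \<open>S\<close>-linear
  map from the dual of \<open>D i\<close> to \<open>C\<close> is evaluation at a point, so dualizing
  the resolution once more returns the exact coresolution.\<close>

lemma cz_End: "cz (op_End R C) (\<lambda>i. HomM R (D i) C) (\<lambda>i. pre (D i) (f i)) k (End_module C)"
  unfolding cz_def
proof (intro allI impI, elim conjE)
  fix \<theta> assume \<theta>: "lmap (op_End R C) (HomM R (D (Suc k)) C) (End_module C) \<theta>"
    "\<forall>h\<in>carrier (HomM R (D (Suc (Suc k))) C). \<theta> (pre (D (Suc k)) (f (Suc k)) h) = \<zero>\<^bsub>End_module C\<^esub>"
  obtain x where x: "x \<in> carrier (D (Suc k))" "\<And>h. h \<in> carrier (HomM R (D (Suc k)) C) \<Longrightarrow> \<theta> h = h x"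
    by (rule eval_surj[OF D \<theta>(1)]) (rule that)
  have "f (Suc k) x = \<zero>\<^bsub>D (Suc (Suc k))\<^esub>"
  proof (rule eval_inj[OF D lmap_closed[OF f x(1)]])
    fix h assume "h \<in> carrier (HomM R (D (Suc (Suc k))) C)"
    then show "h (f (Suc k) x) = \<zero>\<^bsub>C\<^esub>" using \<theta>(2) x pre_in_HomM[OF f] by fastforce
  qed
  then obtain y where y: "y \<in> carrier (D k)" "x = f k y" using ex[of k] x(1) by auto
  then have "\<theta> h = pre (D k) (f k) h y" if "h \<in> carrier (HomM R (D (Suc k)) C)" for h using x(2)[OF that] by simp
  then show "\<exists>b. lmap (op_End R C) (HomM R (D k) C) (End_module C) b \<and>
    (\<forall>h\<in>carrier (HomM R (D (Suc k)) C). \<theta> h = b (pre (D k) (f k) h))"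
    using lmap_eval[OF D_module y(1)] by blast
qed

text \<open>The surjective half of the double centralizer property \<open>R = End(C)\<close> over
  \<open>S\<close>. Composing with the augmentation turns \<open>\<theta>\<close> into evaluation at
  some \<open>x\<close> of \<open>D 0\<close>. This evaluation kills the image of the next dual map,
  so \<open>x\<close> lies in the kernel of \<open>f 0\<close>, which is the image of
  \<open>R\<close>.\<close>

lemma End_End:
  assumes \<theta>: "lmap (op_End R C) (End_module C) (End_module C) \<theta>"
  obtains r where "r \<in> carrier R" "\<And>c. c \<in> carrier C \<Longrightarrow> \<theta> c = r \<odot>\<^bsub>C\<^esub> c"
proof -
  interpret P: presolution "op_End R C" "\<lambda>i. HomM R (D i) C" "\<lambda>i. pre (D i) (f i)" "End_module C" "\<lambda>h. h u"
    by (rule presolution_End)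
  obtain x where x: "x \<in> carrier (D 0)" "\<And>h. h \<in> carrier (HomM R (D 0) C) \<Longrightarrow> \<theta> (h u) = h x"
    by (rule eval_surj[OF D lmap_comp[OF P.e \<theta>]]) (rule that)
  have "f 0 x = \<zero>\<^bsub>D 1\<^esub>"
    unfolding One_nat_def
  proof (rule eval_inj[OF D lmap_closed[OF f x(1)]])
    fix h assume h: "h \<in> carrier (HomM R (D (Suc 0)) C)"
    have "f 0 u = \<zero>\<^bsub>D 1\<^esub>" using ex0 by (metis (mono_tags, lifting) C.R.one_closed imageI mem_Collect_eq)
    then have "pre (D 0) (f 0) h u = \<zero>\<^bsub>C\<^esub>" using lmap_zero[OF HomM_lmap[OF D_module h]] u by simp
    then show "h (f 0 x) = \<zero>\<^bsub>C\<^esub>" using x(2)[OF pre_in_HomM[OF f h]] x(1) lmap_zero[OF \<theta>] by simp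
  qed
  then obtain r where r: "r \<in> carrier R" "x = e0 r" using ex0 x(1) by auto
  have "\<theta> c = r \<odot>\<^bsub>C\<^esub> c" if c: "c \<in> carrier C" for c
  proof -
    obtain h where h: "h \<in> carrier (HomM R (D 0) C)" "c = h u" using P.e_surj c by auto
    then show ?thesis using x(2)[OF h(1)] r lmap_smult[OF HomM_lmap[OF D_module h(1)] r(1) u] e0_eq[OF r(1)] by simp
  qed
  with r(1) that show thesis by blast
qed

text \<open>A map from \<open>D 0\<close> to \<open>C\<close> sends \<open>e0 r\<close> to the
  action of \<open>r\<close> on an element of \<open>C\<close>, hence to zero; such maps separate
  the points of \<open>D 0\<close>, and \<open>e0\<close> is injective.\<close>

lemma faithful:
  assumes r: "r \<in> carrier R" "\<And>c. c \<in> carrier C \<Longrightarrow> r \<odot>\<^bsub>C\<^esub> c = \<zero>\<^bsub>C\<^esub>"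
  shows "r = \<zero>\<^bsub>R\<^esub>"
proof -
  have "e0 r = \<zero>\<^bsub>D 0\<^esub>"
  proof (rule eval_inj[OF D])
    show "e0 r \<in> carrier (D 0)" using lmap_closed[OF e0(1)] r(1) by simp
    fix h assume h: "h \<in> carrier (HomM R (D 0) C)"
    have h': "lmap R (D 0) C h" using HomM_lmap[OF D_module h] .
    show "h (e0 r) = \<zero>\<^bsub>C\<^esub>"
      using r(2)[OF lmap_closed[OF h' u]] lmap_smult[OF h' r(1) u] e0_eq[OF r(1)] by simp
  qed
  then show ?thesis using lmap_inj_on_iff[OF e0(1)] e0(2) r(1) by simp
qed

text \<open>Reflexivity of finitely generated projectives, surjective half. For the regular module
  this is \<open>End_End\<close>; it is applied in each coordinate, and the resulting ring elements
  are reassembled with the \<open>u i\<close>.\<close>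

lemma eval_surj_projective:
  assumes "sumd R (regular_module R) P" and \<theta>: "lmap (op_End R C) (HomM R P C) (End_module C) \<theta>"
  obtains q where "q \<in> carrier P" "\<And>h. h \<in> carrier (HomM R P C) \<Longrightarrow> \<theta> h = h q"
proof -
  obtain n u v where s: "right_module R (regular_module R)" "right_module R P"
    "\<And>i. i < n \<Longrightarrow> lmap R (regular_module R) P (u i)" "\<And>i. i < n \<Longrightarrow> lmap R P (regular_module R) (v i)"
    "\<And>x. x \<in> carrier P \<Longrightarrow> msum P (\<lambda>i. u i (v i x)) (n::nat) = x"
    by (rule sumdE[OF assms(1)]) blast
  let ?U = "\<lambda>i c. \<lambda>x\<in>carrier P. v i x \<odot>\<^bsub>C\<^esub> c"
  have vR: "v i x \<in> carrier R" if "i < n" "x \<in> carrier P" for i x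
    using lmap_closed[OF s(4)[OF that(1)] that(2)] by simp
  have Um: "?U i c \<in> carrier (HomM R P C)" if "i < n" "c \<in> carrier C" for i c
    by (rule restrict_HomM) (rule lmap_comp[OF s(4)[OF that(1)] lmap_orbit[OF C that(2)]])
  have U: "lmap (op_End R C) (End_module C) (HomM R P C) (?U i)" if i: "i < n" for i
    unfolding lmap_def using Um[OF i] vR[OF i] right_module_HomM[OF s(2)] right_module_End
    by (auto simp: C.smult_r_distr lmap_smult[OF End_lmap] intro!: restrict_ext)
  have "\<exists>r\<in>carrier R. \<forall>c\<in>carrier C. \<theta> (?U i c) = r \<odot>\<^bsub>C\<^esub> c" if "i < n" for i
    using End_End[OF lmap_comp[OF U[OF that] \<theta>]] by metis
  then obtain r where r: "\<And>i. i < n \<Longrightarrow> r i \<in> carrier R" "\<And>i c. \<lbrakk>i < n; c \<in> carrier C\<rbrakk> \<Longrightarrow> \<theta> (?U i c) = r i \<odot>\<^bsub>C\<^esub> c"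
    by metis
  have u1: "u i \<one>\<^bsub>R\<^esub> \<in> carrier P" if "i < n" for i using lmap_closed[OF s(3)[OF that], of "\<one>\<^bsub>R\<^esub>"] by simp
  have ur: "u i (r i) \<in> carrier P" if "i < n" for i using lmap_closed[OF s(3)[OF that]] r(1)[OF that] by simp
  show thesis
  proof
    show "msum P (\<lambda>i. u i (r i)) n \<in> carrier P" using ur by (rule msum_closed[OF s(2)])
    fix h assume h: "h \<in> carrier (HomM R P C)"
    have h': "lmap R P C h" using HomM_lmap[OF s(2) h] .
    have hu: "h (u i \<one>\<^bsub>R\<^esub>) \<in> carrier C" if "i < n" for i using lmap_closed[OF h' u1[OF that]] .
    let ?t = "\<lambda>i. ?U i (h (u i \<one>\<^bsub>R\<^esub>))"
    have t: "?t i \<in> carrier (HomM R P C)" if "i < n" for i using Um[OF that hu[OF that]] .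
    have uw: "r' \<odot>\<^bsub>C\<^esub> h (u i \<one>\<^bsub>R\<^esub>) = h (u i r')" if "i < n" "r' \<in> carrier R" for i r'
      using lmap_smult[OF h' that(2) u1[OF that(1)]] lmap_regular[OF ring_R s(3)[OF that(1)] that(2)] by simp
    have "msum (HomM R P C) ?t n = h"
    proof (rule HomM_eqI[OF s(2) _ h])
      show "msum (HomM R P C) ?t n \<in> carrier (HomM R P C)" using t by (rule msum_closed[OF right_module_HomM[OF s(2)]])
      fix x assume x: "x \<in> carrier P"
      have "msum (HomM R P C) ?t n x = msum C (\<lambda>i. ?t i x) n" by (rule HomM_sum[OF s(2) t x])
      also have "\<dots> = msum C (\<lambda>i. h (u i (v i x))) n"
        using x uw[OF _ vR[OF _ x]] by (intro msum_cong) simp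
      also have "\<dots> = h (msum P (\<lambda>i. u i (v i x)) n)"
        using x by (intro lmap_msum[OF h', symmetric] lmap_closed[OF s(3)] lmap_closed[OF s(4)])
      finally show "msum (HomM R P C) ?t n x = h x" using s(5)[OF x] by simp
    qed
    then have "\<theta> h = msum (End_module C) (\<lambda>i. \<theta> (?t i)) n"
      using lmap_msum[OF \<theta>, of n ?t] t by simp
    also have "\<dots> = msum (End_module C) (\<lambda>i. h (u i (r i))) n"
      using r hu uw by (intro msum_cong) simp
    also have "\<dots> = msum C (\<lambda>i. h (u i (r i))) n"
      by (induction n) simp_all
    also have "\<dots> = h (msum P (\<lambda>i. u i (r i)) n)"
      using ur by (rule lmap_msum[OF h', symmetric])
    finally show "\<theta> h = h (msum P (\<lambda>i. u i (r i)) n)" .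
  qed
qed

text \<open>The injective half, reduced to \<open>faithful\<close> in each coordinate.\<close>

lemma eval_inj_projective:
  assumes "sumd R (regular_module R) P" "p \<in> carrier P" "\<And>h. h \<in> carrier (HomM R P C) \<Longrightarrow> h p = \<zero>\<^bsub>C\<^esub>"
  shows "p = \<zero>\<^bsub>P\<^esub>"
proof -
  obtain n u v where s: "right_module R (regular_module R)" "right_module R P"
    "\<And>i. i < n \<Longrightarrow> lmap R (regular_module R) P (u i)" "\<And>i. i < n \<Longrightarrow> lmap R P (regular_module R) (v i)"
    "\<And>x. x \<in> carrier P \<Longrightarrow> msum P (\<lambda>i. u i (v i x)) (n::nat) = x"
    by (rule sumdE[OF assms(1)]) blast
  have "u i (v i p) = \<zero>\<^bsub>P\<^esub>" if i: "i < n" for i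
  proof -
    have "v i p = \<zero>\<^bsub>R\<^esub>"
    proof (rule faithful)
      show "v i p \<in> carrier R" using lmap_closed[OF s(4)[OF i] assms(2)] by simp
      fix c assume c: "c \<in> carrier C"
      have "restrict (\<lambda>x. v i x \<odot>\<^bsub>C\<^esub> c) (carrier P) \<in> carrier (HomM R P C)"
        by (rule restrict_HomM) (rule lmap_comp[OF s(4)[OF i] lmap_orbit[OF C c]])
      from assms(3)[OF this] show "v i p \<odot>\<^bsub>C\<^esub> c = \<zero>\<^bsub>C\<^esub>" using assms(2) by simp
    qed
    then show ?thesis using lmap_zero[OF s(3)[OF i]] by simp
  qed
  then have "msum P (\<lambda>i. u i (v i p)) n = msum P (\<lambda>i. \<zero>\<^bsub>P\<^esub>) n" by (intro msum_cong)
  then show ?thesis using s(5)[OF assms(2)] msum_zero[OF s(2)] by simp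
qed

text \<open>The dual of a projective resolution of \<open>X\<close> is an exact sequence of \<open>S\<close>-modules in \<open>add C\<close>; its
  images have no higher \<open>Ext\<close> into \<open>C\<close>, since that module has finite injective dimension.\<close>

lemma torsionless:
  assumes noeth: "right_noetherian R" and X: "fin_gen R X" "\<And>k. exv k X"
    and S: "injres (op_End R C) (End_module C) E' \<epsilon>' \<delta>'" and fin: "\<And>i. i > n \<Longrightarrow> carrier (E' i) = {\<zero>\<^bsub>E' i\<^esub>}"
    and x: "x \<in> carrier X" "\<And>g. lmap R X C g \<Longrightarrow> g x = \<zero>\<^bsub>C\<^esub>"
  shows "x = \<zero>\<^bsub>X\<^esub>"
proof -
  let ?S = "op_End R C"
  interpret S: injres ?S "End_module C" E' \<epsilon>' \<delta>' by (rule S)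
  have XM: "right_module R X" using X(2) by (simp add: exv_def)
  obtain k e d where res:
    "lmap R (power_module (regular_module R) (k 0)) X e"
    "e ` carrier (power_module (regular_module R) (k 0)) = carrier X"
    "\<And>n. lmap R (power_module (regular_module R) (k (Suc n))) (power_module (regular_module R) (k n)) (d n)"
    "d 0 ` carrier (power_module (regular_module R) (k 1)) =
      {x \<in> carrier (power_module (regular_module R) (k 0)). e x = \<zero>\<^bsub>X\<^esub>}"
    "\<And>n. d (Suc n) ` carrier (power_module (regular_module R) (k (Suc (Suc n)))) =
      {x \<in> carrier (power_module (regular_module R) (k (Suc n))). d n x = \<zero>\<^bsub>power_module (regular_module R) (k n)\<^esub>}"
    by (rule free_resolution[OF noeth XM X(1)]) blast
  define P where "P i = power_module (regular_module R) (k i)" for i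
  have P: "sumd R (regular_module R) (P i)" for i
    unfolding P_def by (rule sumd_power[OF right_module_regular[OF ring_R]])
  have res: "presolution R P d X e"
    by unfold_locales (use res in \<open>simp_all add: P_def\<close>)
  interpret P: presolution R P d X e by (rule res)
  \<comment> \<open>Perpendicularity of \<open>X\<close> makes the dualized resolution exact in
    positive degrees.\<close>
  have cz: "cz R P d j C" for j
    using exv_iff_cz[OF res exv_projective[OF P]] X(2) by blast
  define H where "H i = HomM R (P i) C" for i
  define dH where "dH i = pre (P (Suc i)) (d i)" for i
  have dH: "lmap ?S (H i) (H (Suc i)) (dH i)" for i
    unfolding H_def dH_def by (rule lmap_pre[OF P.d])
  have exH: "{h \<in> carrier (H (Suc i)). dH (Suc i) h = \<zero>\<^bsub>H (Suc (Suc i))\<^esub>} = dH i ` carrier (H i)" for i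
  proof (intro equalityI subsetI)
    fix h assume "h \<in> {h \<in> carrier (H (Suc i)). dH (Suc i) h = \<zero>\<^bsub>H (Suc (Suc i))\<^esub>}"
    then have h: "h \<in> carrier (HomM R (P (Suc i)) C)" and z: "dH (Suc i) h = \<zero>\<^bsub>H (Suc (Suc i))\<^esub>" by (auto simp: H_def)
    have "h (d (Suc i) y) = \<zero>\<^bsub>C\<^esub>" if "y \<in> carrier (P (Suc (Suc i)))" for y
      using fun_cong[OF z, of y] that by (simp add: H_def dH_def)
    then obtain b where b: "lmap R (P i) C b" "\<And>y. y \<in> carrier (P (Suc i)) \<Longrightarrow> h y = b (d i y)"
      using czE[OF cz HomM_lmap[OF P.P_module h]] by metis
    have "h = dH i (restrict b (carrier (P i)))"
      unfolding dH_def using pre_in_HomM[OF P.d restrict_HomM[OF b(1)]] b(2) lmap_closed[OF P.d]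
      by (intro HomM_eqI[OF P.P_module h]) auto
    then show "h \<in> dH i ` carrier (H i)" using restrict_HomM[OF b(1)] by (auto simp: H_def)
  next
    fix h assume "h \<in> dH i ` carrier (H i)"
    then obtain b where b: "b \<in> carrier (HomM R (P i) C)" "h = dH i b" by (auto simp: H_def)
    have "dH (Suc i) (dH i b) = \<zero>\<^bsub>H (Suc (Suc i))\<^esub>"
      using P.dd lmap_closed[OF P.d] lmap_zero[OF HomM_lmap[OF P.P_module b(1)]]
      by (auto simp: H_def dH_def pre_def intro!: restrict_ext)
    then show "h \<in> {h \<in> carrier (H (Suc i)). dH (Suc i) h = \<zero>\<^bsub>H (Suc (Suc i))\<^esub>}"
      using b lmap_closed[OF dH] by (auto simp: H_def)
  qed
  \<comment> \<open>By exactness the image \<open>L i\<close> is also the kernel of the next dual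
    map, so it is a submodule of \<open>H (Suc i)\<close> with quotient
    \<open>L (Suc i)\<close>.\<close>
  define L where "L i = (H (Suc i))\<lparr>carrier := dH i ` carrier (H i)\<rparr>" for i
  have ses: "ses ?S (L i) (\<lambda>h. h) (H (Suc i)) (dH (Suc i)) (L (Suc i))" for i
    using ses_kernel_range[OF dH[of "Suc i"]] unfolding L_def exH .
  have C: "S.exv j (End_module C)" for j
    using S.exv_iff_cz[OF presolution_End] cz_End S.exv_lifting[OF lifting_HomM[OF S.\<delta> D] right_module_HomM[OF D_module]]
    by blast
  have H: "S.exv j (H i)" for i j
    unfolding H_def by (rule S.exv_sumd[OF C sumd_HomM_projective[OF P]])
  have LM: "right_module ?S (L i)" for i using lmap_src[OF sesD(1)[OF ses]] .
  \<comment> \<open>Passing from \<open>L i\<close> to \<open>L (Suc i)\<close> raises the degree by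
    one, since the terms \<open>H i\<close> have no cohomology; after \<open>t\<close> such steps
    the degree exceeds \<open>n\<close>, where the coresolution is zero.\<close>
  have "S.exv j (L i)" if "n \<le> j + t" for i j t
    using that
  proof (induction t arbitrary: i j)
    case 0
    then show ?case by (intro S.exv_high fin LM) simp
  next
    case (Suc t)
    then have "S.exv (Suc j) (L (Suc i))" by (intro Suc.IH) simp
    then show ?case by (rule S.exv_kernel[OF ses _ H])
  qed
  then have L: "S.exv 0 (L 1)" by (metis add_0 order_refl)
  obtain p where p: "p \<in> carrier (P 0)" "x = e p" using x(1) P.e_surj by auto
  have ses0: "ses ?S ((H 0)\<lparr>carrier := {h \<in> carrier (H 0). dH 0 h = \<zero>\<^bsub>H (Suc 0)\<^esub>}\<rparr>) (\<lambda>h. h) (H 0) (dH 0) (L 0)"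
    using ses_kernel_range[OF dH[of 0]] unfolding L_def .
  have van: "h p = \<zero>\<^bsub>C\<^esub>" if h: "h \<in> carrier (H 0)" "dH 0 h = \<zero>\<^bsub>H (Suc 0)\<^esub>" for h
  proof -
    have h': "lmap R (P 0) C h" using HomM_lmap[OF P.P_module] h(1) by (simp add: H_def)
    have z: "h y = \<zero>\<^bsub>C\<^esub>" if "y \<in> carrier (P 0)" "e y = \<zero>\<^bsub>X\<^esub>" for y
    proof -
      have "y \<in> d 0 ` carrier (P 1)" using P.exact0 that by simp
      then obtain z where z: "z \<in> carrier (P (Suc 0))" "y = d 0 z" by auto
      then show ?thesis using fun_cong[OF h(2), of z] by (simp add: H_def dH_def)
    qed
    obtain g where "lmap R X C g" "\<And>y. y \<in> carrier (P 0) \<Longrightarrow> g (e y) = h y"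
      by (rule lmap_factor_surj[OF P.e P.e_surj h']) (use z in auto)
    then show ?thesis using x(2) p by metis
  qed
  have ev: "lmap ?S (H 0) (End_module C) (\<lambda>h. h p)" unfolding H_def by (rule lmap_eval[OF P.P_module p(1)])
  \<comment> \<open>Evaluation at the preimage \<open>p\<close> of \<open>x\<close> descends to
    \<open>L 0\<close>: a cochain killed by \<open>dH 0\<close> comes from a map
    \<open>X \<rightarrow> C\<close>, and all of these kill \<open>x\<close>.\<close>
  obtain \<phi> where \<phi>: "lmap ?S (L 0) (End_module C) \<phi>" "\<And>h. h \<in> carrier (H 0) \<Longrightarrow> \<phi> (dH 0 h) = h p"
    by (rule ses_factor[OF ses0 ev]) (use van in auto)
  \<comment> \<open>It extends to \<open>H 1\<close> because \<open>Ext\<close> of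
    \<open>L 1\<close> vanishes in degree one. By reflexivity of \<open>P 1\<close> the extension is
    evaluation at some \<open>q\<close>, so no map to \<open>C\<close> separates \<open>p\<close>
    from \<open>d 0 q\<close>.\<close>
  obtain \<phi>' where \<phi>': "lmap ?S (H (Suc 0)) (End_module C) \<phi>'" "\<And>h. h \<in> carrier (L 0) \<Longrightarrow> \<phi>' h = \<phi> h"
    using S.exv_extend[OF ses[of 0] _ \<phi>(1)] L by auto
  obtain q where q: "q \<in> carrier (P (Suc 0))" "\<And>h. h \<in> carrier (H (Suc 0)) \<Longrightarrow> \<phi>' h = h q"
    using eval_surj_projective[OF P \<phi>'(1)[unfolded H_def]] unfolding H_def by blast
  interpret P0: right_module R "P 0" by (rule P.P_module)
  have dq: "d 0 q \<in> carrier (P 0)" using lmap_closed[OF P.d q(1)] .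
  have "p \<ominus>\<^bsub>P 0\<^esub> d 0 q = \<zero>\<^bsub>P 0\<^esub>"
  proof (rule eval_inj_projective[OF P])
    show "p \<ominus>\<^bsub>P 0\<^esub> d 0 q \<in> carrier (P 0)" using p(1) dq by simp
    fix h assume h: "h \<in> carrier (HomM R (P 0) C)"
    then have hH: "h \<in> carrier (H 0)" by (simp add: H_def)
    have "h p = \<phi>' (dH 0 h)" using \<phi>(2)[OF hH] \<phi>'(2)[of "dH 0 h"] hH by (simp add: L_def)
    also have "\<dots> = h (d 0 q)" using q(2)[OF lmap_closed[OF dH hH]] q(1) by (simp add: dH_def)
    finally show "h (p \<ominus>\<^bsub>P 0\<^esub> d 0 q) = \<zero>\<^bsub>C\<^esub>"
      using lmap_eq_iff[OF HomM_lmap[OF P.P_module h] p(1) dq] by simp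
  qed
  then have "p = d 0 q" using P0.minus_eq_zero_iff[OF p(1) dq] by simp
  then show ?thesis using P.exact0 q(1) p(2) by auto
qed

text \<open>\<open>Hom(X, C)\<close> is handled as the set of maps on a free cover that vanish on
  the kernel of the cover. The generators supplied by \<open>noetherian_annihilator\<close> descend
  to \<open>X\<close>, and an element killed by all of them is killed by every map to
  \<open>C\<close>, so \<open>torsionless\<close> gives injectivity.\<close>

lemma good_embedding_exists:
  assumes noeth: "right_noetherian R" "left_noetherian (End_ring R C)" and X: "fin_gen R X" "\<And>k. exv k X"
    and S: "injres (op_End R C) (End_module C) E' \<epsilon>' \<delta>'" and fin: "\<And>i. i > n \<Longrightarrow> carrier (E' i) = {\<zero>\<^bsub>E' i\<^esub>}"
  obtains m g where "good_embedding R C X m g"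
proof -
  have XM: "right_module R X" using X(2) by (simp add: exv_def)
  obtain k e where e: "lmap R (power_module (regular_module R) k) X e"
    "e ` carrier (power_module (regular_module R) k) = carrier X"
    by (rule fin_gen_cover[OF XM X(1)])
  let ?P = "power_module (regular_module R) k"
  have P: "sumd R (regular_module R) ?P" by (rule sumd_power[OF right_module_regular[OF ring_R]])
  have fg: "fin_gen (op_End R C) (HomM R ?P C)" by (rule fin_gen_sumd[OF sumd_HomM_projective[OF P] fin_gen_End])
  obtain m a where a: "lmap R ?P (power_module C m) a"
    "\<And>b. b \<in> {x \<in> carrier ?P. e x = \<zero>\<^bsub>X\<^esub>} \<Longrightarrow> a b = \<zero>\<^bsub>power_module C m\<^esub>"
    "\<And>h. \<lbrakk>lmap R ?P C h; \<And>b. b \<in> {x \<in> carrier ?P. e x = \<zero>\<^bsub>X\<^esub>} \<Longrightarrow> h b = \<zero>\<^bsub>C\<^esub>\<rbrakk>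
      \<Longrightarrow> \<exists>h'. lmap R (power_module C m) C h' \<and> (\<forall>x\<in>carrier ?P. h x = h' (a x))"
    by (rule noetherian_annihilator[OF noeth(2) lmap_src[OF e(1)] fg, of "{x \<in> carrier ?P. e x = \<zero>\<^bsub>X\<^esub>}"]) blast+
  obtain f where f: "lmap R X (power_module C m) f" "\<And>x. x \<in> carrier ?P \<Longrightarrow> f (e x) = a x"
    by (rule lmap_factor_surj[OF e a(1)]) (use a(2) in auto)
  have ext: "\<exists>h. lmap R (power_module C m) C h \<and> (\<forall>x\<in>carrier X. h (f x) = g x)" if g: "lmap R X C g" for g
  proof -
    obtain h where h: "lmap R (power_module C m) C h" "\<forall>x\<in>carrier ?P. g (e x) = h (a x)"
      using a(3)[OF lmap_comp[OF e(1) g]] lmap_zero[OF g] by auto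
    have "h (f x) = g x" if x: "x \<in> carrier X" for x
    proof -
      obtain y where y: "y \<in> carrier ?P" "x = e y" using x e(2) by auto
      then show ?thesis using h(2) f(2) by simp
    qed
    with h(1) show ?thesis by blast
  qed
  have "x = \<zero>\<^bsub>X\<^esub>" if x: "x \<in> carrier X" "f x = \<zero>\<^bsub>power_module C m\<^esub>" for x
  proof (rule torsionless[OF noeth(1) X S fin x(1)])
    fix g assume "lmap R X C g"
    then obtain h where "lmap R (power_module C m) C h" "\<forall>x\<in>carrier X. h (f x) = g x" using ext by blast
    then show "g x = \<zero>\<^bsub>C\<^esub>" using x lmap_zero by metis
  qed
  then have "inj_on f (carrier X)" using lmap_inj_on_iff[OF f(1)] by blast
  with f(1) ext that show thesis unfolding good_embedding_def by blast
qed

end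

theorem M_cotilting_AAITY:
  fixes R :: "'r ring" and C :: "('r, 'c) module"
  assumes C: "right_module R C" and M: "M_cotilting R C"
  shows "AAITY_cotilting R C"
proof -
  have noeth: "right_noetherian R" "left_noetherian (End_ring R C)" and wak: "wakamatsu_tilting R C"
    and idR: "inj_dim R C < \<infinity>" and idS: "inj_dim (op_End R C) (End_module C) < \<infinity>"
    using M by (auto simp: M_cotilting_def)
  have so: "self_orthogonal R C" and gen: "gen_star R (regular_module R) C" and cogen: "cogen_star R C (regular_module R)"
    using wak by (auto simp: wakamatsu_tilting_def)
  have R: "ring R" using C by (simp add: right_module_def)
  have RM: "right_module R (regular_module R)" by (rule right_module_regular[OF R])
  obtain E :: "nat \<Rightarrow> ('r, ('r, 'c) coresol) module" and \<epsilon> \<delta> n where E: "injres R C E \<epsilon> \<delta>"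
    by (rule finite_inj_dim[OF C idR])
  interpret E: injres R C E \<epsilon> \<delta> by (rule E)
  obtain E' :: "nat \<Rightarrow> ('c \<Rightarrow> 'c, ('c \<Rightarrow> 'c, 'c) coresol) module" and \<epsilon>' \<delta>' n'
    where E': "injres (op_End R C) (End_module C) E' \<epsilon>' \<delta>'" "\<And>i. i > n' \<Longrightarrow> carrier (E' i) = {\<zero>\<^bsub>E' i\<^esub>}"
    by (rule finite_inj_dim[OF E.right_module_End idS]) (rule that)
  have CC: "E.exv k C" for k
  proof -
    have "in_perp R C C" using so by (simp add: self_orthogonal_def in_perp_def)
    then show ?thesis using E.in_perp_iff by blast
  qed
  \<comment> \<open>\<open>C\<close> is a quotient of the first term of its resolution in
    \<open>gen_star\<close>, which is finitely generated projective.\<close>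
  have fgC: "fin_gen R C"
  proof -
    obtain X :: "nat \<Rightarrow> ('r, nat \<Rightarrow> 'r) module" and e where X: "in_add R (regular_module R) (X 0)"
      "e \<in> mod_hom R (X 0) C" "e ` carrier (X 0) = carrier C"
      using gen unfolding gen_star_def by (elim conjE exE) (rule that, auto)
    have s: "sumd R (regular_module R) (X 0)" using in_add_sumd[OF RM X(1)] .
    then have "right_module R (X 0)" by (simp add: sumd_def)
    from fin_gen_surj[OF mod_hom_lmap[OF X(2) this C] X(3) fin_gen_sumd[OF s fin_gen_regular[OF R]]]
    show ?thesis .
  qed
  obtain D :: "nat \<Rightarrow> ('r, nat \<Rightarrow> 'c) module" and e f where D:
    "\<And>i. in_add R C (D i)" "e \<in> mod_hom R (regular_module R) (D 0)" "\<And>i. f i \<in> mod_hom R (D i) (D (Suc i))"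
    "inj_on e (carrier (regular_module R))" "e ` carrier (regular_module R) = a_kernel (D 0) (D 1) (f 0)"
    "\<And>i. f i ` carrier (D i) = a_kernel (D (Suc i)) (D (Suc (Suc i))) (f (Suc i))"
    "trivial_group (Ext R 1 (coker_module (regular_module R) (D 0) e) C)"
    "\<And>i. trivial_group (Ext R 1 (coker_module (D i) (D (Suc i)) (f i)) C)"
    using cogen unfolding cogen_star_def by (elim conjE exE) (rule that; (assumption | erule spec))
  have sD: "sumd R C (D i)" for i using in_add_sumd[OF C D(1)] .
  then have DM: "right_module R (D i)" for i by (simp add: sumd_def)
  have e: "lmap R (regular_module R) (D 0) e" using mod_hom_lmap[OF D(2) RM DM] .
  have f: "lmap R (D i) (D (Suc i)) (f i)" for i using mod_hom_lmap[OF D(3) DM DM] .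
  have c0: "E.exv 0 (quot_module (D 0) (e ` carrier R))"
    using D(7) E.exv_iff_Ext[OF quot_module_right_module[OF DM submodule_range[OF e]], of 0]
    by (simp add: coker_module_def)
  have c: "E.exv 0 (quot_module (D (Suc i)) (f i ` carrier (D i)))" for i
    using D(8)[of i] E.exv_iff_Ext[OF quot_module_right_module[OF DM submodule_range[OF f]], of 0]
    by (simp add: coker_module_def)
  interpret G: cogen_data R C E \<epsilon> \<delta> D e f
    by unfold_locales (use sD e f D(4,5,6) c0 c in \<open>auto simp: a_kernel_def'\<close>)
  show ?thesis
    unfolding AAITY_cotilting_def
  proof (intro conjI allI impI fgC so idR, elim conjE)
    fix X :: "('r, nat \<Rightarrow> 'r) module"
    assume X: "fin_gen R X" "in_perp R C X"
    have exX: "E.exv k X" for k using X(2) E.in_perp_iff by blast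
    obtain m f where m: "good_embedding R C X m f"
      by (rule G.good_embedding_exists[OF noeth X(1) exX E'])
    obtain X' :: "('r, nat \<Rightarrow> 'c) module" and f' g where
      "short_exact R X f' (power_module C m) g X'" "in_perp R C X'"
      by (rule E.embed_short_exact[OF exX m CC])
    with in_add_power[OF C] show "\<exists>(C0 :: ('r, nat \<Rightarrow> 'c) module) (X' :: ('r, nat \<Rightarrow> 'c) module) f g.
           short_exact R X f C0 g X' \<and> in_add R C C0 \<and> in_perp R C X'" by blast
  qed
qed

section \<open>AAITY-cotilting modules are Wakamatsu tilting\<close>

lemma sumd_power_retract:
  assumes "sumd R M P"
  obtains n i p where "lmap R P (power_module M n) i" "lmap R (power_module M n) P p"
    "\<And>x. x \<in> carrier P \<Longrightarrow> p (i x) = x"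
proof -
  obtain n u v where s: "right_module R M" "right_module R P" "\<And>i. i < n \<Longrightarrow> lmap R M P (u i)"
    "\<And>i. i < n \<Longrightarrow> lmap R P M (v i)" "\<And>x. x \<in> carrier P \<Longrightarrow> msum P (\<lambda>i. u i (v i x)) (n::nat) = x"
    by (rule sumdE[OF assms]) blast
  have "lmap R (power_module M n) P (\<lambda>y. msum P (\<lambda>i. u i (y i)) n)"
    by (intro msum_lmap right_module_power s(1,2)) (rule lmap_comp[OF lmap_proj[OF s(1)] s(3)])
  moreover have "lmap R P (power_module M n) (\<lambda>x. \<lambda>i\<in>{..<n}. v i x)" by (intro lmap_tuple s(1,2,4))
  moreover have "msum P (\<lambda>i. u i ((\<lambda>i\<in>{..<n}. v i x) i)) n = x" if "x \<in> carrier P" for x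
    using s(5)[OF that] msum_cong[of n "\<lambda>i. u i ((\<lambda>i\<in>{..<n}. v i x) i)" "\<lambda>i. u i (v i x)" P] by simp
  ultimately show thesis by (intro that)
qed

lemma short_exact_ses: "short_exact R X f Y g Z \<Longrightarrow> ses R X f Y g Z"
  unfolding short_exact_def ses_def by (auto simp: a_kernel_def' intro: mod_hom_lmap)

text \<open>\<open>zc R C m Z\<close>: the module \<open>Z\<close> has an \<open>add C\<close>-resolution of length \<open>m\<close>.\<close>

primrec zc :: "'r ring \<Rightarrow> ('r, 'c) module \<Rightarrow> nat \<Rightarrow> ('r, nat \<Rightarrow> 'c) module \<Rightarrow> bool" where
  "zc R C 0 Z \<longleftrightarrow> sumd R C Z"
| "zc R C (Suc m) Z \<longleftrightarrow> (\<exists>(Z' :: ('r, nat \<Rightarrow> 'c) module) (B :: ('r, nat \<Rightarrow> 'c) module) i p.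
     ses R Z' i B p Z \<and> sumd R C B \<and> zc R C m Z')"

text \<open>\<open>n\<close> bounds the injective dimension of \<open>C\<close> over
  \<open>R\<close>; the same \<open>n\<close> will be the bound over \<open>S\<close>.\<close>

locale aaity = injres R C E \<epsilon> \<delta>
  for R :: "'r ring" and C :: "('r, 'c) module" and E :: "nat \<Rightarrow> ('r, 'e) module" and \<epsilon> \<delta> +
  fixes n :: nat
  assumes fin: "\<And>i. i > n \<Longrightarrow> carrier (E i) = {\<zero>\<^bsub>E i\<^esub>}"
    and noeth: "right_noetherian R" and noethS: "left_noetherian (End_ring R C)"
    and aaity: "AAITY_cotilting R C"
begin

lemma fgC: "fin_gen R C"
  using aaity by (simp add: AAITY_cotilting_def)

lemma exv_C: "exv k C"
proof -
  have "in_perp R C C" using aaity by (simp add: AAITY_cotilting_def self_orthogonal_def in_perp_def)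
  then show ?thesis using in_perp_iff by blast
qed

lemma exv_sumd_C: "sumd R C B \<Longrightarrow> exv k B"
  using exv_sumd[OF exv_C] .

lemma exv_ge: "\<lbrakk>right_module R M; n \<le> k\<rbrakk> \<Longrightarrow> exv k M"
  by (rule exv_high[OF fin]) simp_all

text \<open>Condition (ii) speaks about modules on a prescribed type, so \<open>X\<close> is moved
  there through a free cover. The module \<open>C0\<close> is a retract of a power of
  \<open>C\<close>, into which the embedding is continued; maps to \<open>C\<close> extend because
  the cokernel \<open>X'\<close> is perpendicular.\<close>

lemma good_embedding_exists:
  assumes X: "fin_gen R X" "\<And>k. exv k X"
  obtains m f where "good_embedding R C X m f"
proof -
  have XM: "right_module R X" using X(2) by (simp add: exv_def)
  obtain k e where e: "lmap R (power_module (regular_module R) k) X e"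
    "e ` carrier (power_module (regular_module R) k) = carrier X"
    by (rule fin_gen_cover[OF XM X(1)])
  obtain Y :: "('r, nat \<Rightarrow> 'r) module" and \<phi> where \<phi>: "lmap R X Y \<phi>" "bij_betw \<phi> (carrier X) (carrier Y)"
    by (rule transport_surj[OF e])
  have Y: "fin_gen R Y" "in_perp R C Y"
    using fin_gen_surj[OF \<phi>(1) _ X(1)] \<phi>(2) lmap_tgt[OF \<phi>(1)] exv_iso[OF X(2) \<phi>] in_perp_iff
    by (auto simp: bij_betw_def)
  obtain C0 X' :: "('r, nat \<Rightarrow> 'c) module" and f g where s: "short_exact R Y f C0 g X'" "in_add R C C0" "in_perp R C X'"
    using aaity Y unfolding AAITY_cotilting_def by blast
  note ses = short_exact_ses[OF s(1)]
  obtain m i p where ip: "lmap R C0 (power_module C m) i" "lmap R (power_module C m) C0 p"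
    "\<And>x. x \<in> carrier C0 \<Longrightarrow> p (i x) = x"
    by (rule sumd_power_retract[OF in_add_sumd[OF C_module s(2)]]) (rule that)
  have "good_embedding R C Y m (\<lambda>x. i (f x))"
    unfolding good_embedding_def
  proof (intro conjI allI impI)
    show "lmap R Y (power_module C m) (\<lambda>x. i (f x))" using lmap_comp[OF sesD(1)[OF ses] ip(1)] .
    show "inj_on (\<lambda>x. i (f x)) (carrier Y)"
      using ip(3) lmap_closed[OF sesD(1)[OF ses]] sesD(3)[OF ses] unfolding inj_on_def by metis
    fix h assume h: "lmap R Y C h"
    obtain h' where h': "lmap R C0 C h'" "\<And>x. x \<in> carrier Y \<Longrightarrow> h' (f x) = h x"
      using exv_extend[OF ses _ h] s(3) in_perp_iff by blast
    show "\<exists>h'. lmap R (power_module C m) C h' \<and> (\<forall>x\<in>carrier Y. h' (i (f x)) = h x)"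
      using lmap_comp[OF ip(2) h'(1)] ip(3) h'(2) lmap_closed[OF sesD(1)[OF ses]]
      by (intro exI[of _ "\<lambda>x. h' (p x)"]) simp
  qed
  from good_embedding_iso[OF this \<phi>] that show thesis by blast
qed

lemma exv_good_quotient:
  assumes "\<And>k. exv k X" "good_embedding R C X m f"
  shows "exv k (quot_module (power_module C m) (f ` carrier X))"
  using assms(2) exv_quotient[OF ses_quot_range assms(1) exv_sumd_C[OF sumd_power[OF C_module]]]
  unfolding good_embedding_def by blast

text \<open>Any resolution of \<open>C\<close> by finitely generated free modules serves, since the
  regular module has no \<open>Ext\<close> in degree one into any module.\<close>

lemma gen_star_C: "gen_star R (regular_module R) C"
proof -
  have RM: "right_module R (regular_module R)" by (rule right_module_regular[OF ring_R])
  obtain k e d where res: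
    "lmap R (power_module (regular_module R) (k 0)) C e"
    "e ` carrier (power_module (regular_module R) (k 0)) = carrier C"
    "\<And>n. lmap R (power_module (regular_module R) (k (Suc n))) (power_module (regular_module R) (k n)) (d n)"
    "d 0 ` carrier (power_module (regular_module R) (k 1)) =
      {x \<in> carrier (power_module (regular_module R) (k 0)). e x = \<zero>\<^bsub>C\<^esub>}"
    "\<And>n. d (Suc n) ` carrier (power_module (regular_module R) (k (Suc (Suc n)))) =
      {x \<in> carrier (power_module (regular_module R) (k (Suc n))). d n x = \<zero>\<^bsub>power_module (regular_module R) (k n)\<^esub>}"
    by (rule free_resolution[OF noeth C_module fgC]) blast
  define X where "X i = power_module (regular_module R) (k i)" for i
  have XM: "right_module R (X i)" for i unfolding X_def by (rule right_module_power[OF RM])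
  define e' where "e' = restrict e (carrier (X 0))"
  define f where "f i = restrict (d i) (carrier (X (Suc i)))" for i
  have e': "e' \<in> mod_hom R (X 0) C" and f: "f i \<in> mod_hom R (X (Suc i)) (X i)" for i
    using lmap_mod_hom[OF res(1)] lmap_mod_hom[OF res(3)] unfolding e'_def f_def X_def by auto
  have le: "lmap R (X 0) C e'" and lf: "lmap R (X (Suc i)) (X i) (f i)" for i
    using mod_hom_lmap[OF e' XM C_module] mod_hom_lmap[OF f XM XM] .
  have "trivial_group (Ext R 1 (regular_module R) (ker_module (X 0) C e'))"
    by (rule Ext1_regular[OF ring_R])
      (simp add: ker_module_def a_kernel_def' right_module.submodule_right_module[OF XM submodule_kernel[OF le]])
  moreover have "trivial_group (Ext R 1 (regular_module R) (ker_module (X (Suc i)) (X i) (f i)))" for i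
    by (rule Ext1_regular[OF ring_R])
      (simp add: ker_module_def a_kernel_def' right_module.submodule_right_module[OF XM submodule_kernel[OF lf]])
  moreover have "in_add R (regular_module R) (X i)" for i unfolding X_def by (rule in_add_power[OF RM])
  moreover have "e' ` carrier (X 0) = carrier C" "f 0 ` carrier (X 1) = a_kernel (X 0) C e'"
    using res(2,4) by (auto simp: e'_def f_def X_def a_kernel_def')
  moreover have "f (Suc i) ` carrier (X (Suc (Suc i))) = a_kernel (X (Suc i)) (X i) (f i)" for i
    using res(5)[of i] by (auto simp: f_def X_def a_kernel_def')
  ultimately show ?thesis unfolding gen_star_def using C_module e' f
    by (intro conjI exI[of _ X] exI[of _ e'] exI[of _ f]) auto
qed

lemma cogen_star_R: "cogen_star R C (regular_module R)"
proof -
  let ?P = "power_module C"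
  have P: "right_module R (?P m)" for m by (rule right_module_power[OF C_module])
  have RM: "right_module R (regular_module R)" by (rule right_module_regular[OF ring_R])
  have exR: "exv k (regular_module R)" for k by (rule exv_projective[OF sumd_refl[OF RM]])
  obtain m0 e where e: "good_embedding R C (regular_module R) m0 e"
    by (rule good_embedding_exists[OF fin_gen_regular[OF ring_R] exR])
  have le: "lmap R (regular_module R) (?P m0) e" and inj: "inj_on e (carrier R)"
    using e unfolding good_embedding_def by auto
  \<comment> \<open>A state is a power of \<open>C\<close> together with the image of the previous
    map in it. The cokernel is perpendicular, and finitely generated because \<open>C\<close> is, so
    it has a good embedding into a further power; preceded by the projection, this is the next
    map.\<close>
  let ?A = "\<lambda>(m, B). submodule B R (?P m) \<and> (\<forall>k. exv k (quot_module (?P m) B))"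
  let ?Q = "\<lambda>(m, B) (m', B'). \<exists>a. lmap R (?P m) (?P m') a \<and> {x \<in> carrier (?P m). a x = \<zero>\<^bsub>?P m'\<^esub>} = B \<and>
    B' = a ` carrier (?P m)"
  have step: "\<exists>t. ?A t \<and> ?Q s t" if "?A s" for s
  proof -
    obtain m B where s: "s = (m, B)" by (cases s) auto
    have B: "submodule B R (?P m)" and ex: "\<And>k. exv k (quot_module (?P m) B)" using that s by auto
    note ses = ses_quot_module[OF P B]
    have fg: "fin_gen R (quot_module (?P m) B)"
      using fin_gen_surj[OF sesD(2,4)[OF ses] fin_gen_sumd[OF sumd_power[OF C_module] fgC]] .
    obtain m' j where j: "good_embedding R C (quot_module (?P m) B) m' j"
      by (rule good_embedding_exists[OF fg ex])
    have lj: "lmap R (quot_module (?P m) B) (?P m') j" "inj_on j (carrier (quot_module (?P m) B))"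
      using j unfolding good_embedding_def by auto
    define a where "a x = j (B +>\<^bsub>?P m\<^esub> x)" for x
    have a: "lmap R (?P m) (?P m') a" unfolding a_def[abs_def] using lmap_comp[OF sesD(2)[OF ses] lj(1)] .
    have im: "a ` carrier (?P m) = j ` carrier (quot_module (?P m) B)"
      unfolding a_def sesD(4)[OF ses, symmetric] by (simp add: image_image)
    have "a x = \<zero>\<^bsub>?P m'\<^esub> \<longleftrightarrow> x \<in> B" if x: "x \<in> carrier (?P m)" for x
      using lmap_inj_on_iff[OF lj(1)] lj(2) lmap_zero[OF lj(1)] lmap_closed[OF sesD(2)[OF ses] x]
        sesD(5)[OF ses x] unfolding a_def by auto
    then have "{x \<in> carrier (?P m). a x = \<zero>\<^bsub>?P m'\<^esub>} = B" using submodule_subset[OF P B] by auto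
    moreover have "exv k (quot_module (?P m') (a ` carrier (?P m)))" for k
      unfolding im by (rule exv_good_quotient[OF ex j])
    ultimately show ?thesis unfolding s using a submodule_range[OF a]
      by (intro exI[of _ "(m', a ` carrier (?P m))"]) auto
  qed
  have s0: "?A (m0, e ` carrier (regular_module R))"
    using submodule_range[OF le] exv_good_quotient[OF exR e] by simp
  obtain s where s: "\<And>i. ?A (s i)" "\<And>i. ?Q (s i) (s (Suc i))" "s 0 = (m0, e ` carrier (regular_module R))"
  proof -
    have "\<exists>s. \<forall>i. (?A (s i) \<and> (i = 0 \<longrightarrow> s i = (m0, e ` carrier (regular_module R)))) \<and> ?Q (s i) (s (Suc i))"
    proof (rule dependent_nat_choice)
      show "\<exists>x. ?A x \<and> (0 = (0::nat) \<longrightarrow> x = (m0, e ` carrier (regular_module R)))" using s0 by blast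
      show "\<exists>y. (?A y \<and> (Suc i = 0 \<longrightarrow> y = (m0, e ` carrier (regular_module R)))) \<and> ?Q x y"
        if "?A x \<and> (i = 0 \<longrightarrow> x = (m0, e ` carrier (regular_module R)))" for x i
        using step[of x] that by simp
    qed
    then obtain s where "\<forall>i. (?A (s i) \<and> (i = 0 \<longrightarrow> s i = (m0, e ` carrier (regular_module R)))) \<and> ?Q (s i) (s (Suc i))" ..
    then show thesis by (intro that[of s]) simp_all
  qed
  define m where "m i = fst (s i)" for i
  define B where "B i = snd (s i)" for i
  have s_eq: "s i = (m i, B i)" for i by (simp add: m_def B_def)
  have mB0: "m 0 = m0" "B 0 = e ` carrier (regular_module R)" using s(3) by (simp_all add: m_def B_def)
  have ex: "exv k (quot_module (?P (m i)) (B i))" for i k using s(1)[of i] unfolding s_eq by simp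
  have "\<forall>i. \<exists>a. lmap R (?P (m i)) (?P (m (Suc i))) a \<and> {x \<in> carrier (?P (m i)). a x = \<zero>\<^bsub>?P (m (Suc i))\<^esub>} = B i \<and>
    B (Suc i) = a ` carrier (?P (m i))" using s(2) unfolding s_eq by simp
  from choice[OF this] obtain a where a0: "\<forall>i. lmap R (?P (m i)) (?P (m (Suc i))) (a i) \<and>
    {x \<in> carrier (?P (m i)). a i x = \<zero>\<^bsub>?P (m (Suc i))\<^esub>} = B i \<and> B (Suc i) = a i ` carrier (?P (m i))" ..
  have a: "lmap R (?P (m i)) (?P (m (Suc i))) (a i)" "{x \<in> carrier (?P (m i)). a i x = \<zero>\<^bsub>?P (m (Suc i))\<^esub>} = B i"
    "B (Suc i) = a i ` carrier (?P (m i))" for i using a0 by blast+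
  define X where "X i = ?P (m i)" for i
  define e' where "e' = restrict e (carrier (regular_module R))"
  define f where "f i = restrict (a i) (carrier (X i))" for i
  have ime: "e' ` carrier (regular_module R) = B 0" and imf: "f i ` carrier (X i) = B (Suc i)" for i
    unfolding mB0(2) a(3) e'_def f_def X_def by auto
  have kf: "a_kernel (X i) (X (Suc i)) (f i) = B i" for i
    using a(2)[of i] by (auto simp: a_kernel_def' f_def X_def)
  have "trivial_group (Ext R 1 (coker_module (regular_module R) (X 0) e') C)"
    using exv_iff_Ext[of "quot_module (X 0) (B 0)" 0] ex[of 0 0]
    unfolding coker_module_def ime by (simp add: exv_def X_def)
  moreover have "trivial_group (Ext R 1 (coker_module (X i) (X (Suc i)) (f i)) C)" for i
    using exv_iff_Ext[of "quot_module (X (Suc i)) (B (Suc i))" 0] ex[of 0 "Suc i"]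
    unfolding coker_module_def imf by (simp add: exv_def X_def)
  moreover have "in_add R C (X i)" for i unfolding X_def by (rule in_add_power[OF C_module])
  moreover have "e' \<in> mod_hom R (regular_module R) (X 0)" "inj_on e' (carrier (regular_module R))"
    using lmap_mod_hom[OF le] inj mB0(1) by (simp_all add: e'_def X_def inj_on_def)
  moreover have "f i \<in> mod_hom R (X i) (X (Suc i))" for i
    using lmap_mod_hom[OF a(1)] by (simp add: f_def X_def)
  moreover have "e' ` carrier (regular_module R) = a_kernel (X 0) (X 1) (f 0)" using ime kf[of 0] by simp
  moreover have "f i ` carrier (X i) = a_kernel (X (Suc i)) (X (Suc (Suc i))) (f (Suc i))" for i
    using imf kf by simp
  ultimately show ?thesis unfolding cogen_star_def using RM
    by (intro conjI exI[of _ X] exI[of _ e'] exI[of _ f]) auto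
qed

section \<open>Auslander--Buchweitz approximations\<close>

lemma zc_module: "zc R C m Z \<Longrightarrow> right_module R Z"
  by (cases m) (auto simp: sumd_def ses_def dest: lmap_tgt)

lemma zc_fin_gen: "zc R C m Z \<Longrightarrow> fin_gen R Z"
  
proof (cases m)
  case 0
  then show "zc R C m Z \<Longrightarrow> fin_gen R Z" using fin_gen_sumd[OF _ fgC] by simp
next
  case (Suc l)
  assume "zc R C m Z"
  then obtain Z' B :: "('r, nat \<Rightarrow> 'c) module" and i p where "ses R Z' i B p Z" "sumd R C B" unfolding Suc by auto
  then show "fin_gen R Z" using fin_gen_surj[OF sesD(2,4)] fin_gen_sumd[OF _ fgC] by blast
qed

text \<open>Dimension shifting along the \<open>add C\<close>-resolution; the step uses
  \<open>Z'\<close> one degree higher, so the induction runs over all degrees at once. Thus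
  \<open>Ext\<close> of \<open>C\<close> into \<open>Z\<close> vanishes in positive degrees.\<close>

lemma zc_cz: "zc R C m Z \<Longrightarrow> cz R (res_module R C) (res_diff R C) k Z"
proof -
  interpret presolution R "res_module R C" "res_diff R C" C "res_aug R C" by (rule presolution_res[OF C_module])
  have C: "cz R (res_module R C) (res_diff R C) k C" for k
    using exv_C exv_iff_Ext[OF C_module] Ext_trivial_iff[OF C_module C_module] by blast
  show "zc R C m Z \<Longrightarrow> cz R (res_module R C) (res_diff R C) k Z"
  proof (induction m arbitrary: k Z)
  case 0
  then show ?case using cz_sumd[OF C] by simp
  next
  case (Suc m)
  then obtain Z' B :: "('r, nat \<Rightarrow> 'c) module" and i p where s: "ses R Z' i B p Z" "sumd R C B" "zc R C m Z'" by auto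
  have "lifting R (res_module R C (Suc k)) B Z p"
    unfolding res_module_def by (rule lifting_free[OF ring_R sesD(2)[OF s(1)]])
  from cz_shift[OF s(1) this cz_sumd[OF C s(2)] Suc.IH[OF s(3)]] show ?case .
  qed
qed

text \<open>\<open>Ext\<close> of \<open>C\<close> into \<open>Z'\<close> vanishes in degree one by
  \<open>zc_cz\<close>, so maps from \<open>C\<close> to \<open>Z\<close> lift to
  \<open>B\<close>.\<close>

lemma zc_lifting:
  assumes s: "ses R Z' i B p Z" and Z': "zc R C m Z'"
  shows "lifting R C B Z p"
proof -
  interpret presolution R "res_module R C" "res_diff R C" C "res_aug R C" by (rule presolution_res[OF C_module])
  have "lifting R (res_module R C 0) B Z p"
    unfolding res_module_def by (rule lifting_free[OF ring_R sesD(2)[OF s]])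
  from cz_lift[OF s this zc_cz[OF Z']] show ?thesis
    unfolding lifting_def using sesD(2)[OF s] by metis
qed

text \<open>Auslander--Buchweitz approximation: the pushout \<open>T\<close> of \<open>P \<leftarrow> Y' \<rightarrow> Z'\<close> lies in the
  perpendicular category, hence embeds into a power of \<open>C\<close>, and \<open>Y = T / Z'\<close>.\<close>

lemma zc_embedding:
  fixes Y :: "('r, nat \<Rightarrow> 'r) module"
  assumes "right_module R Y" "fin_gen R Y" "\<And>k. k \<ge> m \<Longrightarrow> exv k Y"
  shows "\<exists>Z j. zc R C m Z \<and> lmap R Y Z j \<and> inj_on j (carrier Y) \<and> (\<forall>k. exv k (quot_module Z (j ` carrier Y)))"
  using assms
proof (induction m arbitrary: Y)
  case 0
  \<comment> \<open>For bound \<open>0\<close> the module \<open>Y\<close> is itself perpendicular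
    to \<open>C\<close>, and a good embedding has the required cokernel.\<close>
  obtain m f where f: "good_embedding R C Y m f"
    by (rule good_embedding_exists[OF 0(2)]) (use 0(3) in auto)
  have "exv k (quot_module (power_module C m) (f ` carrier Y))" for k
    by (rule exv_good_quotient[OF _ f]) (use 0(3) in auto)
  then show ?case using f sumd_power[OF C_module, of m] unfolding good_embedding_def by auto
next
  case (Suc m)
  let ?R = "regular_module R"
  have RM: "right_module R ?R" by (rule right_module_regular[OF ring_R])
  obtain l e where e: "lmap R (power_module ?R l) Y e" "e ` carrier (power_module ?R l) = carrier Y"
    by (rule fin_gen_cover[OF Suc.prems(1,2)])
  define P where "P = power_module ?R l"
  note e = e[folded P_def]
  have P: "right_module R P" and sP: "sumd R ?R P" unfolding P_def using right_module_power[OF RM] sumd_power[OF RM] .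
  have fgP: "fin_gen R P" unfolding P_def by (rule fin_gen_power[OF ring_R])
  have exP: "exv k P" for k by (rule exv_projective[OF sP])
  interpret P: right_module R P by (rule P)
  define Y' where "Y' = P\<lparr>carrier := {x \<in> carrier P. e x = \<zero>\<^bsub>Y\<^esub>}\<rparr>"
  have sY: "ses R Y' (\<lambda>x. x) P e Y" unfolding Y'_def by (rule ses_kernel[OF e])
  have cY': "carrier Y' = {x \<in> carrier P. e x = \<zero>\<^bsub>Y\<^esub>}" by (simp add: Y'_def)
  \<comment> \<open>Passing to the syzygy \<open>Y'\<close> lowers by one the degree from which
    \<open>Ext\<close> into \<open>C\<close> vanishes, so the induction hypothesis applies to
    it.\<close>
  have "\<exists>Z j. zc R C m Z \<and> lmap R Y' Z j \<and> inj_on j (carrier Y') \<and> (\<forall>k. exv k (quot_module Z (j ` carrier Y')))"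
  proof (rule Suc.IH)
    show "right_module R Y'" using lmap_src[OF sesD(1)[OF sY]] .
    show "fin_gen R Y'" unfolding Y'_def by (rule noetherian_submodule[OF noeth P fgP submodule_kernel[OF e(1)]])
    show "exv k Y'" if "m \<le> k" for k
      using exv_kernel[OF sY Suc.prems(3) exP] that by simp
  qed
  then obtain Z' j where Z': "zc R C m Z'" and j: "lmap R Y' Z' j" "inj_on j (carrier Y')"
    and exQ: "\<And>k. exv k (quot_module Z' (j ` carrier Y'))" by blast
  have Z'M: "right_module R Z'" by (rule zc_module[OF Z'])
  interpret Z': right_module R Z' by (rule Z'M)
  let ?PZ = "prod_module P Z'"
  have PZ: "right_module R ?PZ" by (rule right_module_prod[OF P Z'M])
  interpret PZ: right_module R ?PZ by (rule PZ)
  \<comment> \<open>The pushout is the quotient of \<open>P \<times> Z'\<close> by the antidiagonal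
    copy of \<open>Y'\<close>.\<close>
  define N where "N = (\<lambda>y. (y, \<zero>\<^bsub>Z'\<^esub> \<ominus>\<^bsub>Z'\<^esub> j y)) ` carrier Y'"
  have Nl: "lmap R Y' ?PZ (\<lambda>y. (y, \<zero>\<^bsub>Z'\<^esub> \<ominus>\<^bsub>Z'\<^esub> j y))"
    by (rule lmap_pair[OF sesD(1)[OF sY] lmap_diff[OF lmap_zero_map[OF lmap_src[OF j(1)] Z'M] j(1)]])
  have N: "submodule N R ?PZ" unfolding N_def by (rule submodule_range[OF Nl])
  define T where "T = quot_module ?PZ N"
  define q where "q x = N +>\<^bsub>?PZ\<^esub> x" for x
  have sT: "ses R (?PZ\<lparr>carrier := N\<rparr>) (\<lambda>x. x) ?PZ q T" unfolding T_def q_def[abs_def] by (rule ses_quot_module[OF PZ N])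
  have q: "lmap R ?PZ T q" and T: "right_module R T" using sesD(2)[OF sT] lmap_tgt by blast+
  interpret T: right_module R T by (rule T)
  have q0: "q x = \<zero>\<^bsub>T\<^esub> \<longleftrightarrow> x \<in> N" if "x \<in> carrier ?PZ" for x using sesD(5)[OF sT that] by simp
  have Tex: "\<exists>x z. x \<in> carrier P \<and> z \<in> carrier Z' \<and> t = q (x, z)" if t: "t \<in> carrier T" for t
  proof -
    have "t \<in> q ` carrier ?PZ" using sesD(4)[OF sT] t by simp
    then show ?thesis by auto
  qed
  have inP: "lmap R P ?PZ (\<lambda>x. (x, \<zero>\<^bsub>Z'\<^esub>))" by (rule lmap_pair[OF lmap_id[OF P] lmap_zero_map[OF P Z'M]])
  have inZ: "lmap R Z' ?PZ (\<lambda>z. (\<zero>\<^bsub>P\<^esub>, z))" by (rule lmap_pair[OF lmap_zero_map[OF Z'M P] lmap_id[OF Z'M]])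
  note qP = lmap_comp[OF inP q] and qZ = lmap_comp[OF inZ q]
  have jz: "j y = \<zero>\<^bsub>Z'\<^esub> \<longleftrightarrow> y = \<zero>\<^bsub>P\<^esub>" if "y \<in> carrier Y'" for y
    using lmap_inj_on_iff[OF j(1)] j(2) that lmap_zero[OF j(1)] by (auto simp: Y'_def)
  have jc: "j y \<in> carrier Z'" if "y \<in> carrier Y'" for y using lmap_closed[OF j(1) that] .
  have neg: "\<zero>\<^bsub>Z'\<^esub> \<ominus>\<^bsub>Z'\<^esub> z = \<zero>\<^bsub>Z'\<^esub> \<longleftrightarrow> z = \<zero>\<^bsub>Z'\<^esub>" if "z \<in> carrier Z'" for z
    using that Z'.minus_eq_zero_iff[of "\<zero>\<^bsub>Z'\<^esub>" z] by auto
  let ?X = "quot_module Z' (j ` carrier Y')"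
  let ?c = "\<lambda>z. (j ` carrier Y') +>\<^bsub>Z'\<^esub> z"
  note sX = ses_quot_range[OF j]
  obtain \<pi> where \<pi>: "lmap R T ?X \<pi>" "\<And>x. x \<in> carrier ?PZ \<Longrightarrow> \<pi> (q x) = ?c (snd x)"
  proof (rule ses_factor[OF sT lmap_comp[OF lmap_snd[OF P Z'M] sesD(2)[OF sX]]])
    fix x assume "x \<in> carrier (?PZ\<lparr>carrier := N\<rparr>)"
    then obtain y where y: "y \<in> carrier Y'" "x = (y, \<zero>\<^bsub>Z'\<^esub> \<ominus>\<^bsub>Z'\<^esub> j y)" by (auto simp: N_def)
    have "\<zero>\<^bsub>Z'\<^esub> \<ominus>\<^bsub>Z'\<^esub> j y \<in> j ` carrier Y'"
      using Z'.submodule_minus[OF submodule_range[OF j(1)], of "\<zero>\<^bsub>Z'\<^esub>" "j y"] y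
        submodule_range[OF j(1)] Z'.submodule_iff by auto
    then show "?c (snd x) = \<zero>\<^bsub>?X\<^esub>" using sesD(5)[OF sX] y jc by simp
  qed (rule that)
  \<comment> \<open>The cokernel of \<open>P \<rightarrow> T\<close> is that of \<open>j\<close>. As
    an extension of this cokernel by \<open>P\<close>, the pushout is perpendicular to
    \<open>C\<close>; this is why the induction carries the statement about the cokernel.\<close>
  have sTX: "ses R P (\<lambda>x. q (x, \<zero>\<^bsub>Z'\<^esub>)) T \<pi> ?X"
    unfolding ses_def
  proof (intro conjI ballI qP \<pi>(1))
    show "inj_on (\<lambda>x. q (x, \<zero>\<^bsub>Z'\<^esub>)) (carrier P)"
      unfolding lmap_inj_on_iff[OF qP]
    proof (intro ballI impI)
      fix x assume x: "x \<in> carrier P" "q (x, \<zero>\<^bsub>Z'\<^esub>) = \<zero>\<^bsub>T\<^esub>"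
      then have "(x, \<zero>\<^bsub>Z'\<^esub>) \<in> N" using q0[of "(x, \<zero>\<^bsub>Z'\<^esub>)"] by simp
      then obtain y where y: "y \<in> carrier Y'" "x = y" "\<zero>\<^bsub>Z'\<^esub> = \<zero>\<^bsub>Z'\<^esub> \<ominus>\<^bsub>Z'\<^esub> j y" by (auto simp: N_def)
      then show "x = \<zero>\<^bsub>P\<^esub>" using neg[OF jc[OF y(1)]] jz[OF y(1)] by simp
    qed
    show "\<pi> ` carrier T = carrier ?X"
    proof
      show "\<pi> ` carrier T \<subseteq> carrier ?X" using lmap_closed[OF \<pi>(1)] by auto
      show "carrier ?X \<subseteq> \<pi> ` carrier T"
      proof
        fix x assume "x \<in> carrier ?X"
        then obtain z where z: "z \<in> carrier Z'" "x = ?c z" using sesD(4)[OF sX] by auto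
        then show "x \<in> \<pi> ` carrier T"
          using \<pi>(2)[of "(\<zero>\<^bsub>P\<^esub>, z)"] lmap_closed[OF qZ z(1)] by force
      qed
    qed
    fix t assume t: "t \<in> carrier T"
    obtain x z where xz: "x \<in> carrier P" "z \<in> carrier Z'" "t = q (x, z)" using Tex[OF t] by blast
    have "\<pi> t = \<zero>\<^bsub>?X\<^esub> \<longleftrightarrow> z \<in> j ` carrier Y'" using \<pi>(2)[of "(x, z)"] sesD(5)[OF sX xz(2)] xz by simp
    also have "\<dots> \<longleftrightarrow> t \<in> (\<lambda>x. q (x, \<zero>\<^bsub>Z'\<^esub>)) ` carrier P"
    proof
      assume "z \<in> j ` carrier Y'"
      then obtain y where y: "y \<in> carrier Y'" "z = j y" by auto
      have yP: "y \<in> carrier P" using y by (simp add: cY')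
      have "(x \<oplus>\<^bsub>P\<^esub> y, \<zero>\<^bsub>Z'\<^esub>) = (x, z) \<oplus>\<^bsub>?PZ\<^esub> (y, \<zero>\<^bsub>Z'\<^esub> \<ominus>\<^bsub>Z'\<^esub> j y)"
        using y jc by (simp add: a_minus_def Z'.r_neg)
      moreover have "(y, \<zero>\<^bsub>Z'\<^esub> \<ominus>\<^bsub>Z'\<^esub> j y) \<in> N" using y by (auto simp: N_def)
      ultimately have "q (x \<oplus>\<^bsub>P\<^esub> y, \<zero>\<^bsub>Z'\<^esub>) = t"
        using lmap_add[OF q, of "(x, z)" "(y, \<zero>\<^bsub>Z'\<^esub> \<ominus>\<^bsub>Z'\<^esub> j y)"] q0[of "(y, \<zero>\<^bsub>Z'\<^esub> \<ominus>\<^bsub>Z'\<^esub> j y)"] xz yP y jc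
          lmap_closed[OF q, of "(x, z)"] by (simp del: prod_module_simps(3))
      then show "t \<in> (\<lambda>x. q (x, \<zero>\<^bsub>Z'\<^esub>)) ` carrier P" using xz(1) yP by force
    next
      assume "t \<in> (\<lambda>x. q (x, \<zero>\<^bsub>Z'\<^esub>)) ` carrier P"
      then obtain w where w: "w \<in> carrier P" "t = q (w, \<zero>\<^bsub>Z'\<^esub>)" by auto
      then have "\<pi> t = ?c \<zero>\<^bsub>Z'\<^esub>" using \<pi>(2)[of "(w, \<zero>\<^bsub>Z'\<^esub>)"] by simp
      then have "\<pi> t = \<zero>\<^bsub>?X\<^esub>" using lmap_zero[OF sesD(2)[OF sX]] by simp
      then show "z \<in> j ` carrier Y'" using \<pi>(2)[of "(x, z)"] sesD(5)[OF sX xz(2)] xz by simp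
    qed
    finally show "\<pi> t = \<zero>\<^bsub>?X\<^esub> \<longleftrightarrow> t \<in> (\<lambda>x. q (x, \<zero>\<^bsub>Z'\<^esub>)) ` carrier P" .
  qed
  have exT: "exv k T" for k using exv_middle[OF sTX exP exQ] .
  have fgT: "fin_gen R T"
  proof -
    obtain A where aA: "finite A" "A \<subseteq> carrier P" "\<And>K. \<lbrakk>submodule K R P; A \<subseteq> K\<rbrakk> \<Longrightarrow> K = carrier P"
      by (rule fin_genE[OF fgP]) blast
    obtain D where D: "finite D" "D \<subseteq> carrier Z'" "\<And>K. \<lbrakk>submodule K R Z'; D \<subseteq> K\<rbrakk> \<Longrightarrow> K = carrier Z'"
      by (rule fin_genE[OF zc_fin_gen[OF Z']]) blast
    let ?G = "(\<lambda>x. q (x, \<zero>\<^bsub>Z'\<^esub>)) ` A \<union> (\<lambda>z. q (\<zero>\<^bsub>P\<^esub>, z)) ` D"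
    have "K = carrier T" if K: "submodule K R T" "?G \<subseteq> K" for K
    proof -
      have 1: "{x \<in> carrier P. q (x, \<zero>\<^bsub>Z'\<^esub>) \<in> K} = carrier P"
        using K aA(2) by (intro aA(3) submodule_vimage[OF qP]) auto
      have 2: "{z \<in> carrier Z'. q (\<zero>\<^bsub>P\<^esub>, z) \<in> K} = carrier Z'"
        using K D(2) by (intro D(3) submodule_vimage[OF qZ]) auto
      have "t \<in> K" if t: "t \<in> carrier T" for t
      proof -
        obtain x z where xz: "x \<in> carrier P" "z \<in> carrier Z'" "t = q (x, z)" using Tex[OF t] by blast
        have "t = q (x, \<zero>\<^bsub>Z'\<^esub>) \<oplus>\<^bsub>T\<^esub> q (\<zero>\<^bsub>P\<^esub>, z)"
          using lmap_add[OF q, of "(x, \<zero>\<^bsub>Z'\<^esub>)" "(\<zero>\<^bsub>P\<^esub>, z)"] xz by simp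
        moreover have "q (x, \<zero>\<^bsub>Z'\<^esub>) \<in> K" "q (\<zero>\<^bsub>P\<^esub>, z) \<in> K" using 1 2 xz by auto
        ultimately show ?thesis using K(1) T.submodule_iff by simp
      qed
      then show ?thesis using submodule_subset[OF T K(1)] by blast
    qed
    moreover have "?G \<subseteq> carrier T" using lmap_closed[OF qP] lmap_closed[OF qZ] aA(2) D(2) by auto
    ultimately show ?thesis unfolding fin_gen_def using aA(1) D(1) by (intro exI[of _ ?G]) blast
  qed
  obtain c f where f: "good_embedding R C T c f" by (rule good_embedding_exists[OF fgT exT])
  let ?C = "power_module C c"
  have lf: "lmap R T ?C f" "inj_on f (carrier T)" using f unfolding good_embedding_def by auto
  note fP = lmap_comp[OF qP lf(1)] and fZ = lmap_comp[OF qZ lf(1)]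
  have f0: "f t = \<zero>\<^bsub>?C\<^esub> \<longleftrightarrow> t = \<zero>\<^bsub>T\<^esub>" if "t \<in> carrier T" for t
    using lmap_inj_on_iff[OF lf(1)] lf(2) that lmap_zero[OF lf(1)] by auto
  have injZ: "inj_on (\<lambda>z. f (q (\<zero>\<^bsub>P\<^esub>, z))) (carrier Z')"
    unfolding lmap_inj_on_iff[OF fZ]
  proof (intro ballI impI)
    fix z assume z: "z \<in> carrier Z'" "f (q (\<zero>\<^bsub>P\<^esub>, z)) = \<zero>\<^bsub>?C\<^esub>"
    then have "(\<zero>\<^bsub>P\<^esub>, z) \<in> N" using f0[OF lmap_closed[OF qZ z(1)]] q0[of "(\<zero>\<^bsub>P\<^esub>, z)"] by simp
    then obtain y where y: "y \<in> carrier Y'" "\<zero>\<^bsub>P\<^esub> = y" "z = \<zero>\<^bsub>Z'\<^esub> \<ominus>\<^bsub>Z'\<^esub> j y" by (auto simp: N_def)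
    then show "z = \<zero>\<^bsub>Z'\<^esub>" using neg[OF jc[OF y(1)]] jz[OF y(1)] by simp
  qed
  let ?I = "(\<lambda>z. f (q (\<zero>\<^bsub>P\<^esub>, z))) ` carrier Z'"
  note sZ0 = ses_quot_range[OF fZ injZ]
  obtain Z :: "('r, nat \<Rightarrow> 'c) module" and \<phi> where \<phi>: "lmap R (quot_module ?C ?I) Z \<phi>"
    "bij_betw \<phi> (carrier (quot_module ?C ?I)) (carrier Z)"
    by (rule transport_surj[OF sesD(2,4)[OF sZ0]])
  define p where "p x = \<phi> (?I +>\<^bsub>?C\<^esub> x)" for x
  have p: "lmap R ?C Z p" unfolding p_def[abs_def] using lmap_comp[OF sesD(2)[OF sZ0] \<phi>(1)] .
  have p_surj: "p ` carrier ?C = carrier Z"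
    using sesD(4)[OF sZ0] \<phi>(2) unfolding bij_betw_def p_def[abs_def] by (metis image_image)
  have p0: "p x = \<zero>\<^bsub>Z\<^esub> \<longleftrightarrow> x \<in> ?I" if x: "x \<in> carrier ?C" for x
    using sesD(5)[OF sZ0 x] lmap_inj_on_iff[OF \<phi>(1)] \<phi>(2) lmap_zero[OF \<phi>(1)] lmap_closed[OF sesD(2)[OF sZ0] x]
    unfolding bij_betw_def p_def by metis
  \<comment> \<open>\<open>Z\<close> is the power of \<open>C\<close> modulo the copy of
    \<open>Z'\<close> inside \<open>T\<close>, which prolongs the \<open>add C\<close>-resolution of
    \<open>Z'\<close> by one term.\<close>
  have sZ: "ses R Z' (\<lambda>z. f (q (\<zero>\<^bsub>P\<^esub>, z))) ?C p Z"
    unfolding ses_def using fZ p injZ p_surj p0 by blast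
  have zcZ: "zc R C (Suc m) Z" using sZ sumd_power[OF C_module] Z' by auto
  note pfP = lmap_comp[OF fP p]
  \<comment> \<open>The kernel of \<open>P \<rightarrow> Z\<close> is \<open>Y'\<close>, so this map
    factors through an embedding of \<open>Y\<close>, which is \<open>P\<close> modulo
    \<open>Y'\<close>.\<close>
  have pf0: "p (f (q (x, \<zero>\<^bsub>Z'\<^esub>))) = \<zero>\<^bsub>Z\<^esub> \<longleftrightarrow> e x = \<zero>\<^bsub>Y\<^esub>" if x: "x \<in> carrier P" for x
  proof
    assume "p (f (q (x, \<zero>\<^bsub>Z'\<^esub>))) = \<zero>\<^bsub>Z\<^esub>"
    then obtain z where z: "z \<in> carrier Z'" "f (q (x, \<zero>\<^bsub>Z'\<^esub>)) = f (q (\<zero>\<^bsub>P\<^esub>, z))"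
      using p0[OF lmap_closed[OF fP x]] by auto
    then have "q (x, \<zero>\<^bsub>Z'\<^esub>) = q (\<zero>\<^bsub>P\<^esub>, z)" using lf(2) lmap_closed[OF qP x] lmap_closed[OF qZ z(1)] by (auto dest: inj_onD)
    then have "(x, \<zero>\<^bsub>Z'\<^esub>) \<ominus>\<^bsub>?PZ\<^esub> (\<zero>\<^bsub>P\<^esub>, z) \<in> N"
      using lmap_eq_iff[OF q, of "(x, \<zero>\<^bsub>Z'\<^esub>)" "(\<zero>\<^bsub>P\<^esub>, z)"] x z(1) q0 PZ.minus_closed[of "(x, \<zero>\<^bsub>Z'\<^esub>)" "(\<zero>\<^bsub>P\<^esub>, z)"] by simp
    then have "fst ((x, \<zero>\<^bsub>Z'\<^esub>) \<ominus>\<^bsub>?PZ\<^esub> (\<zero>\<^bsub>P\<^esub>, z)) \<in> carrier Y'" by (auto simp: N_def)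
    then show "e x = \<zero>\<^bsub>Y\<^esub>"
      using lmap_minus[OF lmap_fst[OF P Z'M], of "(x, \<zero>\<^bsub>Z'\<^esub>)" "(\<zero>\<^bsub>P\<^esub>, z)"] x z(1) by (simp add: cY')
  next
    assume "e x = \<zero>\<^bsub>Y\<^esub>"
    then have y: "x \<in> carrier Y'" using x by (simp add: cY')
    have "(x, \<zero>\<^bsub>Z'\<^esub>) = (x, \<zero>\<^bsub>Z'\<^esub> \<ominus>\<^bsub>Z'\<^esub> j x) \<oplus>\<^bsub>?PZ\<^esub> (\<zero>\<^bsub>P\<^esub>, j x)"
      using x jc[OF y] by (simp add: Z'.minus_add_cancel)
    moreover have "(x, \<zero>\<^bsub>Z'\<^esub> \<ominus>\<^bsub>Z'\<^esub> j x) \<in> N" using y by (auto simp: N_def)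
    ultimately have "q (x, \<zero>\<^bsub>Z'\<^esub>) = q (\<zero>\<^bsub>P\<^esub>, j x)"
      using lmap_add[OF q, of "(x, \<zero>\<^bsub>Z'\<^esub> \<ominus>\<^bsub>Z'\<^esub> j x)" "(\<zero>\<^bsub>P\<^esub>, j x)"] q0[of "(x, \<zero>\<^bsub>Z'\<^esub> \<ominus>\<^bsub>Z'\<^esub> j x)"] x jc[OF y]
        lmap_closed[OF qZ jc[OF y]] by (simp del: prod_module_simps(3))
    then show "p (f (q (x, \<zero>\<^bsub>Z'\<^esub>))) = \<zero>\<^bsub>Z\<^esub>" using p0[OF lmap_closed[OF fP x]] jc[OF y] by auto
  qed
  obtain h where h: "lmap R Y Z h" "\<And>x. x \<in> carrier P \<Longrightarrow> h (e x) = p (f (q (x, \<zero>\<^bsub>Z'\<^esub>)))"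
    by (rule lmap_factor_surj[OF e pfP]) (use pf0 in auto)
  have injh: "inj_on h (carrier Y)"
    unfolding lmap_inj_on_iff[OF h(1)]
  proof (intro ballI impI)
    fix y assume y: "y \<in> carrier Y" "h y = \<zero>\<^bsub>Z\<^esub>"
    then obtain x where x: "x \<in> carrier P" "y = e x" using e(2) by auto
    then show "y = \<zero>\<^bsub>Y\<^esub>" using y h(2) pf0 by simp
  qed
  let ?Q = "quot_module Z (h ` carrier Y)"
  note sQ = ses_quot_range[OF h(1) injh]
  \<comment> \<open>The cokernel of the embedding of \<open>Y\<close> is the power of
    \<open>C\<close> modulo \<open>T\<close>, hence perpendicular because \<open>f\<close> is a good
    embedding of the perpendicular module \<open>T\<close>.\<close>
  have sTQ: "ses R T f ?C (\<lambda>x. (h ` carrier Y) +>\<^bsub>Z\<^esub> (p x)) ?Q"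
    unfolding ses_def
  proof (intro conjI ballI lf lmap_comp[OF p sesD(2)[OF sQ]])
    show "(\<lambda>x. (h ` carrier Y) +>\<^bsub>Z\<^esub> (p x)) ` carrier ?C = carrier ?Q"
      using sesD(4)[OF sQ] p_surj by (metis image_image)
    fix x assume x: "x \<in> carrier ?C"
    interpret CC: right_module R ?C using lmap_tgt[OF lf(1)] .
    have "(h ` carrier Y) +>\<^bsub>Z\<^esub> (p x) = \<zero>\<^bsub>?Q\<^esub> \<longleftrightarrow> p x \<in> h ` carrier Y"
      using sesD(5)[OF sQ lmap_closed[OF p x]] .
    also have "\<dots> \<longleftrightarrow> x \<in> f ` carrier T"
    proof
      assume "p x \<in> h ` carrier Y"
      then obtain y where y: "y \<in> carrier Y" "p x = h y" by blast
      then have "y \<in> e ` carrier P" using e(2) by simp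
      then obtain w where w: "w \<in> carrier P" "p x = p (f (q (w, \<zero>\<^bsub>Z'\<^esub>)))" using y(2) h(2) by auto
      have wc: "f (q (w, \<zero>\<^bsub>Z'\<^esub>)) \<in> carrier ?C" using lmap_closed[OF fP w(1)] .
      then have "x \<ominus>\<^bsub>?C\<^esub> f (q (w, \<zero>\<^bsub>Z'\<^esub>)) \<in> ?I"
        using w(2) lmap_eq_iff[OF p x wc] p0[OF CC.minus_closed[OF x wc]] by simp
      then obtain z where z: "z \<in> carrier Z'" "x \<ominus>\<^bsub>?C\<^esub> f (q (w, \<zero>\<^bsub>Z'\<^esub>)) = f (q (\<zero>\<^bsub>P\<^esub>, z))" by auto
      have "x = f (q (\<zero>\<^bsub>P\<^esub>, z)) \<oplus>\<^bsub>?C\<^esub> f (q (w, \<zero>\<^bsub>Z'\<^esub>))"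
        using z(2) CC.minus_eq_iff[OF x wc lmap_closed[OF fZ z(1)]] by simp
      also have "\<dots> = f (q (\<zero>\<^bsub>P\<^esub>, z) \<oplus>\<^bsub>T\<^esub> q (w, \<zero>\<^bsub>Z'\<^esub>))"
        using lmap_add[OF lf(1) lmap_closed[OF qZ z(1)] lmap_closed[OF qP w(1)]] by simp
      finally show "x \<in> f ` carrier T" using lmap_closed[OF qZ z(1)] lmap_closed[OF qP w(1)] by blast
    next
      assume "x \<in> f ` carrier T"
      then obtain t where t: "t \<in> carrier T" "x = f t" by blast
      obtain u z where uz: "u \<in> carrier P" "z \<in> carrier Z'" "x = f (q (u, z))" using Tex[OF t(1)] t(2) by blast
      have "q (u, z) = q (u, \<zero>\<^bsub>Z'\<^esub>) \<oplus>\<^bsub>T\<^esub> q (\<zero>\<^bsub>P\<^esub>, z)"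
        using lmap_add[OF q, of "(u, \<zero>\<^bsub>Z'\<^esub>)" "(\<zero>\<^bsub>P\<^esub>, z)"] uz by simp
      then have "x = f (q (u, \<zero>\<^bsub>Z'\<^esub>)) \<oplus>\<^bsub>?C\<^esub> f (q (\<zero>\<^bsub>P\<^esub>, z))"
        using lmap_add[OF lf(1) lmap_closed[OF qP uz(1)] lmap_closed[OF qZ uz(2)]] uz(3) by simp
      then have "p x = p (f (q (u, \<zero>\<^bsub>Z'\<^esub>)))"
        using lmap_add[OF p lmap_closed[OF fP uz(1)] lmap_closed[OF fZ uz(2)]] p0[OF lmap_closed[OF fZ uz(2)]] uz(2)
          lmap_closed[OF pfP uz(1)] right_module.axioms(2)[OF lmap_tgt[OF p]]
        by (simp add: abelian_group_def abelian_monoid.r_zero)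
      then show "p x \<in> h ` carrier Y" using h(2)[OF uz(1)] lmap_closed[OF e(1) uz(1)] by (metis imageI)
    qed
    finally show "(h ` carrier Y) +>\<^bsub>Z\<^esub> (p x) = \<zero>\<^bsub>?Q\<^esub> \<longleftrightarrow> x \<in> f ` carrier T" .
  qed
  have "exv k ?Q" for k
    using exv_quotient[OF sTQ exT exv_sumd_C[OF sumd_power[OF C_module]]] f unfolding good_embedding_def by blast
  with zcZ h(1) injh show ?case by blast
qed

end

section \<open>Enough injectives on a fixed type\<close>

definition int_ring :: "int ring" where
  "int_ring = \<lparr>carrier = UNIV, mult = (*), one = 1, zero = 0, add = (+)\<rparr>"

lemma int_ring_simps [simp]:
  "carrier int_ring = UNIV" "\<one>\<^bsub>int_ring\<^esub> = 1" "\<zero>\<^bsub>int_ring\<^esub> = 0" "x \<oplus>\<^bsub>int_ring\<^esub> y = x + y" "x \<otimes>\<^bsub>int_ring\<^esub> y = x * y"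
  by (simp_all add: int_ring_def)

lemma ring_int: "ring int_ring"
  by (intro ringI abelian_groupI monoidI) (auto simp: algebra_simps intro: exI[of _ "- _"])

text \<open>Additivity gives compatibility with integer multiples, by induction in both directions
  from zero.\<close>

lemma additive_lmap:
  assumes M: "right_module int_ring M" and N: "right_module int_ring N"
    and cl: "\<And>x. x \<in> carrier M \<Longrightarrow> f x \<in> carrier N"
    and add: "\<And>x y. \<lbrakk>x \<in> carrier M; y \<in> carrier M\<rbrakk> \<Longrightarrow> f (x \<oplus>\<^bsub>M\<^esub> y) = f x \<oplus>\<^bsub>N\<^esub> f y"
  shows "lmap int_ring M N f"
proof -
  interpret M: right_module int_ring M by fact
  interpret N: right_module int_ring N by fact
  have sM: "k \<odot>\<^bsub>M\<^esub> x \<in> carrier M" if "x \<in> carrier M" for k x using M.smult_closed[of k x] that by simp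
  have sN: "k \<odot>\<^bsub>N\<^esub> x \<in> carrier N" if "x \<in> carrier N" for k x using N.smult_closed[of k x] that by simp
  have M1: "(k + 1) \<odot>\<^bsub>M\<^esub> x = k \<odot>\<^bsub>M\<^esub> x \<oplus>\<^bsub>M\<^esub> x" if "x \<in> carrier M" for k x
    using M.smult_l_distr[of k 1 x] M.smult_one[of x] that by simp
  have N1: "(k + 1) \<odot>\<^bsub>N\<^esub> x = k \<odot>\<^bsub>N\<^esub> x \<oplus>\<^bsub>N\<^esub> x" if "x \<in> carrier N" for k x
    using N.smult_l_distr[of k 1 x] N.smult_one[of x] that by simp
  have "f (k \<odot>\<^bsub>M\<^esub> x) = k \<odot>\<^bsub>N\<^esub> f x" if x: "x \<in> carrier M" for k x
  proof (induction k rule: int_induct[where k=0])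
    case base
    have "f \<zero>\<^bsub>M\<^esub> \<oplus>\<^bsub>N\<^esub> f \<zero>\<^bsub>M\<^esub> = f \<zero>\<^bsub>M\<^esub>" using add[of "\<zero>\<^bsub>M\<^esub>" "\<zero>\<^bsub>M\<^esub>"] by simp
    then have "f \<zero>\<^bsub>M\<^esub> = \<zero>\<^bsub>N\<^esub>" using cl[of "\<zero>\<^bsub>M\<^esub>"] by (simp add: N.add.r_cancel_one)
    then show ?case using M.smult_l_null[OF x] N.smult_l_null[OF cl[OF x]] by simp
  next
    case (step1 k)
    then show ?case using M1[OF x] N1[OF cl[OF x]] add[OF sM[OF x] x] by simp
  next
    case (step2 k)
    have "f ((k - 1) \<odot>\<^bsub>M\<^esub> x) \<oplus>\<^bsub>N\<^esub> f x = (k - 1) \<odot>\<^bsub>N\<^esub> f x \<oplus>\<^bsub>N\<^esub> f x"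
      using M1[OF x, of "k - 1"] N1[OF cl[OF x], of "k - 1"] add[OF sM[OF x, of "k - 1"] x] step2 by simp
    then show ?case using cl[OF sM[OF x]] sN[OF cl[OF x]] cl[OF x] by simp
  qed
  then show ?thesis unfolding lmap_def using assms by auto
qed

definition int_module :: "('r, 'm) module \<Rightarrow> (int, 'm) module" where
  "int_module M = \<lparr>carrier = carrier M, mult = undefined, one = undefined, zero = \<zero>\<^bsub>M\<^esub>,
     add = (\<oplus>\<^bsub>M\<^esub>), smult = (\<lambda>k x. [k] \<cdot>\<^bsub>M\<^esub> x)\<rparr>"

lemma int_module_simps [simp]:
  "carrier (int_module M) = carrier M" "\<zero>\<^bsub>int_module M\<^esub> = \<zero>\<^bsub>M\<^esub>" "x \<oplus>\<^bsub>int_module M\<^esub> y = x \<oplus>\<^bsub>M\<^esub> y"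
  "k \<odot>\<^bsub>int_module M\<^esub> x = [k] \<cdot>\<^bsub>M\<^esub> x"
  by (simp_all add: int_module_def)

lemma right_module_int:
  assumes "right_module R M"
  shows "right_module int_ring (int_module M)"
proof -
  interpret M: right_module R M by fact
  have "add_pow M (0::int) x = \<zero>\<^bsub>M\<^esub>" for x by (simp add: add_pow_def)
  then show ?thesis
    by (intro right_moduleI)
      (auto simp: ring_int M.a_ac M.add.int_pow_mult M.add.int_pow_distrib M.add.int_pow_pow mult.commute)
qed

text \<open>A nonzero ideal of the integers is generated by its least positive element
  \<open>k\<close>; dividing the value at \<open>k\<close> by \<open>k\<close> inside
  \<open>D\<close> gives the multiplier.\<close>

lemma baer_int:
  assumes D: "right_module int_ring D"
    and div: "\<And>x k. \<lbrakk>x \<in> carrier D; k > 0\<rbrakk> \<Longrightarrow> \<exists>y\<in>carrier D. k \<odot>\<^bsub>D\<^esub> y = x"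
  shows "baer int_ring D"
  unfolding baer_def
proof (intro conjI allI impI D, elim conjE)
  interpret D: right_module int_ring D by (rule D)
  let ?Z = "regular_module int_ring"
  have Z: "right_module int_ring ?Z" by (rule right_module_regular[OF ring_int])
  interpret Z: right_module int_ring ?Z by (rule Z)
  fix I f assume I: "submodule I int_ring ?Z" and f: "lmap int_ring (?Z\<lparr>carrier := I\<rparr>) D f"
  have IZ: "0 \<in> I" "\<And>x y. \<lbrakk>x \<in> I; y \<in> I\<rbrakk> \<Longrightarrow> x + y \<in> I" "\<And>k x. x \<in> I \<Longrightarrow> x * k \<in> I"
    using I unfolding Z.submodule_iff by auto
  have f0: "f 0 = \<zero>\<^bsub>D\<^esub>" using lmap_zero[OF f] by simp
  show "\<exists>e\<in>carrier D. \<forall>r\<in>I. f r = r \<odot>\<^bsub>D\<^esub> e"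
  proof (cases "\<exists>k\<in>I. k > 0")
    case False
    have "r = 0" if "r \<in> I" for r
      using False that IZ(3)[OF that, of "-1"] by (metis linorder_neqE_linordered_idom mult.right_neutral mult_minus_right neg_0_less_iff_less)
    then show ?thesis using f0 by (intro bexI[of _ "\<zero>\<^bsub>D\<^esub>"]) auto
  next
    case True
    define k where "k = (LEAST k. int k \<in> I \<and> k > 0)"
    obtain k0 where "k0 \<in> I" "k0 > 0" using True by auto
    then have "int (nat k0) \<in> I \<and> nat k0 > 0" by simp
    then have k: "int k \<in> I" "k > 0" unfolding k_def using LeastI[of "\<lambda>k. int k \<in> I \<and> k > 0" "nat k0"] by blast+
    have least: "k \<le> l" if "int l \<in> I" "l > 0" for l unfolding k_def using that by (intro Least_le) simp
    have dvd: "int k dvd r" if r: "r \<in> I" for r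
    proof -
      have "r mod int k = r + int k * (- (r div int k))" by (simp add: minus_mult_div_eq_mod[symmetric])
      then have "r mod int k \<in> I" using IZ(2)[OF r IZ(3)[OF k(1), of "- (r div int k)"]] by simp
      moreover have "0 \<le> r mod int k" "r mod int k < int k" using k by simp_all
      ultimately have "r mod int k = 0" using least[of "nat (r mod int k)"] by (cases "r mod int k = 0") auto
      then show ?thesis by auto
    qed
    obtain e where e: "e \<in> carrier D" "int k \<odot>\<^bsub>D\<^esub> e = f (int k)"
      using div[of "f (int k)" "int k"] k lmap_closed[OF f] by auto
    have "f r = r \<odot>\<^bsub>D\<^esub> e" if r: "r \<in> I" for r
    proof -
      obtain l where l: "r = int k * l" using dvd[OF r] by auto
      then show ?thesis using lmap_smult[OF f, of l "int k"] k e D.smult_assoc[of "int k" l e] by simp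
    qed
    with e(1) show ?thesis by blast
  qed
qed

text \<open>The rational vector space with basis \<open>A\<close>, as a module over the integers;
  finite supports and countable coefficients are what allow it to be coded later.\<close>

definition rat_free :: "'m set \<Rightarrow> (int, 'm \<Rightarrow> rat) module" where
  "rat_free A = \<lparr>carrier = {f. finite {x. f x \<noteq> 0} \<and> {x. f x \<noteq> 0} \<subseteq> A}, mult = undefined, one = undefined,
     zero = (\<lambda>x. 0), add = (\<lambda>f g x. f x + g x), smult = (\<lambda>k f x. of_int k * f x)\<rparr>"

lemma rat_free_simps [simp]:
  "carrier (rat_free A) = {f. finite {x. f x \<noteq> 0} \<and> {x. f x \<noteq> 0} \<subseteq> A}" "\<zero>\<^bsub>rat_free A\<^esub> = (\<lambda>x. 0)"
  "f \<oplus>\<^bsub>rat_free A\<^esub> g = (\<lambda>x. f x + g x)" "k \<odot>\<^bsub>rat_free A\<^esub> f = (\<lambda>x. of_int k * f x)"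
  by (simp_all add: rat_free_def)

lemma right_module_rat_free: "right_module int_ring (rat_free A)"
proof -
  have 1: "finite {x. f x + g x \<noteq> 0}" "{x. f x + g x \<noteq> 0} \<subseteq> A"
    if "finite {x. f x \<noteq> 0}" "finite {x. g x \<noteq> 0}" "{x. f x \<noteq> 0} \<subseteq> A" "{x. g x \<noteq> 0} \<subseteq> A" for f g :: "'a \<Rightarrow> rat"
  proof -
    have "{x. f x + g x \<noteq> 0} \<subseteq> {x. f x \<noteq> 0} \<union> {x. g x \<noteq> 0}" by auto
    with that show "finite {x. f x + g x \<noteq> 0}" "{x. f x + g x \<noteq> 0} \<subseteq> A" by (auto intro: finite_subset)
  qed
  have 2: "finite {x. of_int k * f x \<noteq> 0}" if "finite {x. f x \<noteq> 0}" for f :: "'a \<Rightarrow> rat" and k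
    using that by (rule rev_finite_subset) auto
  show ?thesis
    by (rule right_moduleI) (use 1 2 in \<open>auto simp: ring_int algebra_simps fun_eq_iff\<close>)
qed

text \<open>The divisible hull is a quotient of a free \<open>\<rat>\<close>-module, not a product of copies of \<open>\<rat>/\<int>\<close>, since
  the latter would be too large for the type.\<close>

lemma divisible_hull:
  fixes M :: "(int, 'm) module"
  assumes M: "right_module int_ring M"
  obtains K \<iota> where "submodule K int_ring (rat_free (carrier M))"
    "baer int_ring (quot_module (rat_free (carrier M)) K)"
    "lmap int_ring M (quot_module (rat_free (carrier M)) K) \<iota>" "inj_on \<iota> (carrier M)"
proof -
  let ?Z = "int_ring" and ?G = "rat_free (carrier M)" and ?F = "free_module int_ring (carrier M)"
  have G: "right_module ?Z ?G" by (rule right_module_rat_free)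
  have F: "right_module ?Z ?F" by (rule right_module_free[OF ring_int])
  interpret M: right_module ?Z M by (rule M)
  define l where "l = lin_ext ?Z M (\<lambda>x. x)"
  have l: "lmap ?Z ?F M l" unfolding l_def by (rule lmap_lin_ext[OF M]) simp
  have l_surj: "l ` carrier ?F = carrier M"
  proof
    show "carrier M \<subseteq> l ` carrier ?F"
    proof
      fix x assume x: "x \<in> carrier M"
      then show "x \<in> l ` carrier ?F"
        using lin_ext_delta[OF M, of "\<lambda>x. x" x] delta_in_free[OF ring_int x] unfolding l_def by force
    qed
  qed (use lmap_closed[OF l] in auto)
  \<comment> \<open>\<open>r\<close> includes the free abelian group in the rational vector space on
    the same basis. Dividing both by the relations of \<open>M\<close> embeds \<open>M\<close> into
    a divisible group.\<close>
  define r where "r f = (\<lambda>x. of_int (f x) :: rat)" for f :: "'m \<Rightarrow> int"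
  have r: "lmap ?Z ?F ?G r"
    unfolding lmap_def using F G by (auto simp: r_def free_module_simps mult.commute)
  define K where "K = r ` {f \<in> carrier ?F. l f = \<zero>\<^bsub>M\<^esub>}"
  have K: "submodule K ?Z ?G" unfolding K_def by (rule submodule_image[OF r submodule_kernel[OF l]])
  let ?D = "quot_module ?G K"
  note s = ses_quot_module[OF G K]
  have D: "right_module ?Z ?D" using lmap_tgt[OF sesD(2)[OF s]] .
  have baer: "baer ?Z ?D"
  proof (rule baer_int[OF D])
    fix x k assume x: "x \<in> carrier ?D" and k: "(k::int) > 0"
    then have "x \<in> (\<lambda>x. K +>\<^bsub>?G\<^esub> x) ` carrier ?G" using sesD(4)[OF s] by simp
    then obtain g where g: "g \<in> carrier ?G" "x = K +>\<^bsub>?G\<^esub> g" by blast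
    define h where "h = (\<lambda>x. g x / of_int k)"
    have h: "h \<in> carrier ?G" "k \<odot>\<^bsub>?G\<^esub> h = g" using g k by (auto simp: h_def)
    show "\<exists>y\<in>carrier ?D. k \<odot>\<^bsub>?D\<^esub> y = x"
      using lmap_smult[OF sesD(2)[OF s] _ h(1), of k] lmap_closed[OF sesD(2)[OF s] h(1)] unfolding h(2) g(2) by auto
  qed
  obtain \<iota> where \<iota>: "lmap ?Z M ?D \<iota>" "\<And>f. f \<in> carrier ?F \<Longrightarrow> \<iota> (l f) = K +>\<^bsub>?G\<^esub> (r f)"
  proof (rule lmap_factor_surj[OF l l_surj lmap_comp[OF r sesD(2)[OF s]]])
    show "K +>\<^bsub>?G\<^esub> (r f) = \<zero>\<^bsub>?D\<^esub>" if "f \<in> carrier ?F" "l f = \<zero>\<^bsub>M\<^esub>" for f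
      using sesD(5)[OF s lmap_closed[OF r that(1)]] that by (auto simp: K_def)
  qed (rule that)
  have "inj_on \<iota> (carrier M)"
    unfolding lmap_inj_on_iff[OF \<iota>(1)]
  proof (intro ballI impI)
    fix x assume x: "x \<in> carrier M" "\<iota> x = \<zero>\<^bsub>?D\<^esub>"
    then have "x \<in> l ` carrier ?F" using l_surj by simp
    then obtain f where f: "f \<in> carrier ?F" "x = l f" by blast
    then have "r f \<in> K" using sesD(5)[OF s lmap_closed[OF r f(1)]] x(2) \<iota>(2) by simp
    then obtain g where "g \<in> carrier ?F" "l g = \<zero>\<^bsub>M\<^esub>" "r f = r g" by (auto simp: K_def)
    moreover from this(3) have "f = g" by (auto simp: r_def fun_eq_iff)
    ultimately show "x = \<zero>\<^bsub>M\<^esub>" using f(2) by simp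
  qed
  with K baer \<iota>(1) that show thesis by blast
qed

text \<open>The coinduced module of additive maps \<open>R \<rightarrow> D\<close>; multiplying the
  argument on the left gives a right action on the maps.\<close>

definition coind :: "'r ring \<Rightarrow> (int, 'd) module \<Rightarrow> ('r, 'r \<Rightarrow> 'd) module" where
  "coind R D = \<lparr>carrier = mod_hom int_ring (int_module (regular_module R)) D, mult = undefined, one = undefined,
     zero = (\<lambda>s\<in>carrier R. \<zero>\<^bsub>D\<^esub>), add = (\<lambda>f g. \<lambda>s\<in>carrier R. f s \<oplus>\<^bsub>D\<^esub> g s),
     smult = (\<lambda>r f. \<lambda>s\<in>carrier R. f (r \<otimes>\<^bsub>R\<^esub> s))\<rparr>"

lemma coind_simps [simp]:
  "\<zero>\<^bsub>coind R D\<^esub> = (\<lambda>s\<in>carrier R. \<zero>\<^bsub>D\<^esub>)" "f \<oplus>\<^bsub>coind R D\<^esub> g = (\<lambda>s\<in>carrier R. f s \<oplus>\<^bsub>D\<^esub> g s)"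
  "r \<odot>\<^bsub>coind R D\<^esub> f = (\<lambda>s\<in>carrier R. f (r \<otimes>\<^bsub>R\<^esub> s))"
  by (simp_all add: coind_def)

context
  fixes R :: "'r ring" and D :: "(int, 'd) module"
  assumes R: "ring R" and D: "right_module int_ring D"
begin

private abbreviation "RZ \<equiv> int_module (regular_module R)"

private lemma RZ: "right_module int_ring RZ"
  by (rule right_module_int[OF right_module_regular[OF R]])

lemma carrier_coind: "f \<in> carrier (coind R D) \<longleftrightarrow> lmap int_ring RZ D f \<and> f \<in> extensional (carrier R)"
  by (simp add: coind_def mod_hom_iff[OF RZ D])

lemma restrict_coind: "lmap int_ring RZ D f \<Longrightarrow> restrict f (carrier R) \<in> carrier (coind R D)"
  using lmap_restrict[of int_ring RZ D f] by (simp add: carrier_coind)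

lemma lmap_lmult: "r \<in> carrier R \<Longrightarrow> lmap int_ring RZ RZ (\<lambda>s. r \<otimes>\<^bsub>R\<^esub> s)"
proof -
  interpret R: ring R by (rule R)
  assume "r \<in> carrier R"
  then show ?thesis by (intro additive_lmap RZ) (auto simp: R.r_distr)
qed

lemma coind_eqI: "\<lbrakk>f \<in> carrier (coind R D); g \<in> carrier (coind R D); \<And>s. s \<in> carrier R \<Longrightarrow> f s = g s\<rbrakk> \<Longrightarrow> f = g"
  by (auto simp: carrier_coind intro: extensionalityI)

lemma right_module_coind: "right_module R (coind R D)"
proof -
  interpret R: ring R by (rule R)
  interpret D: right_module int_ring D by (rule D)
  have cl: "f s \<in> carrier D" if "f \<in> carrier (coind R D)" "s \<in> carrier R" for f s
    using lmap_closed[of int_ring RZ D f s] that by (simp add: carrier_coind)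
  have ad: "f (s \<oplus>\<^bsub>R\<^esub> t) = f s \<oplus>\<^bsub>D\<^esub> f t" if "f \<in> carrier (coind R D)" "s \<in> carrier R" "t \<in> carrier R" for f s t
    using lmap_add[of int_ring RZ D f s t] that by (simp add: carrier_coind)
  have f0: "f \<zero>\<^bsub>R\<^esub> = \<zero>\<^bsub>D\<^esub>" if "f \<in> carrier (coind R D)" for f
    using lmap_zero[of int_ring RZ D f] that by (simp add: carrier_coind)
  have e: "restrict g (carrier R) = f" if "f \<in> carrier (coind R D)" "\<And>s. s \<in> carrier R \<Longrightarrow> g s = f s" for f g
    using that by (auto simp: carrier_coind intro!: extensionalityI[of _ "carrier R"])
  have a: "(\<lambda>s\<in>carrier R. f s \<oplus>\<^bsub>D\<^esub> g s) \<in> carrier (coind R D)" if "f \<in> carrier (coind R D)" "g \<in> carrier (coind R D)" for f g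
    using that by (intro restrict_coind lmap_plus) (auto simp: carrier_coind)
  have sm: "(\<lambda>s\<in>carrier R. f (r \<otimes>\<^bsub>R\<^esub> s)) \<in> carrier (coind R D)" if "r \<in> carrier R" "f \<in> carrier (coind R D)" for f r
    using that by (intro restrict_coind lmap_comp[OF lmap_lmult]) (auto simp: carrier_coind)
  show ?thesis
    by (rule right_moduleI)
      (auto simp: R a sm restrict_coind[OF lmap_zero_map[OF RZ D]] cl ad f0 D.a_ac R.l_distr R.r_distr R.m_assoc
        intro!: restrict_ext e)
qed

text \<open>Adjunction: an \<open>R\<close>-linear map into the coinduced module amounts to the
  additive map obtained by evaluation at \<open>\<one>\<close>, and this one extends from the ideal
  to \<open>R\<close> because \<open>D\<close> is injective over the integers.\<close>

lemma baer_coind: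
  assumes baer: "baer int_ring D"
  shows "baer R (coind R D)"
  unfolding baer_def
proof (intro conjI allI impI right_module_coind, elim conjE)
  interpret R: ring R by (rule R)
  let ?R = "regular_module R"
  fix I \<phi> assume I: "submodule I R ?R" and \<phi>: "lmap R (?R\<lparr>carrier := I\<rparr>) (coind R D) \<phi>"
  have RM: "right_module R ?R" by (rule right_module_regular[OF R])
  have IR: "I \<subseteq> carrier R" using submodule_subset[OF RM I] by simp
  have Ic: "r \<otimes>\<^bsub>R\<^esub> s \<in> I" if "r \<in> I" "s \<in> carrier R" for r s
    using I that unfolding right_module.submodule_iff[OF RM] by auto
  let ?I = "int_module (?R\<lparr>carrier := I\<rparr>)"
  have IM: "right_module int_ring ?I" by (rule right_module_int[OF lmap_src[OF \<phi>]])
  have i: "lmap int_ring ?I RZ (\<lambda>x. x)" using IR by (intro additive_lmap IM RZ) auto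
  have \<phi>c: "lmap int_ring RZ D (\<phi> r)" if "r \<in> I" for r
    using lmap_closed[OF \<phi>, of r] that by (simp add: carrier_coind)
  have \<phi>1: "lmap int_ring ?I D (\<lambda>r. \<phi> r \<one>\<^bsub>R\<^esub>)"
  proof (rule additive_lmap[OF IM D])
    show "\<phi> x \<one>\<^bsub>R\<^esub> \<in> carrier D" if "x \<in> carrier ?I" for x using lmap_closed[OF \<phi>c, of x "\<one>\<^bsub>R\<^esub>"] that by simp
    show "\<phi> (x \<oplus>\<^bsub>?I\<^esub> y) \<one>\<^bsub>R\<^esub> = \<phi> x \<one>\<^bsub>R\<^esub> \<oplus>\<^bsub>D\<^esub> \<phi> y \<one>\<^bsub>R\<^esub>" if "x \<in> carrier ?I" "y \<in> carrier ?I" for x y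
      using lmap_add[OF \<phi>, of x y] that by simp
  qed
  obtain \<psi> where \<psi>: "lmap int_ring RZ D \<psi>" "\<And>r. r \<in> I \<Longrightarrow> \<psi> r = \<phi> r \<one>\<^bsub>R\<^esub>"
    by (rule baer_extend[OF baer i _ \<phi>1]) (auto simp: inj_on_def)
  have "\<phi> r = r \<odot>\<^bsub>coind R D\<^esub> restrict \<psi> (carrier R)" if r: "r \<in> I" for r
  proof (rule coind_eqI)
    show "\<phi> r \<in> carrier (coind R D)" using lmap_closed[OF \<phi>, of r] r by simp
    show "r \<odot>\<^bsub>coind R D\<^esub> restrict \<psi> (carrier R) \<in> carrier (coind R D)"
      using right_module.smult_closed[OF right_module_coind _ restrict_coind[OF \<psi>(1)]] r IR by blast
    fix s assume s: "s \<in> carrier R"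
    have "\<phi> (r \<otimes>\<^bsub>R\<^esub> s) = s \<odot>\<^bsub>coind R D\<^esub> \<phi> r" using lmap_smult[OF \<phi> s, of r] r by simp
    then have "\<phi> (r \<otimes>\<^bsub>R\<^esub> s) \<one>\<^bsub>R\<^esub> = \<phi> r s" using s by simp
    then show "\<phi> r s = (r \<odot>\<^bsub>coind R D\<^esub> restrict \<psi> (carrier R)) s" using s r IR Ic[OF r s] \<psi>(2) by auto
  qed
  then show "\<exists>e\<in>carrier (coind R D). \<forall>r\<in>I. \<phi> r = r \<odot>\<^bsub>coind R D\<^esub> e" using restrict_coind[OF \<psi>(1)] by blast
qed

text \<open>Send \<open>m\<close> to the additive map \<open>s \<mapsto> \<iota> (m s)\<close>;
  evaluation at \<open>\<one>\<close> recovers \<open>\<iota> m\<close>, which gives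
  injectivity.\<close>

lemma coind_embed:
  assumes M: "right_module R M" and \<iota>: "lmap int_ring (int_module M) D \<iota>" "inj_on \<iota> (carrier M)"
  obtains j where "lmap R M (coind R D) j" "inj_on j (carrier M)"
proof -
  interpret M: right_module R M by (rule M)
  define j where "j m = restrict (\<lambda>s. \<iota> (s \<odot>\<^bsub>M\<^esub> m)) (carrier R)" for m
  have orb: "lmap int_ring RZ (int_module M) (\<lambda>s. s \<odot>\<^bsub>M\<^esub> m)" if "m \<in> carrier M" for m
    using that by (intro additive_lmap RZ right_module_int[OF M]) (auto simp: M.smult_closed M.smult_l_distr)
  have "lmap R M (coind R D) j"
    unfolding lmap_def
  proof (intro conjI ballI M right_module_coind)
    show "j m \<in> carrier (coind R D)" if "m \<in> carrier M" for m
      unfolding j_def by (rule restrict_coind[OF lmap_comp[OF orb[OF that] \<iota>(1)]])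
    show "j (x \<oplus>\<^bsub>M\<^esub> y) = j x \<oplus>\<^bsub>coind R D\<^esub> j y" if "x \<in> carrier M" "y \<in> carrier M" for x y
      using that lmap_add[OF \<iota>(1)] by (auto simp: j_def M.smult_r_distr M.smult_closed intro!: restrict_ext)
    show "j (r \<odot>\<^bsub>M\<^esub> x) = r \<odot>\<^bsub>coind R D\<^esub> j x" if "r \<in> carrier R" "x \<in> carrier M" for r x
      using that by (auto simp: j_def M.smult_assoc intro!: restrict_ext)
  qed
  moreover have "inj_on j (carrier M)"
  proof (rule inj_onI)
    fix x y assume xy: "x \<in> carrier M" "y \<in> carrier M" "j x = j y"
    from fun_cong[OF this(3), of "\<one>\<^bsub>R\<^esub>"] have "\<iota> x = \<iota> y" using xy by (simp add: j_def M.smult_one)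
    then show "x = y" using \<iota>(2) xy by (auto dest: inj_onD)
  qed
  ultimately show thesis using that by blast
qed

end

section \<open>Codings showing that the type of coresolutions is large enough\<close>

lemma coresol_power_inj:
  "\<exists>J :: (nat + 'r \<Rightarrow> nat + 'r \<Rightarrow> 'x) \<Rightarrow> nat + 'r \<Rightarrow> 'x. inj J"
proof -
  \<comment> \<open>The index type is infinite, so it absorbs its own square, and two levels of
    functions on it fold into one.\<close>
  have "infinite (UNIV :: (nat + 'r) set)" by simp
  then have "(card_of ((UNIV :: (nat + 'r) set) \<times> (UNIV :: (nat + 'r) set)), card_of (UNIV :: (nat + 'r) set)) \<in> ordLeq"
    using card_of_Times_same_infinite ordIso_imp_ordLeq by blast
  then obtain p :: "(nat + 'r) \<times> (nat + 'r) \<Rightarrow> nat + 'r" where p: "inj p"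
    unfolding card_of_ordLeq[symmetric] by auto
  have "inj (\<lambda>F z. F (fst (inv_into UNIV p z)) (snd (inv_into UNIV p z)) :: 'x)"
  proof (rule injI)
    fix F G :: "nat + 'r \<Rightarrow> nat + 'r \<Rightarrow> 'x"
    assume eq: "(\<lambda>z. F (fst (inv_into UNIV p z)) (snd (inv_into UNIV p z))) = (\<lambda>z. G (fst (inv_into UNIV p z)) (snd (inv_into UNIV p z)))"
    have "F x y = G x y" for x y using fun_cong[OF eq, of "p (x, y)"] by (simp add: inv_f_f[OF p])
    then show "F = G" by (simp add: fun_eq_iff)
  qed
  then show ?thesis by blast
qed

text \<open>Functions on \<open>'r\<close> are padded with \<open>undefined\<close> to functions on
  \<open>nat + 'r\<close> and then folded.\<close>

lemma coresol_fun_inj: "\<exists>J :: ('r \<Rightarrow> ('r, 'm) coresol) \<Rightarrow> ('r, 'm) coresol. inj J"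
proof -
  obtain J :: "(nat + 'r \<Rightarrow> ('r, 'm) coresol) \<Rightarrow> ('r, 'm) coresol" where J: "inj J"
    using coresol_power_inj by blast
  have "inj (\<lambda>F. J (case_sum (\<lambda>_. undefined) F))"
  proof (rule injI)
    fix F G :: "'r \<Rightarrow> ('r, 'm) coresol"
    assume "J (case_sum (\<lambda>_. undefined) F) = J (case_sum (\<lambda>_. undefined) G)"
    note eq = J[THEN injD, OF this]
    have "F x = G x" for x using fun_cong[OF eq, of "Inr x"] by simp
    then show "F = G" by (simp add: fun_eq_iff)
  qed
  then show ?thesis by blast
qed

text \<open>A rational function of finite support is coded by a sequence: at position
  \<open>0\<close> the length of a list of the support, at the even positions
  \<open>2 * i + 2\<close> the entries of that list, at the odd positions \<open>2 * i + 1\<close>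
  the codes of their values.\<close>

lemma coresol_rat_inj:
  "\<exists>J :: (('r, 'm) coresol \<Rightarrow> rat) \<Rightarrow> ('r, 'm) coresol. inj_on J {g. finite {x. g x \<noteq> 0}}"
proof -
  obtain J :: "(nat + 'r \<Rightarrow> ('r, 'm) coresol) \<Rightarrow> ('r, 'm) coresol" where J: "inj J"
    using coresol_power_inj by blast
  define L where "L g = (SOME xs. set xs = {x. g x \<noteq> 0})" for g :: "('r, 'm) coresol \<Rightarrow> rat"
  have L: "set (L g) = {x. g x \<noteq> 0}" if "finite {x. g x \<noteq> 0}" for g
    unfolding L_def using finite_list[OF that] by (rule someI_ex)
  define c :: "nat \<Rightarrow> ('r, 'm) coresol" where "c k = (\<lambda>_. Inl k)" for k
  have c: "k = l" if "c k = c l" for k l using fun_cong[OF that] by (simp add: c_def)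
  define F :: "(('r, 'm) coresol \<Rightarrow> rat) \<Rightarrow> nat + 'r \<Rightarrow> ('r, 'm) coresol" where
    "F g = case_sum (\<lambda>k. if k = 0 then c (length (L g)) else if even k then L g ! (k div 2 - 1)
      else c (to_nat (g (L g ! (k div 2))))) (\<lambda>_. undefined)" for g
  have "inj_on (\<lambda>g. J (F g)) {g. finite {x. g x \<noteq> 0}}"
  proof (rule inj_onI)
    fix g h :: "('r, 'm) coresol \<Rightarrow> rat"
    assume fin: "g \<in> {g. finite {x. g x \<noteq> 0}}" "h \<in> {g. finite {x. g x \<noteq> 0}}" and "J (F g) = J (F h)"
    then have FF: "F g = F h" using J by (simp add: inj_eq)
    have len: "length (L g) = length (L h)" using fun_cong[OF FF, of "Inl 0"] c by (simp add: F_def)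
    have "L g ! i = L h ! i" for i using fun_cong[OF FF, of "Inl (2 * i + 2)"] by (simp add: F_def)
    then have LL: "L g = L h" using len by (intro nth_equalityI) auto
    have val: "g (L g ! i) = h (L g ! i)" for i
      using c[of "to_nat (g (L g ! i))" "to_nat (h (L h ! i))"] fun_cong[OF FF, of "Inl (2 * i + 1)"] LL
      by (simp add: F_def)
    show "g = h"
    proof
      fix x
      show "g x = h x"
      proof (cases "x \<in> set (L g)")
        case True
        then show ?thesis using val by (auto simp: in_set_conv_nth)
      next
        case False
        then show ?thesis using L[of g] L[of h] fin LL by auto
      qed
    qed
  qed
  then show ?thesis by blast
qed

text \<open>The divisible hull and coinduction give an injective overmodule, and the codings bring
  it back to the type of \<open>Z\<close>. The cokernel is a quotient of \<open>E\<close> and so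
  fits the same type, which makes the step iterable.\<close>

lemma injective_embedding:
  fixes Z :: "('r, ('r, 'm) coresol) module"
  assumes Z: "right_module R Z"
  shows "\<exists>(E :: ('r, ('r, 'm) coresol) module) i (Z' :: ('r, ('r, 'm) coresol) module) p.
    baer R E \<and> ses R Z i E p Z'"
proof -
  have R: "ring R" using Z by (simp add: right_module_def)
  let ?G = "rat_free (carrier Z)"
  obtain K \<iota> where K: "submodule K int_ring ?G" and baer: "baer int_ring (quot_module ?G K)"
    and \<iota>: "lmap int_ring (int_module Z) (quot_module ?G K) \<iota>" "inj_on \<iota> (carrier Z)"
    using divisible_hull[OF right_module_int[OF Z]] by auto
  let ?D = "quot_module ?G K"
  have D: "right_module int_ring ?D" using baer by (simp add: baer_def)
  obtain j where j: "lmap R Z (coind R ?D) j" "inj_on j (carrier Z)"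
    by (rule coind_embed[OF R D Z \<iota>])
  note s = ses_quot_module[OF right_module_rat_free K]
  obtain J1 :: "('r \<Rightarrow> ('r, 'm) coresol) \<Rightarrow> ('r, 'm) coresol" where J1: "inj J1" using coresol_fun_inj by blast
  obtain J2 :: "(('r, 'm) coresol \<Rightarrow> rat) \<Rightarrow> ('r, 'm) coresol" where J2: "inj_on J2 {g. finite {x. g x \<noteq> 0}}"
    using coresol_rat_inj by blast
  \<comment> \<open>Elements of the divisible hull are cosets; a chosen representative of finite
    support is coded in place of each.\<close>
  define rep where "rep = inv_into (carrier ?G) (\<lambda>x. K +>\<^bsub>?G\<^esub> x)"
  have rep: "rep X \<in> {g. finite {x. g x \<noteq> 0}}" "K +>\<^bsub>?G\<^esub> (rep X) = X" if "X \<in> carrier ?D" for X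
  proof -
    have X: "X \<in> (\<lambda>x. K +>\<^bsub>?G\<^esub> x) ` carrier ?G" using sesD(4)[OF s] that by simp
    show "rep X \<in> {g. finite {x. g x \<noteq> 0}}" using inv_into_into[OF X] by (simp add: rep_def)
    show "K +>\<^bsub>?G\<^esub> (rep X) = X" using f_inv_into_f[OF X] by (simp add: rep_def)
  qed
  define \<phi> where "\<phi> f = J1 (\<lambda>s. J2 (rep (f s)))" for f
  have "inj_on \<phi> (carrier (coind R ?D))"
  proof (rule inj_onI)
    fix f g assume f: "f \<in> carrier (coind R ?D)" and g: "g \<in> carrier (coind R ?D)" and eq: "\<phi> f = \<phi> g"
    have eq': "J2 (rep (f s)) = J2 (rep (g s))" for s
      using fun_cong[OF J1[THEN injD, OF eq[unfolded \<phi>_def]], of s] .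
    show "f = g"
    proof (rule coind_eqI[OF R D f g])
      fix s assume s: "s \<in> carrier R"
      have fg: "f s \<in> carrier ?D" "g s \<in> carrier ?D"
        using f g s lmap_closed[of int_ring "int_module (regular_module R)" ?D _ s] by (auto simp: carrier_coind[OF R D])
      have "rep (f s) = rep (g s)" using J2[THEN inj_onD, OF eq' rep(1)[OF fg(1)] rep(1)[OF fg(2)]] .
      from arg_cong[OF this, of "\<lambda>x. K +>\<^bsub>?G\<^esub> x"] show "f s = g s" unfolding rep(2)[OF fg(1)] rep(2)[OF fg(2)] .
    qed
  qed
  from transport[OF right_module_coind[OF R D] this]
  obtain E :: "('r, ('r, 'm) coresol) module" where E: "lmap R (coind R ?D) E \<phi>"
    "bij_betw \<phi> (carrier (coind R ?D)) (carrier E)" by blast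
  obtain \<psi> where \<psi>: "lmap R E (coind R ?D) \<psi>" "\<And>x. x \<in> carrier E \<Longrightarrow> \<phi> (\<psi> x) = x"
    by (rule lmap_inverse[OF E]) blast
  have "baer R E"
    unfolding baer_def
  proof (intro conjI allI impI, rule lmap_tgt[OF E(1)], elim conjE)
    fix I f assume I: "submodule I R (regular_module R)" and f: "lmap R ((regular_module R)\<lparr>carrier := I\<rparr>) E f"
    obtain e where e: "e \<in> carrier (coind R ?D)" "\<forall>r\<in>I. \<psi> (f r) = r \<odot>\<^bsub>coind R ?D\<^esub> e"
      using baer_coind[OF R D baer] I lmap_comp[OF f \<psi>(1)] unfolding baer_def by blast
    have "f r = r \<odot>\<^bsub>E\<^esub> \<phi> e" if r: "r \<in> I" for r
    proof -
      have "r \<in> carrier R" using submodule_subset[OF right_module_regular[OF R] I] r by auto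
      then have "\<phi> (\<psi> (f r)) = r \<odot>\<^bsub>E\<^esub> \<phi> e" using e(2) r lmap_smult[OF E(1) _ e(1)] by simp
      then show ?thesis using \<psi>(2) lmap_closed[OF f, of r] r by simp
    qed
    then show "\<exists>e\<in>carrier E. \<forall>r\<in>I. f r = r \<odot>\<^bsub>E\<^esub> e" using lmap_closed[OF E(1) e(1)] by blast
  qed
  moreover
  have i: "lmap R Z E (\<lambda>x. \<phi> (j x))" by (rule lmap_comp[OF j(1) E(1)])
  have inj: "inj_on (\<lambda>x. \<phi> (j x)) (carrier Z)"
  proof (rule inj_onI)
    fix x y assume xy: "x \<in> carrier Z" "y \<in> carrier Z" and eq: "\<phi> (j x) = \<phi> (j y)"
    have "j x = j y"
      using E(2)[unfolded bij_betw_def, THEN conjunct1, THEN inj_onD, OF eq lmap_closed[OF j(1) xy(1)] lmap_closed[OF j(1) xy(2)]] .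
    then show "x = y" using j(2)[THEN inj_onD] xy by blast
  qed
  note q = ses_quot_range[OF i inj]
  let ?Q = "quot_module E ((\<lambda>x. \<phi> (j x)) ` carrier Z)"
  obtain Z' :: "('r, ('r, 'm) coresol) module" and \<chi> where \<chi>: "lmap R ?Q Z' \<chi>" "bij_betw \<chi> (carrier ?Q) (carrier Z')"
    by (rule transport_surj[OF sesD(2,4)[OF q]])
  have "ses R Z (\<lambda>x. \<phi> (j x)) E (\<lambda>x. \<chi> (((\<lambda>x. \<phi> (j x)) ` carrier Z) +>\<^bsub>E\<^esub> x)) Z'"
    unfolding ses_def
  proof (intro conjI ballI i inj lmap_comp[OF sesD(2)[OF q] \<chi>(1)])
    show "(\<lambda>x. \<chi> (((\<lambda>x. \<phi> (j x)) ` carrier Z) +>\<^bsub>E\<^esub> x)) ` carrier E = carrier Z'"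
      using sesD(4)[OF q] \<chi>(2) unfolding bij_betw_def by (metis image_image)
    show "\<chi> (((\<lambda>x. \<phi> (j x)) ` carrier Z) +>\<^bsub>E\<^esub> x) = \<zero>\<^bsub>Z'\<^esub> \<longleftrightarrow> x \<in> (\<lambda>x. \<phi> (j x)) ` carrier Z" if x: "x \<in> carrier E" for x
      using sesD(5)[OF q x] lmap_inj_on_iff[OF \<chi>(1)] \<chi>(2) lmap_zero[OF \<chi>(1)] lmap_closed[OF sesD(2)[OF q] x]
      unfolding bij_betw_def by metis
  qed
  ultimately show ?thesis by blast
qed

lemma baer_injective_module: "baer R E \<Longrightarrow> injective_module R E"
  unfolding injective_module_def
proof (intro conjI allI impI; (elim conjE)?)
  assume E: "baer R E"
  then show EM: "right_module R E" by (simp add: baer_def)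
  fix A B :: "('a, 'a + 'b) module" and i f
  assume A: "right_module R A" "right_module R B" and i: "i \<in> mod_hom R A B" "inj_on i (carrier A)" and f: "f \<in> mod_hom R A E"
  obtain g where g: "lmap R B E g" "\<And>x. x \<in> carrier A \<Longrightarrow> g (i x) = f x"
    by (rule baer_extend[OF E mod_hom_lmap[OF i(1) A] i(2) mod_hom_lmap[OF f A(1) EM]]) (rule that)
  show "\<exists>g\<in>mod_hom R B E. \<forall>x\<in>carrier A. g (i x) = f x"
    using lmap_mod_hom[OF g(1)] g(2) lmap_closed[OF mod_hom_lmap[OF i(1) A]]
    by (intro bexI[of _ "restrict g (carrier B)"]) auto
qed

lemma injres_injective_resolution:
  assumes "injres R C E \<epsilon> \<delta>"
  shows "injective_resolution R C E (restrict \<epsilon> (carrier C)) (\<lambda>n. restrict (\<delta> n) (carrier (E n)))"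
proof -
  interpret injres R C E \<epsilon> \<delta> by fact
  show ?thesis
    unfolding injective_resolution_def
    using baer_injective_module[OF inj] lmap_mod_hom[OF \<epsilon>(1)] lmap_mod_hom[OF \<delta>] \<epsilon>(2) exact0 exact
    by (auto simp: a_kernel_def' inj_on_def)
qed

section \<open>Finite injective dimension over the endomorphism ring\<close>

context aaity
begin

text \<open>A complex in \<open>add C\<close> whose dual is exact in positive degrees:
  \<open>fac\<close> is that exactness, read as a factorization property. Exactness of the complex
  itself has to be derived, at \<open>V (Suc i)\<close> for \<open>n \<le> i\<close>.\<close>

context
  fixes V :: "nat \<Rightarrow> ('r, nat \<Rightarrow> 'c) module" and a
  assumes V: "\<And>i. sumd R C (V i)" and a: "\<And>i. lmap R (V i) (V (Suc i)) (a i)"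
    and aa: "\<And>i x. x \<in> carrier (V i) \<Longrightarrow> a (Suc i) (a i x) = \<zero>\<^bsub>V (Suc (Suc i))\<^esub>"
    and fac: "\<And>i h. \<lbrakk>lmap R (V (Suc i)) C h; \<And>x. x \<in> carrier (V i) \<Longrightarrow> h (a i x) = \<zero>\<^bsub>C\<^esub>\<rbrakk>
      \<Longrightarrow> \<exists>h'. lmap R (V (Suc (Suc i))) C h' \<and> (\<forall>x\<in>carrier (V (Suc i)). h x = h' (a (Suc i) x))"
begin

lemma V_module: "right_module R (V i)"
  using V by (simp add: sumd_def)

lemma factor_sumd:
  assumes B: "sumd R C B" and \<phi>: "lmap R (V (Suc i)) B \<phi>" "\<And>x. x \<in> carrier (V i) \<Longrightarrow> \<phi> (a i x) = \<zero>\<^bsub>B\<^esub>"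
  shows "\<exists>\<psi>. lmap R (V (Suc (Suc i))) B \<psi> \<and> (\<forall>x\<in>carrier (V (Suc i)). \<phi> x = \<psi> (a (Suc i) x))"
proof -
  obtain n u v where s: "right_module R C" "right_module R B" "\<And>i. i < n \<Longrightarrow> lmap R C B (u i)"
    "\<And>i. i < n \<Longrightarrow> lmap R B C (v i)" "\<And>x. x \<in> carrier B \<Longrightarrow> msum B (\<lambda>i. u i (v i x)) (n::nat) = x"
    by (rule sumdE[OF B]) blast
  have "\<exists>h'. lmap R (V (Suc (Suc i))) C h' \<and> (\<forall>x\<in>carrier (V (Suc i)). v l (\<phi> x) = h' (a (Suc i) x))" if "l < n" for l
    using fac[OF lmap_comp[OF \<phi>(1) s(4)[OF that]]] \<phi>(2) lmap_zero[OF s(4)[OF that]] by simp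
  then obtain h where h: "\<And>l. l < n \<Longrightarrow> lmap R (V (Suc (Suc i))) C (h l)"
    "\<And>l x. \<lbrakk>l < n; x \<in> carrier (V (Suc i))\<rbrakk> \<Longrightarrow> v l (\<phi> x) = h l (a (Suc i) x)" by metis
  have "\<phi> x = msum B (\<lambda>l. u l (h l (a (Suc i) x))) n" if x: "x \<in> carrier (V (Suc i))" for x
    using s(5)[OF lmap_closed[OF \<phi>(1) x]] h(2)[OF _ x]
      msum_cong[of n "\<lambda>l. u l (v l (\<phi> x))" "\<lambda>l. u l (h l (a (Suc i) x))" B] by simp
  moreover have "lmap R (V (Suc (Suc i))) B (\<lambda>y. msum B (\<lambda>l. u l (h l y)) n)"
    by (intro msum_lmap V_module s(2)) (rule lmap_comp[OF h(1) s(3)])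
  ultimately show ?thesis by blast
qed

text \<open>Induction on the length of the resolution of \<open>Z\<close>. A lift of
  \<open>\<phi>\<close> to \<open>B\<close> fails to kill the range of \<open>a i\<close> by a map
  into \<open>Z'\<close>, which is factored one degree lower and then subtracted. Each step costs
  one degree, hence \<open>m \<le> i\<close>.\<close>

lemma factor_zc:
  assumes "zc R C m Z" "m \<le> i" "lmap R (V (Suc i)) Z \<phi>" "\<And>x. x \<in> carrier (V i) \<Longrightarrow> \<phi> (a i x) = \<zero>\<^bsub>Z\<^esub>"
  shows "\<exists>\<psi>. lmap R (V (Suc (Suc i))) Z \<psi> \<and> (\<forall>x\<in>carrier (V (Suc i)). \<phi> x = \<psi> (a (Suc i) x))"
  using assms
proof (induction m arbitrary: i Z \<phi>)
  case 0
  then have "sumd R C Z" by simp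
  from factor_sumd[OF this 0(3,4)] show ?case .
next
  case (Suc m)
  obtain l where l: "i = Suc l" "m \<le> l" using Suc.prems(2) by (cases i) auto
  from Suc.prems(1) obtain Z' B :: "('r, nat \<Rightarrow> 'c) module" and j p where
    ses: "ses R Z' j B p Z" and B: "sumd R C B" and Z': "zc R C m Z'" by auto
  note s = sesD[OF ses]
  interpret B: right_module R B using lmap_tgt[OF s(1)] .
  interpret Z: right_module R Z using lmap_tgt[OF s(2)] .
  have \<phi>: "lmap R (V (Suc i)) Z \<phi>" "\<And>x. x \<in> carrier (V i) \<Longrightarrow> \<phi> (a i x) = \<zero>\<^bsub>Z\<^esub>" using Suc.prems by auto
  obtain \<phi>' where \<phi>': "lmap R (V (Suc i)) B \<phi>'" "\<And>x. x \<in> carrier (V (Suc i)) \<Longrightarrow> p (\<phi>' x) = \<phi> x"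
    by (rule liftingE[OF lifting_sumd[OF zc_lifting[OF ses Z'] V] \<phi>(1)]) (use s(4) lmap_closed[OF \<phi>(1)] in auto)
  obtain \<chi> where \<chi>: "lmap R (V i) Z' \<chi>" "\<And>x. x \<in> carrier (V i) \<Longrightarrow> j (\<chi> x) = \<phi>' (a i x)"
  proof (rule lmap_factor_inj[OF s(1,3) lmap_comp[OF a \<phi>'(1)]])
    show "\<phi>' (a i x) \<in> j ` carrier Z'" if x: "x \<in> carrier (V i)" for x
      using s(5)[OF lmap_closed[OF \<phi>'(1) lmap_closed[OF a x]]] \<phi>'(2)[OF lmap_closed[OF a x]] \<phi>(2)[OF x] by simp
  qed (rule that)
  have "\<chi> (a l x) = \<zero>\<^bsub>Z'\<^esub>" if x: "x \<in> carrier (V l)" for x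
  proof -
    have "a l x \<in> carrier (V i)" using lmap_closed[OF a x] l(1) by simp
    moreover have "j (\<chi> (a l x)) = \<zero>\<^bsub>B\<^esub>"
      using \<chi>(2)[OF calculation] aa[OF x] lmap_zero[OF \<phi>'(1)] l(1) by simp
    ultimately show ?thesis using lmap_inj_on_iff[OF s(1)] s(3) lmap_closed[OF \<chi>(1)] by blast
  qed
  then obtain \<psi>' where \<psi>': "lmap R (V (Suc i)) Z' \<psi>'" "\<And>x. x \<in> carrier (V i) \<Longrightarrow> \<chi> x = \<psi>' (a i x)"
    using Suc.IH[OF Z' l(2)] \<chi>(1) unfolding l(1) by blast
  note j\<psi> = lmap_comp[OF \<psi>'(1) s(1)]
  have "\<phi>' (a i x) \<ominus>\<^bsub>B\<^esub> j (\<psi>' (a i x)) = \<zero>\<^bsub>B\<^esub>" if x: "x \<in> carrier (V i)" for x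
    using \<chi>(2)[OF x] \<psi>'(2)[OF x] lmap_closed[OF \<phi>'(1) lmap_closed[OF a x]] by (simp add: B.minus_eq_zero_iff)
  from factor_sumd[OF B lmap_diff[OF \<phi>'(1) j\<psi>] this]
  obtain \<psi> where \<psi>: "lmap R (V (Suc (Suc i))) B \<psi>"
    "\<And>x. x \<in> carrier (V (Suc i)) \<Longrightarrow> \<phi>' x \<ominus>\<^bsub>B\<^esub> j (\<psi>' x) = \<psi> (a (Suc i) x)" by blast
  have "\<phi> x = p (\<psi> (a (Suc i) x))" if x: "x \<in> carrier (V (Suc i))" for x
    using \<psi>(2)[OF x, symmetric] lmap_minus[OF s(2) lmap_closed[OF \<phi>'(1) x] lmap_closed[OF j\<psi> x]]
      s(6)[OF lmap_closed[OF \<psi>'(1) x]] \<phi>'(2)[OF x] lmap_closed[OF \<phi>(1) x] by simp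
  then show ?case using lmap_comp[OF \<psi>(1) s(2)] by blast
qed

text \<open>The quotient of \<open>V (Suc i)\<close> by the range of \<open>a i\<close> embeds into
  some \<open>Z\<close> with a resolution of length \<open>n\<close>. The resulting map to
  \<open>Z\<close> factors through \<open>a (Suc i)\<close>, so everything that
  \<open>a (Suc i)\<close> kills lies in that range.\<close>

lemma V_exact:
  assumes "n \<le> i" and x: "x \<in> carrier (V (Suc i))" "a (Suc i) x = \<zero>\<^bsub>V (Suc (Suc i))\<^esub>"
  shows "x \<in> a i ` carrier (V i)"
proof -
  note s = ses_quot_module[OF V_module submodule_range[OF a]]
  let ?Y = "quot_module (V (Suc i)) (a i ` carrier (V i))"
  have fgY: "fin_gen R ?Y" using fin_gen_surj[OF sesD(2,4)[OF s] fin_gen_sumd[OF V fgC]] .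
  have YM: "right_module R ?Y" using lmap_tgt[OF sesD(2)[OF s]] .
  obtain k e where e: "lmap R (power_module (regular_module R) k) ?Y e"
    "e ` carrier (power_module (regular_module R) k) = carrier ?Y"
    by (rule fin_gen_cover[OF YM fgY])
  obtain Y :: "('r, nat \<Rightarrow> 'r) module" and \<chi> where \<chi>: "lmap R ?Y Y \<chi>" "bij_betw \<chi> (carrier ?Y) (carrier Y)"
    by (rule transport_surj[OF e])
  have YM': "right_module R Y" using lmap_tgt[OF \<chi>(1)] .
  have "fin_gen R Y" using fin_gen_surj[OF \<chi>(1) _ fgY] \<chi>(2) by (simp add: bij_betw_def)
  \<comment> \<open>Every module has vanishing \<open>Ext\<close> into \<open>C\<close> in degrees
    above \<open>n\<close>, so length \<open>n\<close> serves for all quotients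
    \<open>Y\<close>.\<close>
  from zc_embedding[OF YM' this exv_ge[OF YM']]
  obtain Z j where Z: "zc R C n Z" "lmap R Y Z j" "inj_on j (carrier Y)" by blast
  let ?\<phi> = "\<lambda>x. j (\<chi> ((a i ` carrier (V i)) +>\<^bsub>V (Suc i)\<^esub> x))"
  have \<phi>: "lmap R (V (Suc i)) Z ?\<phi>" using lmap_comp[OF lmap_comp[OF sesD(2)[OF s] \<chi>(1)] Z(2)] .
  have \<phi>0: "?\<phi> y = \<zero>\<^bsub>Z\<^esub> \<longleftrightarrow> y \<in> a i ` carrier (V i)" if y: "y \<in> carrier (V (Suc i))" for y
  proof -
    have c: "(a i ` carrier (V i)) +>\<^bsub>V (Suc i)\<^esub> y \<in> carrier ?Y" using lmap_closed[OF sesD(2)[OF s] y] .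
    have "?\<phi> y = \<zero>\<^bsub>Z\<^esub> \<longleftrightarrow> \<chi> ((a i ` carrier (V i)) +>\<^bsub>V (Suc i)\<^esub> y) = \<zero>\<^bsub>Y\<^esub>"
      using lmap_inj_on_iff[OF Z(2)] Z(3) lmap_zero[OF Z(2)] lmap_closed[OF \<chi>(1) c] by auto
    also have "\<dots> \<longleftrightarrow> (a i ` carrier (V i)) +>\<^bsub>V (Suc i)\<^esub> y = \<zero>\<^bsub>?Y\<^esub>"
      using lmap_inj_on_iff[OF \<chi>(1)] \<chi>(2) lmap_zero[OF \<chi>(1)] c by (auto simp: bij_betw_def)
    also have "\<dots> \<longleftrightarrow> y \<in> a i ` carrier (V i)" using sesD(5)[OF s y] by simp
    finally show ?thesis .
  qed
  have "?\<phi> (a i y) = \<zero>\<^bsub>Z\<^esub>" if "y \<in> carrier (V i)" for y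
    using \<phi>0[OF lmap_closed[OF a that]] that by blast
  from factor_zc[OF Z(1) assms(1) \<phi> this]
  obtain \<psi> where \<psi>: "lmap R (V (Suc (Suc i))) Z \<psi>" "\<forall>x\<in>carrier (V (Suc i)). ?\<phi> x = \<psi> (a (Suc i) x)" by blast
  then have "?\<phi> x = \<zero>\<^bsub>Z\<^esub>" using x lmap_zero[OF \<psi>(1)] by simp
  then show ?thesis using \<phi>0[OF x(1)] by simp
qed

lemma pcx_V: "pcx (op_End R C) (\<lambda>i. HomM R (V i) C) (\<lambda>i. pre (V i) (a i))"
proof
  show "lmap (op_End R C) (HomM R (V (Suc i)) C) (HomM R (V i) C) (pre (V i) (a i))" for i
    by (rule lmap_pre[OF a])
  show "pre (V (Suc i)) (a (Suc i)) ` carrier (HomM R (V (Suc (Suc i))) C) =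
    {h \<in> carrier (HomM R (V (Suc i)) C). pre (V i) (a i) h = \<zero>\<^bsub>HomM R (V i) C\<^esub>}" for i
  proof (intro equalityI subsetI)
    fix h assume "h \<in> pre (V (Suc i)) (a (Suc i)) ` carrier (HomM R (V (Suc (Suc i))) C)"
    then obtain g where g: "g \<in> carrier (HomM R (V (Suc (Suc i))) C)" "h = pre (V (Suc i)) (a (Suc i)) g" by auto
    have "pre (V i) (a i) h = \<zero>\<^bsub>HomM R (V i) C\<^esub>"
      using aa lmap_zero[OF HomM_lmap[OF V_module g(1)]] lmap_closed[OF a] unfolding g(2)
      by (auto simp: pre_def intro!: restrict_ext)
    then show "h \<in> {h \<in> carrier (HomM R (V (Suc i)) C). pre (V i) (a i) h = \<zero>\<^bsub>HomM R (V i) C\<^esub>}"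
      using pre_in_HomM[OF a g(1)] g(2) by simp
  next
    fix h assume "h \<in> {h \<in> carrier (HomM R (V (Suc i)) C). pre (V i) (a i) h = \<zero>\<^bsub>HomM R (V i) C\<^esub>}"
    then have h: "h \<in> carrier (HomM R (V (Suc i)) C)" and z: "pre (V i) (a i) h = (\<lambda>x\<in>carrier (V i). \<zero>\<^bsub>C\<^esub>)" by auto
    have "h (a i x) = \<zero>\<^bsub>C\<^esub>" if "x \<in> carrier (V i)" for x using fun_cong[OF z, of x] that by simp
    from fac[OF HomM_lmap[OF V_module h] this] obtain g where
      g: "lmap R (V (Suc (Suc i))) C g" "\<forall>x\<in>carrier (V (Suc i)). h x = g (a (Suc i) x)" by blast
    have "h = pre (V (Suc i)) (a (Suc i)) (restrict g (carrier (V (Suc (Suc i)))))"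
      using pre_in_HomM[OF a restrict_HomM[OF g(1)]] g(2) lmap_closed[OF a]
      by (intro HomM_eqI[OF V_module h]) auto
    then show "h \<in> pre (V (Suc i)) (a (Suc i)) ` carrier (HomM R (V (Suc (Suc i))) C)"
      using restrict_HomM[OF g(1)] by blast
  qed
qed

text \<open>As in \<open>cz_End\<close>, maps from the duals to \<open>C\<close> are evaluations, so
  the vanishing is exactness of the complex at \<open>V (Suc k)\<close>.\<close>

lemma cz_V:
  assumes "n \<le> k"
  shows "cz (op_End R C) (\<lambda>i. HomM R (V i) C) (\<lambda>i. pre (V i) (a i)) k (End_module C)"
  unfolding cz_def
proof (intro allI impI, elim conjE)
  fix \<theta> assume \<theta>: "lmap (op_End R C) (HomM R (V (Suc k)) C) (End_module C) \<theta>"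
    "\<forall>h\<in>carrier (HomM R (V (Suc (Suc k))) C). \<theta> (pre (V (Suc k)) (a (Suc k)) h) = \<zero>\<^bsub>End_module C\<^esub>"
  obtain x where x: "x \<in> carrier (V (Suc k))" "\<And>h. h \<in> carrier (HomM R (V (Suc k)) C) \<Longrightarrow> \<theta> h = h x"
    by (rule eval_surj[OF V \<theta>(1)]) (rule that)
  have "a (Suc k) x = \<zero>\<^bsub>V (Suc (Suc k))\<^esub>"
  proof (rule eval_inj[OF V lmap_closed[OF a x(1)]])
    fix h assume "h \<in> carrier (HomM R (V (Suc (Suc k))) C)"
    then show "h (a (Suc k) x) = \<zero>\<^bsub>C\<^esub>" using \<theta>(2) x pre_in_HomM[OF a] by fastforce
  qed
  then obtain y where y: "y \<in> carrier (V k)" "x = a k y" using V_exact[OF assms x(1)] by auto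
  then have "\<theta> h = pre (V k) (a k) h y" if "h \<in> carrier (HomM R (V (Suc k)) C)" for h using x(2)[OF that] by simp
  then show "\<exists>b. lmap (op_End R C) (HomM R (V k) C) (End_module C) b \<and>
    (\<forall>h\<in>carrier (HomM R (V (Suc k)) C). \<theta> h = b (pre (V k) (a k) h))"
    using lmap_eval[OF V_module y(1)] by blast
qed

end

text \<open>A free resolution of \<open>S / I\<close>, given by the \<open>R\<close>-linear maps between powers of \<open>C\<close> whose duals are
  its differentials.\<close>

lemma ideal_resolution:
  assumes I: "submodule I (op_End R C) (regular_module (op_End R C))"
  obtains V :: "nat \<Rightarrow> ('r, nat \<Rightarrow> 'c) module" and a
  where "pcx (op_End R C) (\<lambda>i. HomM R (V i) C) (\<lambda>i. pre (V i) (a i))" "\<And>i. sumd R C (V i)"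
    "\<And>k. n \<le> k \<Longrightarrow> cz (op_End R C) (\<lambda>i. HomM R (V i) C) (\<lambda>i. pre (V i) (a i)) k (End_module C)"
    "V 0 = power_module C 1"
    "\<And>s. s \<in> I \<Longrightarrow> pre (V 0) (\<lambda>x. x 0) s \<in> pre (V 0) (a 0) ` carrier (HomM R (V 1) C)"
    "\<And>h. h \<in> carrier (HomM R (V 1) C) \<Longrightarrow> pre C (pinj C 1 0) (pre (V 0) (a 0) h) \<in> I"
proof -
  let ?S = "op_End R C" and ?P = "power_module C"
  have P: "right_module R (?P m)" for m by (rule right_module_power[OF C_module])
  have sP: "sumd R C (?P m)" for m by (rule sumd_power[OF C_module])
  have SM: "right_module ?S (regular_module ?S)" by (rule right_module_regular[OF ring_op_End])
  have H: "right_module ?S (HomM R C C)" by (rule right_module_HomM[OF C_module])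
  have IH: "submodule I ?S (HomM R C C)"
    using I unfolding right_module.submodule_iff[OF SM] right_module.submodule_iff[OF H] by (simp add: carrier_End)
  have "fin_gen ?S ((HomM R C C)\<lparr>carrier := I\<rparr>)"
    by (rule noetherian_submodule[OF right_noetherian_op[OF noethS] H fin_gen_HomM[OF sumd_refl[OF C_module]] IH])
  then obtain A where A: "finite A" "A \<subseteq> I" "\<And>K. \<lbrakk>submodule K ?S (HomM R C C); K \<subseteq> I; A \<subseteq> K\<rbrakk> \<Longrightarrow> K = I"
    by (rule fin_genE) (auto simp: submodule_sub_iff[OF H IH])
  obtain m1 and g :: "nat \<Rightarrow> 'c \<Rightarrow> 'c" where g: "A = g ` {i. i < m1}"
    using A(1) finite_imp_nat_seg_image_inj_on by metis
  have gI: "g i \<in> I" if "i < m1" for i using g A(2) that by auto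
  have gH: "g i \<in> carrier (HomM R C C)" if "i < m1" for i
    using gI[OF that] submodule_subset[OF H IH] by blast
  have gl: "lmap R C C (g i)" if "i < m1" for i using HomM_lmap[OF C_module gH[OF that]] .
  \<comment> \<open>Generators of \<open>I\<close>, taken as coordinates of one map from
    \<open>C\<close> to a power of \<open>C\<close>; the dual of this map has image
    \<open>I\<close>.\<close>
  define b where "b x = (\<lambda>i\<in>{..<m1}. g i x)" for x
  have b: "lmap R C (?P m1) b" unfolding b_def[abs_def] using lmap_tuple[OF C_module C_module gl] .
  have bI: "pre C b h \<in> I" if h: "h \<in> carrier (HomM R (?P m1) C)" for h
  proof -
    have h': "lmap R (?P m1) C h" using HomM_lmap[OF P h] .
    let ?s = "\<lambda>i. pre C (pinj C m1 i) h"
    have s: "?s i \<in> carrier ?S" for i using pre_in_HomM[OF lmap_pinj[OF C_module] h] by (simp add: carrier_End)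
    let ?t = "\<lambda>i. ?s i \<odot>\<^bsub>HomM R C C\<^esub> g i"
    have t: "?t i \<in> I" if "i < m1" for i
      using IH s gI[OF that] unfolding right_module.submodule_iff[OF H] by blast
    have tH: "?t i \<in> carrier (HomM R C C)" if "i < m1" for i using t[OF that] submodule_subset[OF H IH] by blast
    have "pre C b h = msum (HomM R C C) ?t m1"
    proof (rule HomM_eqI[OF C_module pre_in_HomM[OF b h]])
      show "msum (HomM R C C) ?t m1 \<in> carrier (HomM R C C)" using tH by (rule msum_closed[OF H])
      fix c assume c: "c \<in> carrier C"
      have "pre C b h c = h (msum (?P m1) (\<lambda>i. pinj C m1 i (b c i)) m1)"
        using power_decomp[OF C_module lmap_closed[OF b c]] c by simp
      also have "\<dots> = msum C (\<lambda>i. h (pinj C m1 i (b c i))) m1"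
      proof (rule lmap_msum[OF h'])
        show "pinj C m1 i (b c i) \<in> carrier (?P m1)" if "i < m1" for i
          using lmap_closed[OF lmap_pinj[OF C_module] lmap_closed[OF gl[OF that] c]] that by (simp add: b_def)
      qed
      also have "\<dots> = msum C (\<lambda>i. ?t i c) m1"
        using c lmap_closed[OF gl _] by (intro msum_cong) (simp add: b_def)
      also have "\<dots> = msum (HomM R C C) ?t m1 c" by (rule HomM_sum[OF C_module tH c, symmetric])
      finally show "pre C b h c = msum (HomM R C C) ?t m1 c" .
    qed
    then show ?thesis using msum_in_submodule[OF H IH t] by simp
  qed
  have "pre C b ` carrier (HomM R (?P m1) C) = I"
  proof (rule A(3))
    show "submodule (pre C b ` carrier (HomM R (?P m1) C)) ?S (HomM R C C)"
      by (rule submodule_range[OF lmap_pre[OF b]])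
    show "pre C b ` carrier (HomM R (?P m1) C) \<subseteq> I" using bI by blast
    have "g i \<in> pre C b ` carrier (HomM R (?P m1) C)" if i: "i < m1" for i
    proof -
      have p: "restrict (\<lambda>x. x i) (carrier (?P m1)) \<in> carrier (HomM R (?P m1) C)" using restrict_HomM[OF lmap_proj[OF C_module i]] .
      have "g i = pre C b (restrict (\<lambda>x. x i) (carrier (?P m1)))"
      proof (rule HomM_eqI[OF C_module gH[OF i] pre_in_HomM[OF b p]])
        show "g i x = pre C b (restrict (\<lambda>x. x i) (carrier (?P m1))) x" if "x \<in> carrier C" for x
          using that i lmap_closed[OF b that] by (simp add: b_def)
      qed
      then show ?thesis using p by blast
    qed
    then show "A \<subseteq> pre C b ` carrier (HomM R (?P m1) C)" using g by auto
  qed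
  note bI = this
  have pr0: "lmap R (?P 1) C (\<lambda>x. x 0)" by (rule lmap_proj[OF C_module]) simp
  have in0: "lmap R C (?P 1) (pinj C 1 0)" by (rule lmap_pinj[OF C_module])
  \<comment> \<open>The complex starts with the first power of \<open>C\<close> instead of
    \<open>C\<close>, so that all its terms are powers of \<open>C\<close> on one type;
    \<open>pr0\<close> and \<open>in0\<close> identify the two.\<close>
  have a0: "lmap R (?P 1) (?P m1) (\<lambda>x. b (x 0))" by (rule lmap_comp[OF pr0 b])
  let ?A = "\<lambda>(k, m, a). lmap R (?P k) (?P m) a"
  let ?Q = "\<lambda>(k, m, a) (k', m', a'). k' = m \<and> (\<forall>x\<in>carrier (?P k). a' (a x) = \<zero>\<^bsub>?P m'\<^esub>) \<and>
    (\<forall>h. lmap R (?P m) C h \<and> (\<forall>x\<in>carrier (?P k). h (a x) = \<zero>\<^bsub>C\<^esub>) \<longrightarrow>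
      (\<exists>h'. lmap R (?P m') C h' \<and> (\<forall>x\<in>carrier (?P m). h x = h' (a' x))))"
  \<comment> \<open>The next map consists of generators of the \<open>S\<close>-module of maps that
    vanish on the range of \<open>a\<close>, so its dual covers the kernel of the dual of
    \<open>a\<close>.\<close>
  have step: "\<exists>t. ?A t \<and> ?Q s t" if As: "?A s" for s
  proof -
    obtain k m a where s: "s = (k, m, a)" by (cases s) auto
    have a: "lmap R (?P k) (?P m) a" using As s by simp
    have B: "a ` carrier (?P k) \<subseteq> carrier (?P m)" using lmap_closed[OF a] by blast
    obtain m' a' where a': "lmap R (?P m) (?P m') a'" "\<And>x. x \<in> a ` carrier (?P k) \<Longrightarrow> a' x = \<zero>\<^bsub>?P m'\<^esub>"
      "\<And>h. \<lbrakk>lmap R (?P m) C h; \<And>x. x \<in> a ` carrier (?P k) \<Longrightarrow> h x = \<zero>\<^bsub>C\<^esub>\<rbrakk>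
        \<Longrightarrow> \<exists>h'. lmap R (?P m') C h' \<and> (\<forall>x\<in>carrier (?P m). h x = h' (a' x))"
      by (rule noetherian_annihilator[OF noethS P fin_gen_HomM[OF sP] B]) (rule that, assumption, assumption, blast)
    have "\<exists>h'. lmap R (?P m') C h' \<and> (\<forall>x\<in>carrier (?P m). h x = h' (a' x))"
      if "lmap R (?P m) C h" "\<forall>x\<in>carrier (?P k). h (a x) = \<zero>\<^bsub>C\<^esub>" for h
      by (rule a'(3)[OF that(1)]) (use that(2) in auto)
    then show ?thesis unfolding s by (intro exI[of _ "(m, m', a')"]) (use a'(1,2) in auto)
  qed
  let ?s0 = "(1::nat, m1, \<lambda>x. b (x 0))"
  obtain s where s: "\<And>i. ?A (s i)" "\<And>i. ?Q (s i) (s (Suc i))" "s 0 = ?s0"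
  proof -
    have "\<exists>s. \<forall>i. (?A (s i) \<and> (i = 0 \<longrightarrow> s i = ?s0)) \<and> ?Q (s i) (s (Suc i))"
    proof (rule dependent_nat_choice)
      show "\<exists>x. ?A x \<and> (0 = (0::nat) \<longrightarrow> x = ?s0)" using a0 by (intro exI[of _ ?s0]) simp
      show "\<exists>y. (?A y \<and> (Suc i = 0 \<longrightarrow> y = ?s0)) \<and> ?Q x y" if "?A x \<and> (i = 0 \<longrightarrow> x = ?s0)" for x i
        using step[of x] that by simp
    qed
    then obtain s where "\<forall>i. (?A (s i) \<and> (i = 0 \<longrightarrow> s i = ?s0)) \<and> ?Q (s i) (s (Suc i))" ..
    then show thesis by (intro that[of s]) simp_all
  qed
  define V where "V i = ?P (fst (s i))" for i
  define a where "a i = snd (snd (s i))" for i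
  have seq: "s i = (fst (s i), fst (s (Suc i)), a i)" for i
    using s(2)[of i] by (auto simp: a_def split: prod.splits)
  have sA: "lmap R (V i) (V (Suc i)) (a i)" for i using s(1)[of i] unfolding V_def by (subst (asm) seq) simp
  have sQ: "(\<forall>x\<in>carrier (V i). a (Suc i) (a i x) = \<zero>\<^bsub>V (Suc (Suc i))\<^esub>) \<and>
    (\<forall>h. lmap R (V (Suc i)) C h \<and> (\<forall>x\<in>carrier (V i). h (a i x) = \<zero>\<^bsub>C\<^esub>) \<longrightarrow>
      (\<exists>h'. lmap R (V (Suc (Suc i))) C h' \<and> (\<forall>x\<in>carrier (V (Suc i)). h x = h' (a (Suc i) x))))" for i
  proof -
    have "?Q (fst (s i), fst (s (Suc i)), a i) (fst (s (Suc i)), fst (s (Suc (Suc i))), a (Suc i))"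
      using s(2)[of i] seq[of i] seq[of "Suc i"] by metis
    then show ?thesis unfolding V_def by simp
  qed
  have sV: "sumd R C (V i)" for i unfolding V_def by (rule sP)
  have aa: "a (Suc i) (a i x) = \<zero>\<^bsub>V (Suc (Suc i))\<^esub>" if "x \<in> carrier (V i)" for i x using sQ that by blast
  have fac: "\<exists>h'. lmap R (V (Suc (Suc i))) C h' \<and> (\<forall>x\<in>carrier (V (Suc i)). h x = h' (a (Suc i) x))"
    if "lmap R (V (Suc i)) C h" "\<And>x. x \<in> carrier (V i) \<Longrightarrow> h (a i x) = \<zero>\<^bsub>C\<^esub>" for i h using sQ[of i] that by blast
  have V0: "V 0 = ?P 1" "V 1 = ?P m1" "a 0 = (\<lambda>x. b (x 0))"
    using seq[of 0] s(3) by (simp_all add: V_def)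
  show thesis
  proof (rule that[of V a])
    show "pcx ?S (\<lambda>i. HomM R (V i) C) (\<lambda>i. pre (V i) (a i))" by (rule pcx_V[where V=V and a=a, OF sV sA aa fac])
    show "cz ?S (\<lambda>i. HomM R (V i) C) (\<lambda>i. pre (V i) (a i)) k (End_module C)" if "n \<le> k" for k
      by (rule cz_V[where V=V and a=a, OF sV sA aa fac that])
    show "sumd R C (V i)" for i by (rule sV)
    show "V 0 = ?P 1" by (rule V0)
    show "pre (V 0) (\<lambda>x. x 0) t \<in> pre (V 0) (a 0) ` carrier (HomM R (V 1) C)" if t: "t \<in> I" for t
    proof -
      obtain h where h: "h \<in> carrier (HomM R (?P m1) C)" "t = pre C b h" using t bI by blast
      have "pre (V 0) (\<lambda>x. x 0) t = pre (V 0) (a 0) h"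
        unfolding h(2) V0 pre_def using lmap_closed[OF pr0] by (auto intro!: restrict_ext)
      then show ?thesis using h(1) V0(2) by simp
    qed
    show "pre C (pinj C 1 0) (pre (V 0) (a 0) h) \<in> I" if h: "h \<in> carrier (HomM R (V 1) C)" for h
    proof -
      have "pre C (pinj C 1 0) (pre (V 0) (a 0) h) = pre C b h"
        unfolding V0 pre_def using lmap_closed[OF in0] by (auto simp: pinj_def intro!: restrict_ext)
      then show ?thesis using h bI V0(2) by auto
    qed
  qed
qed

end

text \<open>\<open>P I\<close> stands for a resolution of \<open>S / I\<close>. Induction on
  \<open>n\<close>: passing to the cokernel of an embedding into an injective module lowers by one
  the degree in which \<open>Ext\<close> vanishes (\<open>cz_shift\<close>), and for
  \<open>n = 0\<close> the assumption \<open>test\<close> turns vanishing in degree one into Baer's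
  criterion. All cosyzygies stay on one type by \<open>injective_embedding\<close>.\<close>

lemma finite_injective_resolution:
  fixes S :: "'s ring" and Z :: "('s, ('s, 'm) coresol) module"
    and P :: "'s set \<Rightarrow> nat \<Rightarrow> ('s, 'p) module" and d
  assumes pcx: "\<And>I. submodule I S (regular_module S) \<Longrightarrow> pcx S (P I) (d I)"
    and lift: "\<And>I k B N (q :: ('s, 'm) coresol \<Rightarrow> ('s, 'm) coresol).
      \<lbrakk>submodule I S (regular_module S); lmap S B N q\<rbrakk> \<Longrightarrow> lifting S (P I k) B N q"
    and test: "\<And>I (Z :: ('s, ('s, 'm) coresol) module) f. \<lbrakk>submodule I S (regular_module S); cz S (P I) (d I) 0 Z;
      lmap S ((regular_module S)\<lparr>carrier := I\<rparr>) Z f\<rbrakk> \<Longrightarrow> \<exists>e\<in>carrier Z. \<forall>r\<in>I. f r = r \<odot>\<^bsub>Z\<^esub> e"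
    and Z: "right_module S Z" "\<And>I. submodule I S (regular_module S) \<Longrightarrow> cz S (P I) (d I) n Z"
  shows "\<exists>(E :: nat \<Rightarrow> ('s, ('s, 'm) coresol) module) (\<epsilon> :: ('s, 'm) coresol \<Rightarrow> ('s, 'm) coresol) \<delta>.
    injres S Z E \<epsilon> \<delta> \<and> (\<forall>i>n. carrier (E i) = {\<zero>\<^bsub>E i\<^esub>})"
  using Z
proof (induction n arbitrary: Z)
  case 0
  have Z: "baer S Z" unfolding baer_def using 0 test by blast
  interpret Z: right_module S Z by (rule 0(1))
  \<comment> \<open>An injective module is coresolved by itself, followed by zero modules.\<close>
  let ?O = "Z\<lparr>carrier := {\<zero>\<^bsub>Z\<^esub>}\<rparr>"
  have O: "right_module S ?O" by (rule Z.submodule_right_module[OF Z.submodule_zero])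
  have bO: "baer S ?O"
    unfolding baer_def using O lmap_closed[of S _ ?O] right_module.smult_r_null[OF 0(1)]
      submodule_subset[OF right_module_regular[OF Z.R.ring_axioms]] by fastforce
  define E where "E i = (if i = 0 then Z else ?O)" for i :: nat
  have E: "baer S (E i)" for i using Z bO by (simp add: E_def)
  then have EM: "right_module S (E i)" for i by (simp add: baer_def)
  have "injres S Z E (\<lambda>x. x) (\<lambda>i x. \<zero>\<^bsub>Z\<^esub>)"
  proof
    show "lmap S (E i) (E (Suc i)) (\<lambda>x. \<zero>\<^bsub>Z\<^esub>)" for i
      using lmap_zero_map[OF EM EM, of i "Suc i"] by (simp add: E_def)
  qed (use E lmap_id[OF 0(1)] Z.zero_closed in \<open>auto simp: E_def inj_on_def\<close>)
  then show ?case by (intro exI[of _ E] exI conjI) (auto simp: E_def)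
next
  case (Suc n)
  obtain E0 :: "('s, ('s, 'm) coresol) module" and i and Z' :: "('s, ('s, 'm) coresol) module" and p
    where E0: "baer S E0" and ses: "ses S Z i E0 p Z'"
    using injective_embedding[OF Suc.prems(1)] by blast
  note sd = sesD[OF ses]
  have "cz S (P I) (d I) n Z'" if I: "submodule I S (regular_module S)" for I
    by (rule pcx.cz_shift[OF pcx[OF I] ses lift[OF I sd(2)] pcx.cz_baer[OF pcx[OF I] E0] Suc.prems(2)[OF I]])
  then obtain E :: "nat \<Rightarrow> ('s, ('s, 'm) coresol) module" and \<epsilon> :: "('s, 'm) coresol \<Rightarrow> ('s, 'm) coresol" and \<delta>
    where inj: "injres S Z' E \<epsilon> \<delta>" and fin: "\<forall>i>n. carrier (E i) = {\<zero>\<^bsub>E i\<^esub>}"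
    using Suc.IH[OF lmap_tgt[OF sd(2)]] by blast
  interpret injres S Z' E \<epsilon> \<delta> by (rule inj)
  \<comment> \<open>The coresolution of the cokernel \<open>Z'\<close> is spliced behind
    \<open>E0\<close>.\<close>
  define E' where "E' = case_nat E0 E"
  define \<delta>' where "\<delta>' = case_nat (\<lambda>x. \<epsilon> (p x)) \<delta>"
  have e0: "\<epsilon> (p x) = \<zero>\<^bsub>E 0\<^esub> \<longleftrightarrow> x \<in> i ` carrier Z" if x: "x \<in> carrier E0" for x
    using lmap_inj_on_iff[OF \<epsilon>(1)] \<epsilon>(2) lmap_zero[OF \<epsilon>(1)] lmap_closed[OF sd(2) x] sd(5)[OF x] by auto
  have "injres S Z E' i \<delta>'"
  proof
    show "baer S (E' k)" for k using E0 inj by (cases k) (simp_all add: E'_def)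
    show "lmap S Z (E' 0) i" "inj_on i (carrier Z)" using sd by (simp_all add: E'_def)
    show "lmap S (E' k) (E' (Suc k)) (\<delta>' k)" for k
      using lmap_comp[OF sd(2) \<epsilon>(1)] \<delta> by (cases k) (simp_all add: E'_def \<delta>'_def)
    show "i ` carrier Z = {x \<in> carrier (E' 0). \<delta>' 0 x = \<zero>\<^bsub>E' 1\<^esub>}"
      using e0 lmap_closed[OF sd(1)] by (auto simp: E'_def \<delta>'_def)
    show "\<delta>' k ` carrier (E' k) = {x \<in> carrier (E' (Suc k)). \<delta>' (Suc k) x = \<zero>\<^bsub>E' (Suc (Suc k))\<^esub>}" for k
    proof (cases k)
      case 0
      have "(\<lambda>x. \<epsilon> (p x)) ` carrier E0 = \<epsilon> ` carrier Z'" using sd(4) by (metis image_image)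
      then show ?thesis using exact0 0 by (simp add: E'_def \<delta>'_def)
    next
      case (Suc l)
      then show ?thesis using exact[of l] by (simp add: E'_def \<delta>'_def)
    qed
  qed
  moreover have "\<forall>k>Suc n. carrier (E' k) = {\<zero>\<^bsub>E' k\<^esub>}" using fin by (auto simp: E'_def split: nat.split)
  ultimately show ?case by blast
qed

text \<open>The resolutions of all \<open>S / I\<close> are chosen at once. Their term in degree
  \<open>0\<close>, the dual of the first power of \<open>C\<close>, is identified with
  \<open>S\<close> by precomposition with the coordinate embedding. The range of the first
  differential then becomes \<open>I\<close>, so that extension of maps from \<open>K 0\<close> to
  \<open>P I 0\<close> is Baer's condition for \<open>I\<close>.\<close>

lemma (in aaity) inj_dim_End: "inj_dim (op_End R C) (End_module C) < \<infinity>"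
proof -
  let ?S = "op_End R C"
  let ?ideal = "\<lambda>I. submodule I ?S (regular_module ?S)"
  let ?ok = "\<lambda>I V a. pcx ?S (\<lambda>i. HomM R (V i) C) (\<lambda>i. pre (V i) (a i)) \<and> (\<forall>i. sumd R C (V i)) \<and>
    cz ?S (\<lambda>i. HomM R (V i) C) (\<lambda>i. pre (V i) (a i)) n (End_module C) \<and> V 0 = power_module C 1 \<and>
    (\<forall>s\<in>I. pre (V 0) (\<lambda>x. x 0) s \<in> pre (V 0) (a 0) ` carrier (HomM R (V 1) C)) \<and>
    (\<forall>h\<in>carrier (HomM R (V 1) C). pre C (pinj C 1 0) (pre (V 0) (a 0) h) \<in> I)"
  have "\<forall>I. \<exists>Va. ?ideal I \<longrightarrow> ?ok I (fst Va) (snd Va)"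
  proof (intro allI)
    fix I
    show "\<exists>Va. ?ideal I \<longrightarrow> ?ok I (fst Va) (snd Va)"
    proof (cases "?ideal I")
      case True
      obtain V a where "pcx ?S (\<lambda>i. HomM R (V i) C) (\<lambda>i. pre (V i) (a i))" "\<And>i. sumd R C (V i)"
        "\<And>k. n \<le> k \<Longrightarrow> cz ?S (\<lambda>i. HomM R (V i) C) (\<lambda>i. pre (V i) (a i)) k (End_module C)"
        "V 0 = power_module C 1"
        "\<And>s. s \<in> I \<Longrightarrow> pre (V 0) (\<lambda>x. x 0) s \<in> pre (V 0) (a 0) ` carrier (HomM R (V 1) C)"
        "\<And>h. h \<in> carrier (HomM R (V 1) C) \<Longrightarrow> pre C (pinj C 1 0) (pre (V 0) (a 0) h) \<in> I"
        by (rule ideal_resolution[OF True]) (rule that)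
      then have "?ok I V a" by blast
      then show ?thesis by (intro exI[of _ "(V, a)"]) (unfold fst_conv snd_conv, rule impI)
    qed simp
  qed
  from choice[OF this] obtain F where F: "\<forall>I. ?ideal I \<longrightarrow> ?ok I (fst (F I)) (snd (F I))" ..
  define V where "V I = fst (F I)" for I
  define a where "a I = snd (F I)" for I
  have ok: "?ok I (V I) (a I)" if "?ideal I" for I using F that unfolding V_def a_def by blast
  define P where "P I i = HomM R (V I i) C" for I i
  define d where "d I i = pre (V I i) (a I i)" for I i
  have pcx: "pcx ?S (P I) (d I)" if "?ideal I" for I
    using ok[OF that] unfolding P_def[abs_def] d_def[abs_def] by blast
  have P0: "pre C (pinj C 1 0) h \<in> carrier (regular_module ?S)" if "h \<in> carrier (HomM R (power_module C 1) C)" for h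
    using pre_in_HomM[OF lmap_pinj[OF C_module] that] by (simp add: carrier_End)
  have \<kappa>: "lmap ?S (HomM R (power_module C 1) C) (regular_module ?S) (pre C (pinj C 1 0))"
    using lmap_comp[OF lmap_pre[OF lmap_pinj[OF C_module]] lmap_HomM_regular(1)] .
  have pr0: "lmap R (power_module C 1) C (\<lambda>x. x 0)" by (rule lmap_proj[OF C_module]) simp
  have \<kappa>': "lmap ?S (regular_module ?S) (HomM R (power_module C 1) C) (pre (power_module C 1) (\<lambda>x. x 0))"
    using lmap_comp[OF lmap_HomM_regular(2) lmap_pre[OF pr0]] .
  have \<kappa>\<kappa>': "pre C (pinj C 1 0) (pre (power_module C 1) (\<lambda>x. x 0) s) = s" if s: "s \<in> carrier (End_ring R C)" for s
  proof (rule End_eqI)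
    show "pre C (pinj C 1 0) (pre (power_module C 1) (\<lambda>x. x 0) s) \<in> carrier (End_ring R C)"
      using lmap_closed[OF \<kappa> lmap_closed[OF \<kappa>', of s]] s by simp
    show "s \<in> carrier (End_ring R C)" by (rule s)
    show "pre C (pinj C 1 0) (pre (power_module C 1) (\<lambda>x. x 0) s) x = s x" if "x \<in> carrier C" for x
      using that lmap_closed[OF lmap_pinj[OF C_module, of 1 0] that] by (simp add: pinj_def)
  qed
  have SM: "right_module ?S (regular_module ?S)" by (rule right_module_regular[OF ring_op_End])
  have test: "\<exists>e\<in>carrier Z. \<forall>r\<in>I. f r = r \<odot>\<^bsub>Z\<^esub> e"
    if I: "?ideal I" and cz: "cz ?S (P I) (d I) 0 Z" and f: "lmap ?S ((regular_module ?S)\<lparr>carrier := I\<rparr>) Z f"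
    for I f and Z :: "('c \<Rightarrow> 'c, ('c \<Rightarrow> 'c, 'c) coresol) module"
  proof -
    interpret pcx ?S "P I" "d I" by (rule pcx[OF I])
    have V0: "V I 0 = power_module C 1" using ok[OF I] by blast
    have K0: "x \<in> carrier (K 0) \<Longrightarrow> pre C (pinj C 1 0) x \<in> I" for x
      using ok[OF I] by (auto simp: P_def d_def)
    have \<kappa>K: "lmap ?S (K 0) ((regular_module ?S)\<lparr>carrier := I\<rparr>) (pre C (pinj C 1 0))"
    proof (rule lmap_corestrict[OF _ I K0])
      have "lmap ?S (P I 0) (regular_module ?S) (pre C (pinj C 1 0))" using \<kappa> V0 by (simp add: P_def)
      then show "lmap ?S (K 0) (regular_module ?S) (pre C (pinj C 1 0))"
        by (rule lmap_comp[OF K_incl(1)])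
    qed
    obtain b where b: "lmap ?S (P I 0) Z b" "\<forall>x\<in>carrier (K 0). b x = f (pre C (pinj C 1 0) x)"
      using cz lmap_comp[OF \<kappa>K f] unfolding cz_iff_extends extends_def by blast
    have b\<kappa>: "lmap ?S (regular_module ?S) Z (\<lambda>s. b (pre (power_module C 1) (\<lambda>x. x 0) s))"
      using lmap_comp[OF \<kappa>'] b(1) V0 by (simp add: P_def)
    let ?e = "b (pre (power_module C 1) (\<lambda>x. x 0) \<one>\<^bsub>?S\<^esub>)"
    have "f r = r \<odot>\<^bsub>Z\<^esub> ?e" if r: "r \<in> I" for r
    proof -
      have rS: "r \<in> carrier (End_ring R C)" using submodule_subset[OF SM I] r by auto
      have "pre (power_module C 1) (\<lambda>x. x 0) r \<in> carrier (K 0)" using ok[OF I] r V0 by (simp add: P_def d_def)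
      from bspec[OF b(2) this] have "f r = b (pre (power_module C 1) (\<lambda>x. x 0) r)" unfolding \<kappa>\<kappa>'[OF rS] by (rule sym)
      then show ?thesis using lmap_regular[OF ring_op_End b\<kappa>, of r] rS by simp
    qed
    moreover have "?e \<in> carrier Z"
      using lmap_closed[OF b\<kappa>, of "\<one>\<^bsub>?S\<^esub>"] right_module.smult_one ring.ring_simprules(6)[OF ring_op_End] by simp
    ultimately show ?thesis by blast
  qed
  \<comment> \<open>Constant functions embed \<open>C\<close> into the type of coresolutions, where
    \<open>finite_injective_resolution\<close> expects the module.\<close>
  have "inj_on (\<lambda>c. (\<lambda>_. Inr c) :: ('c \<Rightarrow> 'c, 'c) coresol) (carrier (End_module C))"
    by (auto simp: inj_on_def fun_eq_iff)
  from transport[OF right_module_End this]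
  obtain Z :: "('c \<Rightarrow> 'c, ('c \<Rightarrow> 'c, 'c) coresol) module" and \<phi> where \<phi>: "lmap ?S (End_module C) Z \<phi>"
    "bij_betw \<phi> (carrier (End_module C)) (carrier Z)" by blast
  obtain \<psi> where \<psi>: "lmap ?S Z (End_module C) \<psi>" "\<And>x. x \<in> carrier Z \<Longrightarrow> \<phi> (\<psi> x) = x"
    by (rule lmap_inverse[OF \<phi>]) blast
  have czZ: "cz ?S (P I) (d I) n Z" if I: "?ideal I" for I
  proof (rule pcx.cz_sumd[OF pcx[OF I]])
    show "cz ?S (P I) (d I) n (End_module C)" using ok[OF I] unfolding P_def[abs_def] d_def[abs_def] by blast
    show "sumd ?S (End_module C) Z" by (rule sumd_retract[OF sumd_refl[OF right_module_End] \<phi>(1) \<psi>])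
  qed
  have "\<exists>(E :: nat \<Rightarrow> ('c \<Rightarrow> 'c, ('c \<Rightarrow> 'c, 'c) coresol) module)
    (\<epsilon> :: ('c \<Rightarrow> 'c, 'c) coresol \<Rightarrow> ('c \<Rightarrow> 'c, 'c) coresol) \<delta>.
    injres ?S Z E \<epsilon> \<delta> \<and> (\<forall>i>n. carrier (E i) = {\<zero>\<^bsub>E i\<^esub>})"
  proof (rule finite_injective_resolution[where P=P and d=d])
    show "lifting ?S (P I k) B N q" if "?ideal I" "lmap ?S B N q"
      for I k B N and q :: "('c \<Rightarrow> 'c, 'c) coresol \<Rightarrow> ('c \<Rightarrow> 'c, 'c) coresol"
      unfolding P_def using lifting_HomM[OF that(2)] ok[OF that(1)] by blast
  qed (use pcx test czZ lmap_tgt[OF \<phi>(1)] in auto)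
  then obtain E :: "nat \<Rightarrow> ('c \<Rightarrow> 'c, ('c \<Rightarrow> 'c, 'c) coresol) module"
    and \<epsilon> :: "('c \<Rightarrow> 'c, 'c) coresol \<Rightarrow> ('c \<Rightarrow> 'c, 'c) coresol" and \<delta>
    where E: "injres ?S Z E \<epsilon> \<delta>" "\<forall>i>n. carrier (E i) = {\<zero>\<^bsub>E i\<^esub>}" by blast
  interpret E: injres ?S Z E \<epsilon> \<delta> by (rule E(1))
  have "injres ?S (End_module C) E (\<lambda>c. \<epsilon> (\<phi> c)) \<delta>"
  proof
    show "lmap ?S (End_module C) (E 0) (\<lambda>c. \<epsilon> (\<phi> c))" by (rule lmap_comp[OF \<phi>(1) E.\<epsilon>(1)])
    show "inj_on (\<lambda>c. \<epsilon> (\<phi> c)) (carrier (End_module C))"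
      using comp_inj_on[of \<phi> "carrier (End_module C)" \<epsilon>] \<phi>(2) E.\<epsilon>(2) by (simp add: bij_betw_def o_def)
    have "(\<lambda>c. \<epsilon> (\<phi> c)) ` carrier (End_module C) = \<epsilon> ` carrier Z"
      using \<phi>(2) unfolding bij_betw_def by (metis image_image)
    then show "(\<lambda>c. \<epsilon> (\<phi> c)) ` carrier (End_module C) = {x \<in> carrier (E 0). \<delta> 0 x = \<zero>\<^bsub>E 1\<^esub>}" using E.exact0 by simp
  qed (rule E.inj E.\<delta> E.exact)+
  from injres_injective_resolution[OF this]
  have "enat n \<in> {enat n | n. \<exists>(E :: nat \<Rightarrow> ('c \<Rightarrow> 'c, ('c \<Rightarrow> 'c, 'c) coresol) module) \<epsilon> d.
       injective_resolution ?S (End_module C) E \<epsilon> d \<and> (\<forall>i>n. carrier (E i) = {\<zero>\<^bsub>E i\<^esub>})}"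
    using E(2) by blast
  then have "inj_dim ?S (End_module C) \<le> enat n" unfolding inj_dim_def by (rule Inf_lower)
  moreover have "enat n < \<infinity>" by simp
  ultimately show ?thesis by (rule le_less_trans)
qed

theorem AAITY_M_cotilting:
  fixes R :: "'r ring" and C :: "('r, 'c) module"
  assumes C: "right_module R C" and noeth: "right_noetherian R" "left_noetherian (End_ring R C)"
    and aaity: "AAITY_cotilting R C"
  shows "M_cotilting R C"
proof -
  have idR: "inj_dim R C < \<infinity>" and so: "self_orthogonal R C" using aaity by (auto simp: AAITY_cotilting_def)
  obtain E :: "nat \<Rightarrow> ('r, ('r, 'c) coresol) module" and \<epsilon> \<delta> n where E: "injres R C E \<epsilon> \<delta>"
    "\<And>i. i > n \<Longrightarrow> carrier (E i) = {\<zero>\<^bsub>E i\<^esub>}"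
    by (rule finite_inj_dim[OF C idR]) (rule that)
  interpret aaity R C E \<epsilon> \<delta> n
    using E noeth aaity by (intro aaity.intro aaity_axioms.intro)
  show ?thesis
    unfolding M_cotilting_def wakamatsu_tilting_def
    using assms(2,3) so gen_star_C cogen_star_R idR inj_dim_End by blast
qed

theorem theorem3p18:
  fixes R :: "'r ring" and C :: "('r, 'c) module"
  assumes "ring R" and "right_module R C"
  shows "(M_cotilting R C \<longrightarrow> AAITY_cotilting R C) \<and>
    (right_noetherian R \<and> left_noetherian (End_ring R C) \<longrightarrow>
      AAITY_cotilting R C \<longrightarrow> M_cotilting R C)"
  using M_cotilting_AAITY[OF assms(2)] AAITY_M_cotilting[OF assms(2)] by blast

end
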